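(* Let $(A,\Phi)$ be an $\ell$EAS with $A$ finite-dimensional, and let $\Phi^*:A^*\otimes A^*\longrightarrow A^*\otimes A^*$ be the transpose of $\Phi$. 1. The Koszul dual of the nonsymmetric operad $\mathbf{As}_\Phi$ is isomorphic to $\mathbf{As}_{\Phi^*}'$. 2. The Koszul dual of the nonsymmetric operad $\mathbf{As}_\Phi'$ is isomorphic to $\mathbf{As}_{\Phi^*}$. 3. The Koszul dual of the operad $\mathrm{Sym}\mathbf{As}_\Phi$ is isomorphic to $\mathrm{Sym}\mathbf{As}_{\Phi^*}$.
   Context: All vector spaces are over a field $\mathbb{K}$. Sweedler-like notation: $\Phi(a\otimes b)=\sum a'\rightarrow b'\otimes a''\triangleright b''$ (purely symbolic), for a linear map $\Phi:A\otimes A\to A\otimes A$. $(A,\Phi)$ is an $\ell$EAS if $(\mathrm{Id}\otimes\Phi)\circ(\Phi\otimes\mathrm{Id})\circ(\mathrm{Id}\otimes\Phi)=(\Phi\otimes\mathrm{Id})\circ(\mathrm{Id}\otimes\tau)\circ(\Phi\otimes\mathrm{Id})$ on $A^{\otimes 3}$, where $\tau(a\otimes b)=b\otimes a$. $\mathbf{As}_\Phi$ (operad of $\Phi$-associative algebras) is the nonsymmetric operad generated by the space of binary operations $A$ with relations $a\circ_2b=\sum(a'\rightarrow b')\circ_1(a''\triangleright b'')$, $a,b\in A$; $\mathbf{As}_\Phi'$ (operad of opposite $\Phi$-associative algebras) is the nonsymmetric operad generated by the space of binary operations $A$ with relations $a\circ_1b=\sum(a'\rightarrow b')\circ_2(a''\triangleright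 b'')$. $\mathrm{Sym}\mathbf{As}_\Phi$ is the symmetric operad of $\Phi$-associative algebras, i.e. the symmetrisation of $\mathbf{As}_\Phi$. $A^*\otimes A^*$ is identified with $(A\otimes A)^*$, via $(f\otimes g)(a\otimes b)=f(a)g(b)$. Koszul dual convention (nonsymmetric binary quadratic case): the dual of $\mathbf{F}(E)/(R)$ is $\mathbf{F}(E^* )/(R^\perp)$, for the pairing $\langle f\circ_1g,a\circ_1b\rangle=f(a)g(b)$, $\langle f\circ_2g,a\circ_2b\rangle=-f(a)g(b)$, other pairings zero. *)

theory Defs
  imports
    "HOL.Vector_Spaces"
    "HOL-Combinatorics.Permutations"
    "HOL-Library.Poly_Mapping"
    "HOL-Library.Function_Algebras"
    "HOL-Library.Set_Algebras"
    "HOL-Library.Product_Plus"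
    "HOL-Library.Tree"
begin

text \<open>
  A vector space over the field \<open>'k\<close> is a subspace \<open>E\<close> of a vector space \<open>(s, 'e)\<close> in the sense of
  theory \<open>Vector_Spaces\<close>, so that a space and its dual can be treated alike.
  Quotient spaces consist of cosets, added with the operation \<open>+\<close> of theory \<open>Set_Algebras\<close>;
  this is coset addition, but its neutral element \<open>{0}\<close> is in general not the zero coset.
\<close>


section \<open>Vector spaces, duals, formal linear combinations\<close>

definition fin_dim_space :: "('k::field \<Rightarrow> 'e::ab_group_add \<Rightarrow> 'e) \<Rightarrow> 'e set \<Rightarrow> bool" where
  "fin_dim_space s E \<longleftrightarrow>
     vector_space s \<and> module.subspace s E \<and> (\<exists>B. finite B \<and> E = module.span s B)"

definition linear_map_on ::
  "('k \<Rightarrow> 'x \<Rightarrow> 'x) \<Rightarrow> 'x::plus set \<Rightarrow> ('k \<Rightarrow> 'y \<Rightarrow> 'y) \<Rightarrow> 'y::plus set \<Rightarrow> ('x \<Rightarrow> 'y) \<Rightarrow> bool" where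
  "linear_map_on s V t W f \<longleftrightarrow>
     (\<forall>x\<in>V. f x \<in> W) \<and>
     (\<forall>x\<in>V. \<forall>y\<in>V. f (x + y) = f x + f y) \<and>
     (\<forall>c. \<forall>x\<in>V. f (s c x) = t c (f x))"

text \<open>Functionals on \<open>E\<close> are extended by \<open>0\<close> outside \<open>E\<close>, so that equality is equality on \<open>E\<close>.\<close>

definition dual_space :: "('k::field \<Rightarrow> 'e::plus \<Rightarrow> 'e) \<Rightarrow> 'e set \<Rightarrow> ('e \<Rightarrow> 'k) set" where
  "dual_space s E = {f. linear_map_on s E (*) UNIV f \<and> (\<forall>x. x \<notin> E \<longrightarrow> f x = 0)}"

definition fun_scale :: "'k::times \<Rightarrow> ('e \<Rightarrow> 'k) \<Rightarrow> ('e \<Rightarrow> 'k)" where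
  "fun_scale c f = (\<lambda>x. c * f x)"

text \<open>The free vector space on a set of type \<open>'x\<close> consists of elements of \<open>'x \<Rightarrow>\<^sub>0 'k\<close>.\<close>

abbreviation basis_vec :: "'x \<Rightarrow> ('x \<Rightarrow>\<^sub>0 'k::field)" where
  "basis_vec x \<equiv> Poly_Mapping.single x 1"

definition fsmul :: "'k::field \<Rightarrow> ('x \<Rightarrow>\<^sub>0 'k) \<Rightarrow> ('x \<Rightarrow>\<^sub>0 'k)" where
  "fsmul c x = Poly_Mapping.map ((*) c) x"

definition lin_ext :: "('x \<Rightarrow> 'y) \<Rightarrow> ('x \<Rightarrow>\<^sub>0 'k::field) \<Rightarrow> ('y \<Rightarrow>\<^sub>0 'k)" where
  "lin_ext g x = (\<Sum>t\<in>Poly_Mapping.keys x. Poly_Mapping.single (g t) (Poly_Mapping.lookup x t))"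

definition bilin_ext ::
  "('x \<Rightarrow> 'y \<Rightarrow> 'z) \<Rightarrow> ('x \<Rightarrow>\<^sub>0 'k::field) \<Rightarrow> ('y \<Rightarrow>\<^sub>0 'k) \<Rightarrow> ('z \<Rightarrow>\<^sub>0 'k)" where
  "bilin_ext g x y =
     (\<Sum>s\<in>Poly_Mapping.keys x. \<Sum>t\<in>Poly_Mapping.keys y.
        Poly_Mapping.single (g s t) (Poly_Mapping.lookup x s * Poly_Mapping.lookup y t))"

definition bilin_form ::
  "('x \<Rightarrow> 'y \<Rightarrow> 'k) \<Rightarrow> ('x \<Rightarrow>\<^sub>0 'k::field) \<Rightarrow> ('y \<Rightarrow>\<^sub>0 'k) \<Rightarrow> 'k" where
  "bilin_form p x y =
     (\<Sum>s\<in>Poly_Mapping.keys x. \<Sum>t\<in>Poly_Mapping.keys y.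
        Poly_Mapping.lookup x s * Poly_Mapping.lookup y t * p s t)"


section \<open>Tensor powers\<close>

text \<open>
  \<open>E\<^sup>\<otimes>\<^sup>n\<close> is the free vector space on the lists of length \<open>n\<close> over \<open>E\<close> modulo multilinearity;
  \<open>pure_tensor s E [a, b]\<close> is \<open>a \<otimes> b\<close>.
\<close>

definition multilin_rels ::
  "('k::field \<Rightarrow> 'e::ab_group_add \<Rightarrow> 'e) \<Rightarrow> 'e set \<Rightarrow> nat \<Rightarrow> ('e list \<Rightarrow>\<^sub>0 'k) set" where
  "multilin_rels s E n = module.span fsmul
     ({basis_vec (xs @ [a + b] @ ys) - basis_vec (xs @ [a] @ ys) - basis_vec (xs @ [b] @ ys)
         | xs ys a b. set xs \<subseteq> E \<and> set ys \<subseteq> E \<and> a \<in> E \<and> b \<in> E \<and> Suc (length xs + length ys) = n} \<union>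
      {basis_vec (xs @ [s c a] @ ys) - fsmul c (basis_vec (xs @ [a] @ ys))
         | xs ys a c. set xs \<subseteq> E \<and> set ys \<subseteq> E \<and> a \<in> E \<and> Suc (length xs + length ys) = n})"

definition tensor_power ::
  "('k::field \<Rightarrow> 'e::ab_group_add \<Rightarrow> 'e) \<Rightarrow> 'e set \<Rightarrow> nat \<Rightarrow> ('e list \<Rightarrow>\<^sub>0 'k) set set" where
  "tensor_power s E n =
     (\<lambda>x. x +o multilin_rels s E n) `
       {x. Poly_Mapping.keys x \<subseteq> {xs. length xs = n \<and> set xs \<subseteq> E}}"

definition pure_tensor ::
  "('k::field \<Rightarrow> 'e::ab_group_add \<Rightarrow> 'e) \<Rightarrow> 'e set \<Rightarrow> 'e list \<Rightarrow> ('e list \<Rightarrow>\<^sub>0 'k) set" where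
  "pure_tensor s E xs = basis_vec xs +o multilin_rels s E (length xs)"

definition tensor_scale ::
  "('k::field \<Rightarrow> 'e::ab_group_add \<Rightarrow> 'e) \<Rightarrow> 'e set \<Rightarrow> nat
     \<Rightarrow> 'k \<Rightarrow> ('e list \<Rightarrow>\<^sub>0 'k) set \<Rightarrow> ('e list \<Rightarrow>\<^sub>0 'k) set" where
  "tensor_scale s E n c X = fsmul c ` X + multilin_rels s E n"

text \<open>Juxtaposition \<open>E\<^sup>\<otimes>\<^sup>m \<times> E\<^sup>\<otimes>\<^sup>(n - m) \<rightarrow> E\<^sup>\<otimes>\<^sup>n\<close>.\<close>

definition tensor_mult ::
  "('k::field \<Rightarrow> 'e::ab_group_add \<Rightarrow> 'e) \<Rightarrow> 'e set \<Rightarrow> nat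
     \<Rightarrow> ('e list \<Rightarrow>\<^sub>0 'k) set \<Rightarrow> ('e list \<Rightarrow>\<^sub>0 'k) set \<Rightarrow> ('e list \<Rightarrow>\<^sub>0 'k) set" where
  "tensor_mult s E n X Y = {bilin_ext (@) x y | x y. x \<in> X \<and> y \<in> Y} + multilin_rels s E n"

text \<open>The linear map into \<open>E\<^sup>\<otimes>\<^sup>n\<close> which sends the pure tensor of a list \<open>xs\<close> to \<open>W xs\<close>.\<close>

definition tensor_lift ::
  "('k::field \<Rightarrow> 'e::ab_group_add \<Rightarrow> 'e) \<Rightarrow> 'e set \<Rightarrow> nat
     \<Rightarrow> ('e list \<Rightarrow> ('e list \<Rightarrow>\<^sub>0 'k) set) \<Rightarrow> ('e list \<Rightarrow>\<^sub>0 'k) set \<Rightarrow> ('e list \<Rightarrow>\<^sub>0 'k) set" where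
  "tensor_lift s E n W X =
     (\<Union>x\<in>X. (\<Sum>xs\<in>Poly_Mapping.keys x. fsmul (Poly_Mapping.lookup x xs) ` W xs)
              + multilin_rels s E n)"

text \<open>\<open>f \<otimes> g\<close> as an endomorphism of \<open>E\<^sup>\<otimes>\<^sup>n\<close>, with \<open>f\<close> acting on the first \<open>m\<close> factors.\<close>

definition tensor_map ::
  "('k::field \<Rightarrow> 'e::ab_group_add \<Rightarrow> 'e) \<Rightarrow> 'e set \<Rightarrow> nat \<Rightarrow> nat
     \<Rightarrow> (('e list \<Rightarrow>\<^sub>0 'k) set \<Rightarrow> ('e list \<Rightarrow>\<^sub>0 'k) set) \<Rightarrow> (('e list \<Rightarrow>\<^sub>0 'k) set \<Rightarrow> ('e list \<Rightarrow>\<^sub>0 'k) set)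
     \<Rightarrow> ('e list \<Rightarrow>\<^sub>0 'k) set \<Rightarrow> ('e list \<Rightarrow>\<^sub>0 'k) set" where
  "tensor_map s E n m f g =
     tensor_lift s E n (\<lambda>xs. tensor_mult s E n (f (pure_tensor s E (take m xs)))
                                               (g (pure_tensor s E (drop m xs))))"

definition tensor_flip ::
  "('k::field \<Rightarrow> 'e::ab_group_add \<Rightarrow> 'e) \<Rightarrow> 'e set
     \<Rightarrow> ('e list \<Rightarrow>\<^sub>0 'k) set \<Rightarrow> ('e list \<Rightarrow>\<^sub>0 'k) set" where
  "tensor_flip s E = tensor_lift s E 2 (\<lambda>xs. pure_tensor s E (rev xs))"

definition lEAS ::
  "('k::field \<Rightarrow> 'e::ab_group_add \<Rightarrow> 'e) \<Rightarrow> 'e set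
     \<Rightarrow> (('e list \<Rightarrow>\<^sub>0 'k) set \<Rightarrow> ('e list \<Rightarrow>\<^sub>0 'k) set) \<Rightarrow> bool" where
  "lEAS s E \<Phi> \<longleftrightarrow>
     linear_map_on (tensor_scale s E 2) (tensor_power s E 2)
                   (tensor_scale s E 2) (tensor_power s E 2) \<Phi> \<and>
     (\<forall>X\<in>tensor_power s E 3.
        tensor_map s E 3 1 id \<Phi> (tensor_map s E 3 2 \<Phi> id (tensor_map s E 3 1 id \<Phi> X)) =
        tensor_map s E 3 2 \<Phi> id (tensor_map s E 3 1 id (tensor_flip s E) (tensor_map s E 3 2 \<Phi> id X)))"

text \<open>The value of an element of \<open>E\<^sup>* \<otimes> E\<^sup>*\<close>, seen as a functional on \<open>E \<otimes> E\<close>.\<close>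

definition tensor_eval ::
  "(('e \<Rightarrow> 'k::field) list \<Rightarrow>\<^sub>0 'k) set \<Rightarrow> ('e list \<Rightarrow>\<^sub>0 'k) set \<Rightarrow> 'k" where
  "tensor_eval F X =
     (THE c. \<forall>f\<in>F. \<forall>x\<in>X. bilin_form (\<lambda>fs xs. (fs ! 0) (xs ! 0) * (fs ! 1) (xs ! 1)) f x = c)"

definition transpose_map ::
  "('k::field \<Rightarrow> 'e::ab_group_add \<Rightarrow> 'e) \<Rightarrow> 'e set
     \<Rightarrow> (('e list \<Rightarrow>\<^sub>0 'k) set \<Rightarrow> ('e list \<Rightarrow>\<^sub>0 'k) set)
     \<Rightarrow> (('e \<Rightarrow> 'k) list \<Rightarrow>\<^sub>0 'k) set \<Rightarrow> (('e \<Rightarrow> 'k) list \<Rightarrow>\<^sub>0 'k) set" where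
  "transpose_map s E \<Phi> F =
     (THE G. G \<in> tensor_power fun_scale (dual_space s E) 2 \<and>
             (\<forall>X\<in>tensor_power s E 2. tensor_eval G X = tensor_eval F (\<Phi> X)))"


section \<open>Operads\<close>

text \<open>
  \<open>op_comp P m i n x y\<close> is the partial composition \<open>x \<circ>\<^sub>i y\<close> of \<open>x \<in> P(m)\<close> and \<open>y \<in> P(n)\<close>, for
  \<open>1 \<le> i \<le> m\<close>. The addition of \<open>P(n)\<close> is the one of the type \<open>'x\<close>; the zero of \<open>P(n)\<close> is a
  component of its own because of quotients. The action of the symmetric groups is a right
  action, \<open>op_act P n \<sigma> x\<close> being \<open>x \<cdot> \<sigma>\<close>.
\<close>

record ('k, 'x) ns_operad =
  op_space :: "nat \<Rightarrow> 'x set"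
  op_zero  :: "nat \<Rightarrow> 'x"
  op_scale :: "nat \<Rightarrow> 'k \<Rightarrow> 'x \<Rightarrow> 'x"
  op_comp  :: "nat \<Rightarrow> nat \<Rightarrow> nat \<Rightarrow> 'x \<Rightarrow> 'x \<Rightarrow> 'x"
  op_unit  :: "'x"

record ('k, 'x) operad = "('k, 'x) ns_operad" +
  op_act   :: "nat \<Rightarrow> (nat \<Rightarrow> nat) \<Rightarrow> 'x \<Rightarrow> 'x"

definition ns_operad_iso ::
  "('k, 'x::plus, 'u) ns_operad_scheme \<Rightarrow> ('k, 'y::plus, 'v) ns_operad_scheme
     \<Rightarrow> (nat \<Rightarrow> 'x \<Rightarrow> 'y) \<Rightarrow> bool" where
  "ns_operad_iso P Q \<phi> \<longleftrightarrow>
     (\<forall>n. linear_map_on (op_scale P n) (op_space P n) (op_scale Q n) (op_space Q n) (\<phi> n)) \<and>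
     (\<forall>n. bij_betw (\<phi> n) (op_space P n) (op_space Q n)) \<and>
     (\<forall>m n i x y. 1 \<le> i \<longrightarrow> i \<le> m \<longrightarrow> x \<in> op_space P m \<longrightarrow> y \<in> op_space P n \<longrightarrow>
        \<phi> (m + n - 1) (op_comp P m i n x y) = op_comp Q m i n (\<phi> m x) (\<phi> n y)) \<and>
     \<phi> 1 (op_unit P) = op_unit Q"

definition ns_isomorphic ::
  "('k, 'x::plus, 'u) ns_operad_scheme \<Rightarrow> ('k, 'y::plus, 'v) ns_operad_scheme \<Rightarrow> bool" where
  "ns_isomorphic P Q \<longleftrightarrow> (\<exists>\<phi>. ns_operad_iso P Q \<phi>)"

definition sym_isomorphic ::
  "('k, 'x::plus) operad \<Rightarrow> ('k, 'y::plus) operad \<Rightarrow> bool" where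
  "sym_isomorphic P Q \<longleftrightarrow> (\<exists>\<phi>. ns_operad_iso P Q \<phi> \<and>
     (\<forall>n \<sigma> x. \<sigma> permutes {1..n} \<longrightarrow> x \<in> op_space P n \<longrightarrow>
        \<phi> n (op_act P n \<sigma> x) = op_act Q n \<sigma> (\<phi> n x)))"

inductive_set ns_ideal ::
  "('k, 'x::plus, 'u) ns_operad_scheme \<Rightarrow> (nat \<Rightarrow> 'x set) \<Rightarrow> (nat \<times> 'x) set"
  for P :: "('k, 'x, 'u) ns_operad_scheme" and G :: "nat \<Rightarrow> 'x set" where
  "x \<in> G n \<Longrightarrow> (n, x) \<in> ns_ideal P G"
| "(n, op_zero P n) \<in> ns_ideal P G"
| "(n, x) \<in> ns_ideal P G \<Longrightarrow> (n, y) \<in> ns_ideal P G \<Longrightarrow> (n, x + y) \<in> ns_ideal P G"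
| "(n, x) \<in> ns_ideal P G \<Longrightarrow> (n, op_scale P n c x) \<in> ns_ideal P G"
| "(m, x) \<in> ns_ideal P G \<Longrightarrow> y \<in> op_space P n \<Longrightarrow> 1 \<le> i \<Longrightarrow> i \<le> m
     \<Longrightarrow> (m + n - 1, op_comp P m i n x y) \<in> ns_ideal P G"
| "x \<in> op_space P m \<Longrightarrow> (n, y) \<in> ns_ideal P G \<Longrightarrow> 1 \<le> i \<Longrightarrow> i \<le> m
     \<Longrightarrow> (m + n - 1, op_comp P m i n x y) \<in> ns_ideal P G"

inductive_set sym_ideal ::
  "('k, 'x::plus) operad \<Rightarrow> (nat \<Rightarrow> 'x set) \<Rightarrow> (nat \<times> 'x) set"
  for P :: "('k, 'x) operad" and G :: "nat \<Rightarrow> 'x set" where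
  "x \<in> G n \<Longrightarrow> (n, x) \<in> sym_ideal P G"
| "(n, op_zero P n) \<in> sym_ideal P G"
| "(n, x) \<in> sym_ideal P G \<Longrightarrow> (n, y) \<in> sym_ideal P G \<Longrightarrow> (n, x + y) \<in> sym_ideal P G"
| "(n, x) \<in> sym_ideal P G \<Longrightarrow> (n, op_scale P n c x) \<in> sym_ideal P G"
| "(m, x) \<in> sym_ideal P G \<Longrightarrow> y \<in> op_space P n \<Longrightarrow> 1 \<le> i \<Longrightarrow> i \<le> m
     \<Longrightarrow> (m + n - 1, op_comp P m i n x y) \<in> sym_ideal P G"
| "x \<in> op_space P m \<Longrightarrow> (n, y) \<in> sym_ideal P G \<Longrightarrow> 1 \<le> i \<Longrightarrow> i \<le> m
     \<Longrightarrow> (m + n - 1, op_comp P m i n x y) \<in> sym_ideal P G"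
| "(n, x) \<in> sym_ideal P G \<Longrightarrow> \<sigma> permutes {1..n} \<Longrightarrow> (n, op_act P n \<sigma> x) \<in> sym_ideal P G"

definition ns_quotient ::
  "('k, 'x::ab_group_add, 'u) ns_operad_scheme \<Rightarrow> (nat \<times> 'x) set \<Rightarrow> ('k, 'x set) ns_operad" where
  "ns_quotient P I =
     (let J = (\<lambda>n. {x. (n, x) \<in> I}) in
      \<lparr> op_space = (\<lambda>n. (\<lambda>x. x +o J n) ` op_space P n),
        op_zero  = J,
        op_scale = (\<lambda>n c X. op_scale P n c ` X + J n),
        op_comp  = (\<lambda>m i n X Y. {op_comp P m i n x y | x y. x \<in> X \<and> y \<in> Y} + J (m + n - 1)),
        op_unit  = op_unit P +o J 1 \<rparr>)"

definition sym_quotient ::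
  "('k, 'x::ab_group_add) operad \<Rightarrow> (nat \<times> 'x) set \<Rightarrow> ('k, 'x set) operad" where
  "sym_quotient P I =
     ns_operad.extend (ns_quotient P I) (operad.fields (\<lambda>n \<sigma> X. op_act P n \<sigma> ` X))"


section \<open>Nonsymmetric binary quadratic operads\<close>

fun graft :: "'e tree \<Rightarrow> nat \<Rightarrow> 'e tree \<Rightarrow> 'e tree" where
  "graft \<langle>\<rangle> i t = t"
| "graft \<langle>l, a, r\<rangle> i t =
     (if i \<le> size1 l then \<langle>graft l i t, a, r\<rangle> else \<langle>l, a, graft r (i - size1 l) t\<rangle>)"

text \<open>The free nonsymmetric operad on the \<^emph>\<open>set\<close> \<open>E\<close> of binary operations; \<open>size1\<close> counts leaves.\<close>

definition tree_operad :: "'e set \<Rightarrow> ('k::field, 'e tree \<Rightarrow>\<^sub>0 'k) ns_operad" where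
  "tree_operad E =
     \<lparr> op_space = (\<lambda>n. {x. Poly_Mapping.keys x \<subseteq> {t. size1 t = n \<and> set_tree t \<subseteq> E}}),
       op_zero  = (\<lambda>n. 0),
       op_scale = (\<lambda>n. fsmul),
       op_comp  = (\<lambda>m i n. bilin_ext (\<lambda>t u. graft t i u)),
       op_unit  = basis_vec \<langle>\<rangle> \<rparr>"

abbreviation corolla :: "'e \<Rightarrow> 'e tree" where
  "corolla a \<equiv> \<langle>\<langle>\<rangle>, a, \<langle>\<rangle>\<rangle>"

definition circ :: "nat \<Rightarrow> 'e \<Rightarrow> 'e \<Rightarrow> 'e tree" where
  "circ i a b = graft (corolla a) i (corolla b)"

text \<open>
  The free operad on the \<^emph>\<open>vector space\<close> \<open>E\<close> arises by making the corollas linear in their label.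
  Elements of its component of arity 3 are given by representatives in \<open>tree_operad E\<close>,
  and \<open>ns_presented s E R\<close> is \<open>F(E)/(R)\<close>.
\<close>

definition corolla_lin_rels ::
  "('k::field \<Rightarrow> 'e::ab_group_add \<Rightarrow> 'e) \<Rightarrow> 'e set \<Rightarrow> ('e tree \<Rightarrow>\<^sub>0 'k) set" where
  "corolla_lin_rels s E =
     {basis_vec (corolla (a + b)) - basis_vec (corolla a) - basis_vec (corolla b)
        | a b. a \<in> E \<and> b \<in> E} \<union>
     {basis_vec (corolla (s c a)) - fsmul c (basis_vec (corolla a)) | a c. a \<in> E}"

definition ns_presented ::
  "('k::field \<Rightarrow> 'e::ab_group_add \<Rightarrow> 'e) \<Rightarrow> 'e set \<Rightarrow> ('e tree \<Rightarrow>\<^sub>0 'k) set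
     \<Rightarrow> ('k, ('e tree \<Rightarrow>\<^sub>0 'k) set) ns_operad" where
  "ns_presented s E R =
     ns_quotient (tree_operad E)
       (ns_ideal (tree_operad E)
          (\<lambda>n. if n = 2 then corolla_lin_rels s E else if n = 3 then R else {}))"

text \<open>The cases are \<open>\<langle>f \<circ>\<^sub>1 g, a \<circ>\<^sub>1 b\<rangle>\<close> and \<open>\<langle>f \<circ>\<^sub>2 g, a \<circ>\<^sub>2 b\<rangle>\<close>.\<close>

fun tree_pairing :: "('e \<Rightarrow> 'k::field) tree \<Rightarrow> 'e tree \<Rightarrow> 'k" where
  "tree_pairing \<langle>\<langle>\<langle>\<rangle>, g, \<langle>\<rangle>\<rangle>, f, \<langle>\<rangle>\<rangle> \<langle>\<langle>\<langle>\<rangle>, b, \<langle>\<rangle>\<rangle>, a, \<langle>\<rangle>\<rangle> = f a * g b"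
| "tree_pairing \<langle>\<langle>\<rangle>, f, \<langle>\<langle>\<rangle>, g, \<langle>\<rangle>\<rangle>\<rangle> \<langle>\<langle>\<rangle>, a, \<langle>\<langle>\<rangle>, b, \<langle>\<rangle>\<rangle>\<rangle> = - (f a * g b)"
| "tree_pairing _ _ = 0"

definition ns_orthogonal ::
  "('k::field \<Rightarrow> 'e::ab_group_add \<Rightarrow> 'e) \<Rightarrow> 'e set \<Rightarrow> ('e tree \<Rightarrow>\<^sub>0 'k) set
     \<Rightarrow> (('e \<Rightarrow> 'k) tree \<Rightarrow>\<^sub>0 'k) set" where
  "ns_orthogonal s E R =
     {x \<in> op_space (tree_operad (dual_space s E)) 3. \<forall>r\<in>R. bilin_form tree_pairing x r = 0}"

definition ns_koszul_dual ::
  "('k::field \<Rightarrow> 'e::ab_group_add \<Rightarrow> 'e) \<Rightarrow> 'e set \<Rightarrow> ('e tree \<Rightarrow>\<^sub>0 'k) set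
     \<Rightarrow> ('k, (('e \<Rightarrow> 'k) tree \<Rightarrow>\<^sub>0 'k) set) ns_operad" where
  "ns_koszul_dual s E R = ns_presented fun_scale (dual_space s E) (ns_orthogonal s E R)"

text \<open>
  The relations \<open>a \<circ>\<^sub>2 b = \<Sum> (a' \<rightarrow> b') \<circ>\<^sub>1 (a'' \<triangleright> b'')\<close>: an element \<open>u\<close> of the coset \<open>\<Phi> (a \<otimes> b)\<close>
  is one way of writing this tensor as a sum \<open>\<Sum> (a' \<rightarrow> b') \<otimes> (a'' \<triangleright> b'')\<close>.
\<close>

definition As_rels ::
  "('k::field \<Rightarrow> 'e::ab_group_add \<Rightarrow> 'e) \<Rightarrow> 'e set
     \<Rightarrow> (('e list \<Rightarrow>\<^sub>0 'k) set \<Rightarrow> ('e list \<Rightarrow>\<^sub>0 'k) set) \<Rightarrow> ('e tree \<Rightarrow>\<^sub>0 'k) set" where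
  "As_rels s E \<Phi> =
     {basis_vec (circ 2 a b) - lin_ext (\<lambda>xs. circ 1 (xs ! 0) (xs ! 1)) u
        | a b u. a \<in> E \<and> b \<in> E \<and> u \<in> \<Phi> (pure_tensor s E [a, b])}"

definition As_op_rels ::
  "('k::field \<Rightarrow> 'e::ab_group_add \<Rightarrow> 'e) \<Rightarrow> 'e set
     \<Rightarrow> (('e list \<Rightarrow>\<^sub>0 'k) set \<Rightarrow> ('e list \<Rightarrow>\<^sub>0 'k) set) \<Rightarrow> ('e tree \<Rightarrow>\<^sub>0 'k) set" where
  "As_op_rels s E \<Phi> =
     {basis_vec (circ 1 a b) - lin_ext (\<lambda>xs. circ 2 (xs ! 0) (xs ! 1)) u
        | a b u. a \<in> E \<and> b \<in> E \<and> u \<in> \<Phi> (pure_tensor s E [a, b])}"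

definition As_operad ::
  "('k::field \<Rightarrow> 'e::ab_group_add \<Rightarrow> 'e) \<Rightarrow> 'e set
     \<Rightarrow> (('e list \<Rightarrow>\<^sub>0 'k) set \<Rightarrow> ('e list \<Rightarrow>\<^sub>0 'k) set) \<Rightarrow> ('k, ('e tree \<Rightarrow>\<^sub>0 'k) set) ns_operad" where
  "As_operad s E \<Phi> = ns_presented s E (As_rels s E \<Phi>)"

definition As_op_operad ::
  "('k::field \<Rightarrow> 'e::ab_group_add \<Rightarrow> 'e) \<Rightarrow> 'e set
     \<Rightarrow> (('e list \<Rightarrow>\<^sub>0 'k) set \<Rightarrow> ('e list \<Rightarrow>\<^sub>0 'k) set) \<Rightarrow> ('k, ('e tree \<Rightarrow>\<^sub>0 'k) set) ns_operad" where
  "As_op_operad s E \<Phi> = ns_presented s E (As_op_rels s E \<Phi>)"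


section \<open>Symmetrisation\<close>

text \<open>
  The partial composition of permutations: with \<open>x \<cdot> \<sigma>\<close> the operation which feeds its \<open>k\<close>-th input
  into input \<open>\<sigma> k\<close> of \<open>x\<close>, one has
  \<open>(x \<cdot> \<sigma>) \<circ>\<^sub>i (y \<cdot> \<rho>) = (x \<circ>\<^bsub>\<sigma> i\<^esub> y) \<cdot> perm_comp m i n \<sigma> \<rho>\<close> for \<open>x \<in> P(m)\<close>, \<open>y \<in> P(n)\<close>.
\<close>

definition perm_comp :: "nat \<Rightarrow> nat \<Rightarrow> nat \<Rightarrow> (nat \<Rightarrow> nat) \<Rightarrow> (nat \<Rightarrow> nat) \<Rightarrow> nat \<Rightarrow> nat" where
  "perm_comp m i n \<sigma> \<rho> k =
     (let shift = (\<lambda>p. if p < \<sigma> i then p else p + n - 1) in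
      if k < 1 \<or> m + n - 1 < k then k
      else if k < i then shift (\<sigma> k)
      else if k < i + n then \<sigma> i + \<rho> (k - i + 1) - 1
      else shift (\<sigma> (k + 1 - n)))"

text \<open>
  \<open>Sym P (n) = P(n) \<otimes> K[S\<^sub>n]\<close>: the function \<open>f\<close> stands for the sum of the \<open>f \<sigma> \<cdot> \<sigma>\<close>, and is
  normalised to the \<open>0\<close> of the type outside \<open>S\<^sub>n\<close>.
\<close>

definition sym_operad ::
  "('k, 'x::comm_monoid_add, 'u) ns_operad_scheme \<Rightarrow> ('k, (nat \<Rightarrow> nat) \<Rightarrow> 'x) operad" where
  "sym_operad P =
     \<lparr> op_space = (\<lambda>n. {f. \<forall>\<sigma>. if \<sigma> permutes {1..n} then f \<sigma> \<in> op_space P n else f \<sigma> = 0}),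
       op_zero  = (\<lambda>n \<sigma>. if \<sigma> permutes {1..n} then op_zero P n else 0),
       op_scale = (\<lambda>n c f \<sigma>. if \<sigma> permutes {1..n} then op_scale P n c (f \<sigma>) else 0),
       op_comp  = (\<lambda>m i n f g \<pi>.
         if \<pi> permutes {1..m + n - 1}
         then op_zero P (m + n - 1) +
              (\<Sum>(\<sigma>, \<rho>) \<in> {(\<sigma>, \<rho>). \<sigma> permutes {1..m} \<and> \<rho> permutes {1..n} \<and> perm_comp m i n \<sigma> \<rho> = \<pi>}.
                 op_comp P m (\<sigma> i) n (f \<sigma>) (g \<rho>))
         else 0),
       op_unit  = (\<lambda>\<sigma>. if \<sigma> = id then op_unit P else 0),
       op_act   = (\<lambda>n \<rho> f \<sigma>. f (\<sigma> \<circ> inv \<rho>)) \<rparr>"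


section \<open>Symmetric binary quadratic operads\<close>

text \<open>\<open>x \<cdot> \<sigma>\<close> in the symmetrisation of \<open>tree_operad E\<close>.\<close>

definition sym_elem :: "('e tree \<Rightarrow>\<^sub>0 'k::field) \<Rightarrow> (nat \<Rightarrow> nat) \<Rightarrow> (nat \<Rightarrow> nat) \<Rightarrow> ('e tree \<Rightarrow>\<^sub>0 'k)" where
  "sym_elem x \<sigma> = (\<lambda>\<rho>. if \<rho> = \<sigma> then x else 0)"

text \<open>
  Binary quadratic data: a finite-dimensional representation of \<open>S\<^sub>2\<close>, the transposition acting by
  \<open>\<tau>\<close>, together with relations of arity 3. The latter are given by representatives in the
  symmetrisation of \<open>tree_operad E\<close>, which is the free symmetric operad on the \<^emph>\<open>set\<close> \<open>E\<close>;
  the free symmetric operad on the representation \<open>E\<close> arises by making the corollas linear and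
  equivariant. \<open>sym_presented s E \<tau> R\<close> is \<open>F(E)/(R)\<close>.
\<close>

definition quadratic_data ::
  "('k::field \<Rightarrow> 'e::ab_group_add \<Rightarrow> 'e) \<Rightarrow> 'e set \<Rightarrow> ('e \<Rightarrow> 'e)
     \<Rightarrow> ((nat \<Rightarrow> nat) \<Rightarrow> ('e tree \<Rightarrow>\<^sub>0 'k)) set \<Rightarrow> bool" where
  "quadratic_data s E \<tau> R \<longleftrightarrow>
     fin_dim_space s E \<and> linear_map_on s E s E \<tau> \<and> (\<forall>e\<in>E. \<tau> (\<tau> e) = e) \<and>
     R \<subseteq> op_space (sym_operad (tree_operad E :: ('k, 'e tree \<Rightarrow>\<^sub>0 'k) ns_operad)) 3"

definition sym_presented ::
  "('k::field \<Rightarrow> 'e::ab_group_add \<Rightarrow> 'e) \<Rightarrow> 'e set \<Rightarrow> ('e \<Rightarrow> 'e)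
     \<Rightarrow> ((nat \<Rightarrow> nat) \<Rightarrow> ('e tree \<Rightarrow>\<^sub>0 'k)) set
     \<Rightarrow> ('k, ((nat \<Rightarrow> nat) \<Rightarrow> ('e tree \<Rightarrow>\<^sub>0 'k)) set) operad" where
  "sym_presented s E \<tau> R =
     sym_quotient (sym_operad (tree_operad E))
       (sym_ideal (sym_operad (tree_operad E))
          (\<lambda>n. if n = 2
               then {sym_elem x id | x. x \<in> corolla_lin_rels s E} \<union>
                    {sym_elem (basis_vec (corolla (\<tau> e))) id
                       - sym_elem (basis_vec (corolla e)) (Transposition.transpose 1 2) | e. e \<in> E}
               else if n = 3 then R else {}))"

text \<open>
  In arity 3 every decorated tree with permuted inputs can be written, using the action of \<open>S\<^sub>2\<close>, in
  one of the three forms \<open>a(b(x\<^sub>1, x\<^sub>2), x\<^sub>3)\<close>, \<open>a(b(x\<^sub>2, x\<^sub>3), x\<^sub>1)\<close>, \<open>a(b(x\<^sub>3, x\<^sub>1), x\<^sub>2)\<close>, encoded as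
  \<open>(k, a, b)\<close> where \<open>x\<^sub>k\<close> is the outer input. \<open>normal_form \<tau> a b p q k\<close> treats \<open>a(b(x\<^sub>p, x\<^sub>q), x\<^sub>k)\<close>.
  The pairing makes the three summands \<open>E \<otimes> E\<close> orthogonal to each other.
\<close>

definition normal_form ::
  "('e \<Rightarrow> 'e) \<Rightarrow> 'e \<Rightarrow> 'e \<Rightarrow> nat \<Rightarrow> nat \<Rightarrow> nat \<Rightarrow> nat \<times> 'e \<times> 'e" where
  "normal_form \<tau> a b p q k = (k, a, if (p, q) \<in> {(1, 2), (2, 3), (3, 1)} then b else \<tau> b)"

fun tree_normal_form :: "('e \<Rightarrow> 'e) \<Rightarrow> 'e tree \<Rightarrow> (nat \<Rightarrow> nat) \<Rightarrow> (nat \<times> 'e \<times> 'e) option" where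
  "tree_normal_form \<tau> \<langle>\<langle>\<langle>\<rangle>, b, \<langle>\<rangle>\<rangle>, a, \<langle>\<rangle>\<rangle> \<sigma> = Some (normal_form \<tau> a b (inv \<sigma> 1) (inv \<sigma> 2) (inv \<sigma> 3))"
| "tree_normal_form \<tau> \<langle>\<langle>\<rangle>, a, \<langle>\<langle>\<rangle>, b, \<langle>\<rangle>\<rangle>\<rangle> \<sigma> = Some (normal_form \<tau> (\<tau> a) b (inv \<sigma> 2) (inv \<sigma> 3) (inv \<sigma> 1))"
| "tree_normal_form \<tau> _ \<sigma> = None"

definition dual_action :: "'e set \<Rightarrow> ('e \<Rightarrow> 'e) \<Rightarrow> ('e \<Rightarrow> 'k::field) \<Rightarrow> ('e \<Rightarrow> 'k)" where
  "dual_action E \<tau> f = (\<lambda>e. if e \<in> E then - f (\<tau> e) else 0)"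

definition sym_tree_pairing ::
  "'e set \<Rightarrow> ('e \<Rightarrow> 'e) \<Rightarrow> (nat \<Rightarrow> nat) \<Rightarrow> (nat \<Rightarrow> nat) \<Rightarrow> ('e \<Rightarrow> 'k::field) tree \<Rightarrow> 'e tree \<Rightarrow> 'k" where
  "sym_tree_pairing E \<tau> \<sigma> \<rho> t u =
     (case (tree_normal_form (dual_action E \<tau>) t \<sigma>, tree_normal_form \<tau> u \<rho>) of
        (Some (k, f, g), Some (l, a, b)) \<Rightarrow> if k = l then f a * g b else 0
      | _ \<Rightarrow> 0)"

definition sym_pairing ::
  "'e set \<Rightarrow> ('e \<Rightarrow> 'e) \<Rightarrow> ((nat \<Rightarrow> nat) \<Rightarrow> (('e \<Rightarrow> 'k::field) tree \<Rightarrow>\<^sub>0 'k))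
     \<Rightarrow> ((nat \<Rightarrow> nat) \<Rightarrow> ('e tree \<Rightarrow>\<^sub>0 'k)) \<Rightarrow> 'k" where
  "sym_pairing E \<tau> X Y =
     (\<Sum>\<sigma> | \<sigma> permutes {1..3}. \<Sum>\<rho> | \<rho> permutes {1..3}.
        bilin_form (sym_tree_pairing E \<tau> \<sigma> \<rho>) (X \<sigma>) (Y \<rho>))"

text \<open>The orthogonal of the subrepresentation of \<open>F(E)(3)\<close> generated by \<open>R\<close>.\<close>

definition sym_orthogonal ::
  "('k::field \<Rightarrow> 'e::ab_group_add \<Rightarrow> 'e) \<Rightarrow> 'e set \<Rightarrow> ('e \<Rightarrow> 'e)
     \<Rightarrow> ((nat \<Rightarrow> nat) \<Rightarrow> ('e tree \<Rightarrow>\<^sub>0 'k)) set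
     \<Rightarrow> ((nat \<Rightarrow> nat) \<Rightarrow> (('e \<Rightarrow> 'k) tree \<Rightarrow>\<^sub>0 'k)) set" where
  "sym_orthogonal s E \<tau> R =
     {X \<in> op_space (sym_operad (tree_operad (dual_space s E))) 3.
        \<forall>r\<in>R. \<forall>\<sigma>. \<sigma> permutes {1..3} \<longrightarrow>
          sym_pairing E \<tau> X (op_act (sym_operad (tree_operad E)) 3 \<sigma> r) = 0}"

text \<open>The dual representation is \<open>E\<^sup>*\<close> twisted by the signature, see \<open>dual_action\<close>.\<close>

definition sym_koszul_dual ::
  "('k::field \<Rightarrow> 'e::ab_group_add \<Rightarrow> 'e) \<Rightarrow> 'e set \<Rightarrow> ('e \<Rightarrow> 'e)
     \<Rightarrow> ((nat \<Rightarrow> nat) \<Rightarrow> ('e tree \<Rightarrow>\<^sub>0 'k)) set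
     \<Rightarrow> ('k, ((nat \<Rightarrow> nat) \<Rightarrow> (('e \<Rightarrow> 'k) tree \<Rightarrow>\<^sub>0 'k)) set) operad" where
  "sym_koszul_dual s E \<tau> R =
     sym_presented fun_scale (dual_space s E) (dual_action E \<tau>) (sym_orthogonal s E \<tau> R)"

end

theory Submission
  imports Defs
begin

text \<open>A symmetric Koszul dual is formed from a presentation, while the isomorphism of that
  presentation with the symmetrisation is only given abstractly. What survives of \<open>R\<close>
  is its ideal, so the ideal has to be read off from the isomorphism before an orthogonal can be
  computed. Free operads start here from a set of labels: linearity and equivariance of the corollas
  belong to the ideal, most identities hold only modulo it, and a vertex labelled 0 is not 0.
  Composition in a symmetrisation sums over pairs of permutations; on trees with labelled leaves it
  becomes substitution, and the action becomes relabelling. That the pairing is defined on the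
  quotient by linearity and equivariance needs control of the ideals in arities up to 3, where a
  composite has few possible factors. The sign that the nonsymmetric pairing puts on
  \<open>\<circ>\<^sub>2\<close> by hand comes in the symmetric case from the signature twist of the
  dual representation.\<close>

text \<open>
  An element of arity 3 of the free operad on \<open>E\<^sup>*\<close> is \<open>x\<^sub>1 + x\<^sub>2\<close> with \<open>x\<^sub>i\<close> coming from \<open>E\<^sup>* \<otimes> E\<^sup>*\<close> by \<open>\<circ>\<^sub>i\<close>.
  Orthogonality to \<open>a \<circ>\<^sub>2 b = \<Sum> (a' \<rightarrow> b') \<circ>\<^sub>1 (a'' \<triangleright> b'')\<close> says \<open>x\<^sub>2 = - \<Phi>\<^sup>*(x\<^sub>1)\<close>; these are the combinations of
  the relations for \<open>\<Phi>\<^sup>*\<close> with the roles of \<open>\<circ>\<^sub>1\<close> and \<open>\<circ>\<^sub>2\<close> exchanged. This is the nonsymmetric part.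

  An isomorphism of \<open>F(E)/(R)\<close> with \<open>Sym As\<^sub>\<Phi>\<close> gives in arity 2 a splitting \<open>E = \<gamma> A \<oplus> \<tau> (\<gamma> A)\<close>, and \<open>R\<close> can be
  replaced by the relations of \<open>As\<^sub>\<Phi>\<close> between the \<open>\<gamma> a\<close>. The dual representation splits in the same way. If the
  generators of the dual are embedded by \<open>f \<mapsto> f \<circ> p\<^sub>2\<close>, where \<open>p\<^sub>2\<close> is the projection to the second summand, they are
  opposite to the \<open>\<gamma> a\<close>, and \<open>\<circ>\<^sub>1\<close> is paired with \<open>\<circ>\<^sub>2\<close>; so now the relations for \<open>\<Phi>\<^sup>*\<close> appear without
  exchanging \<open>\<circ>\<^sub>1\<close> and \<open>\<circ>\<^sub>2\<close>.
\<close>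

section \<open>Linear maps on free vector spaces\<close>

lemma lookup_fsmul [simp]: "Poly_Mapping.lookup (fsmul c x) t = c * Poly_Mapping.lookup x t"
  by (simp add: fsmul_def Poly_Mapping.map.rep_eq when_def)

lemma vector_space_fsmul: "vector_space (fsmul :: 'k::field \<Rightarrow> ('x \<Rightarrow>\<^sub>0 'k) \<Rightarrow> _)"
  by unfold_locales (auto intro!: poly_mapping_eqI simp: lookup_add algebra_simps)

lemma vector_space_fun_scale: "vector_space (fun_scale :: 'k::field \<Rightarrow> ('x \<Rightarrow> 'k) \<Rightarrow> _)"
  by unfold_locales (auto simp: fun_scale_def algebra_simps)

lemma vector_space_mult: "vector_space ((*) :: 'k::field \<Rightarrow> 'k \<Rightarrow> 'k)"
  by unfold_locales (auto simp: algebra_simps)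

lemma keys_fsmul: "Poly_Mapping.keys (fsmul c x) \<subseteq> Poly_Mapping.keys x"
  by (auto simp: in_keys_iff)

lemma fsmul_single: "fsmul c (Poly_Mapping.single t d) = Poly_Mapping.single t (c * d)"
  by (auto intro!: poly_mapping_eqI simp: lookup_single when_def)

lemma fsmul_simps [simp]:
  "fsmul 0 x = 0" "fsmul c 0 = 0" "fsmul 1 x = x" "fsmul (- 1) x = - x"
  "fsmul c (fsmul d x) = fsmul (c * d) x"
  by (auto intro!: poly_mapping_eqI)

lemma fsmul_algebra:
  "fsmul c (x + y) = fsmul c x + fsmul c y" "fsmul c (x - y) = fsmul c x - fsmul c y"
  "fsmul (c + d) x = fsmul c x + fsmul d x" "fsmul c (- x) = - fsmul c x"
  by (auto intro!: poly_mapping_eqI simp: lookup_add lookup_minus algebra_simps)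

lemma fsmul_sum: "fsmul c (sum f S) = (\<Sum>x\<in>S. fsmul c (f x))"
  by (induction S rule: infinite_finite_induct) (auto simp: fsmul_algebra)

lemma decompose_basis:
  "x = (\<Sum>t\<in>Poly_Mapping.keys x. fsmul (Poly_Mapping.lookup x t) (basis_vec t))"
  by (rule poly_mapping_eqI) (simp add: fsmul_single lookup_sum lookup_single when_def in_keys_iff)

text \<open>The scalar operation of the target is a parameter because values are taken in free
  spaces, in the field and in spaces of generators.\<close>

definition flin :: "('k::field \<Rightarrow> 'v \<Rightarrow> 'v) \<Rightarrow> (('x \<Rightarrow>\<^sub>0 'k) \<Rightarrow> 'v::ab_group_add) \<Rightarrow> bool" where
  "flin sc f \<longleftrightarrow> (\<forall>x y. f (x + y) = f x + f y) \<and> (\<forall>c x. f (fsmul c x) = sc c (f x))"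

lemma flin_add: "flin sc f \<Longrightarrow> f (x + y) = f x + f y"
  and flin_scale: "flin sc f \<Longrightarrow> f (fsmul c x) = sc c (f x)"
  by (auto simp: flin_def)

lemma flin_zero: assumes "flin sc f" shows "f 0 = 0"
  using flin_add[OF assms, of 0 0] by simp

lemma flin_uminus: assumes "flin sc f" shows "f (- x) = - f x"
  using flin_add[OF assms, of x "- x"] flin_zero[OF assms]
  by (metis add.right_inverse minus_unique)

lemma flin_diff: assumes "flin sc f" shows "f (x - y) = f x - f y"
  using flin_add[OF assms, of x "- y"] flin_uminus[OF assms] by simp

lemma flin_sum: assumes "flin sc f" shows "f (sum g S) = (\<Sum>x\<in>S. f (g x))"
  by (induction S rule: infinite_finite_induct) (auto simp: flin_zero[OF assms] flin_add[OF assms])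

lemma flin_expand:
  assumes "flin sc f"
  shows "f x = (\<Sum>t\<in>Poly_Mapping.keys x. sc (Poly_Mapping.lookup x t) (f (basis_vec t)))"
  by (subst decompose_basis) (simp only: flin_sum[OF assms] flin_scale[OF assms])

lemma flin_eqI:
  assumes "flin sc f" "flin sc g" "\<And>t. t \<in> Poly_Mapping.keys x \<Longrightarrow> f (basis_vec t) = g (basis_vec t)"
  shows "f x = g x"
  using assms by (simp add: flin_expand[of sc f x] flin_expand[of sc g x])

lemma flin_zeroI:
  assumes "flin sc f" "\<And>c. sc c 0 = 0" "\<And>t. t \<in> Poly_Mapping.keys x \<Longrightarrow> f (basis_vec t) = 0"
  shows "f x = 0"
  using assms by (simp add: flin_expand[of sc f x])

lemma support_induct [consumes 1, case_names zero basis add]: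
  assumes "Poly_Mapping.keys x \<subseteq> S" "P 0"
    and "\<And>c t. t \<in> S \<Longrightarrow> P (fsmul c (basis_vec t))"
    and "\<And>x y. P x \<Longrightarrow> P y \<Longrightarrow> Poly_Mapping.keys x \<subseteq> S \<Longrightarrow> Poly_Mapping.keys y \<subseteq> S \<Longrightarrow> P (x + y)"
  shows "P x"
proof -
  \<comment> \<open>The support bound belongs to the claim because the hypothesis on sums asks for
    it.\<close>
  have "P (\<Sum>t\<in>T. fsmul (Poly_Mapping.lookup x t) (basis_vec t)) \<and>
        Poly_Mapping.keys (\<Sum>t\<in>T. fsmul (Poly_Mapping.lookup x t) (basis_vec t)) \<subseteq> S"
    if "finite T" "T \<subseteq> S" for T
    using that
  proof (induction T rule: finite_induct)
    case empty
    then show ?case using assms(2) by simp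
  next
    case (insert a T)
    have k: "Poly_Mapping.keys (fsmul (Poly_Mapping.lookup x a) (basis_vec a)) \<subseteq> S"
      using insert(4) by (auto simp: in_keys_iff lookup_single when_def split: if_splits)
    have IH: "P (\<Sum>t\<in>T. fsmul (Poly_Mapping.lookup x t) (basis_vec t))"
        "Poly_Mapping.keys (\<Sum>t\<in>T. fsmul (Poly_Mapping.lookup x t) (basis_vec t)) \<subseteq> S"
      using insert by blast+
    have "Poly_Mapping.keys (fsmul (Poly_Mapping.lookup x a) (basis_vec a)
        + (\<Sum>t\<in>T. fsmul (Poly_Mapping.lookup x t) (basis_vec t))) \<subseteq> S"
      using order_trans[OF keys_add] k IH(2) by (metis Un_least)
    moreover have "a \<in> S" using insert(4) by blast
    ultimately show ?case
      unfolding sum.insert[OF insert(1,2)] using assms(4)[OF assms(3) IH(1) k IH(2)] by blast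
  qed
  from this[OF finite_keys assms(1)] show ?thesis
    unfolding decompose_basis[of x, symmetric] by blast
qed

text \<open>\<open>lin_ext\<close>, \<open>bilin_ext\<close> and \<open>bilin_form\<close> are
  single or iterated instances, so their linearity all comes from \<open>flin_lext\<close>.\<close>

definition lext :: "('k::field \<Rightarrow> 'v \<Rightarrow> 'v) \<Rightarrow> ('x \<Rightarrow> 'v) \<Rightarrow> ('x \<Rightarrow>\<^sub>0 'k) \<Rightarrow> 'v::ab_group_add" where
  "lext sc h x = (\<Sum>t\<in>Poly_Mapping.keys x. sc (Poly_Mapping.lookup x t) (h t))"

lemma lext_superset:
  assumes "vector_space sc" "finite S" "Poly_Mapping.keys x \<subseteq> S"
  shows "lext sc h x = (\<Sum>t\<in>S. sc (Poly_Mapping.lookup x t) (h t))"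
proof -
  interpret vector_space sc by fact
  show ?thesis unfolding lext_def
    by (rule sum.mono_neutral_left) (use assms in \<open>auto simp: in_keys_iff\<close>)
qed

lemma flin_lext:
  assumes "vector_space sc" shows "flin sc (lext sc h)"
proof -
  interpret vector_space sc by fact
  \<comment> \<open>Over a common finite superset of the supports additivity is termwise;
    cancellation of keys in the sum then does no harm.\<close>
  have "lext sc h (x + y) = lext sc h x + lext sc h y" for x y
    using keys_add[of x y]
    by (simp add: lext_superset[OF assms, where S="Poly_Mapping.keys x \<union> Poly_Mapping.keys y"]
        lookup_add scale_left_distrib sum.distrib)
  moreover have "lext sc h (fsmul c x) = sc c (lext sc h x)" for c x
    using keys_fsmul[of c x]
    by (simp add: lext_superset[OF assms, where S="Poly_Mapping.keys x"] scale_sum_right)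
  ultimately show ?thesis by (simp add: flin_def)
qed

lemma lext_basis:
  assumes "vector_space sc" shows "lext sc h (basis_vec t) = h t"
proof -
  interpret vector_space sc by fact
  show ?thesis by (simp add: lext_def)
qed

lemma lext_cong: "(\<And>t. t \<in> Poly_Mapping.keys x \<Longrightarrow> h t = h' t) \<Longrightarrow> lext sc h x = lext sc h' x"
  by (simp add: lext_def)

lemma lext_closed:
  assumes "\<And>t. t \<in> Poly_Mapping.keys x \<Longrightarrow> h t \<in> V" "0 \<in> V"
    "\<And>a b. a \<in> V \<Longrightarrow> b \<in> V \<Longrightarrow> a + b \<in> V" "\<And>c a. a \<in> V \<Longrightarrow> sc c a \<in> V"
  shows "lext sc h x \<in> V"
proof -
  have "(\<Sum>t\<in>T. sc (Poly_Mapping.lookup x t) (h t)) \<in> V" if "finite T" "T \<subseteq> Poly_Mapping.keys x" for T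
    using that by (induction T rule: finite_induct) (use assms in auto)
  then show ?thesis by (simp add: lext_def)
qed

lemma lin_ext_lext: "lin_ext g = lext fsmul (\<lambda>t. basis_vec (g t))"
  by (rule ext) (simp add: lin_ext_def lext_def fsmul_single)

lemma bilin_ext_lext:
  "bilin_ext g x y = lext fsmul (\<lambda>s. lext fsmul (\<lambda>t. basis_vec (g s t)) y) x"
  by (simp add: bilin_ext_def lext_def fsmul_sum fsmul_single)

lemma bilin_form_lext: "bilin_form p x y = lext (*) (\<lambda>s. lext (*) (\<lambda>t. p s t) y) x"
  by (simp add: bilin_form_def lext_def sum_distrib_left mult_ac)

text \<open>An iterated extension is visibly linear in its outer argument only. Linearity in the
  inner one uses that scalars commute.\<close>

lemma flin_fun_swap:
  assumes "vector_space sc" "\<And>s. flin sc (F s)"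
  shows "flin sc (\<lambda>y. lext sc (\<lambda>s. F s y) x)"
proof -
  interpret vector_space sc by fact
  show ?thesis using assms(2)
    by (auto simp: flin_def lext_def scale_right_distrib sum.distrib scale_sum_right scale_scale mult.commute)
qed

lemma flin_comp: "flin fsmul f \<Longrightarrow> flin sc g \<Longrightarrow> flin sc (\<lambda>x. g (f x))"
  by (simp add: flin_def)

lemma flin_lin_ext: "flin fsmul (lin_ext g)"
  by (simp add: lin_ext_lext flin_lext vector_space_fsmul)

lemma lin_ext_basis [simp]: "lin_ext g (basis_vec t) = basis_vec (g t)"
  by (simp add: lin_ext_lext lext_basis vector_space_fsmul)

lemma flin_bilin_ext_left: "flin fsmul (\<lambda>x. bilin_ext g x y)"
  by (simp add: bilin_ext_lext flin_lext vector_space_fsmul)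

lemma flin_bilin_ext_right: "flin fsmul (\<lambda>y. bilin_ext g x y)"
  unfolding bilin_ext_lext by (intro flin_fun_swap flin_lext vector_space_fsmul)

lemma bilin_ext_basis [simp]: "bilin_ext g (basis_vec s) (basis_vec t) = basis_vec (g s t)"
  by (simp add: bilin_ext_lext lext_basis vector_space_fsmul)

lemma flin_bilin_form_left: "flin (*) (\<lambda>x. bilin_form p x y)"
  by (simp add: bilin_form_lext flin_lext vector_space_mult)

lemma flin_bilin_form_right: "flin (*) (\<lambda>y. bilin_form p x y)"
  unfolding bilin_form_lext by (intro flin_fun_swap flin_lext vector_space_mult)

lemma bilin_form_basis [simp]: "bilin_form p (basis_vec s) (basis_vec t) = p s t"
  by (simp add: bilin_form_lext lext_basis vector_space_mult)

lemma bilin_ext_basis_left: "bilin_ext g (basis_vec s) y = lin_ext (g s) y"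
  by (simp add: bilin_ext_lext lext_basis vector_space_fsmul lin_ext_lext)

lemma bilin_ext_basis_right: "bilin_ext g x (basis_vec t) = lin_ext (\<lambda>s. g s t) x"
  by (simp add: bilin_ext_lext lext_basis vector_space_fsmul lin_ext_lext)

lemma lin_ext_cong:
  assumes "\<And>s. s \<in> Poly_Mapping.keys x \<Longrightarrow> g s = g' s" shows "lin_ext g x = lin_ext g' x"
  using assms by (simp add: lin_ext_def)

lemma bilin_form_cong:
  assumes "\<And>s t. s \<in> Poly_Mapping.keys x \<Longrightarrow> t \<in> Poly_Mapping.keys y \<Longrightarrow> p s t = p' s t"
  shows "bilin_form p x y = bilin_form p' x y"
  using assms by (simp add: bilin_form_def)

lemmas bilin_simps =
  flin_add[OF flin_bilin_ext_left] flin_add[OF flin_bilin_ext_right]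
  flin_diff[OF flin_bilin_ext_left] flin_diff[OF flin_bilin_ext_right]
  flin_scale[OF flin_bilin_ext_left] flin_scale[OF flin_bilin_ext_right]
  flin_zero[OF flin_bilin_ext_left] flin_zero[OF flin_bilin_ext_right]
  flin_uminus[OF flin_bilin_ext_left] flin_uminus[OF flin_bilin_ext_right]

lemmas lin_simps =
  flin_add[OF flin_lin_ext] flin_diff[OF flin_lin_ext] flin_scale[OF flin_lin_ext]
  flin_zero[OF flin_lin_ext] flin_uminus[OF flin_lin_ext]

lemmas form_simps =
  flin_add[OF flin_bilin_form_left] flin_add[OF flin_bilin_form_right]
  flin_diff[OF flin_bilin_form_left] flin_diff[OF flin_bilin_form_right]
  flin_scale[OF flin_bilin_form_left] flin_scale[OF flin_bilin_form_right]
  flin_zero[OF flin_bilin_form_left] flin_zero[OF flin_bilin_form_right]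
  flin_uminus[OF flin_bilin_form_left] flin_uminus[OF flin_bilin_form_right]

lemma bilin_eqI:
  assumes "\<And>y. flin sc (\<lambda>x. F x y)" "\<And>y. flin sc (\<lambda>x. G x y)" "\<And>x. flin sc (F x)" "\<And>x. flin sc (G x)"
    and "\<And>s t. s \<in> Poly_Mapping.keys x \<Longrightarrow> t \<in> Poly_Mapping.keys y
      \<Longrightarrow> F (basis_vec s) (basis_vec t) = G (basis_vec s) (basis_vec t)"
  shows "F x y = G x y"
proof -
  have "F (basis_vec s) y = G (basis_vec s) y" if "s \<in> Poly_Mapping.keys x" for s
    using assms(3,4) by (rule flin_eqI) (use assms(5) that in blast)
  with flin_eqI[of sc "\<lambda>x. F x y" "\<lambda>x. G x y" x] assms(1,2) show ?thesis by blast
qed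

lemma keys_add_subset: "Poly_Mapping.keys x \<subseteq> S \<Longrightarrow> Poly_Mapping.keys y \<subseteq> S \<Longrightarrow> Poly_Mapping.keys (x + y) \<subseteq> S"
  using keys_add by fastforce

lemma keys_lext_fsmul:
  fixes x :: "'x \<Rightarrow>\<^sub>0 'a::field"
  assumes "\<And>t. t \<in> Poly_Mapping.keys x \<Longrightarrow> Poly_Mapping.keys (h t) \<subseteq> S"
  shows "Poly_Mapping.keys (lext fsmul h x) \<subseteq> S"
proof -
  have "lext fsmul h x \<in> {y. Poly_Mapping.keys y \<subseteq> S}"
    proof (rule lext_closed)
    fix c and a :: "_ \<Rightarrow>\<^sub>0 'a" assume "a \<in> {y. Poly_Mapping.keys y \<subseteq> S}"
    then show "fsmul c a \<in> {y. Poly_Mapping.keys y \<subseteq> S}" using keys_fsmul[of c a] by auto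
  qed (simp_all add: assms keys_add_subset)
  then show ?thesis by simp
qed

lemma keys_lin_ext:
  assumes "\<And>t. t \<in> Poly_Mapping.keys x \<Longrightarrow> g t \<in> S"
  shows "Poly_Mapping.keys (lin_ext g x) \<subseteq> S"
  unfolding lin_ext_lext by (rule keys_lext_fsmul) (use assms in simp)

lemma keys_bilin_ext:
  assumes "\<And>s t. s \<in> Poly_Mapping.keys x \<Longrightarrow> t \<in> Poly_Mapping.keys y \<Longrightarrow> g s t \<in> S"
  shows "Poly_Mapping.keys (bilin_ext g x y) \<subseteq> S"
  unfolding bilin_ext_lext by (intro keys_lext_fsmul) (use assms in simp)

lemma keys_fsmul_subset: "Poly_Mapping.keys x \<subseteq> S \<Longrightarrow> Poly_Mapping.keys (fsmul c x) \<subseteq> S"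
  by (rule order_trans[OF keys_fsmul])

lemma keys_diff_subset:
  fixes x y :: "'x \<Rightarrow>\<^sub>0 'k::ab_group_add"
  assumes "Poly_Mapping.keys x \<subseteq> S" "Poly_Mapping.keys y \<subseteq> S"
  shows "Poly_Mapping.keys (x - y) \<subseteq> S"
proof
  fix t assume "t \<in> Poly_Mapping.keys (x - y)"
  then have "t \<in> Poly_Mapping.keys x \<or> t \<in> Poly_Mapping.keys y" by (auto simp: in_keys_iff lookup_minus)
  then show "t \<in> S" using assms by blast
qed

lemma keys_sum_subset: "(\<And>i. i \<in> I \<Longrightarrow> Poly_Mapping.keys (f i) \<subseteq> S) \<Longrightarrow> Poly_Mapping.keys (sum f I) \<subseteq> S"
proof (induction I rule: infinite_finite_induct)
  case (insert i I)
  then show ?case by (metis insertCI keys_add_subset sum.insert)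
qed auto

section \<open>Cosets\<close>

text \<open>Cosets need no more than a subgroup; scalars are treated separately. One notion thus
  serves multilinearity relations, ideals of trees and ideals of families of trees.\<close>

definition add_sub :: "'v::ab_group_add set \<Rightarrow> bool" where
  "add_sub J \<longleftrightarrow> 0 \<in> J \<and> (\<forall>x\<in>J. \<forall>y\<in>J. x - y \<in> J)"

lemma add_subD:
  assumes "add_sub J"
  shows "0 \<in> J" "x \<in> J \<Longrightarrow> y \<in> J \<Longrightarrow> x - y \<in> J" "x \<in> J \<Longrightarrow> - x \<in> J" "x \<in> J \<Longrightarrow> y \<in> J \<Longrightarrow> x + y \<in> J"
proof -
  have z: "0 \<in> J" and d: "\<And>x y. x \<in> J \<Longrightarrow> y \<in> J \<Longrightarrow> x - y \<in> J"
    using assms unfolding add_sub_def by blast+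
  have u: "- x \<in> J" if "x \<in> J" for x using d[OF z that] by simp
  show "0 \<in> J" by (rule z)
  show "x \<in> J \<Longrightarrow> y \<in> J \<Longrightarrow> x - y \<in> J" by (rule d)
  show "x \<in> J \<Longrightarrow> - x \<in> J" by (rule u)
  show "x + y \<in> J" if "x \<in> J" "y \<in> J" using d[OF that(1) u[OF that(2)]] by simp
qed

lemma coset_mem: "y \<in> x +o (J :: 'v::ab_group_add set) \<longleftrightarrow> y - x \<in> J"
  by (rule set_minus_plus[symmetric])

lemma coset_eq_iff:
  assumes "add_sub J" shows "x +o J = y +o J \<longleftrightarrow> x - y \<in> J"
proof
  assume "x +o J = y +o J"
  moreover have "x \<in> x +o J" using add_subD(1)[OF assms] by (simp add: coset_mem)
  ultimately have "x \<in> y +o J" by blast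
  then show "x - y \<in> J" by (simp only: coset_mem)
next
  assume *: "x - y \<in> J"
  have "z - y \<in> J \<longleftrightarrow> z - x \<in> J" for z
  proof
    assume "z - y \<in> J"
    from add_subD(2)[OF assms this *] show "z - x \<in> J" by simp
  next
    assume "z - x \<in> J"
    from add_subD(4)[OF assms this *] show "z - y \<in> J" by simp
  qed
  then show "x +o J = y +o J" by (simp only: set_eq_iff coset_mem simp_thms)
qed

lemma coset_self: "add_sub J \<Longrightarrow> x \<in> x +o J"
  by (simp add: coset_mem add_subD(1))

lemma add_sub_plus: assumes "add_sub J" shows "J + J = J"
proof
  show "J + J \<subseteq> J"
  proof
    fix z assume "z \<in> J + J"
    then obtain a b where "z = a + b" "a \<in> J" "b \<in> J" by (rule set_plus_elim)
    then show "z \<in> J" using add_subD(4)[OF assms] by simp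
  qed
  show "J \<subseteq> J + J" by (rule set_zero_plus2) (rule add_subD(1)[OF assms])
qed

lemma coset_add: "add_sub J \<Longrightarrow> (x +o J) + (y +o J) = (x + y) +o J"
  by (simp add: set_plus_rearrange add_sub_plus)

text \<open>Scaling and composition in quotients are defined as a set of results plus the ideal. To
  recognise such a set as a coset, one result is needed and the differences to it must lie in
  \<open>J\<close>.\<close>

lemma plus_coset_eq:
  assumes "add_sub J" "x \<in> S" "\<And>y. y \<in> S \<Longrightarrow> y - x \<in> J" shows "S + J = x +o J"
proof (rule set_eqI, rule iffI)
  fix z assume "z \<in> S + J"
  then obtain a b where "z = a + b" "a \<in> S" "b \<in> J" by (rule set_plus_elim)
  moreover have "(a - x) + b \<in> J"
    using add_subD(4)[OF assms(1) assms(3)[OF \<open>a \<in> S\<close>] \<open>b \<in> J\<close>] .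
  ultimately show "z \<in> x +o J" by (simp add: coset_mem algebra_simps)
next
  fix z assume "z \<in> x +o J"
  then show "z \<in> S + J" using assms(2) unfolding elt_set_plus_def by blast
qed

text \<open>The extra summand \<open>J\<close> takes care of empty \<open>K\<close>: an empty sum of
  sets is \<open>{0}\<close>, whereas the zero class is \<open>J\<close>. The composition of
  \<open>sym_operad\<close> has the summand \<open>op_zero\<close> for the same purpose.\<close>

lemma sum_cosets:
  assumes "add_sub J" "finite K"
  shows "J + (\<Sum>k\<in>K. x k +o J) = (\<Sum>k\<in>K. x k) +o J"
  using assms(2)
proof (induction K rule: finite_induct)
  case empty
  then show ?case by (simp add: add_sub_plus[OF assms(1)])
next
  case (insert k K)
  have "J + (\<Sum>k\<in>insert k K. x k +o J) = (x k +o J) + (J + (\<Sum>k\<in>K. x k +o J))"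
    by (simp only: sum.insert[OF insert(1,2)] add.left_commute[of J])
  also have "\<dots> = (x k + (\<Sum>k\<in>K. x k)) +o J"
    by (simp only: insert.IH coset_add[OF assms(1)])
  finally show ?case by (simp only: sum.insert[OF insert(1,2)])
qed

section \<open>Ideals of nonsymmetric presented operads\<close>

interpretation fs: vector_space "fsmul :: 'k::field \<Rightarrow> ('x \<Rightarrow>\<^sub>0 'k) \<Rightarrow> _"
  by (rule vector_space_fsmul)

definition tree_space :: "'e set \<Rightarrow> nat \<Rightarrow> ('e tree \<Rightarrow>\<^sub>0 'k::field) set" where
  "tree_space E n = {x. Poly_Mapping.keys x \<subseteq> {t. size1 t = n \<and> set_tree t \<subseteq> E}}"

lemma tree_space_basis [simp]: "basis_vec t \<in> tree_space E n \<longleftrightarrow> size1 t = n \<and> set_tree t \<subseteq> E"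
  by (simp add: tree_space_def)

lemma tree_space_closed:
  "0 \<in> tree_space E n" "x \<in> tree_space E n \<Longrightarrow> y \<in> tree_space E n \<Longrightarrow> x + y \<in> tree_space E n"
  "x \<in> tree_space E n \<Longrightarrow> y \<in> tree_space E n \<Longrightarrow> x - y \<in> tree_space E n"
  "x \<in> tree_space E n \<Longrightarrow> fsmul c x \<in> tree_space E n"
  unfolding tree_space_def mem_Collect_eq
  by (simp, rule keys_add_subset, assumption+, rule keys_diff_subset, assumption+, rule keys_fsmul_subset)

lemma tree_space_sum: "(\<And>i. i \<in> I \<Longrightarrow> f i \<in> tree_space E n) \<Longrightarrow> sum f I \<in> tree_space E n"
  by (induction I rule: infinite_finite_induct) (simp_all add: tree_space_closed)

lemma tree_space_induct [consumes 1, case_names zero basis add]: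
  assumes "x \<in> tree_space E n" "P 0"
    "\<And>c t. size1 t = n \<Longrightarrow> set_tree t \<subseteq> E \<Longrightarrow> P (fsmul c (basis_vec t))"
    "\<And>x y. P x \<Longrightarrow> P y \<Longrightarrow> x \<in> tree_space E n \<Longrightarrow> y \<in> tree_space E n \<Longrightarrow> P (x + y)"
  shows "P x"
  using assms(1) unfolding tree_space_def mem_Collect_eq
  by (induction x rule: support_induct) (use assms(2-4) in \<open>auto simp: tree_space_def\<close>)

lemma tree_space_keys:
  "x \<in> tree_space E n \<Longrightarrow> t \<in> Poly_Mapping.keys x \<Longrightarrow> size1 t = n"
  "x \<in> tree_space E n \<Longrightarrow> t \<in> Poly_Mapping.keys x \<Longrightarrow> set_tree t \<subseteq> E"
  by (auto simp: tree_space_def)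

lemma tree_operad_simps [simp]:
  "op_space (tree_operad E) n = tree_space E n"
  "op_zero (tree_operad E) n = 0" "op_scale (tree_operad E) n = fsmul"
  "op_comp (tree_operad E) m i n = bilin_ext (\<lambda>t u. graft t i u)"
  "op_unit (tree_operad E) = basis_vec \<langle>\<rangle>"
  by (simp_all add: tree_operad_def tree_space_def)

lemma size1_graft: "1 \<le> i \<Longrightarrow> i \<le> size1 t \<Longrightarrow> size1 (graft t i u) = size1 t + size1 u - 1"
proof (induction t arbitrary: i)
  case (Node l a r)
  have "size1 u \<noteq> 0" "size1 l \<noteq> 0" "size1 r \<noteq> 0" by auto
  then show ?case using Node by auto
qed auto

lemma set_tree_graft: "set_tree (graft t i u) \<subseteq> set_tree t \<union> set_tree u"
  by (induction t arbitrary: i) auto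

lemma tree_comp_closed:
  assumes "x \<in> tree_space E m" "y \<in> tree_space E n" "1 \<le> i" "i \<le> m"
  shows "bilin_ext (\<lambda>t u. graft t i u) x y \<in> tree_space E (m + n - 1)"
  unfolding tree_space_def mem_Collect_eq
proof (rule keys_bilin_ext)
  fix t u assume "t \<in> Poly_Mapping.keys x" "u \<in> Poly_Mapping.keys y"
  with tree_space_keys[OF assms(1)] tree_space_keys[OF assms(2)]
  have "size1 t = m" "set_tree t \<subseteq> E" "size1 u = n" "set_tree u \<subseteq> E" by blast+
  then show "graft t i u \<in> {t. size1 t = m + n - 1 \<and> set_tree t \<subseteq> E}"
    using size1_graft[of i t u] set_tree_graft[of t i u] assms(3,4) by blast
qed

text \<open>The ideal is generated by \<open>R\<close> together with linearity of corollas, so that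
  its quotient is already an operad over the vector space and not over the set of labels.\<close>

definition pres_ideal ::
  "('k::field \<Rightarrow> 'e::ab_group_add \<Rightarrow> 'e) \<Rightarrow> 'e set \<Rightarrow> ('e tree \<Rightarrow>\<^sub>0 'k) set \<Rightarrow> nat \<Rightarrow> ('e tree \<Rightarrow>\<^sub>0 'k) set" where
  "pres_ideal s E R n = {x. (n, x) \<in> ns_ideal (tree_operad E)
          (\<lambda>n. if n = 2 then corolla_lin_rels s E else if n = 3 then R else {})}"

lemma pres_ideal_lin: "x \<in> corolla_lin_rels s E \<Longrightarrow> x \<in> pres_ideal s E R 2"
  unfolding pres_ideal_def by (auto intro: ns_ideal.intros(1))

lemma pres_ideal_rel: "x \<in> R \<Longrightarrow> x \<in> pres_ideal s E R 3"
  unfolding pres_ideal_def by (auto intro: ns_ideal.intros(1))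

lemma pres_ideal_zero: "0 \<in> pres_ideal s E R n"
  using ns_ideal.intros(2)[of n "tree_operad E"] by (simp add: pres_ideal_def)

lemma pres_ideal_add: "x \<in> pres_ideal s E R n \<Longrightarrow> y \<in> pres_ideal s E R n \<Longrightarrow> x + y \<in> pres_ideal s E R n"
  by (simp add: pres_ideal_def ns_ideal.intros(3))

lemma pres_ideal_scale: "x \<in> pres_ideal s E R n \<Longrightarrow> fsmul c x \<in> pres_ideal s E R n"
  using ns_ideal.intros(4)[of n x "tree_operad E"] by (simp add: pres_ideal_def)

lemma pres_ideal_uminus: "x \<in> pres_ideal s E R n \<Longrightarrow> - x \<in> pres_ideal s E R n"
  using pres_ideal_scale[of x s E R n "- 1"] by simp

lemma add_sub_pres_ideal: "add_sub (pres_ideal s E R n)"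
  unfolding add_sub_def
proof (intro conjI ballI pres_ideal_zero)
  fix x y assume "x \<in> pres_ideal s E R n" "y \<in> pres_ideal s E R n"
  then have "x + - y \<in> pres_ideal s E R n" by (intro pres_ideal_add pres_ideal_uminus)
  then show "x - y \<in> pres_ideal s E R n" by simp
qed

lemma pres_ideal_comp_left:
  assumes "x \<in> pres_ideal s E R m" "y \<in> tree_space E n" "1 \<le> i" "i \<le> m"
  shows "bilin_ext (\<lambda>t u. graft t i u) x y \<in> pres_ideal s E R (m + n - 1)"
  using ns_ideal.intros(5)[of m x "tree_operad E" _ y n i] assms by (simp add: pres_ideal_def)

lemma pres_ideal_comp_right:
  assumes "x \<in> tree_space E m" "y \<in> pres_ideal s E R n" "1 \<le> i" "i \<le> m"
  shows "bilin_ext (\<lambda>t u. graft t i u) x y \<in> pres_ideal s E R (m + n - 1)"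
  using ns_ideal.intros(6)[of x "tree_operad E" m n y _ i] assms by (simp add: pres_ideal_def)

lemma pres_ideal_induct [consumes 1, case_names lin rel zero add scale left right]:
  assumes "x \<in> pres_ideal s E R n"
    and "\<And>x. x \<in> corolla_lin_rels s E \<Longrightarrow> P 2 x"
    and "\<And>x. x \<in> R \<Longrightarrow> P 3 x"
    and "\<And>n. P n 0"
    and "\<And>n x y. P n x \<Longrightarrow> P n y \<Longrightarrow> P n (x + y)"
    and "\<And>n c x. P n x \<Longrightarrow> P n (fsmul c x)"
    and "\<And>m n i x y. P m x \<Longrightarrow> y \<in> tree_space E n \<Longrightarrow> 1 \<le> i \<Longrightarrow> i \<le> m
      \<Longrightarrow> P (m + n - 1) (bilin_ext (\<lambda>t u. graft t i u) x y)"
    and "\<And>m n i x y. x \<in> tree_space E m \<Longrightarrow> P n y \<Longrightarrow> 1 \<le> i \<Longrightarrow> i \<le> m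
      \<Longrightarrow> P (m + n - 1) (bilin_ext (\<lambda>t u. graft t i u) x y)"
  shows "P n x"
proof -
  have "(n, x) \<in> ns_ideal (tree_operad E)
          (\<lambda>n. if n = 2 then corolla_lin_rels s E else if n = 3 then R else {})"
    using assms(1) by (simp add: pres_ideal_def)
  then show ?thesis
  proof (induction rule: ns_ideal.induct)
    case (1 x n)
    then show ?case using assms(2,3) by (auto split: if_splits)
  next
    case (5 m x y n i)
    then show ?case using assms(7) by simp
  next
    case (6 x m n y i)
    then show ?case using assms(8) by simp
  qed (use assms(4-6) in auto)
qed

lemma pres_ideal_least:
  assumes "R \<subseteq> pres_ideal s E R' 3"
  shows "pres_ideal s E R n \<subseteq> pres_ideal s E R' n"
proof
  fix x assume "x \<in> pres_ideal s E R n"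
  then show "x \<in> pres_ideal s E R' n"
    by (induction rule: pres_ideal_induct)
      (use assms in \<open>blast intro: pres_ideal_lin pres_ideal_zero pres_ideal_add pres_ideal_scale
         pres_ideal_comp_left pres_ideal_comp_right\<close>)+
qed

lemma corolla_lin_rels_space:
  assumes "module s" "module.subspace s E"
  shows "corolla_lin_rels s E \<subseteq> tree_space E 2"
proof -
  interpret module s by fact
  have "a + b \<in> E" "s c a \<in> E" if "a \<in> E" "b \<in> E" for a b c
    using assms(2) that by (auto simp: subspace_def)
  then show ?thesis
    by (auto simp: corolla_lin_rels_def intro!: tree_space_closed)
qed

lemma pres_ideal_space:
  assumes "module s" "module.subspace s E" "R \<subseteq> tree_space E 3"
  shows "pres_ideal s E R n \<subseteq> tree_space E n"
proof
  fix x assume "x \<in> pres_ideal s E R n"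
  then show "x \<in> tree_space E n"
  proof (induction rule: pres_ideal_induct)
    case (add n x y)
    then show ?case by (simp add: tree_space_closed)
  next
    case (scale n c x)
    then show ?case by (simp add: tree_space_closed)
  next
    case (left m n i x y)
    then show ?case using tree_comp_closed by simp
  next
    case (right m n i x y)
    then show ?case using tree_comp_closed by simp
  qed (use corolla_lin_rels_space[OF assms(1,2)] assms(3) in \<open>auto simp: tree_space_closed\<close>)
qed

lemma ns_isomorphic_refl: "ns_isomorphic P P"
  unfolding ns_isomorphic_def ns_operad_iso_def linear_map_on_def
  by (rule exI[of _ "\<lambda>n. id"]) (simp add: bij_betw_def)

text \<open>Relations generating each other give literally equal quotients. Hence the nonsymmetric
  duals are obtained as equalities, and the identity serves as the isomorphism.\<close>

lemma ns_presented_eqI: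
  assumes "R \<subseteq> pres_ideal s E R' 3" "R' \<subseteq> pres_ideal s E R 3"
  shows "ns_presented s E R = ns_presented s E R'"
proof -
  have "pres_ideal s E R = pres_ideal s E R'"
    using pres_ideal_least[OF assms(1)] pres_ideal_least[OF assms(2)] by blast
  then have "ns_ideal (tree_operad E)
          (\<lambda>n. if n = 2 then corolla_lin_rels s E else if n = 3 then R else {})
      = ns_ideal (tree_operad E)
          (\<lambda>n. if n = 2 then corolla_lin_rels s E else if n = 3 then R' else {})"
    by (auto simp: pres_ideal_def fun_eq_iff set_eq_iff)
  then show ?thesis by (simp add: ns_presented_def)
qed

section \<open>Tensors of degree two\<close>

definition tensor2 :: "'e set \<Rightarrow> ('e list \<Rightarrow>\<^sub>0 'k::field) set" where
  "tensor2 E = {x. Poly_Mapping.keys x \<subseteq> {xs. length xs = 2 \<and> set xs \<subseteq> E}}"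

lemma tensor2_basis [simp]: "basis_vec [a, b] \<in> tensor2 E \<longleftrightarrow> a \<in> E \<and> b \<in> E"
  by (auto simp: tensor2_def)

lemma tensor2_closed [simp]:
  "0 \<in> tensor2 E" "x \<in> tensor2 E \<Longrightarrow> y \<in> tensor2 E \<Longrightarrow> x + y \<in> tensor2 E"
  "x \<in> tensor2 E \<Longrightarrow> y \<in> tensor2 E \<Longrightarrow> x - y \<in> tensor2 E"
  "x \<in> tensor2 E \<Longrightarrow> fsmul c x \<in> tensor2 E"
  using keys_fsmul[of c x] by (auto simp: tensor2_def keys_add_subset keys_diff_subset)

lemma tensor2_sum: "(\<And>i. i \<in> I \<Longrightarrow> f i \<in> tensor2 E) \<Longrightarrow> sum f I \<in> tensor2 E"
  by (induction I rule: infinite_finite_induct) simp_all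

lemma tensor2_induct [consumes 1, case_names zero basis add]:
  assumes "x \<in> tensor2 E" "P 0" "\<And>c a b. a \<in> E \<Longrightarrow> b \<in> E \<Longrightarrow> P (fsmul c (basis_vec [a, b]))"
    "\<And>x y. P x \<Longrightarrow> P y \<Longrightarrow> x \<in> tensor2 E \<Longrightarrow> y \<in> tensor2 E \<Longrightarrow> P (x + y)"
  shows "P x"
proof -
  have "Poly_Mapping.keys x \<subseteq> {xs. length xs = 2 \<and> set xs \<subseteq> E}"
    using assms(1) by (simp add: tensor2_def)
  then show ?thesis
  proof (induction x rule: support_induct)
    case (basis c t)
    then obtain a b where "t = [a, b]" by (auto simp: numeral_2_eq_2 length_Suc_conv)
    then show ?case using basis assms(3) by simp
  next
    case (add x y)
    then show ?case using assms(4) by (simp add: tensor2_def)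
  qed (rule assms(2))
qed

lemma multilin_rels2_gen:
  assumes "a \<in> E" "b \<in> E" "d \<in> E"
  shows "basis_vec [a + b, d] - basis_vec [a, d] - basis_vec [b, d] \<in> multilin_rels s E 2"
    "basis_vec [d, a + b] - basis_vec [d, a] - basis_vec [d, b] \<in> multilin_rels s E 2"
    "basis_vec [s c a, d] - fsmul c (basis_vec [a, d]) \<in> multilin_rels s E 2"
    "basis_vec [d, s c a] - fsmul c (basis_vec [d, a]) \<in> multilin_rels s E 2"
proof -
  let ?A = "{basis_vec (xs @ [a + b] @ ys) - basis_vec (xs @ [a] @ ys) - basis_vec (xs @ [b] @ ys) :: 'a list \<Rightarrow>\<^sub>0 'b
         | xs ys a b. set xs \<subseteq> E \<and> set ys \<subseteq> E \<and> a \<in> E \<and> b \<in> E \<and> Suc (length xs + length ys) = 2}"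
  let ?B = "{basis_vec (xs @ [s c a] @ ys) - fsmul c (basis_vec (xs @ [a] @ ys))
         | xs ys a c. set xs \<subseteq> E \<and> set ys \<subseteq> E \<and> a \<in> E \<and> Suc (length xs + length ys) = 2}"
  have M: "x \<in> multilin_rels s E 2" if "x \<in> ?A \<union> ?B" for x
    unfolding multilin_rels_def by (rule fs.span_base) (rule that)
  have "basis_vec ([] @ [a + b] @ [d]) - basis_vec ([] @ [a] @ [d]) - basis_vec ([] @ [b] @ [d]) \<in> ?A"
    by (rule CollectI) (intro exI conjI, rule refl, use assms in auto)
  then show "basis_vec [a + b, d] - basis_vec [a, d] - basis_vec [b, d] \<in> multilin_rels s E 2"
    using M by simp
  have "basis_vec ([d] @ [a + b] @ []) - basis_vec ([d] @ [a] @ []) - basis_vec ([d] @ [b] @ []) \<in> ?A"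
    by (rule CollectI) (intro exI conjI, rule refl, use assms in auto)
  then show "basis_vec [d, a + b] - basis_vec [d, a] - basis_vec [d, b] \<in> multilin_rels s E 2"
    using M by simp
  have "basis_vec ([] @ [s c a] @ [d]) - fsmul c (basis_vec ([] @ [a] @ [d])) \<in> ?B"
    by (rule CollectI) (intro exI conjI, rule refl, use assms in auto)
  then show "basis_vec [s c a, d] - fsmul c (basis_vec [a, d]) \<in> multilin_rels s E 2"
    using M by simp
  have "basis_vec ([d] @ [s c a] @ []) - fsmul c (basis_vec ([d] @ [a] @ [])) \<in> ?B"
    by (rule CollectI) (intro exI conjI, rule refl, use assms in auto)
  then show "basis_vec [d, s c a] - fsmul c (basis_vec [d, a]) \<in> multilin_rels s E 2"
    using M by simp
qed

lemma multilin_rels2_induct [consumes 1, case_names sub add1 add2 scale1 scale2]: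
  assumes "x \<in> multilin_rels s E 2" "fs.subspace {x. P x}"
    and "\<And>a b d. a \<in> E \<Longrightarrow> b \<in> E \<Longrightarrow> d \<in> E
      \<Longrightarrow> P (basis_vec [a + b, d] - basis_vec [a, d] - basis_vec [b, d])"
    and "\<And>a b d. a \<in> E \<Longrightarrow> b \<in> E \<Longrightarrow> d \<in> E
      \<Longrightarrow> P (basis_vec [d, a + b] - basis_vec [d, a] - basis_vec [d, b])"
    and "\<And>c a d. a \<in> E \<Longrightarrow> d \<in> E \<Longrightarrow> P (basis_vec [s c a, d] - fsmul c (basis_vec [a, d]))"
    and "\<And>c a d. a \<in> E \<Longrightarrow> d \<in> E \<Longrightarrow> P (basis_vec [d, s c a] - fsmul c (basis_vec [d, a]))"
  shows "P x"
  using assms(1) unfolding multilin_rels_def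
proof (induction rule: fs.span_induct)
  case base
  then show ?case by (rule assms(2))
next
  case (step x)
  have l: "(xs = [] \<and> (\<exists>d. ys = [d])) \<or> (ys = [] \<and> (\<exists>d. xs = [d]))"
    if "Suc (length xs + length ys) = 2" for xs ys :: "'a list"
    using that by (cases xs; cases ys) auto
  from step consider
    (a) xs ys a b where "x = basis_vec (xs @ [a + b] @ ys) - basis_vec (xs @ [a] @ ys) - basis_vec (xs @ [b] @ ys)"
      "set xs \<subseteq> E" "set ys \<subseteq> E" "a \<in> E" "b \<in> E" "Suc (length xs + length ys) = 2"
    | (b) xs ys a c where "x = basis_vec (xs @ [s c a] @ ys) - fsmul c (basis_vec (xs @ [a] @ ys))"
      "set xs \<subseteq> E" "set ys \<subseteq> E" "a \<in> E" "Suc (length xs + length ys) = 2"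
    by blast
  then show ?case
  proof cases
    case a
    then show ?thesis using l[of xs ys] assms(3,4) by auto
  next
    case b
    then show ?thesis using l[OF b(5)] assms(5,6) by (auto)
  qed
qed

lemma add_sub_multilin: "add_sub (multilin_rels s E n)"
  unfolding add_sub_def multilin_rels_def by (blast intro: fs.span_zero fs.span_diff)

lemma multilin_scale: "x \<in> multilin_rels s E n \<Longrightarrow> fsmul c x \<in> multilin_rels s E n"
  unfolding multilin_rels_def by (rule fs.span_scale)

lemma multilin_rels2_tensor2:
  assumes "module s" "module.subspace s E" shows "multilin_rels s E 2 \<subseteq> tensor2 E"
proof
  interpret module s by fact
  have E: "a + b \<in> E" "s c a \<in> E" if "a \<in> E" "b \<in> E" for a b c
    using assms(2) that by (auto simp: subspace_def)
  fix x assume "x \<in> multilin_rels s E 2"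
  then show "x \<in> tensor2 E"
    by (induction rule: multilin_rels2_induct) (auto simp: fs.subspace_def E)
qed

lemma multilin_rels2_sum1:
  assumes "module s" "module.subspace s E" "finite I" "\<And>i. i \<in> I \<Longrightarrow> h i \<in> E" "d \<in> E"
  shows "basis_vec [(\<Sum>i\<in>I. s (k i) (h i)), d] - (\<Sum>i\<in>I. fsmul (k i) (basis_vec [h i, d])) \<in> multilin_rels s E 2"
    "basis_vec [d, (\<Sum>i\<in>I. s (k i) (h i))] - (\<Sum>i\<in>I. fsmul (k i) (basis_vec [d, h i])) \<in> multilin_rels s E 2"
proof -
  interpret module s by fact
  note M = add_subD[OF add_sub_multilin[of s E 2]]
  have *: "(\<Sum>i\<in>I. s (k i) (h i)) \<in> E \<and>
     basis_vec [(\<Sum>i\<in>I. s (k i) (h i)), d] - (\<Sum>i\<in>I. fsmul (k i) (basis_vec [h i, d])) \<in> multilin_rels s E 2 \<and>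
    basis_vec [d, (\<Sum>i\<in>I. s (k i) (h i))] - (\<Sum>i\<in>I. fsmul (k i) (basis_vec [d, h i])) \<in> multilin_rels s E 2"
    using assms(3,4)
  proof (induction I rule: finite_induct)
    case empty
    have "0 \<in> E" using assms(2) by (rule subspace_0)
    \<comment> \<open>An empty sum leaves a slot \<open>0 = s 0 0\<close>, and the scaling relation
      with factor 0 puts such a tensor among the relations.\<close>
    then show ?case
      using multilin_rels2_gen(3,4)[of 0 E d d s 0] assms(5) by simp
  next
    case (insert i I)
    let ?S = "\<Sum>i\<in>I. s (k i) (h i)"
    have hE: "s (k i) (h i) \<in> E" "h i \<in> E"
      using insert assms(2) by (auto intro: subspace_scale)
    have S: "?S \<in> E" using insert by blast
    have "basis_vec [s (k i) (h i) + ?S, d] - (fsmul (k i) (basis_vec [h i, d]) + (\<Sum>i\<in>I. fsmul (k i) (basis_vec [h i, d])))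
      = (basis_vec [s (k i) (h i) + ?S, d] - basis_vec [s (k i) (h i), d] - basis_vec [?S, d])
       + (basis_vec [s (k i) (h i), d] - fsmul (k i) (basis_vec [h i, d]))
       + (basis_vec [?S, d] - (\<Sum>i\<in>I. fsmul (k i) (basis_vec [h i, d])))"
      by simp
    also have "\<dots> \<in> multilin_rels s E 2"
      using insert multilin_rels2_gen(1)[OF hE(1) S assms(5)] multilin_rels2_gen(3)[OF hE(2) S assms(5)]
      by (intro M(4)) auto
    finally have 1: "basis_vec [s (k i) (h i) + ?S, d] - (fsmul (k i) (basis_vec [h i, d]) + (\<Sum>i\<in>I. fsmul (k i) (basis_vec [h i, d])))
       \<in> multilin_rels s E 2" .
    have "basis_vec [d, s (k i) (h i) + ?S] - (fsmul (k i) (basis_vec [d, h i]) + (\<Sum>i\<in>I. fsmul (k i) (basis_vec [d, h i])))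
      = (basis_vec [d, s (k i) (h i) + ?S] - basis_vec [d, s (k i) (h i)] - basis_vec [d, ?S])
       + (basis_vec [d, s (k i) (h i)] - fsmul (k i) (basis_vec [d, h i]))
       + (basis_vec [d, ?S] - (\<Sum>i\<in>I. fsmul (k i) (basis_vec [d, h i])))"
      by simp
    also have "\<dots> \<in> multilin_rels s E 2"
      using insert multilin_rels2_gen(2)[OF hE(1) S assms(5)] multilin_rels2_gen(4)[OF hE(2) S assms(5)]
      by (intro M(4)) auto
    finally have 2: "basis_vec [d, s (k i) (h i) + ?S] - (fsmul (k i) (basis_vec [d, h i]) + (\<Sum>i\<in>I. fsmul (k i) (basis_vec [d, h i])))
       \<in> multilin_rels s E 2" .
    show ?case using 1 2 S hE assms(2) insert(1,2) by (simp add: subspace_add)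
  qed
  then show "basis_vec [(\<Sum>i\<in>I. s (k i) (h i)), d] - (\<Sum>i\<in>I. fsmul (k i) (basis_vec [h i, d])) \<in> multilin_rels s E 2"
    "basis_vec [d, (\<Sum>i\<in>I. s (k i) (h i))] - (\<Sum>i\<in>I. fsmul (k i) (basis_vec [d, h i])) \<in> multilin_rels s E 2"
    by blast+
qed

text \<open>The left slot is expanded with the right slot kept whole, then the right slot in each
  summand; \<open>?x\<close> is the sum of both errors.\<close>

lemma multilin_rels2_sum:
  assumes "module s" "module.subspace s E" "finite I" "finite J" "\<And>i. i \<in> I \<Longrightarrow> h i \<in> E" "\<And>j. j \<in> J \<Longrightarrow> g j \<in> E"
  shows "basis_vec [(\<Sum>i\<in>I. s (k i) (h i)), (\<Sum>j\<in>J. s (l j) (g j))]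
     - (\<Sum>i\<in>I. \<Sum>j\<in>J. fsmul (k i * l j) (basis_vec [h i, g j])) \<in> multilin_rels s E 2" (is "?x \<in> _")
proof -
  interpret module s by fact
  note M = add_subD[OF add_sub_multilin[of s E 2]]
  let ?G = "\<Sum>j\<in>J. s (l j) (g j)"
  have G: "?G \<in> E" using assms by (intro subspace_sum[OF assms(2)] subspace_scale[OF assms(2)]) auto
  have 0: "basis_vec [h i, ?G] - (\<Sum>j\<in>J. fsmul (l j) (basis_vec [h i, g j])) \<in> multilin_rels s E 2"
    if "i \<in> I" for i
    using assms that by (intro multilin_rels2_sum1)
  have 1: "(\<Sum>i\<in>I. fsmul (k i) (basis_vec [h i, ?G] - (\<Sum>j\<in>J. fsmul (l j) (basis_vec [h i, g j])))) \<in> multilin_rels s E 2"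
    unfolding multilin_rels_def
    by (intro fs.span_sum fs.span_scale) (use 0 in \<open>simp add: multilin_rels_def\<close>)
  have 2: "basis_vec [(\<Sum>i\<in>I. s (k i) (h i)), ?G] - (\<Sum>i\<in>I. fsmul (k i) (basis_vec [h i, ?G])) \<in> multilin_rels s E 2"
    using assms G by (intro multilin_rels2_sum1)
  have "?x = (basis_vec [(\<Sum>i\<in>I. s (k i) (h i)), ?G] - (\<Sum>i\<in>I. fsmul (k i) (basis_vec [h i, ?G])))
     + (\<Sum>i\<in>I. fsmul (k i) (basis_vec [h i, ?G] - (\<Sum>j\<in>J. fsmul (l j) (basis_vec [h i, g j]))))"
    by (simp add: fsmul_algebra fsmul_sum sum_subtractf)
  then show ?thesis using M(4)[OF 2 1] by (simp only:)
qed

section \<open>The arity three part of a free nonsymmetric operad\<close>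

text \<open>\<open>circ_map i\<close> is the inclusion \<open>a \<otimes> b \<mapsto> a \<circ>\<^sub>i b\<close> of \<open>E \<otimes> E\<close> into the arity 3 part.\<close>

definition circ_map :: "nat \<Rightarrow> ('e list \<Rightarrow>\<^sub>0 'k::field) \<Rightarrow> ('e tree \<Rightarrow>\<^sub>0 'k)" where
  "circ_map i = lin_ext (\<lambda>xs. circ i (xs ! 0) (xs ! 1))"

lemma flin_circ_map: "flin fsmul (circ_map i)"
  unfolding circ_map_def by (rule flin_lin_ext)

lemmas circ_map_simps =
  flin_add[OF flin_circ_map] flin_diff[OF flin_circ_map] flin_scale[OF flin_circ_map]
  flin_zero[OF flin_circ_map] flin_uminus[OF flin_circ_map]

lemma circ_map_basis [simp]: "circ_map i (basis_vec [a, b]) = basis_vec (circ i a b)"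
  by (simp add: circ_map_def)

lemma circ_1 [simp]: "circ (Suc 0) a b = \<langle>\<langle>\<langle>\<rangle>, b, \<langle>\<rangle>\<rangle>, a, \<langle>\<rangle>\<rangle>"
  and circ_2 [simp]: "circ 2 a b = \<langle>\<langle>\<rangle>, a, \<langle>\<langle>\<rangle>, b, \<langle>\<rangle>\<rangle>\<rangle>"
  by (simp_all add: circ_def)

lemma circ_map_space:
  assumes "u \<in> tensor2 E" "i \<in> {1, 2}" shows "circ_map i u \<in> tree_space E 3"
proof -
  have "size1 (circ i (xs ! 0) (xs ! 1)) = 3 \<and> set_tree (circ i (xs ! 0) (xs ! 1)) \<subseteq> E"
    if "length xs = 2" "set xs \<subseteq> E" for xs
  proof -
    have "length xs = Suc (Suc 0)" using that by simp
    then obtain a b where "xs = [a, b]" by (auto simp: length_Suc_conv)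
    then show ?thesis using that assms(2) by auto
  qed
  then show ?thesis using assms(1) unfolding circ_map_def tensor2_def tree_space_def mem_Collect_eq
    by (intro keys_lin_ext) auto
qed

text \<open>A multilinearity relation in one slot is a linearity relation between corollas, composed
  with the corolla \<open>d\<close> of the other slot: from the right for the first slot, from the
  left for the second.\<close>

lemma circ_map_multilin:
  assumes "u \<in> multilin_rels s E 2" "i \<in> {1, 2}"
  shows "circ_map i u \<in> pres_ideal s E R 3"
  using assms(1)
proof (induction rule: multilin_rels2_induct)
  case sub
  then show ?case
    by (auto simp: fs.subspace_def circ_map_simps pres_ideal_zero pres_ideal_add pres_ideal_scale)
next
  case (add1 a b d)
  have "basis_vec (corolla (a + b)) - basis_vec (corolla a) - basis_vec (corolla b) \<in> pres_ideal s E R 2"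
    by (rule pres_ideal_lin) (use add1 in \<open>auto simp: corolla_lin_rels_def\<close>)
  from pres_ideal_comp_left[OF this, of "basis_vec (corolla d)" 2 i] show ?case
    using add1 assms(2) by (auto simp: circ_map_simps bilin_simps circ_def)
next
  case (add2 a b d)
  have "basis_vec (corolla (a + b)) - basis_vec (corolla a) - basis_vec (corolla b) \<in> pres_ideal s E R 2"
    by (rule pres_ideal_lin) (use add2 in \<open>auto simp: corolla_lin_rels_def\<close>)
  from pres_ideal_comp_right[OF _ this, of "basis_vec (corolla d)" 2 i] show ?case
    using add2 assms(2) by (auto simp: circ_map_simps bilin_simps circ_def)
next
  case (scale1 c a d)
  have "basis_vec (corolla (s c a)) - fsmul c (basis_vec (corolla a)) \<in> pres_ideal s E R 2"
    by (rule pres_ideal_lin) (use scale1 in \<open>auto simp: corolla_lin_rels_def\<close>)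
  from pres_ideal_comp_left[OF this, of "basis_vec (corolla d)" 2 i] show ?case
    using scale1 assms(2) by (auto simp: circ_map_simps bilin_simps circ_def)
next
  case (scale2 c a d)
  have "basis_vec (corolla (s c a)) - fsmul c (basis_vec (corolla a)) \<in> pres_ideal s E R 2"
    by (rule pres_ideal_lin) (use scale2 in \<open>auto simp: corolla_lin_rels_def\<close>)
  from pres_ideal_comp_right[OF _ this, of "basis_vec (corolla d)" 2 i] show ?case
    using scale2 assms(2) by (auto simp: circ_map_simps bilin_simps circ_def)
qed

lemma size1_eq_3:
  assumes "size1 t = 3"
  obtains a b where "t = circ 1 a b" | a b where "t = circ 2 a b"
proof -
  have s1: "size1 t = 1 \<longleftrightarrow> t = \<langle>\<rangle>" for t :: "'a tree" by (cases t) (auto simp: size1_size)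
  have s2: "size1 t = 2 \<Longrightarrow> \<exists>b. t = corolla b" for t :: "'a tree"
    by (cases t) (auto simp: size1_size)
  obtain l a r where t: "t = \<langle>l, a, r\<rangle>" using assms by (cases t) auto
  have "size1 l + size1 r = 3" "size1 l \<ge> 1" "size1 r \<ge> 1" using assms t by (auto simp: size1_size)
  then have "size1 l = 1 \<and> size1 r = 2 \<or> size1 l = 2 \<and> size1 r = 1" by linarith
  then show ?thesis using that t s1 s2 by fastforce
qed

text \<open>A tree with three leaves is a left or a right comb, so arity 3 consists of two copies of
  the tensor square.\<close>

lemma arity3_decompose:
  assumes "x \<in> tree_space E 3"
  obtains x1 x2 where "x1 \<in> tensor2 E" "x2 \<in> tensor2 E" "x = circ_map 1 x1 + circ_map 2 x2"
proof -
  have "x \<in> tree_space E 3" using assms by simp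
  then have "\<exists>x1 x2. x1 \<in> tensor2 E \<and> x2 \<in> tensor2 E \<and> x = circ_map 1 x1 + circ_map 2 x2"
  proof (induction x rule: tree_space_induct)
    case zero
    show ?case by (rule exI[of _ 0], rule exI[of _ 0]) (simp add: circ_map_simps)
  next
    case (basis c t)
    from basis(1) show ?case
    proof (cases rule: size1_eq_3)
      case (1 a b)
      then have "a \<in> E" "b \<in> E" using basis by auto
      with 1 show ?thesis
        by (intro exI[of _ "fsmul c (basis_vec [a, b])"] exI[of _ 0])
          (simp add: circ_map_simps)
    next
      case (2 a b)
      then have "a \<in> E" "b \<in> E" using basis by auto
      with 2 show ?thesis
        by (intro exI[of _ 0] exI[of _ "fsmul c (basis_vec [a, b])"])
          (simp add: circ_map_simps)
    qed
  next
    case (add x y)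
    then obtain x1 x2 y1 y2 where "x1 \<in> tensor2 E" "x2 \<in> tensor2 E" "x = circ_map 1 x1 + circ_map 2 x2"
      "y1 \<in> tensor2 E" "y2 \<in> tensor2 E" "y = circ_map 1 y1 + circ_map 2 y2" by blast
    then show ?case
      by (intro exI[of _ "x1 + y1"] exI[of _ "x2 + y2"]) (simp add: circ_map_simps algebra_simps)
  qed
  then show ?thesis using that by blast
qed

section \<open>Duality\<close>

lemma fin_dim_spaceD:
  assumes "fin_dim_space s E"
  shows "vector_space s" "module s" "module.subspace s E"
proof -
  show v: "vector_space s" and "module.subspace s E" using assms by (auto simp: fin_dim_space_def)
  interpret vector_space s by (rule v)
  show "module s" by (rule module_axioms)
qed

lemma dual_spaceD:
  assumes "f \<in> dual_space s E"
  shows "x \<in> E \<Longrightarrow> y \<in> E \<Longrightarrow> f (x + y) = f x + f y" "x \<in> E \<Longrightarrow> f (s c x) = c * f x" "x \<notin> E \<Longrightarrow> f x = 0"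
  using assms by (auto simp: dual_space_def linear_map_on_def)

lemma dual_spaceI:
  assumes "\<And>x y. x \<in> E \<Longrightarrow> y \<in> E \<Longrightarrow> f (x + y) = f x + f y" "\<And>c x. x \<in> E \<Longrightarrow> f (s c x) = c * f x"
    "\<And>x. x \<notin> E \<Longrightarrow> f x = 0"
  shows "f \<in> dual_space s E"
  using assms by (auto simp: dual_space_def linear_map_on_def)

interpretation fun_sc: vector_space "fun_scale :: 'k::field \<Rightarrow> ('x \<Rightarrow> 'k) \<Rightarrow> _"
  by (rule vector_space_fun_scale)

lemma module_fun_scale: "module (fun_scale :: 'k::field \<Rightarrow> ('x \<Rightarrow> 'k) \<Rightarrow> _)"
  by (rule fun_sc.module_axioms)

lemma subspace_dual_space: "module.subspace fun_scale (dual_space s E)"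
  unfolding fun_sc.subspace_def
  by (auto intro!: dual_spaceI simp: dual_spaceD fun_scale_def algebra_simps)

lemma dual_space_zero: assumes "f \<in> dual_space s E" "module s" "module.subspace s E" shows "f 0 = 0"
proof -
  interpret module s by fact
  have "f (s 0 0) = 0 * f 0" using assms(1) by (rule dual_spaceD) (rule subspace_0[OF assms(3)])
  then show ?thesis by simp
qed

lemma dual_space_sum:
  assumes "f \<in> dual_space s E" "module s" "module.subspace s E" "\<And>i. i \<in> I \<Longrightarrow> h i \<in> E"
  shows "f (\<Sum>i\<in>I. s (k i) (h i)) = (\<Sum>i\<in>I. k i * f (h i))"
proof -
  interpret module s by fact
  have "(\<Sum>i\<in>I. s (k i) (h i)) \<in> E \<and> f (\<Sum>i\<in>I. s (k i) (h i)) = (\<Sum>i\<in>I. k i * f (h i))"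
    using assms(4)
  proof (induction I rule: infinite_finite_induct)
    case (insert i I)
    have "s (k i) (h i) \<in> E" using insert assms(3) by (auto intro: subspace_scale)
    then show ?case
      using insert assms(3) by (simp add: dual_spaceD[OF assms(1)] subspace_add)
  qed (auto simp: dual_space_zero[OF assms(1-3)] subspace_0[OF assms(3)])
  then show ?thesis ..
qed

text \<open>The \<open>c b\<close> are the coordinate functionals of a basis \<open>B\<close>; all
  consequences of finite dimension are drawn from the resulting expansion.\<close>

lemma dual_basis_exists:
  fixes s :: "'k::field \<Rightarrow> 'e::ab_group_add \<Rightarrow> 'e"
  assumes "fin_dim_space s E"
  obtains B c where "finite B" "B \<subseteq> E" "\<And>b. b \<in> B \<Longrightarrow> c b \<in> dual_space s E"
    "\<And>a. a \<in> E \<Longrightarrow> a = (\<Sum>b\<in>B. s (c b a) b)"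
proof -
  interpret vector_space s using fin_dim_spaceD(1)[OF assms] .
  obtain S where S: "finite S" "E = span S" using assms by (auto simp: fin_dim_space_def)
  obtain B where B: "B \<subseteq> S" "independent B" "span B = span S"
    by (metis maximal_independent_subset span_mono span_span subset_antisym order_refl span_minimal subspace_span)
  have fB: "finite B" using B(1) S(1) finite_subset by blast
  \<comment> \<open>The cut-off outside \<open>E\<close> is the normalisation demanded by
    \<open>dual_space\<close>.\<close>
  define c where "c b a = (if a \<in> E then representation B a b else 0)" for b a
  have sub: "subspace E" using S by simp
  have E: "E = span B" using B S by simp
  show ?thesis
  proof
    show "finite B" by (rule fB)
    show "B \<subseteq> E" unfolding E by (rule span_superset)
    show "c b \<in> dual_space s E" for b
      by (rule dual_spaceI)
        (use B(2) E sub in \<open>auto simp: c_def representation_add representation_scale subspace_add subspace_scale\<close>)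
    show "a = (\<Sum>b\<in>B. s (c b a) b)" if "a \<in> E" for a
      using sum_representation_eq[OF B(2) _ fB order_refl, of a] that E by (simp add: c_def)
  qed
qed

abbreviation tensor_ev :: "(('e \<Rightarrow> 'k::field) list \<Rightarrow>\<^sub>0 'k) \<Rightarrow> ('e list \<Rightarrow>\<^sub>0 'k) \<Rightarrow> 'k" where
  "tensor_ev \<equiv> bilin_form (\<lambda>fs xs. (fs ! 0) (xs ! 0) * (fs ! 1) (xs ! 1))"

lemma tensor_ev_multilin_left:
  assumes "u \<in> multilin_rels fun_scale D 2" shows "tensor_ev u v = 0"
  using assms
proof (induction rule: multilin_rels2_induct)
  case sub
  then show ?case by (auto simp: fs.subspace_def form_simps)
qed (rule flin_zeroI[where sc="(*)", OF flin_bilin_form_right mult_zero_right],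
     simp add: form_simps fun_scale_def algebra_simps)+

lemma tensor_ev_multilin_right:
  assumes "v \<in> multilin_rels s E 2" "u \<in> tensor2 (dual_space s E)" shows "tensor_ev u v = 0"
  using assms(2)
proof (induction u rule: tensor2_induct)
  case (basis c f g)
  have "tensor_ev (basis_vec [f, g]) v = 0"
    using assms(1)
  proof (induction rule: multilin_rels2_induct)
    case sub
    then show ?case by (auto simp: fs.subspace_def form_simps)
  qed (auto simp: form_simps dual_spaceD[OF basis(1)] dual_spaceD[OF basis(2)] algebra_simps)
  then show ?case by (simp add: form_simps)
qed (auto simp: form_simps)

text \<open>This is injectivity of the map from the tensor square of the dual to the dual of the
  tensor square. In a dual basis, \<open>u\<close> is congruent to a combination whose coefficients
  are the values of \<open>u\<close> on pairs of basis vectors, and these vanish.\<close>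

lemma tensor_ev_injective:
  fixes s :: "'k::field \<Rightarrow> 'e::ab_group_add \<Rightarrow> 'e"
  assumes "fin_dim_space s E" "u \<in> tensor2 (dual_space s E)"
    and "\<And>a b. a \<in> E \<Longrightarrow> b \<in> E \<Longrightarrow> tensor_ev u (basis_vec [a, b]) = 0"
  shows "u \<in> multilin_rels fun_scale (dual_space s E) 2"
proof -
  obtain B c where B: "finite B" "B \<subseteq> E" "\<And>b. b \<in> B \<Longrightarrow> c b \<in> dual_space s E"
    "\<And>a. a \<in> E \<Longrightarrow> a = (\<Sum>b\<in>B. s (c b a) b)" by (rule dual_basis_exists[OF assms(1)]) blast
  note M = fin_dim_spaceD[OF assms(1)]
  let ?M = "multilin_rels fun_scale (dual_space s E) 2"
  note sub = add_subD[OF add_sub_multilin[of fun_scale "dual_space s E" 2]]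
  have expand: "f = (\<Sum>b\<in>B. fun_scale (f b) (c b))" if f: "f \<in> dual_space s E" for f
  proof
    fix a
    show "f a = (\<Sum>b\<in>B. fun_scale (f b) (c b)) a"
    proof (cases "a \<in> E")
      case True
      have "f a = f (\<Sum>b\<in>B. s (c b a) b)" using B(4)[OF True] by simp
      also have "\<dots> = (\<Sum>b\<in>B. c b a * f b)" using B(2) by (intro dual_space_sum[OF f M(2,3)]) auto
      also have "\<dots> = (\<Sum>b\<in>B. fun_scale (f b) (c b) a)" by (simp add: fun_scale_def mult.commute)
      also have "\<dots> = (\<Sum>b\<in>B. fun_scale (f b) (c b)) a"
        by (induction B rule: infinite_finite_induct) auto
      finally show ?thesis .
    next
      case False
      have "(\<Sum>b\<in>B. fun_scale (f b) (c b)) a = (\<Sum>b\<in>B. fun_scale (f b) (c b) a)"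
        by (induction B rule: infinite_finite_induct) auto
      also have "\<dots> = 0" using B(3) dual_spaceD(3) False by (intro sum.neutral) (force simp: fun_scale_def)
      finally show ?thesis using f False by (simp add: dual_spaceD(3))
    qed
  qed
  \<comment> \<open>\<open>?r u\<close> is the expansion of \<open>u\<close> in tensors of
    coordinate functionals.\<close>
  let ?r = "\<lambda>u. \<Sum>b\<in>B. \<Sum>b'\<in>B. fsmul (tensor_ev u (basis_vec [b, b'])) (basis_vec [c b, c b'])"
  have "u - ?r u \<in> ?M"
    using assms(2)
  proof (induction u rule: tensor2_induct)
    case zero
    show ?case by (simp add: form_simps sub)
  next
    case (basis k f g)
    have "basis_vec [f, g] - (\<Sum>b\<in>B. \<Sum>b'\<in>B. fsmul (f b * g b') (basis_vec [c b, c b'])) \<in> ?M"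
      using multilin_rels2_sum[OF module_fun_scale subspace_dual_space B(1) B(1), where h=c and g=c and k=f and l=g]
        B(3) unfolding expand[OF basis(1), symmetric] expand[OF basis(2), symmetric] by blast
    then have "fsmul k (basis_vec [f, g] - (\<Sum>b\<in>B. \<Sum>b'\<in>B. fsmul (f b * g b') (basis_vec [c b, c b']))) \<in> ?M"
      by (rule multilin_scale)
    then show ?case by (simp add: fsmul_algebra fsmul_sum form_simps)
  next
    case (add x y)
    have "x + y - ?r (x + y) = (x - ?r x) + (y - ?r y)"
      by (simp add: form_simps fsmul_algebra sum.distrib)
    then show ?case using sub(4)[OF add(1,2)] by (simp only:)
  qed
  moreover have "?r u = 0" using assms(3) B(2) by (intro sum.neutral ballI) (auto simp: subset_iff)
  ultimately show ?thesis by simp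
qed

section \<open>The transpose\<close>

lemma tensor_power_2: "tensor_power s E 2 = (\<lambda>x. x +o multilin_rels s E 2) ` tensor2 E"
  by (simp add: tensor_power_def tensor2_def)

text \<open>Evaluation kills the multilinearity relations on both sides, so the definite description
  in \<open>tensor_eval\<close> denotes the value on any representatives.\<close>

lemma tensor_eval_cosets:
  assumes "u \<in> tensor2 (dual_space s E)"
  shows "tensor_eval (u +o multilin_rels fun_scale (dual_space s E) 2) (v +o multilin_rels s E 2) = tensor_ev u v"
proof -
  have "tensor_ev f x = tensor_ev u v"
    if "f \<in> u +o multilin_rels fun_scale (dual_space s E) 2" "x \<in> v +o multilin_rels s E 2" for f x
  proof -
    have "tensor_ev (f - u) x = 0" "tensor_ev u (x - v) = 0"
      using that tensor_ev_multilin_left tensor_ev_multilin_right[OF _ assms] by (auto simp: coset_mem)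
    then show ?thesis by (simp add: form_simps)
  qed
  note eq = this
  note self = coset_self[OF add_sub_multilin, of u fun_scale "dual_space s E" 2]
    coset_self[OF add_sub_multilin, of v s E 2]
  show ?thesis unfolding tensor_eval_def
  proof (rule the_equality)
    show "\<forall>f\<in>u +o multilin_rels fun_scale (dual_space s E) 2. \<forall>x\<in>v +o multilin_rels s E 2. tensor_ev f x = tensor_ev u v"
      using eq by (intro ballI)
    show "c = tensor_ev u v"
      if "\<forall>f\<in>u +o multilin_rels fun_scale (dual_space s E) 2. \<forall>x\<in>v +o multilin_rels s E 2. tensor_ev f x = c" for c
      using that[rule_format, OF self] by (rule sym)
  qed
qed

lemma pure_tensor_2: "pure_tensor s E [a, b] = basis_vec [a, b] +o multilin_rels s E 2"
  by (simp add: pure_tensor_def numeral_2_eq_2)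

locale tensor_endo =
  fixes s :: "'k::field \<Rightarrow> 'a::ab_group_add \<Rightarrow> 'a" and A :: "'a set"
    and \<Phi> :: "('a list \<Rightarrow>\<^sub>0 'k) set \<Rightarrow> ('a list \<Rightarrow>\<^sub>0 'k) set"
  assumes fin_dim: "fin_dim_space s A"
    and lin: "linear_map_on (tensor_scale s A 2) (tensor_power s A 2) (tensor_scale s A 2) (tensor_power s A 2) \<Phi>"
begin

abbreviation "rels \<equiv> multilin_rels s A 2"
abbreviation "dual \<equiv> dual_space s A"
abbreviation "drels \<equiv> multilin_rels fun_scale dual 2"
abbreviation "\<Phi>t \<equiv> transpose_map s A \<Phi>"

lemmas sp = fin_dim_spaceD[OF fin_dim]

text \<open>\<open>img x y\<close>: the tensor represented by \<open>y\<close> is the image of the one represented by \<open>x\<close>.\<close>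

definition img :: "('a list \<Rightarrow>\<^sub>0 'k) \<Rightarrow> ('a list \<Rightarrow>\<^sub>0 'k) \<Rightarrow> bool" where
  "img x y \<longleftrightarrow> x \<in> tensor2 A \<and> y \<in> \<Phi> (x +o rels)"

lemma img_coset:
  assumes "img x y" shows "y \<in> tensor2 A" "\<Phi> (x +o rels) = y +o rels"
proof -
  have "\<Phi> (x +o rels) \<in> tensor_power s A 2"
    using lin assms by (auto simp: linear_map_on_def img_def tensor_power_2)
  then obtain y0 where y0: "y0 \<in> tensor2 A" "\<Phi> (x +o rels) = y0 +o rels" by (auto simp: tensor_power_2)
  have d: "y - y0 \<in> rels" using assms y0(2) by (simp add: img_def coset_mem)
  then show "\<Phi> (x +o rels) = y +o rels"
    using y0(2) coset_eq_iff[OF add_sub_multilin, of y s A 2 y0] by simp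
  have "y = y0 + (y - y0)" by simp
  then show "y \<in> tensor2 A"
    using tensor2_closed(2)[OF y0(1)] multilin_rels2_tensor2[OF sp(2,3)] d by (metis subsetD)
qed

lemma img_ex: assumes "x \<in> tensor2 A" shows "\<exists>y. img x y"
proof -
  have "\<Phi> (x +o rels) \<in> tensor_power s A 2"
    using lin assms by (auto simp: linear_map_on_def tensor_power_2)
  then obtain y where "\<Phi> (x +o rels) = y +o rels" by (auto simp: tensor_power_2)
  then show ?thesis using coset_self[OF add_sub_multilin, of y s A 2] assms by (auto simp: img_def)
qed

lemma img_cong: assumes "img x y" "x' \<in> tensor2 A" "x - x' \<in> rels" shows "img x' y"
  using assms coset_eq_iff[OF add_sub_multilin, of x s A 2 x'] by (simp add: img_def)

lemma img_unique: "img x y \<Longrightarrow> img x y' \<Longrightarrow> y - y' \<in> rels"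
  by (metis coset_mem img_coset(2) img_def)

lemma img_add: assumes "img x y" "img x' y'" shows "img (x + x') (y + y')"
proof -
  have X: "x \<in> tensor2 A" "x' \<in> tensor2 A" using assms by (auto simp: img_def)
  then have "\<Phi> ((x +o rels) + (x' +o rels)) = \<Phi> (x +o rels) + \<Phi> (x' +o rels)"
    using lin by (auto simp: linear_map_on_def tensor_power_2)
  then have "\<Phi> ((x + x') +o rels) = (y + y') +o rels"
    unfolding coset_add[OF add_sub_multilin] img_coset(2)[OF assms(1)] img_coset(2)[OF assms(2)] .
  then show ?thesis using X coset_self[OF add_sub_multilin] by (simp add: img_def)
qed

lemma tensor_scale_coset: "tensor_scale s A 2 c (x +o rels) = fsmul c x +o rels"
  unfolding tensor_scale_def
proof (rule plus_coset_eq[OF add_sub_multilin])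
  show "fsmul c x \<in> fsmul c ` (x +o rels)" using coset_self[OF add_sub_multilin] by blast
  fix y assume "y \<in> fsmul c ` (x +o rels)"
  then obtain z where z: "y = fsmul c z" "z \<in> x +o rels" by blast
  from z(2) have "z - x \<in> rels" by (simp only: coset_mem)
  then show "y - fsmul c x \<in> rels" using z(1) multilin_scale[of "z - x"] by (simp add: fsmul_algebra)
qed

lemma img_scale: assumes "img x y" shows "img (fsmul c x) (fsmul c y)"
proof -
  have X: "x \<in> tensor2 A" using assms by (auto simp: img_def)
  then have "\<Phi> (tensor_scale s A 2 c (x +o rels)) = tensor_scale s A 2 c (\<Phi> (x +o rels))"
    using lin by (auto simp: linear_map_on_def tensor_power_2)
  then have "\<Phi> (fsmul c x +o rels) = fsmul c y +o rels"
    by (simp add: tensor_scale_coset img_coset(2)[OF assms])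
  then show ?thesis using X coset_self[OF add_sub_multilin] by (simp add: img_def)
qed

lemma img_zero: "img 0 0"
proof -
  obtain y where "img 0 y" using img_ex[of 0] by auto
  from img_scale[OF this, of 0] show ?thesis by simp
qed

lemma img_sum: "(\<And>i. i \<in> I \<Longrightarrow> img (x i) (y i)) \<Longrightarrow> img (sum x I) (sum y I)"
  by (induction I rule: infinite_finite_induct) (auto simp: img_zero img_add)

lemma pure_img: "a \<in> A \<Longrightarrow> b \<in> A \<Longrightarrow> v \<in> \<Phi> (pure_tensor s A [a, b]) \<longleftrightarrow> img (basis_vec [a, b]) v"
  by (simp add: img_def pure_tensor_2)

text \<open>\<open>w\<close> represents the transpose of \<Phi> at \<open>u\<close>. Only pure
  tensors are tested, and all is phrased with representatives because \<Phi> maps cosets to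
  cosets.\<close>

definition adj :: "(('a \<Rightarrow> 'k) list \<Rightarrow>\<^sub>0 'k) \<Rightarrow> (('a \<Rightarrow> 'k) list \<Rightarrow>\<^sub>0 'k) \<Rightarrow> bool" where
  "adj u w \<longleftrightarrow> (\<forall>a\<in>A. \<forall>b\<in>A. \<forall>v. img (basis_vec [a, b]) v \<longrightarrow> tensor_ev w (basis_vec [a, b]) = tensor_ev u v)"

lemma ev_img_cong:
  assumes "u \<in> tensor2 dual" "img x v" "img x v'" shows "tensor_ev u v = tensor_ev u v'"
  using tensor_ev_multilin_right[OF img_unique[OF assms(2,3)] assms(1)] by (simp add: form_simps)

text \<open>In a basis with coordinate functionals, the coefficient of
  \<open>c b \<otimes> c b'\<close> has to be the value of \<open>u\<close> on the image of
  \<open>b \<otimes> b'\<close>; this determines the witness \<open>?w\<close>.\<close>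

lemma adj_ex:
  assumes u: "u \<in> tensor2 dual" shows "\<exists>w\<in>tensor2 dual. adj u w"
proof -
  obtain B c where B: "finite B" "B \<subseteq> A" "\<And>b. b \<in> B \<Longrightarrow> c b \<in> dual"
    "\<And>a. a \<in> A \<Longrightarrow> a = (\<Sum>b\<in>B. s (c b a) b)" by (rule dual_basis_exists[OF fin_dim]) blast
  \<comment> \<open>A fixed choice of representatives of the images under \<Phi>.\<close>
  obtain y where y: "\<And>x. x \<in> tensor2 A \<Longrightarrow> img x (y x)" using img_ex by metis
  let ?w = "\<Sum>b\<in>B. \<Sum>b'\<in>B. fsmul (tensor_ev u (y (basis_vec [b, b']))) (basis_vec [c b, c b'])"
  have "?w \<in> tensor2 dual" using B(3) by (intro tensor2_sum tensor2_closed) auto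
  moreover have "adj u ?w"
    unfolding adj_def
  proof (intro ballI allI impI)
    fix a a' v assume a: "a \<in> A" "a' \<in> A" and v: "img (basis_vec [a, a']) v"
    let ?x = "\<Sum>b\<in>B. \<Sum>b'\<in>B. fsmul (c b a * c b' a') (basis_vec [b, b'])"
    let ?y = "\<Sum>b\<in>B. \<Sum>b'\<in>B. fsmul (c b a * c b' a') (y (basis_vec [b, b']))"
    have "img ?x ?y" using B(2) by (intro img_sum img_scale y) auto
    moreover have "basis_vec [a, a'] - ?x \<in> rels"
      using multilin_rels2_sum[OF sp(2,3) B(1) B(1), where h="\<lambda>b. b" and g="\<lambda>b. b" and k="\<lambda>b. c b a" and l="\<lambda>b. c b a'"]
        B(2) unfolding B(4)[OF a(1), symmetric] B(4)[OF a(2), symmetric] by blast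
    moreover have "?x \<in> tensor2 A" using \<open>img ?x ?y\<close> by (simp add: img_def)
    ultimately have "tensor_ev u v = tensor_ev u ?y"
      using img_cong[OF v] ev_img_cong[OF u] by blast
    also have "\<dots> = (\<Sum>b\<in>B. \<Sum>b'\<in>B. c b a * c b' a' * tensor_ev u (y (basis_vec [b, b'])))"
      by (simp add: flin_sum[OF flin_bilin_form_right] form_simps)
    also have "\<dots> = tensor_ev ?w (basis_vec [a, a'])"
      by (simp add: flin_sum[OF flin_bilin_form_left] form_simps mult_ac)
    finally show "tensor_ev ?w (basis_vec [a, a']) = tensor_ev u v" by simp
  qed
  ultimately show ?thesis by blast
qed

lemma adj_add: "adj u w \<Longrightarrow> adj u' w' \<Longrightarrow> adj (u + u') (w + w')"
  by (simp add: adj_def form_simps)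

lemma adj_scale: "adj u w \<Longrightarrow> adj (fsmul c u) (fsmul c w)"
  by (simp add: adj_def form_simps)

lemma adj_ev:
  assumes "adj u w" "u \<in> tensor2 dual" "x \<in> tensor2 A" "img x v"
  shows "tensor_ev w x = tensor_ev u v"
  using assms(3,4)
proof (induction x arbitrary: v rule: tensor2_induct)
  case zero
  then show ?case using ev_img_cong[OF assms(2) zero img_zero] by (simp add: form_simps)
next
  case (basis c a b)
  obtain z where z: "img (basis_vec [a, b]) z" using img_ex[of "basis_vec [a, b]"] basis by auto
  have "tensor_ev u v = tensor_ev u (fsmul c z)" using ev_img_cong[OF assms(2) basis(3)] img_scale[OF z] by blast
  then show ?case using assms(1) basis z by (simp add: adj_def form_simps)
next
  case (add x y)
  obtain p q where "img x p" "img y q" using img_ex add by meson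
  then show ?case using ev_img_cong[OF assms(2) add(5) img_add] add(1,2) by (simp add: form_simps)
qed

text \<open>Makes the definite description in \<open>transpose_map\<close> usable: existence is
  \<open>adj_ex\<close>, and uniqueness modulo \<open>drels\<close> is injectivity of
  evaluation.\<close>

lemma transpose_pure:
  assumes "f \<in> dual" "g \<in> dual"
  shows "\<exists>w. w \<in> \<Phi>t (pure_tensor fun_scale dual [f, g])"
    "w \<in> \<Phi>t (pure_tensor fun_scale dual [f, g]) \<Longrightarrow> w \<in> tensor2 dual"
    "w \<in> \<Phi>t (pure_tensor fun_scale dual [f, g]) \<Longrightarrow> adj (basis_vec [f, g]) w"
proof -
  let ?u = "basis_vec [f, g] :: ('a \<Rightarrow> 'k) list \<Rightarrow>\<^sub>0 'k"
  have u: "?u \<in> tensor2 dual" using assms by simp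
  obtain w0 where w0: "w0 \<in> tensor2 dual" "adj ?u w0" using adj_ex[OF u] by blast
  have "\<Phi>t (pure_tensor fun_scale dual [f, g]) = w0 +o drels"
    unfolding transpose_map_def
  proof (rule the_equality, intro conjI ballI)
    show "w0 +o drels \<in> tensor_power fun_scale dual 2" using w0 by (simp add: tensor_power_2)
    fix X assume "X \<in> tensor_power s A 2"
    then obtain x where x: "x \<in> tensor2 A" "X = x +o rels" by (auto simp: tensor_power_2)
    obtain y where y: "img x y" using img_ex x by blast
    show "tensor_eval (w0 +o drels) X = tensor_eval (pure_tensor fun_scale dual [f, g]) (\<Phi> X)"
      using tensor_eval_cosets[OF w0(1), of x] tensor_eval_cosets[OF u, of y] adj_ev[OF w0(2) u x(1) y]
      by (simp add: x(2) img_coset(2)[OF y] pure_tensor_2)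
  next
    fix G
    assume G: "G \<in> tensor_power fun_scale dual 2 \<and>
      (\<forall>X\<in>tensor_power s A 2. tensor_eval G X = tensor_eval (pure_tensor fun_scale dual [f, g]) (\<Phi> X))"
    then obtain g0 where g0: "g0 \<in> tensor2 dual" "G = g0 +o drels" by (auto simp: tensor_power_2)
    have "tensor_ev (g0 - w0) (basis_vec [a, b]) = 0" if "a \<in> A" "b \<in> A" for a b
    proof -
      have x: "basis_vec [a, b] \<in> tensor2 A" using that by simp
      obtain y where y: "img (basis_vec [a, b]) y" using img_ex[OF x] by blast
      have "basis_vec [a, b] +o rels \<in> tensor_power s A 2" using x by (auto simp: tensor_power_2)
      with G have "tensor_eval G (basis_vec [a, b] +o rels) = tensor_eval (pure_tensor fun_scale dual [f, g]) (\<Phi> (basis_vec [a, b] +o rels))"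
        by blast
      then have "tensor_ev g0 (basis_vec [a, b]) = tensor_ev ?u y"
        using tensor_eval_cosets[OF g0(1), of "basis_vec [a, b]"] tensor_eval_cosets[OF u, of y]
        by (simp add: g0(2) img_coset(2)[OF y] pure_tensor_2)
      then show ?thesis using adj_ev[OF w0(2) u x y] by (simp add: form_simps)
    qed
    then have "g0 - w0 \<in> drels" using g0 w0 by (intro tensor_ev_injective[OF fin_dim]) auto
    then show "G = w0 +o drels" using g0 coset_eq_iff[OF add_sub_multilin, of g0 fun_scale dual 2 w0] by simp
  qed
  note eq = this
  show "\<exists>w. w \<in> \<Phi>t (pure_tensor fun_scale dual [f, g])"
    unfolding eq using coset_self[OF add_sub_multilin] by blast
  assume "w \<in> \<Phi>t (pure_tensor fun_scale dual [f, g])"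
  then have d: "w - w0 \<in> drels" by (simp add: eq coset_mem)
  have "w = w0 + (w - w0)" by simp
  then show "w \<in> tensor2 dual"
    using tensor2_closed(2)[OF w0(1)] multilin_rels2_tensor2[OF module_fun_scale subspace_dual_space] d
    by (metis subsetD)
  show "adj (basis_vec [f, g]) w"
    using w0(2) tensor_ev_multilin_left[OF d] by (simp add: adj_def form_simps)
qed

section \<open>Relations for the transpose, orthogonals and the nonsymmetric Koszul duals\<close>

text \<open>The relations \<open>f \<circ>\<^sub>j g = \<Phi>\<^sup>*(f \<otimes> g)\<close>, the right hand side composed with \<open>\<circ>\<^sub>i\<close>.\<close>

definition dual_As_rels :: "nat \<Rightarrow> nat \<Rightarrow> (('a \<Rightarrow> 'k) tree \<Rightarrow>\<^sub>0 'k) set" where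
  "dual_As_rels i j = {basis_vec (circ j f g) - circ_map i u
     | f g u. f \<in> dual \<and> g \<in> dual \<and> u \<in> \<Phi>t (pure_tensor fun_scale dual [f, g])}"

lemma dual_As_rels_eq:
  "As_rels fun_scale dual \<Phi>t = dual_As_rels 1 2" "As_op_rels fun_scale dual \<Phi>t = dual_As_rels 2 1"
  by (auto simp: As_rels_def As_op_rels_def dual_As_rels_def circ_map_def)

text \<open>The generating relations are given for pure tensors only; modulo the ideal they extend
  to all tensors by linearity of \<open>adj\<close>.\<close>

lemma dual_As_rels_linear:
  assumes "u \<in> tensor2 dual"
  shows "\<exists>w\<in>tensor2 dual. adj u w \<and>
    circ_map j u - circ_map i w \<in> pres_ideal fun_scale dual (dual_As_rels i j) 3"
  using assms
proof (induction u rule: tensor2_induct)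
  case zero
  show ?case by (rule bexI[of _ 0]) (auto simp: adj_def form_simps circ_map_simps pres_ideal_zero)
next
  case (basis c f g)
  obtain w where w: "w \<in> \<Phi>t (pure_tensor fun_scale dual [f, g])" using transpose_pure(1) basis by blast
  have "basis_vec (circ j f g) - circ_map i w \<in> pres_ideal fun_scale dual (dual_As_rels i j) 3"
    by (rule pres_ideal_rel) (use w basis in \<open>auto simp: dual_As_rels_def\<close>)
  from pres_ideal_scale[OF this, of c] show ?case
    using transpose_pure(2,3)[OF basis w]
    by (intro bexI[of _ "fsmul c w"] conjI adj_scale) (simp_all add: circ_map_simps fsmul_algebra)
next
  case (add x y)
  then obtain w w' where w: "w \<in> tensor2 dual" "adj x w"
    "circ_map j x - circ_map i w \<in> pres_ideal fun_scale dual (dual_As_rels i j) 3"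
    "w' \<in> tensor2 dual" "adj y w'"
    "circ_map j y - circ_map i w' \<in> pres_ideal fun_scale dual (dual_As_rels i j) 3" by blast
  from pres_ideal_add[OF w(3,6)] show ?case
    using w by (intro bexI[of _ "w + w'"] conjI adj_add) (simp_all add: circ_map_simps algebra_simps)
qed

text \<open>If \<open>w\<close> represents the transpose at \<open>y\<close>, the hypothesis says
  that \<open>x + w\<close> evaluates to 0 everywhere, hence is a multilinearity relation. The
  element is then \<open>circ_map i (x + w)\<close> plus the relation
  \<open>circ_map j y - circ_map i w\<close>.\<close>

lemma orthogonal_in_ideal:
  assumes "x \<in> tensor2 dual" "y \<in> tensor2 dual" "i \<in> {1, 2}"
    and "\<And>a b v. a \<in> A \<Longrightarrow> b \<in> A \<Longrightarrow> img (basis_vec [a, b]) v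
      \<Longrightarrow> tensor_ev x (basis_vec [a, b]) + tensor_ev y v = 0"
  shows "circ_map i x + circ_map j y \<in> pres_ideal fun_scale dual (dual_As_rels i j) 3"
proof -
  obtain w where w: "w \<in> tensor2 dual" "adj y w"
    "circ_map j y - circ_map i w \<in> pres_ideal fun_scale dual (dual_As_rels i j) 3"
    using dual_As_rels_linear[OF assms(2)] by blast
  have "x + w \<in> drels"
  proof (rule tensor_ev_injective[OF fin_dim])
    show "x + w \<in> tensor2 dual" using assms(1) w(1) by simp
    fix a b assume ab: "a \<in> A" "b \<in> A"
    then obtain v where "img (basis_vec [a, b]) v" using img_ex[of "basis_vec [a, b]"] by auto
    with assms(4)[OF ab this] w(2) ab show "tensor_ev (x + w) (basis_vec [a, b]) = 0"
      by (simp add: adj_def form_simps)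
  qed
  from pres_ideal_add[OF circ_map_multilin[OF this assms(3)] w(3)]
  show ?thesis by (simp add: circ_map_simps)
qed

lemma bilin_form_circ_maps:
  assumes "\<And>f g a b. p (circ i f g) (circ j a b) = k * (f a * g b)"
    "u \<in> tensor2 D" "v \<in> tensor2 E"
  shows "bilin_form p (circ_map i u) (circ_map j v) = k * tensor_ev u v"
  using assms(2)
proof (induction u rule: tensor2_induct)
  case (basis c f g)
  have "bilin_form p (circ_map i (basis_vec [f, g])) (circ_map j v) = k * tensor_ev (basis_vec [f, g]) v"
    using assms(3)
    by (induction v rule: tensor2_induct) (auto simp: circ_map_simps form_simps assms(1) algebra_simps)
  then show ?case by (simp add: circ_map_simps form_simps)
qed (auto simp: circ_map_simps form_simps algebra_simps)

definition primal_rels :: "nat \<Rightarrow> nat \<Rightarrow> ('a tree \<Rightarrow>\<^sub>0 'k) set" where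
  "primal_rels i j = {basis_vec (circ j a b) - circ_map i v | a b v. a \<in> A \<and> b \<in> A \<and> img (basis_vec [a, b]) v}"

lemma primal_rels_eq: "As_rels s A \<Phi> = primal_rels 1 2" "As_op_rels s A \<Phi> = primal_rels 2 1"
  unfolding As_rels_def As_op_rels_def primal_rels_def circ_map_def using pure_img by blast+

lemma tree_pairing_circ:
  "tree_pairing (circ 1 f g) (circ 1 a b) = 1 * (f a * g b)"
  "tree_pairing (circ 2 f g) (circ 2 a b) = (- 1) * (f a * g b)"
  "tree_pairing (circ 1 f g) (circ 2 a b) = 0 * (f a * g b)"
  "tree_pairing (circ 2 f g) (circ 1 a b) = 0 * (f a * g b)"
  by simp_all

lemma pairing_circ_maps:
  assumes "u \<in> tensor2 D" "v \<in> tensor2 E"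
  shows "bilin_form tree_pairing (circ_map 1 u) (circ_map 1 v) = tensor_ev u v"
    "bilin_form tree_pairing (circ_map 2 u) (circ_map 2 v) = - tensor_ev u v"
    "bilin_form tree_pairing (circ_map 1 u) (circ_map 2 v) = 0"
    "bilin_form tree_pairing (circ_map 2 u) (circ_map 1 v) = 0"
  using bilin_form_circ_maps[OF tree_pairing_circ(1) assms] bilin_form_circ_maps[OF tree_pairing_circ(2) assms]
    bilin_form_circ_maps[OF tree_pairing_circ(3) assms] bilin_form_circ_maps[OF tree_pairing_circ(4) assms]
  by simp_all

text \<open>Both nonsymmetric statements are the instances (1,2) and (2,1) of one computation; the
  dual relations have \<open>i\<close> and \<open>j\<close> in exchanged positions.\<close>

lemma koszul_dual_presented:
  assumes "(i, j) = (1, 2) \<or> (i, j) = (2, 1)"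
  shows "ns_koszul_dual s A (primal_rels i j) = ns_presented fun_scale dual (dual_As_rels j i)"
  unfolding ns_koszul_dual_def
proof (rule ns_presented_eqI)
  show "ns_orthogonal s A (primal_rels i j) \<subseteq> pres_ideal fun_scale dual (dual_As_rels j i) 3"
  proof
    fix x assume x: "x \<in> ns_orthogonal s A (primal_rels i j)"
    then obtain x1 x2 where d: "x1 \<in> tensor2 dual" "x2 \<in> tensor2 dual" "x = circ_map 1 x1 + circ_map 2 x2"
      by (auto simp: ns_orthogonal_def elim: arity3_decompose)
    have 0: "bilin_form tree_pairing x (circ_map j (basis_vec [a, b]) - circ_map i v) = 0"
      if "a \<in> A" "b \<in> A" "img (basis_vec [a, b]) v" for a b v
      using x that by (auto simp: ns_orthogonal_def primal_rels_def)
    \<comment> \<open>Since the pairing is negative on \<open>\<circ>\<^sub>2\<close>, the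
      difference in the relation becomes a sum of two evaluations, up to a global sign.\<close>
    have "tensor_ev (if j = 1 then x1 else x2) (basis_vec [a, b]) + tensor_ev (if j = 1 then x2 else x1) v = 0"
      if "a \<in> A" "b \<in> A" "img (basis_vec [a, b]) v" for a b v
    proof -
      have ab: "basis_vec [a, b] \<in> tensor2 A" using that by simp
      show ?thesis
        using 0[OF that] assms that(1,2) img_coset(1)[OF that(3)] d
        by (auto simp: form_simps pairing_circ_maps[OF d(1) ab] pairing_circ_maps[OF d(2) ab]
            pairing_circ_maps[OF d(1) img_coset(1)[OF that(3)]] pairing_circ_maps[OF d(2) img_coset(1)[OF that(3)]]
            add_eq_0_iff simp del: circ_map_basis One_nat_def)
    qed
    then have "circ_map j (if j = 1 then x1 else x2) + circ_map i (if j = 1 then x2 else x1)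
        \<in> pres_ideal fun_scale dual (dual_As_rels j i) 3"
      using d assms by (intro orthogonal_in_ideal) auto
    then show "x \<in> pres_ideal fun_scale dual (dual_As_rels j i) 3"
      using assms d by (auto simp: add.commute)
  qed
  have "dual_As_rels j i \<subseteq> ns_orthogonal s A (primal_rels i j)"
  proof
    fix x assume "x \<in> dual_As_rels j i"
    then obtain f g u where x: "x = circ_map i (basis_vec [f, g]) - circ_map j u"
      "f \<in> dual" "g \<in> dual" "u \<in> \<Phi>t (pure_tensor fun_scale dual [f, g])"
      by (auto simp: dual_As_rels_def)
    note u = transpose_pure(2,3)[OF x(2-4)]
    have fg: "basis_vec [f, g] \<in> tensor2 dual" using x by simp
    have "x \<in> tree_space dual 3"
      using circ_map_space[OF fg, of i] circ_map_space[OF u(1), of j] x assms by (auto intro: tree_space_closed)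
    moreover have "bilin_form tree_pairing x r = 0" if "r \<in> primal_rels i j" for r
    proof -
      obtain a b v where r: "r = circ_map j (basis_vec [a, b]) - circ_map i v" "a \<in> A" "b \<in> A" "img (basis_vec [a, b]) v"
        using \<open>r \<in> primal_rels i j\<close> by (auto simp: primal_rels_def)
      have ab: "basis_vec [a, b] \<in> tensor2 A" using r by simp
      note v = img_coset(1)[OF r(4)]
      have "tensor_ev u (basis_vec [a, b]) = tensor_ev (basis_vec [f, g]) v"
        using u(2) r by (simp add: adj_def)
      then show ?thesis
        using assms
        by (auto simp: x(1) r(1) form_simps pairing_circ_maps[OF fg ab] pairing_circ_maps[OF u(1) ab]
            pairing_circ_maps[OF fg v] pairing_circ_maps[OF u(1) v] simp del: circ_map_basis One_nat_def)
    qed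
    ultimately show "x \<in> ns_orthogonal s A (primal_rels i j)" by (simp add: ns_orthogonal_def)
  qed
  then show "dual_As_rels j i \<subseteq> pres_ideal fun_scale dual (ns_orthogonal s A (primal_rels i j)) 3"
    by (blast intro: pres_ideal_rel)
qed

lemma ns_koszul_duals:
  "ns_koszul_dual s A (As_rels s A \<Phi>) = As_op_operad fun_scale dual \<Phi>t"
  "ns_koszul_dual s A (As_op_rels s A \<Phi>) = As_operad fun_scale dual \<Phi>t"
  by (simp_all add: primal_rels_eq koszul_dual_presented As_op_operad_def As_operad_def dual_As_rels_eq)

end

section \<open>Leaf-labelled trees\<close>

text \<open>
  The basis element \<open>t \<cdot> \<sigma>\<close> of the symmetrisation of a free operad is the tree \<open>t\<close> with its leaves
  labelled \<open>\<sigma>\<^sup>-\<^sup>1 1, \<dots>, \<sigma>\<^sup>-\<^sup>1 n\<close> from left to right.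
\<close>

datatype 'e ltree = Lf nat | Nd "'e ltree" 'e "'e ltree"

primrec lleaves :: "'e ltree \<Rightarrow> nat list" where
  "lleaves (Lf k) = [k]"
| "lleaves (Nd l a r) = lleaves l @ lleaves r"

primrec lshape :: "'e ltree \<Rightarrow> 'e tree" where
  "lshape (Lf k) = \<langle>\<rangle>"
| "lshape (Nd l a r) = \<langle>lshape l, a, lshape r\<rangle>"

primrec lren :: "(nat \<Rightarrow> nat) \<Rightarrow> 'e ltree \<Rightarrow> 'e ltree" where
  "lren f (Lf k) = Lf (f k)"
| "lren f (Nd l a r) = Nd (lren f l) a (lren f r)"

primrec lab :: "'e tree \<Rightarrow> (nat \<Rightarrow> nat) \<Rightarrow> 'e ltree" where
  "lab \<langle>\<rangle> p = Lf (p 1)"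
| "lab \<langle>l, a, r\<rangle> p = Nd (lab l p) a (lab r (\<lambda>k. p (k + size1 l)))"

text \<open>New name of input \<open>k\<close> once input \<open>i\<close> has been replaced by
  \<open>n\<close> inputs.\<close>

definition lshift :: "nat \<Rightarrow> nat \<Rightarrow> nat \<Rightarrow> nat" where
  "lshift i n k = (if k < i then k else k + n - 1)"

text \<open>Partial composition on labelled trees. The leaf is found by its label instead of its
  planar position, and this removes the permutations from the composition.\<close>

primrec lsubst :: "nat \<Rightarrow> nat \<Rightarrow> 'e ltree \<Rightarrow> 'e ltree \<Rightarrow> 'e ltree" where
  "lsubst i n (Lf k) w = (if k = i then lren (\<lambda>j. j + i - 1) w else Lf (lshift i n k))"
| "lsubst i n (Nd l a r) w = Nd (lsubst i n l w) a (lsubst i n r w)"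

lemma lab_cong: "(\<And>k. 1 \<le> k \<Longrightarrow> k \<le> size1 t \<Longrightarrow> p k = q k) \<Longrightarrow> lab t p = lab t q"
proof (induction t arbitrary: p q)
  case (Node l a r)
  have "lab l p = lab l q" by (rule Node.IH) (use Node.prems in auto)
  moreover have "lab r (\<lambda>k. p (k + size1 l)) = lab r (\<lambda>k. q (k + size1 l))"
    by (rule Node.IH) (use Node.prems in auto)
  ultimately show ?case by simp
qed simp

lemma lren_lab: "lren f (lab t p) = lab t (\<lambda>k. f (p k))"
  by (induction t arbitrary: p) auto

lemma lshape_lab [simp]: "lshape (lab t p) = t"
  by (induction t arbitrary: p) auto

lemma lleaves_lab: "lleaves (lab t p) = map p [1..<Suc (size1 t)]"
proof (induction t arbitrary: p)
  case (Node l a r)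
  have 1: "[Suc 0..<Suc (size1 l + size1 r)] = [Suc 0..<Suc (size1 l)] @ [Suc (size1 l)..<Suc (size1 l + size1 r)]"
    using upt_add_eq_append[of "Suc 0" "Suc (size1 l)" "size1 r"] by (simp del: upt_Suc)
  have 2: "[Suc (size1 l)..<Suc (size1 l + size1 r)] = map (\<lambda>k. k + size1 l) [Suc 0..<Suc (size1 r)]"
    by (rule nth_equalityI) (auto simp del: upt_Suc)
  show ?case by (simp add: Node 1 2 o_def del: upt_Suc)
qed simp

lemma length_lleaves: "length (lleaves z) = size1 (lshape z)"
  by (induction z) auto

lemma lab_lshape: "lleaves z = map p [1..<Suc (size1 (lshape z))] \<Longrightarrow> lab (lshape z) p = z"
proof (induction z arbitrary: p)
  case (Nd l a r)
  let ?l = "size1 (lshape l)" and ?r = "size1 (lshape r)"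
  have 1: "[Suc 0..<Suc (?l + ?r)] = [Suc 0..<Suc ?l] @ [Suc ?l..<Suc (?l + ?r)]"
    using upt_add_eq_append[of "Suc 0" "Suc ?l" "?r"] by (simp del: upt_Suc)
  have 2: "[Suc ?l..<Suc (?l + ?r)] = map (\<lambda>k. k + ?l) [Suc 0..<Suc ?r]"
    by (rule nth_equalityI) (auto simp del: upt_Suc)
  have "lleaves l = map p [1..<Suc ?l] \<and> lleaves r = map (\<lambda>k. p (k + ?l)) [1..<Suc ?r]"
    using Nd.prems by (simp add: 1 2 o_def length_lleaves append_eq_append_conv del: upt_Suc)
  then show ?case using Nd.IH by simp
qed simp

lemma lsubst_notin: "i \<notin> set (lleaves z) \<Longrightarrow> lsubst i n z w = lren (lshift i n) z"
  by (induction z) auto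

lemma lren_id: "(\<And>k. k \<in> set (lleaves z) \<Longrightarrow> f k = k) \<Longrightarrow> lren f z = z"
  by (induction z) auto

lemma lab_graft_aux:
  assumes "1 \<le> j" "j \<le> size1 t" "n = size1 u" "pt j = i"
    and "\<And>q. 1 \<le> q \<Longrightarrow> q \<le> size1 t \<Longrightarrow> q \<noteq> j \<Longrightarrow> pt q \<noteq> i"
    and "\<And>q. 1 \<le> q \<Longrightarrow> q < j \<Longrightarrow> p q = lshift i n (pt q)"
    and "\<And>q. j \<le> q \<Longrightarrow> q < j + n \<Longrightarrow> p q = pu (q - j + 1) + i - 1"
    and "\<And>q. j + n \<le> q \<Longrightarrow> q \<le> size1 t + n - 1 \<Longrightarrow> p q = lshift i n (pt (q + 1 - n))"
  shows "lab (graft t j u) p = lsubst i n (lab t pt) (lab u pu)"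
  using assms
proof (induction t arbitrary: j p pt)
  case Leaf
  then have j: "j = 1" by simp
  have "lab u p = lab u (\<lambda>k. pu k + i - 1)"
    by (rule lab_cong) (use Leaf j in auto)
  then show ?case using Leaf(4) j by (simp add: lren_lab)
next
  case (Node l a r)
  let ?l = "size1 l"
  have n: "1 \<le> n" using Node.prems(3) by (simp add: size1_size)
  show ?case
  proof (cases "j \<le> ?l")
    case True
    have "lab (graft l j u) p = lsubst i n (lab l pt) (lab u pu)"
      by (rule Node.IH(1)) (use Node.prems True in auto)
    moreover have "lab r (\<lambda>k. p (k + size1 (graft l j u))) = lren (lshift i n) (lab r (\<lambda>k. pt (k + ?l)))"
      unfolding lren_lab
    proof (rule lab_cong)
      fix k assume k: "1 \<le> k" "k \<le> size1 r"
      \<comment> \<open>Grafting into the left subtree moves the leaves of the right one by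
        \<open>n - 1\<close> positions, into the range of the last hypothesis.\<close>
      have s: "k + size1 (graft l j u) = k + ?l + n - 1"
        using size1_graft[of j l u] Node.prems(1,3) True by simp
      have "k + ?l + n - 1 + 1 - n = k + ?l" using n by simp
      then show "p (k + size1 (graft l j u)) = lshift i n (pt (k + ?l))"
        unfolding s using Node.prems(8)[of "k + ?l + n - 1"] k True by simp
    qed
    moreover have "i \<notin> set (lleaves (lab r (\<lambda>k. pt (k + ?l))))"
    proof -
      have "pt (k + ?l) \<noteq> i" if "1 \<le> k" "k \<le> size1 r" for k
        using Node.prems(5)[of "k + ?l"] that True by simp
      then show ?thesis by (fastforce simp: lleaves_lab simp del: upt_Suc)
    qed
    ultimately show ?thesis using True by (simp add: lsubst_notin)
  next
    case False
    have "lab l p = lren (lshift i n) (lab l pt)"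
      unfolding lren_lab by (rule lab_cong) (use Node.prems(6) False in auto)
    moreover have "i \<notin> set (lleaves (lab l pt))"
      using Node.prems(5) False by (force simp: lleaves_lab simp del: upt_Suc)
    moreover have "lab (graft r (j - ?l) u) (\<lambda>k. p (k + ?l)) = lsubst i n (lab r (\<lambda>k. pt (k + ?l))) (lab u pu)"
    proof (rule Node.IH(2))
      fix q assume q: "j - ?l + n \<le> q" "q \<le> size1 r + n - 1"
      have "q + ?l + 1 - n = q + 1 - n + ?l" using q n by linarith
      then show "p (q + ?l) = lshift i n (pt (q + 1 - n + ?l))"
        using Node.prems(8)[of "q + ?l"] q False by simp
    next
      fix q assume q: "j - ?l \<le> q" "q < j - ?l + n"
      then have "q + ?l - j = q - (j - ?l)" using False by simp
      then show "p (q + ?l) = pu (q - (j - ?l) + 1) + i - 1"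
        using Node.prems(7)[of "q + ?l"] q False by simp
    next
      fix q assume q: "1 \<le> q" "q \<le> size1 r" "q \<noteq> j - ?l"
      then show "pt (q + ?l) \<noteq> i" using Node.prems(5)[of "q + ?l"] by auto
    qed (use Node.prems False in auto)
    ultimately show ?thesis using False by (simp add: lsubst_notin)
  qed
qed

subsection \<open>Composition of permutations\<close>

text \<open>The label of the \<open>q\<close>-th leaf of the grafted tree: leaves left of the
  grafted part, in it, and right of it.\<close>

definition perm_comp_inv :: "nat \<Rightarrow> nat \<Rightarrow> (nat \<Rightarrow> nat) \<Rightarrow> (nat \<Rightarrow> nat) \<Rightarrow> nat \<Rightarrow> nat" where
  "perm_comp_inv i n \<sigma> \<rho> q =
     (if q < \<sigma> i then lshift i n (inv \<sigma> q)
      else if q < \<sigma> i + n then inv \<rho> (q - \<sigma> i + 1) + i - 1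
      else lshift i n (inv \<sigma> (q + 1 - n)))"

lemma perm_comp_inverse:
  assumes "\<sigma> permutes {1..m}" "\<rho> permutes {1..n}" "1 \<le> i" "i \<le> m" "1 \<le> n" "q \<in> {1..m + n - 1}"
  shows "perm_comp_inv i n \<sigma> \<rho> q \<in> {1..m + n - 1}"
    "perm_comp m i n \<sigma> \<rho> (perm_comp_inv i n \<sigma> \<rho> q) = q"
proof -
  have \<sigma>i: "\<sigma> i \<in> {1..m}" using permutes_in_image[OF assms(1), of i] assms(3,4) by simp
  have inv\<sigma>: "inv \<sigma> k \<in> {1..m} \<and> \<sigma> (inv \<sigma> k) = k \<and> (k \<noteq> \<sigma> i \<longrightarrow> inv \<sigma> k \<noteq> i)" if "k \<in> {1..m}" for k
    using permutes_in_image[OF permutes_inv[OF assms(1)], of k] permutes_inverses[OF assms(1)] that by auto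
  have inv\<rho>: "inv \<rho> k \<in> {1..n} \<and> \<rho> (inv \<rho> k) = k" if "k \<in> {1..n}" for k
    using permutes_in_image[OF permutes_inv[OF assms(2)], of k] permutes_inverses[OF assms(2)] that by auto
  consider "q < \<sigma> i" | "\<sigma> i \<le> q" "q < \<sigma> i + n" | "\<sigma> i + n \<le> q" by linarith
  then have "perm_comp_inv i n \<sigma> \<rho> q \<in> {1..m + n - 1} \<and>
    perm_comp m i n \<sigma> \<rho> (perm_comp_inv i n \<sigma> \<rho> q) = q"
  proof cases
    case 1
    have k: "inv \<sigma> q \<in> {1..m}" "\<sigma> (inv \<sigma> q) = q" "inv \<sigma> q \<noteq> i" using inv\<sigma>[of q] 1 \<sigma>i assms(6) by auto
    show ?thesis
    proof (cases "inv \<sigma> q < i")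
      case True
      then show ?thesis using 1 k assms(4,5) by (auto simp: perm_comp_inv_def lshift_def perm_comp_def Let_def)
    next
      case False
      then have "inv \<sigma> q > i" using k by simp
      then show ?thesis using 1 k assms(4,5) by (auto simp: perm_comp_inv_def lshift_def perm_comp_def Let_def)
    qed
  next
    case 2
    have k: "inv \<rho> (q - \<sigma> i + 1) \<in> {1..n}" "\<rho> (inv \<rho> (q - \<sigma> i + 1)) = q - \<sigma> i + 1"
      using inv\<rho>[of "q - \<sigma> i + 1"] 2 by auto
    define r where "r = inv \<rho> (q - \<sigma> i + 1)"
    have r: "1 \<le> r" "r \<le> n" "\<rho> r = q - \<sigma> i + 1" using k by (auto simp: r_def)
    have e: "perm_comp_inv i n \<sigma> \<rho> q = r + i - 1" using 2 by (simp add: perm_comp_inv_def r_def)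
    have "r + i - 1 - i + 1 = r" using r assms(3) by linarith
    then show ?thesis unfolding e using 2 r assms(3-5)
      by (auto simp: perm_comp_def Let_def)
  next
    case 3
    have q: "q + 1 - n \<in> {1..m}" "q + 1 - n \<noteq> \<sigma> i" "q + 1 - n \<ge> \<sigma> i" using 3 assms(5,6) by auto
    have k: "inv \<sigma> (q + 1 - n) \<in> {1..m}" "\<sigma> (inv \<sigma> (q + 1 - n)) = q + 1 - n" "inv \<sigma> (q + 1 - n) \<noteq> i"
      using inv\<sigma>[OF q(1)] q(2) by auto
    define r where "r = inv \<sigma> (q + 1 - n)"
    have r: "r \<in> {1..m}" "\<sigma> r = q + 1 - n" "r \<noteq> i" using k by (auto simp: r_def)
    have e: "perm_comp_inv i n \<sigma> \<rho> q = lshift i n r" using 3 by (simp add: perm_comp_inv_def r_def)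
    show ?thesis
    proof (cases "r < i")
      case True
      then show ?thesis unfolding e using 3 r q assms(4-6) by (auto simp: lshift_def perm_comp_def Let_def)
    next
      case False
      then have "r > i" using r by simp
      then show ?thesis unfolding e using 3 r q assms(4-6) by (auto simp: lshift_def perm_comp_def Let_def)
    qed
  qed
  then show "perm_comp_inv i n \<sigma> \<rho> q \<in> {1..m + n - 1}"
    "perm_comp m i n \<sigma> \<rho> (perm_comp_inv i n \<sigma> \<rho> q) = q" by auto
qed

text \<open>\<open>perm_comp_inverse\<close> is one-sided, but it makes \<open>?g\<close> an
  injective self-map of a finite set, hence a surjective one, and so the inverse is
  two-sided.\<close>

lemma perm_comp_permutes:
  assumes "\<sigma> permutes {1..m}" "\<rho> permutes {1..n}" "1 \<le> i" "i \<le> m" "1 \<le> n"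
  shows "perm_comp m i n \<sigma> \<rho> permutes {1..m + n - 1}"
    "q \<in> {1..m + n - 1} \<Longrightarrow> inv (perm_comp m i n \<sigma> \<rho>) q = perm_comp_inv i n \<sigma> \<rho> q"
proof -
  let ?S = "{1..m + n - 1}" and ?f = "perm_comp m i n \<sigma> \<rho>" and ?g = "perm_comp_inv i n \<sigma> \<rho>"
  note inv = perm_comp_inverse[OF assms]
  have "inj_on ?g ?S" by (rule inj_on_inverseI[where g="?f"]) (rule inv(2))
  moreover have g: "?g ` ?S \<subseteq> ?S" using inv(1) by blast
  ultimately have surj: "?g ` ?S = ?S" by (intro endo_inj_surj) auto
  have *: "?g (?f a) = a \<and> ?f a \<in> ?S" if "a \<in> ?S" for a
  proof -
    from that surj obtain q where q: "q \<in> ?S" "a = ?g q" by blast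
    then show ?thesis using inv(2)[OF q(1)] by simp
  qed
  have "bij_betw ?f ?S ?S"
    by (rule bij_betw_byWitness[where f'="?g"]) (use inv * g in auto)
  moreover have "?f x = x" if "x \<notin> ?S" for x
    using that by (auto simp: perm_comp_def)
  ultimately show p: "?f permutes ?S" by (rule bij_imp_permutes)
  show "inv ?f q = ?g q" if "q \<in> ?S" using permutes_inv_eq[OF p] inv(2)[OF that] by blast
qed

text \<open>The label \<open>i\<close> sits at the leaf in position \<open>\<sigma> i\<close>;
  therefore the symmetrised composition grafts there, and on labelled trees it is the substitution
  at \<open>i\<close>.\<close>

lemma lab_graft:
  assumes "\<sigma> permutes {1..m}" "\<rho> permutes {1..n}" "1 \<le> i" "i \<le> m" "size1 t = m" "size1 u = n"
  shows "lab (graft t (\<sigma> i) u) (inv (perm_comp m i n \<sigma> \<rho>)) = lsubst i n (lab t (inv \<sigma>)) (lab u (inv \<rho>))"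
proof -
  have n: "1 \<le> n" using assms(6) by (auto simp: size1_size)
  have j: "1 \<le> \<sigma> i" "\<sigma> i \<le> m" using permutes_in_image[OF assms(1), of i] assms(3,4) by auto
  have s: "size1 (graft t (\<sigma> i) u) = m + n - 1" using size1_graft j assms(5,6) by blast
  have "lab (graft t (\<sigma> i) u) (inv (perm_comp m i n \<sigma> \<rho>)) = lab (graft t (\<sigma> i) u) (perm_comp_inv i n \<sigma> \<rho>)"
    by (rule lab_cong) (use perm_comp_permutes(2)[OF assms(1-4) n] s in auto)
  also have "\<dots> = lsubst i n (lab t (inv \<sigma>)) (lab u (inv \<rho>))"
  proof (rule lab_graft_aux)
    show "inv \<sigma> (\<sigma> i) = i" using permutes_inverses(2)[OF assms(1)] .
    show "inv \<sigma> q \<noteq> i" if "q \<noteq> \<sigma> i" for q using permutes_inverses(1)[OF assms(1), of q] that by auto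
  qed (use j assms n in \<open>auto simp: perm_comp_inv_def\<close>)
  finally show ?thesis .
qed

lemma perm_comp_id:
  assumes "1 \<le> i" "i \<le> m" shows "perm_comp m i n id id = id"
  by (rule ext) (use assms in \<open>auto simp: perm_comp_def Let_def\<close>)

section \<open>The symmetrisation of a free operad\<close>

definition sym_space :: "'e set \<Rightarrow> nat \<Rightarrow> ((nat \<Rightarrow> nat) \<Rightarrow> ('e tree \<Rightarrow>\<^sub>0 'k::field)) set" where
  "sym_space E n = {f. \<forall>\<sigma>. if \<sigma> permutes {1..n} then f \<sigma> \<in> tree_space E n else f \<sigma> = 0}"

text \<open>Unlike the scaling of \<open>sym_operad\<close> it has no case distinction on
  permutations; both agree on \<open>sym_space\<close>, whose elements vanish off the symmetric
  group.\<close>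

definition sym_scale :: "'k::field \<Rightarrow> ((nat \<Rightarrow> nat) \<Rightarrow> ('e tree \<Rightarrow>\<^sub>0 'k)) \<Rightarrow> (nat \<Rightarrow> nat) \<Rightarrow> ('e tree \<Rightarrow>\<^sub>0 'k)" where
  "sym_scale c f = (\<lambda>\<sigma>. fsmul c (f \<sigma>))"

definition sym_comp :: "nat \<Rightarrow> nat \<Rightarrow> nat \<Rightarrow> ((nat \<Rightarrow> nat) \<Rightarrow> ('e tree \<Rightarrow>\<^sub>0 'k::field))
    \<Rightarrow> ((nat \<Rightarrow> nat) \<Rightarrow> ('e tree \<Rightarrow>\<^sub>0 'k)) \<Rightarrow> (nat \<Rightarrow> nat) \<Rightarrow> ('e tree \<Rightarrow>\<^sub>0 'k)" where
  "sym_comp m i n f g \<pi> = (if \<pi> permutes {1..m + n - 1}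
     then (\<Sum>(\<sigma>, \<rho>) \<in> {(\<sigma>, \<rho>). \<sigma> permutes {1..m} \<and> \<rho> permutes {1..n} \<and> perm_comp m i n \<sigma> \<rho> = \<pi>}.
             bilin_ext (\<lambda>t u. graft t (\<sigma> i) u) (f \<sigma>) (g \<rho>))
     else 0)"

definition sym_act :: "(nat \<Rightarrow> nat) \<Rightarrow> ((nat \<Rightarrow> nat) \<Rightarrow> 'v) \<Rightarrow> (nat \<Rightarrow> nat) \<Rightarrow> 'v" where
  "sym_act \<rho> f = (\<lambda>\<sigma>. f (\<sigma> \<circ> inv \<rho>))"

lemma sym_space_iff:
  "f \<in> sym_space E n \<longleftrightarrow> (\<forall>\<sigma>. \<sigma> permutes {1..n} \<longrightarrow> f \<sigma> \<in> tree_space E n) \<and> (\<forall>\<sigma>. \<not> \<sigma> permutes {1..n} \<longrightarrow> f \<sigma> = 0)"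
  unfolding sym_space_def by auto

lemma sym_operad_simps:
  "op_space (sym_operad (tree_operad E)) n = sym_space E n"
  "op_zero (sym_operad (tree_operad E)) n = 0"
  "f \<in> sym_space E n \<Longrightarrow> op_scale (sym_operad (tree_operad E)) n c f = sym_scale c f"
  "op_comp (sym_operad (tree_operad E)) m i n = sym_comp m i n"
  "op_unit (sym_operad (tree_operad E)) = sym_elem (basis_vec \<langle>\<rangle>) id"
  "op_act (sym_operad (tree_operad E)) n \<rho> f = sym_act \<rho> f"
  by (auto simp: sym_operad_def sym_space_def sym_scale_def sym_comp_def sym_elem_def sym_act_def fun_eq_iff)

lemma finite_pairs: "finite {(\<sigma>, \<rho>). \<sigma> permutes {1..m::nat} \<and> \<rho> permutes {1..n::nat} \<and> P \<sigma> \<rho>}"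
proof -
  have "finite ({\<sigma>. \<sigma> permutes {1..m}} \<times> {\<rho>. \<rho> permutes {1..n}})"
    by (intro finite_cartesian_product finite_permutations) auto
  then show ?thesis by (rule rev_finite_subset) auto
qed

lemma sym_space_closed:
  "0 \<in> sym_space E n" "f \<in> sym_space E n \<Longrightarrow> g \<in> sym_space E n \<Longrightarrow> f + g \<in> sym_space E n"
  "f \<in> sym_space E n \<Longrightarrow> g \<in> sym_space E n \<Longrightarrow> f - g \<in> sym_space E n"
  "f \<in> sym_space E n \<Longrightarrow> sym_scale c f \<in> sym_space E n"
  by (auto simp: sym_space_iff sym_scale_def tree_space_closed)

lemma sym_elem_space: "x \<in> tree_space E n \<Longrightarrow> \<sigma> permutes {1..n} \<Longrightarrow> sym_elem x \<sigma> \<in> sym_space E n"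
  by (auto simp: sym_space_iff sym_elem_def tree_space_closed)

lemma sym_comp_space:
  assumes "f \<in> sym_space E m" "g \<in> sym_space E n" "1 \<le> i" "i \<le> m"
  shows "sym_comp m i n f g \<in> sym_space E (m + n - 1)"
proof -
  have "bilin_ext (\<lambda>t u. graft t (\<sigma> i) u) (f \<sigma>) (g \<rho>) \<in> tree_space E (m + n - 1)"
    if "\<sigma> permutes {1..m}" "\<rho> permutes {1..n}" for \<sigma> \<rho>
    using assms that permutes_in_image[OF that(1), of i]
    by (intro tree_comp_closed) (auto simp: sym_space_iff)
  then show ?thesis
    by (auto simp: sym_space_iff sym_comp_def intro!: tree_space_sum)
qed

lemma permutes_comp_inv_iff:
  assumes "\<rho> permutes S" shows "\<sigma> \<circ> inv \<rho> permutes S \<longleftrightarrow> \<sigma> permutes S"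
proof
  assume "\<sigma> \<circ> inv \<rho> permutes S"
  then have "(\<sigma> \<circ> inv \<rho>) \<circ> \<rho> permutes S" using assms by (rule permutes_compose[rotated])
  moreover have "(\<sigma> \<circ> inv \<rho>) \<circ> \<rho> = \<sigma>" using permutes_inverses[OF assms] by (simp add: fun_eq_iff)
  ultimately show "\<sigma> permutes S" by simp
qed (use permutes_compose[OF permutes_inv[OF assms]] in blast)

lemma sym_act_space:
  "f \<in> sym_space E n \<Longrightarrow> \<rho> permutes {1..n} \<Longrightarrow> sym_act \<rho> f \<in> sym_space E n"
  by (simp add: sym_space_iff sym_act_def permutes_comp_inv_iff)

lemma sym_act_elem:
  assumes "\<rho> permutes S" shows "sym_act \<rho> (sym_elem x \<sigma>) = sym_elem x (\<sigma> \<circ> \<rho>)"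
proof -
  have "\<pi> \<circ> inv \<rho> = \<sigma> \<longleftrightarrow> \<pi> = \<sigma> \<circ> \<rho>" for \<pi>
    using permutes_inverses[OF assms] by (auto simp: fun_eq_iff) metis+
  then show ?thesis by (simp add: sym_act_def sym_elem_def fun_eq_iff)
qed

lemma sym_act_linear:
  "sym_act \<rho> (f + g) = sym_act \<rho> f + sym_act \<rho> g" "sym_act \<rho> (f - g) = sym_act \<rho> f - sym_act \<rho> g"
  "sym_act \<rho> (sym_scale c f) = sym_scale c (sym_act \<rho> f)" "sym_act \<rho> 0 = 0"
  by (auto simp: sym_act_def sym_scale_def fun_eq_iff)

lemma sym_comp_linear:
  "sym_comp m i n (f + f') g = sym_comp m i n f g + sym_comp m i n f' g"
  "sym_comp m i n f (g + g') = sym_comp m i n f g + sym_comp m i n f g'"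
  "sym_comp m i n (f - f') g = sym_comp m i n f g - sym_comp m i n f' g"
  "sym_comp m i n f (g - g') = sym_comp m i n f g - sym_comp m i n f g'"
  "sym_comp m i n 0 g = 0" "sym_comp m i n f 0 = 0"
  by (auto simp: sym_comp_def fun_eq_iff bilin_simps sum.distrib sum_subtractf case_prod_beta)

lemma sum_fun_apply: "(\<Sum>i\<in>I. F i) x = (\<Sum>i\<in>I. F i x)"
  by (induction I rule: infinite_finite_induct) auto

text \<open>Together with \<open>sym_act_elem\<close> this reduces equivariant statements to
  elements concentrated at the identity.\<close>

lemma sym_decompose:
  assumes "f \<in> sym_space E n" shows "f = (\<Sum>\<sigma> | \<sigma> permutes {1..n}. sym_elem (f \<sigma>) \<sigma>)"
proof
  fix \<pi>
  have fin: "finite {\<sigma>. \<sigma> permutes {1..n}}" by (simp add: finite_permutations)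
  have "(\<Sum>\<sigma> | \<sigma> permutes {1..n}. sym_elem (f \<sigma>) \<sigma>) \<pi> = (\<Sum>\<sigma> | \<sigma> permutes {1..n}. sym_elem (f \<sigma>) \<sigma> \<pi>)"
    by (rule sum_fun_apply)
  also have "\<dots> = f \<pi>"
    using assms fin by (cases "\<pi> permutes {1..n}") (auto simp: sym_elem_def sym_space_iff sum.delta' cong: if_cong intro!: sum.neutral)
  finally show "f \<pi> = (\<Sum>\<sigma> | \<sigma> permutes {1..n}. sym_elem (f \<sigma>) \<sigma>) \<pi>" ..
qed

text \<open>In the sum over pairs of permutations only the pair of identities contributes, and its
  composite is the identity. So the nonsymmetric operad sits in its symmetrisation.\<close>

lemma sym_comp_elem_id:
  assumes "1 \<le> i" "i \<le> m"
  shows "sym_comp m i n (sym_elem x id) (sym_elem y id) = sym_elem (bilin_ext (\<lambda>t u. graft t i u) x y) id"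
proof
  fix \<pi>
  let ?P = "{(\<sigma>, \<rho>). \<sigma> permutes {1..m} \<and> \<rho> permutes {1..n} \<and> perm_comp m i n \<sigma> \<rho> = \<pi>}"
  let ?h = "\<lambda>(\<sigma>, \<rho>). bilin_ext (\<lambda>t u. graft t (\<sigma> i) u) (sym_elem x id \<sigma>) (sym_elem y id \<rho>)"
  have z: "?h p = 0" if "p \<noteq> (id, id)" for p
  proof -
    obtain \<sigma> \<rho> where p: "p = (\<sigma>, \<rho>)" by (cases p)
    with that have "\<sigma> \<noteq> id \<or> \<rho> \<noteq> id" by simp
    then show ?thesis unfolding p by (auto simp: sym_elem_def bilin_simps)
  qed
  have "sum ?h ?P = (if (id, id) \<in> ?P then ?h (id, id) else 0)"
  proof (cases "(id, id) \<in> ?P")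
    case True
    have "sum ?h ?P = sum ?h {(id, id)}"
    proof (rule sum.mono_neutral_right)
      show "finite ?P" by (rule finite_pairs)
      show "{(id, id)} \<subseteq> ?P" using True by (simp only: insert_subset empty_subsetI simp_thms)
      show "\<forall>p\<in>?P - {(id, id)}. ?h p = 0"
      proof
        fix p assume "p \<in> ?P - {(id, id)}"
        then show "?h p = 0" by (intro z) (simp only: DiffE singleton_iff Diff_iff simp_thms)
      qed
    qed
    with True show ?thesis by (simp only: if_True sum.empty add_0_right sum.insert empty_iff finite.emptyI not_False_eq_True)
  next
    case False
    have "?h p = 0" if "p \<in> ?P" for p
    proof (rule z)
      show "p \<noteq> (id, id)" using that False by metis
    qed
    then have "sum ?h ?P = 0" by (rule sum.neutral[OF ballI])
    with False show ?thesis by (simp only: if_False)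
  qed
  moreover have "(id, id) \<in> ?P \<longleftrightarrow> \<pi> = id"
    using perm_comp_id[OF assms] by (auto simp: permutes_id)
  ultimately show "sym_comp m i n (sym_elem x id) (sym_elem y id) \<pi> = sym_elem (bilin_ext (\<lambda>t u. graft t i u) x y) id \<pi>"
    by (auto simp: sym_comp_def sym_elem_def permutes_id)
qed

lemma sym_elem_linear:
  "sym_elem (x + y) \<sigma> = sym_elem x \<sigma> + sym_elem y \<sigma>" "sym_elem (x - y) \<sigma> = sym_elem x \<sigma> - sym_elem y \<sigma>"
  "sym_elem (fsmul c x) \<sigma> = sym_scale c (sym_elem x \<sigma>)" "sym_elem 0 \<sigma> = 0"
  by (auto simp: sym_elem_def sym_scale_def fun_eq_iff)

section \<open>Passage between the symmetrised free operad and labelled trees\<close>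

definition theta :: "nat \<Rightarrow> ((nat \<Rightarrow> nat) \<Rightarrow> ('e tree \<Rightarrow>\<^sub>0 'k::field)) \<Rightarrow> ('e ltree \<Rightarrow>\<^sub>0 'k)" where
  "theta n X = (\<Sum>\<sigma> | \<sigma> permutes {1..n}. lin_ext (\<lambda>t. lab t (inv \<sigma>)) (X \<sigma>))"

text \<open>The component at \<sigma> consists of the trees whose leaf word is
  \<open>inv \<sigma>\<close>; extracting these for every \<sigma> inverts
  \<open>theta\<close>.\<close>

definition unlab :: "nat \<Rightarrow> (nat \<Rightarrow> nat) \<Rightarrow> ('e ltree \<Rightarrow>\<^sub>0 'k::field) \<Rightarrow> ('e tree \<Rightarrow>\<^sub>0 'k)" where
  "unlab n \<sigma> = lext fsmul (\<lambda>z. if lleaves z = map (inv \<sigma>) [1..<Suc n] then basis_vec (lshape z) else 0)"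

definition ltrees :: "'e set \<Rightarrow> nat \<Rightarrow> 'e ltree set" where
  "ltrees E n = {z. set (lleaves z) = {1..n} \<and> distinct (lleaves z) \<and> set_tree (lshape z) \<subseteq> E}"

lemma flin_unlab: "flin fsmul (unlab n \<sigma>)"
  unfolding unlab_def by (rule flin_lext[OF vector_space_fsmul])

lemma unlab_basis: "unlab n \<sigma> (basis_vec z) = (if lleaves z = map (inv \<sigma>) [1..<Suc n] then basis_vec (lshape z) else 0)"
  unfolding unlab_def by (rule lext_basis[OF vector_space_fsmul])

lemma theta_linear:
  "theta n (X + Y) = theta n X + theta n Y" "theta n (X - Y) = theta n X - theta n Y" "theta n (sym_scale c X) = fsmul c (theta n X)"
  by (simp_all add: theta_def lin_simps sum.distrib sum_subtractf sym_scale_def fsmul_sum)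

lemma theta_elem:
  assumes "\<sigma> permutes {1..n}" shows "theta n (sym_elem x \<sigma>) = lin_ext (\<lambda>t. lab t (inv \<sigma>)) x"
proof -
  have "theta n (sym_elem x \<sigma>) = (\<Sum>\<rho> | \<rho> permutes {1..n}. if \<rho> = \<sigma> then lin_ext (\<lambda>t. lab t (inv \<sigma>)) x else 0)"
    unfolding theta_def by (rule sum.cong) (auto simp: sym_elem_def lin_simps)
  then show ?thesis using assms by (simp add: finite_permutations)
qed

lemma lab_in_ltrees:
  assumes "\<sigma> permutes {1..n}" "size1 t = n" "set_tree t \<subseteq> E" shows "lab t (inv \<sigma>) \<in> ltrees E n"
proof -
  have p: "inv \<sigma> permutes {1..n}" by (rule permutes_inv[OF assms(1)])
  have "set [1..<Suc n] = {1..n}" by auto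
  then show ?thesis
    using permutes_image[OF p] permutes_inj_on[OF p] assms(2,3)
    by (simp add: ltrees_def lleaves_lab distinct_map del: upt_Suc)
qed

lemma keys_theta: assumes "X \<in> sym_space E n" shows "Poly_Mapping.keys (theta n X) \<subseteq> ltrees E n"
  unfolding theta_def
  by (intro keys_sum_subset keys_lin_ext lab_in_ltrees)
    (use assms in \<open>auto simp: sym_space_iff dest: tree_space_keys\<close>)

text \<open>Different permutations produce different leaf words, so a single summand of
  \<open>theta\<close> survives the extraction.\<close>

lemma unlab_theta:
  assumes "X \<in> sym_space E n" "\<sigma> permutes {1..n}" shows "unlab n \<sigma> (theta n X) = X \<sigma>"
proof -
  have *: "unlab n \<sigma> (lin_ext (\<lambda>t. lab t (inv \<rho>)) (X \<rho>)) = (if \<rho> = \<sigma> then X \<sigma> else 0)"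
    if \<rho>: "\<rho> permutes {1..n}" for \<rho>
  proof -
    have eq: "map (inv \<rho>) [1..<Suc n] = map (inv \<sigma>) [1..<Suc n] \<longleftrightarrow> \<rho> = \<sigma>"
    proof
      assume "map (inv \<rho>) [1..<Suc n] = map (inv \<sigma>) [1..<Suc n]"
      then have "inv \<rho> k = inv \<sigma> k" if "k \<in> {1..n}" for k using that by (auto simp del: upt_Suc)
      moreover have "inv \<rho> k = inv \<sigma> k" if "k \<notin> {1..n}" for k
        using that permutes_not_in[OF permutes_inv[OF \<rho>]] permutes_not_in[OF permutes_inv[OF assms(2)]] by metis
      ultimately have "inv \<rho> = inv \<sigma>" by blast
      then show "\<rho> = \<sigma>" using permutes_inv_inv[OF \<rho>] permutes_inv_inv[OF assms(2)] by metis
    qed simp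
    have k: "size1 t = n" if "t \<in> Poly_Mapping.keys (X \<rho>)" for t
      using assms(1) \<rho> that by (auto simp: sym_space_iff dest: tree_space_keys)
    have "unlab n \<sigma> (lin_ext (\<lambda>t. lab t (inv \<rho>)) (X \<rho>)) = lext fsmul (\<lambda>t. if \<rho> = \<sigma> then basis_vec t else 0) (X \<rho>)"
      by (rule flin_eqI[OF flin_comp[OF flin_lin_ext flin_unlab] flin_lext[OF vector_space_fsmul]])
        (simp only: lin_ext_basis unlab_basis lleaves_lab k eq lext_basis[OF vector_space_fsmul] lshape_lab)
    also have "\<dots> = (if \<rho> = \<sigma> then X \<sigma> else 0)"
      by (auto simp: lext_def decompose_basis[symmetric])
    finally show ?thesis .
  qed
  have "unlab n \<sigma> (theta n X) = (\<Sum>\<rho> | \<rho> permutes {1..n}. if \<rho> = \<sigma> then X \<sigma> else 0)"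
    unfolding theta_def flin_sum[OF flin_unlab] by (rule sum.cong) (use * in auto)
  then show ?thesis using assms(2) by (simp add: finite_permutations)
qed

text \<open>Identities between families indexed by permutations may now be checked on labelled
  trees.\<close>

lemma theta_inj:
  assumes "X \<in> sym_space E n" "Y \<in> sym_space E' n" "theta n X = theta n Y" shows "X = Y"
proof
  fix \<sigma>
  show "X \<sigma> = Y \<sigma>"
    using unlab_theta[OF assms(1), of \<sigma>] unlab_theta[OF assms(2), of \<sigma>] assms
    by (cases "\<sigma> permutes {1..n}") (auto simp: sym_space_iff)
qed

lemma unlab_space:
  assumes "Poly_Mapping.keys x \<subseteq> ltrees E n"
  shows "unlab n \<sigma> x \<in> tree_space E n"
  unfolding tree_space_def mem_Collect_eq unlab_def
proof (rule keys_lext_fsmul)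
  fix z assume "z \<in> Poly_Mapping.keys x"
  then have "z \<in> ltrees E n" using assms by blast
  then have "size1 (lshape z) = n" "set_tree (lshape z) \<subseteq> E"
    using distinct_card[of "lleaves z"] length_lleaves[of z] by (auto simp: ltrees_def)
  then show "Poly_Mapping.keys (if lleaves z = map (inv \<sigma>) [1..<Suc n] then basis_vec (lshape z) else 0 :: _ \<Rightarrow>\<^sub>0 'b)
     \<subseteq> {t. size1 t = n \<and> set_tree t \<subseteq> E}" by auto
qed

lemma ltrees_lab:
  assumes "z \<in> ltrees E n"
  obtains \<sigma> where "\<sigma> permutes {1..n}" "lleaves z = map (inv \<sigma>) [1..<Suc n]"
proof -
  have z: "set (lleaves z) = {1..n}" "distinct (lleaves z)" using assms by (auto simp: ltrees_def)
  then have len: "length (lleaves z) = n" using distinct_card[of "lleaves z"] by simp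
  \<comment> \<open>The leaf word read as a permutation; list positions start at 0 and inputs at 1.
    The permutation sought is its inverse.\<close>
  define p where "p k = (if k \<in> {1..n} then lleaves z ! (k - 1) else k)" for k
  have m: "map p [1..<Suc n] = lleaves z"
  proof (rule nth_equalityI)
    fix k assume "k < length (map p [1..<Suc n])"
    then have k: "k < n" by (simp del: upt_Suc)
    then have "map p [1..<Suc n] ! k = p (Suc k)" by (simp del: upt_Suc)
    then show "map p [1..<Suc n] ! k = lleaves z ! k" using k by (simp add: p_def)
  qed (simp add: len del: upt_Suc)
  have "bij_betw p {1..n} {1..n}"
  proof -
    have e: "set [1..<Suc n] = {1..n}" by auto
    have "inj_on p {1..n}" using z(2) e unfolding m[symmetric] by (simp add: distinct_map del: upt_Suc)
    moreover have "p ` {1..n} = {1..n}" using z(1) e unfolding m[symmetric] by (simp del: upt_Suc)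
    ultimately show ?thesis by (simp add: bij_betw_def)
  qed
  then have p: "p permutes {1..n}" by (rule bij_imp_permutes) (unfold p_def, rule if_not_P)
  show ?thesis
    by (rule that[OF permutes_inv[OF p]]) (simp only: permutes_inv_inv[OF p] m)
qed

lemma theta_unlab:
  assumes "Poly_Mapping.keys x \<subseteq> ltrees E n"
  shows "theta n (\<lambda>\<sigma>. if \<sigma> permutes {1..n} then unlab n \<sigma> x else 0) = x"
  using assms
proof (induction x rule: support_induct)
  case zero
  show ?case by (simp add: theta_def flin_zero[OF flin_unlab] lin_simps)
next
  case (basis c z)
  then obtain \<sigma> where \<sigma>: "\<sigma> permutes {1..n}" "lleaves z = map (inv \<sigma>) [1..<Suc n]" by (rule ltrees_lab)
  then have l: "size1 (lshape z) = n" using length_lleaves[of z] by (simp del: upt_Suc)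
  have "(\<lambda>\<rho>. if \<rho> permutes {1..n} then unlab n \<rho> (fsmul c (basis_vec z)) else 0)
      = sym_elem (fsmul c (basis_vec (lshape z))) \<sigma>"
  proof
    fix \<rho>
    have Xin: "sym_elem (basis_vec (lshape z)) \<sigma> \<in> sym_space UNIV n"
      using \<sigma>(1) l by (intro sym_elem_space) auto
    have "theta n (sym_elem (basis_vec (lshape z)) \<sigma>) = basis_vec z"
      using lab_lshape[of z "inv \<sigma>"] \<sigma>(2) l by (simp add: theta_elem[OF \<sigma>(1)] del: upt_Suc)
    with unlab_theta[OF Xin, of \<rho>]
    have "\<rho> permutes {1..n} \<Longrightarrow> unlab n \<rho> (basis_vec z) = sym_elem (basis_vec (lshape z)) \<sigma> \<rho>" by metis
    then show "(if \<rho> permutes {1..n} then unlab n \<rho> (fsmul c (basis_vec z)) else 0) = sym_elem (fsmul c (basis_vec (lshape z))) \<sigma> \<rho>"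
      using \<sigma>(1) by (auto simp: flin_scale[OF flin_unlab] sym_elem_def)
  qed
  then show ?case
    using lab_lshape[of z "inv \<sigma>"] \<sigma>(2) l by (simp add: theta_elem[OF \<sigma>(1)] lin_simps del: upt_Suc)
next
  case (add x y)
  have "(\<lambda>\<sigma>. if \<sigma> permutes {1..n} then unlab n \<sigma> (x + y) else 0)
    = (\<lambda>\<sigma>. if \<sigma> permutes {1..n} then unlab n \<sigma> x else 0) + (\<lambda>\<sigma>. if \<sigma> permutes {1..n} then unlab n \<sigma> y else 0)"
    by (auto simp: fun_eq_iff flin_add[OF flin_unlab])
  then show ?case using add by (simp add: theta_linear)
qed

text \<open>Grouping the pairs of permutations by their composite, as the symmetrised composition
  does, is undone by summing over all composites; each pair is then an instance of
  \<open>lab_graft\<close>.\<close>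

lemma theta_comp:
  fixes X Y :: "(nat \<Rightarrow> nat) \<Rightarrow> ('e tree \<Rightarrow>\<^sub>0 'k::field)"
  assumes "X \<in> sym_space E m" "Y \<in> sym_space E' n" "1 \<le> i" "i \<le> m"
  shows "theta (m + n - 1) (sym_comp m i n X Y) = bilin_ext (lsubst i n) (theta m X) (theta n Y)"
proof (cases "n = 0")
  case True
  \<comment> \<open>Every tree has a leaf, so arity 0 is zero. This case is split off because
    \<open>perm_comp\<close> is known to be a permutation for positive \<open>n\<close>
    only.\<close>
  have "Y \<sigma> = 0" for \<sigma>
  proof (cases "\<sigma> permutes {1..n}")
    case True
    then have "t \<notin> Poly_Mapping.keys (Y \<sigma>)" for t
      using assms(2) \<open>n = 0\<close> tree_space_keys(1)[of "Y \<sigma>" E' 0 t] by (auto simp: sym_space_iff size1_size)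
    then show ?thesis by (intro poly_mapping_eqI) (simp add: in_keys_iff)
  qed (use assms(2) in \<open>simp add: sym_space_iff\<close>)
  then have "Y = 0" by (simp add: fun_eq_iff)
  then show ?thesis by (simp add: sym_comp_linear) (simp add: theta_def lin_simps bilin_simps)
next
  case False
  then have n: "1 \<le> n" by simp
  let ?S = "\<lambda>m::nat. {\<sigma>. \<sigma> permutes {1..m}}" and ?N = "m + n - 1"
  let ?h = "\<lambda>\<sigma> \<rho>. bilin_ext (\<lambda>t u. graft t (\<sigma> i) u) (X \<sigma>) (Y \<rho>)"
  let ?f = "\<lambda>(\<sigma>, \<rho>). perm_comp m i n \<sigma> \<rho>"
  have eq: "{(\<sigma>, \<rho>). \<sigma> permutes {1..m} \<and> \<rho> permutes {1..n} \<and> perm_comp m i n \<sigma> \<rho> = \<pi>}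
     = {p \<in> ?S m \<times> ?S n. ?f p = \<pi>}" for \<pi> by auto
  have "theta ?N (sym_comp m i n X Y)
    = (\<Sum>\<pi>\<in>?S ?N. \<Sum>p\<in>{p \<in> ?S m \<times> ?S n. ?f p = \<pi>}. lin_ext (\<lambda>t. lab t (inv (?f p))) (case p of (\<sigma>, \<rho>) \<Rightarrow> ?h \<sigma> \<rho>))"
    unfolding theta_def
  proof (rule sum.cong[OF refl])
    fix \<pi> assume "\<pi> \<in> ?S ?N"
    then have "sym_comp m i n X Y \<pi> = (\<Sum>p\<in>{p \<in> ?S m \<times> ?S n. ?f p = \<pi>}. case p of (\<sigma>, \<rho>) \<Rightarrow> ?h \<sigma> \<rho>)"
      unfolding sym_comp_def eq[symmetric] by simp
    then have "lin_ext (\<lambda>t. lab t (inv \<pi>)) (sym_comp m i n X Y \<pi>)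
      = (\<Sum>p\<in>{p \<in> ?S m \<times> ?S n. ?f p = \<pi>}. lin_ext (\<lambda>t. lab t (inv \<pi>)) (case p of (\<sigma>, \<rho>) \<Rightarrow> ?h \<sigma> \<rho>))"
      by (simp only: flin_sum[OF flin_lin_ext])
    also have "\<dots> = (\<Sum>p\<in>{p \<in> ?S m \<times> ?S n. ?f p = \<pi>}. lin_ext (\<lambda>t. lab t (inv (?f p))) (case p of (\<sigma>, \<rho>) \<Rightarrow> ?h \<sigma> \<rho>))"
      by (rule sum.cong) auto
    finally show "lin_ext (\<lambda>t. lab t (inv \<pi>)) (sym_comp m i n X Y \<pi>)
      = (\<Sum>p\<in>{p \<in> ?S m \<times> ?S n. ?f p = \<pi>}. lin_ext (\<lambda>t. lab t (inv (?f p))) (case p of (\<sigma>, \<rho>) \<Rightarrow> ?h \<sigma> \<rho>))" .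
  qed
  \<comment> \<open>The fibres of \<open>?f\<close> over all permutations of the composite arity
    exhaust the pairs.\<close>
  also have "\<dots> = (\<Sum>p\<in>?S m \<times> ?S n. lin_ext (\<lambda>t. lab t (inv (?f p))) (case p of (\<sigma>, \<rho>) \<Rightarrow> ?h \<sigma> \<rho>))"
    by (rule sum.group)
      (use perm_comp_permutes(1)[OF _ _ assms(3,4) n] in \<open>auto simp: finite_permutations intro!: finite_cartesian_product\<close>)
  also have "\<dots> = (\<Sum>\<sigma>\<in>?S m. \<Sum>\<rho>\<in>?S n. lin_ext (\<lambda>t. lab t (inv (perm_comp m i n \<sigma> \<rho>))) (?h \<sigma> \<rho>))"
    by (simp add: sum.cartesian_product case_prod_beta)
  also have "\<dots> = (\<Sum>\<sigma>\<in>?S m. \<Sum>\<rho>\<in>?S n. bilin_ext (lsubst i n) (lin_ext (\<lambda>t. lab t (inv \<sigma>)) (X \<sigma>)) (lin_ext (\<lambda>t. lab t (inv \<rho>)) (Y \<rho>)))"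
  proof (intro sum.cong refl)
    fix \<sigma> \<rho> assume p: "\<sigma> \<in> ?S m" "\<rho> \<in> ?S n"
    show "lin_ext (\<lambda>t. lab t (inv (perm_comp m i n \<sigma> \<rho>))) (?h \<sigma> \<rho>)
      = bilin_ext (lsubst i n) (lin_ext (\<lambda>t. lab t (inv \<sigma>)) (X \<sigma>)) (lin_ext (\<lambda>t. lab t (inv \<rho>)) (Y \<rho>))"
    proof (rule bilin_eqI[where sc=fsmul
          and F="\<lambda>x y. lin_ext (\<lambda>t. lab t (inv (perm_comp m i n \<sigma> \<rho>))) (bilin_ext (\<lambda>t u. graft t (\<sigma> i) u) x y)"
          and G="\<lambda>x y. bilin_ext (lsubst i n) (lin_ext (\<lambda>t. lab t (inv \<sigma>)) x) (lin_ext (\<lambda>t. lab t (inv \<rho>)) y)"])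
      fix t u assume "t \<in> Poly_Mapping.keys (X \<sigma>)" "u \<in> Poly_Mapping.keys (Y \<rho>)"
      then have "size1 t = m" "size1 u = n"
        using assms(1,2) p by (auto simp: sym_space_iff dest: tree_space_keys)
      then show "lin_ext (\<lambda>t. lab t (inv (perm_comp m i n \<sigma> \<rho>))) (bilin_ext (\<lambda>t u. graft t (\<sigma> i) u) (basis_vec t) (basis_vec u))
        = bilin_ext (lsubst i n) (lin_ext (\<lambda>t. lab t (inv \<sigma>)) (basis_vec t)) (lin_ext (\<lambda>t. lab t (inv \<rho>)) (basis_vec u))"
        using lab_graft[of \<sigma> m \<rho> n i t u] p assms(3,4) by (simp only: lin_ext_basis bilin_ext_basis mem_Collect_eq)
    qed (simp_all add: flin_def lin_simps bilin_simps)
  qed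
  also have "\<dots> = bilin_ext (lsubst i n) (theta m X) (theta n Y)"
    by (simp add: theta_def flin_sum[OF flin_bilin_ext_left] flin_sum[OF flin_bilin_ext_right])
      (rule sum.swap)
  finally show ?thesis .
qed

text \<open>After reindexing by \<open>\<sigma> \<circ> \<rho>\<close>, inversion reverses the order
  of the factors, so \<open>inv \<rho>\<close> is applied last, that is, to the labels.\<close>

lemma theta_act:
  assumes "\<rho> permutes {1..n}"
  shows "theta n (sym_act \<rho> X) = lin_ext (lren (inv \<rho>)) (theta n X)"
proof -
  have b: "bij_betw (\<lambda>\<sigma>. \<sigma> \<circ> \<rho>) {\<sigma>. \<sigma> permutes {1..n}} {\<sigma>. \<sigma> permutes {1..n}}"
    using permutes_inverses[OF assms] permutes_compose[OF assms] permutes_compose[OF permutes_inv[OF assms]]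
    by (intro bij_betw_byWitness[where f'="\<lambda>\<sigma>. \<sigma> \<circ> inv \<rho>"]) (auto simp: fun_eq_iff)
  have "theta n (sym_act \<rho> X)
    = (\<Sum>\<sigma> | \<sigma> permutes {1..n}. lin_ext (\<lambda>t. lab t (inv (\<sigma> \<circ> \<rho>))) (sym_act \<rho> X (\<sigma> \<circ> \<rho>)))"
    unfolding theta_def by (rule sum.reindex_bij_betw[OF b, symmetric])
  also have "\<dots> = (\<Sum>\<sigma> | \<sigma> permutes {1..n}. lin_ext (lren (inv \<rho>)) (lin_ext (\<lambda>t. lab t (inv \<sigma>)) (X \<sigma>)))"
  proof (intro sum.cong refl)
    fix \<sigma> assume "\<sigma> \<in> {\<sigma>. \<sigma> permutes {1..n}}"
    then have \<sigma>: "bij \<sigma>" "bij \<rho>" using permutes_bij assms by auto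
    have "sym_act \<rho> X (\<sigma> \<circ> \<rho>) = X \<sigma>"
      using permutes_inverses[OF assms] by (auto simp: sym_act_def comp_def)
    moreover have "inv (\<sigma> \<circ> \<rho>) = inv \<rho> \<circ> inv \<sigma>" by (rule o_inv_distrib[OF \<sigma>])
    ultimately have e: "lin_ext (\<lambda>t. lab t (inv (\<sigma> \<circ> \<rho>))) (sym_act \<rho> X (\<sigma> \<circ> \<rho>)) = lin_ext (\<lambda>t. lren (inv \<rho>) (lab t (inv \<sigma>))) (X \<sigma>)"
      by (simp only: lren_lab comp_def)
    show "lin_ext (\<lambda>t. lab t (inv (\<sigma> \<circ> \<rho>))) (sym_act \<rho> X (\<sigma> \<circ> \<rho>)) = lin_ext (lren (inv \<rho>)) (lin_ext (\<lambda>t. lab t (inv \<sigma>)) (X \<sigma>))"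
      unfolding e
      by (rule flin_eqI[OF flin_lin_ext flin_comp[OF flin_lin_ext flin_lin_ext]]) (simp only: lin_ext_basis)
  qed
  also have "\<dots> = lin_ext (lren (inv \<rho>)) (theta n X)"
    by (simp add: theta_def flin_sum[OF flin_lin_ext])
  finally show ?thesis .
qed

section \<open>Splitting the generators of a symmetric operad\<close>

lemma bilin_ext_lin_ext:
  assumes "\<And>s t. s \<in> Poly_Mapping.keys x \<Longrightarrow> t \<in> Poly_Mapping.keys y \<Longrightarrow> g (a s) (b t) = c (g' s t)"
  shows "bilin_ext g (lin_ext a x) (lin_ext b y) = lin_ext c (bilin_ext g' x y)"
  by (rule bilin_eqI[where sc=fsmul and F="\<lambda>x y. bilin_ext g (lin_ext a x) (lin_ext b y)"
        and G="\<lambda>x y. lin_ext c (bilin_ext g' x y)"])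
    (simp_all add: flin_def lin_simps bilin_simps assms)

text \<open>Meant for forming a vertex and substituting into its left subtree. The condition on the
  keys of \<open>y\<close> expresses that the other subtree does not contain the label that is
  replaced.\<close>

lemma bilin_ext_trilinear_left:
  assumes "\<And>s t u. t \<in> Poly_Mapping.keys y \<Longrightarrow> g (a s u) (b t) = c (g' s t) u"
  shows "bilin_ext g (bilin_ext a x w) (lin_ext b y) = bilin_ext c (bilin_ext g' x y) w"
proof (rule flin_eqI[where sc=fsmul and f="\<lambda>x. bilin_ext g (bilin_ext a x w) (lin_ext b y)"
      and g="\<lambda>x. bilin_ext c (bilin_ext g' x y) w"])
  fix s
  show "bilin_ext g (bilin_ext a (basis_vec s) w) (lin_ext b y) = bilin_ext c (bilin_ext g' (basis_vec s) y) w"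
    by (rule bilin_eqI[where sc=fsmul and F="\<lambda>w y. bilin_ext g (bilin_ext a (basis_vec s) w) (lin_ext b y)"
          and G="\<lambda>w y. bilin_ext c (bilin_ext g' (basis_vec s) y) w"])
      (simp_all add: flin_def lin_simps bilin_simps assms)
qed (simp_all add: flin_def lin_simps bilin_simps)

lemma bilin_ext_trilinear_right:
  assumes "\<And>s t u. s \<in> Poly_Mapping.keys x \<Longrightarrow> g (b s) (a t u) = c (g' s t) u"
  shows "bilin_ext g (lin_ext b x) (bilin_ext a y w) = bilin_ext c (bilin_ext g' x y) w"
proof (rule flin_eqI[where sc=fsmul and f="\<lambda>x. bilin_ext g (lin_ext b x) (bilin_ext a y w)"
      and g="\<lambda>x. bilin_ext c (bilin_ext g' x y) w"])
  fix s assume s: "s \<in> Poly_Mapping.keys x"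
  show "bilin_ext g (lin_ext b (basis_vec s)) (bilin_ext a y w) = bilin_ext c (bilin_ext g' (basis_vec s) y) w"
    by (rule bilin_eqI[where sc=fsmul and F="\<lambda>w y. bilin_ext g (lin_ext b (basis_vec s)) (bilin_ext a y w)"
          and G="\<lambda>w y. bilin_ext c (bilin_ext g' (basis_vec s) y) w"])
      (simp_all add: flin_def lin_simps bilin_simps assms[OF s])
qed (simp_all add: flin_def lin_simps bilin_simps)

text \<open>
  If every generator is \<open>e = \<gamma> (p1 e) + (\<gamma> (p2 e)) \<cdot> (1 2)\<close>, a tree becomes a sum of trees with labels
  from the image of \<open>\<gamma>\<close>: at each vertex one keeps the label \<open>p1 e\<close>, or exchanges the two subtrees and
  takes the label \<open>p2 e\<close>. The case distinction makes this exact on trees over the image of \<open>\<gamma>\<close>, since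
  a vertex labelled \<open>0\<close> is not yet \<open>0\<close> in the free operad on the set of labels.
\<close>

primrec split_tree :: "('e \<Rightarrow> 'a::zero) \<Rightarrow> ('e \<Rightarrow> 'a) \<Rightarrow> 'e ltree \<Rightarrow> ('a ltree \<Rightarrow>\<^sub>0 'k::field)" where
  "split_tree p1 p2 (Lf k) = basis_vec (Lf k)"
| "split_tree p1 p2 (Nd l e r) =
     bilin_ext (\<lambda>x y. Nd x (p1 e) y) (split_tree p1 p2 l) (split_tree p1 p2 r) +
     (if p2 e = 0 then 0 else bilin_ext (\<lambda>x y. Nd y (p2 e) x) (split_tree p1 p2 l) (split_tree p1 p2 r))"

lemma split_tree_lren:
  "(split_tree p1 p2 (lren f z) :: _ \<Rightarrow>\<^sub>0 'k::field) = lin_ext (lren f) (split_tree p1 p2 z)"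
proof (induction z)
  case (Nd l e r)
  have "bilin_ext (\<lambda>x y. Nd x (p1 e) y) (lin_ext (lren f) x) (lin_ext (lren f) y)
      = lin_ext (lren f) (bilin_ext (\<lambda>x y. Nd x (p1 e) y) x y)"
    "bilin_ext (\<lambda>x y. Nd y (p2 e) x) (lin_ext (lren f) x) (lin_ext (lren f) y)
      = lin_ext (lren f) (bilin_ext (\<lambda>x y. Nd y (p2 e) x) x y)" for x y :: "_ \<Rightarrow>\<^sub>0 'k"
    by (rule bilin_ext_lin_ext, simp)+
  then show ?case by (simp add: Nd lin_simps)
qed simp

text \<open>Exchanging subtrees permutes the leaves, so the multiset of labels is what remains
  invariant.\<close>

lemma keys_split_tree:
  assumes "\<And>e. e \<in> E \<Longrightarrow> p1 e \<in> A" "\<And>e. e \<in> E \<Longrightarrow> p2 e \<in> A" "set_tree (lshape z) \<subseteq> E"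
  shows "Poly_Mapping.keys (split_tree p1 p2 z :: _ \<Rightarrow>\<^sub>0 'k::field)
    \<subseteq> {y. mset (lleaves y) = mset (lleaves z) \<and> set_tree (lshape y) \<subseteq> A}"
  using assms(3)
proof (induction z)
  case (Nd l e r)
  have e: "p1 e \<in> A" "p2 e \<in> A" using Nd.prems assms(1,2) by auto
  let ?K = "\<lambda>z. {y. mset (lleaves y) = mset (lleaves z) \<and> set_tree (lshape y) \<subseteq> A}"
  have IH: "Poly_Mapping.keys (split_tree p1 p2 l :: _ \<Rightarrow>\<^sub>0 'k) \<subseteq> ?K l" "Poly_Mapping.keys (split_tree p1 p2 r :: _ \<Rightarrow>\<^sub>0 'k) \<subseteq> ?K r"
    using Nd by auto
  have "Poly_Mapping.keys (bilin_ext (\<lambda>x y. Nd x (p1 e) y) (split_tree p1 p2 l) (split_tree p1 p2 r) :: _ \<Rightarrow>\<^sub>0 'k) \<subseteq> ?K (Nd l e r)"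
    "Poly_Mapping.keys (bilin_ext (\<lambda>x y. Nd y (p2 e) x) (split_tree p1 p2 l) (split_tree p1 p2 r) :: _ \<Rightarrow>\<^sub>0 'k) \<subseteq> ?K (Nd l e r)"
    by (rule keys_bilin_ext, use IH e in fastforce)+
  then show ?case by (simp add: keys_add_subset)
qed simp

text \<open>With distinct labels the substitution takes place in exactly one subtree of each vertex
  and merely shifts labels in the other. Keeping or exchanging the subtrees commutes with
  both.\<close>

lemma split_tree_lsubst:
  assumes "distinct (lleaves z)" "i \<in> set (lleaves z)"
  shows "(split_tree p1 p2 (lsubst i n z w) :: _ \<Rightarrow>\<^sub>0 'k::field) = bilin_ext (lsubst i n) (split_tree p1 p2 z) (split_tree p1 p2 w)"
  using assms
proof (induction z)
  case (Lf k)
  then show ?case by (auto simp: split_tree_lren bilin_ext_basis_left intro: lin_ext_cong)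
next
  case (Nd l e r)
  let ?d = "split_tree p1 p2 :: _ \<Rightarrow> _ \<Rightarrow>\<^sub>0 'k"
  have notin: "i \<notin> set (lleaves y)"
    if "y \<in> Poly_Mapping.keys (?d z)" "i \<notin> set (lleaves z)" for y z
    using that keys_split_tree[of UNIV p1 UNIV p2 z] mset_eq_setD[of "lleaves y" "lleaves z"] by auto
  show ?case
  proof (cases "i \<in> set (lleaves l)")
    case True
    then have r: "i \<notin> set (lleaves r)" using Nd.prems(1) by auto
    have IH: "?d (lsubst i n l w) = bilin_ext (lsubst i n) (?d l) (?d w)" using Nd True by auto
    have "bilin_ext (\<lambda>x y. Nd x (p1 e) y) (bilin_ext (lsubst i n) (?d l) (?d w)) (lin_ext (lren (lshift i n)) (?d r))
        = bilin_ext (lsubst i n) (bilin_ext (\<lambda>x y. Nd x (p1 e) y) (?d l) (?d r)) (?d w)"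
      "bilin_ext (\<lambda>x y. Nd y (p2 e) x) (bilin_ext (lsubst i n) (?d l) (?d w)) (lin_ext (lren (lshift i n)) (?d r))
        = bilin_ext (lsubst i n) (bilin_ext (\<lambda>x y. Nd y (p2 e) x) (?d l) (?d r)) (?d w)"
      by (rule bilin_ext_trilinear_left, simp add: notin[OF _ r] lsubst_notin)+
    then show ?thesis by (simp add: IH lsubst_notin[OF r] split_tree_lren bilin_simps)
  next
    case False
    then have IH: "?d (lsubst i n r w) = bilin_ext (lsubst i n) (?d r) (?d w)" using Nd by auto
    have "bilin_ext (\<lambda>x y. Nd x (p1 e) y) (lin_ext (lren (lshift i n)) (?d l)) (bilin_ext (lsubst i n) (?d r) (?d w))
        = bilin_ext (lsubst i n) (bilin_ext (\<lambda>x y. Nd x (p1 e) y) (?d l) (?d r)) (?d w)"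
      "bilin_ext (\<lambda>x y. Nd y (p2 e) x) (lin_ext (lren (lshift i n)) (?d l)) (bilin_ext (lsubst i n) (?d r) (?d w))
        = bilin_ext (lsubst i n) (bilin_ext (\<lambda>x y. Nd y (p2 e) x) (?d l) (?d r)) (?d w)"
      by (rule bilin_ext_trilinear_right, simp add: notin[OF _ False] lsubst_notin)+
    then show ?thesis by (simp add: IH lsubst_notin[OF False] split_tree_lren bilin_simps)
  qed
qed

definition split_lin :: "('e \<Rightarrow> 'a::zero) \<Rightarrow> ('e \<Rightarrow> 'a) \<Rightarrow> ('e ltree \<Rightarrow>\<^sub>0 'k::field) \<Rightarrow> ('a ltree \<Rightarrow>\<^sub>0 'k)" where
  "split_lin p1 p2 = lext fsmul (split_tree p1 p2)"

lemma flin_split_lin: "flin fsmul (split_lin p1 p2)"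
  unfolding split_lin_def by (rule flin_lext[OF vector_space_fsmul])

lemma split_lin_basis: "split_lin p1 p2 (basis_vec z) = split_tree p1 p2 z"
  unfolding split_lin_def by (rule lext_basis[OF vector_space_fsmul])

lemmas split_lin_simps = flin_add[OF flin_split_lin] flin_diff[OF flin_split_lin] flin_scale[OF flin_split_lin]
  flin_zero[OF flin_split_lin] split_lin_basis

lemma split_lin_lsubst:
  assumes "Poly_Mapping.keys x \<subseteq> {z. distinct (lleaves z) \<and> i \<in> set (lleaves z)}"
  shows "split_lin p1 p2 (bilin_ext (lsubst i n) x y) = bilin_ext (lsubst i n) (split_lin p1 p2 x) (split_lin p1 p2 y)"
  by (rule bilin_eqI[where sc=fsmul and F="\<lambda>x y. split_lin p1 p2 (bilin_ext (lsubst i n) x y)"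
        and G="\<lambda>x y. bilin_ext (lsubst i n) (split_lin p1 p2 x) (split_lin p1 p2 y)"])
    (use assms in \<open>auto simp: flin_def split_lin_simps bilin_simps split_tree_lsubst\<close>)

lemma split_lin_lren: "split_lin p1 p2 (lin_ext (lren f) x) = lin_ext (lren f) (split_lin p1 p2 x)"
  by (rule flin_eqI[OF flin_comp[OF flin_lin_ext flin_split_lin] flin_comp[OF flin_split_lin flin_lin_ext]])
    (simp add: split_lin_basis split_tree_lren)

lemma keys_split_lin:
  fixes x :: "'e ltree \<Rightarrow>\<^sub>0 'k::field"
  assumes "\<And>e. e \<in> E \<Longrightarrow> p1 e \<in> A" "\<And>e. e \<in> E \<Longrightarrow> p2 e \<in> A" "Poly_Mapping.keys x \<subseteq> ltrees E n"
  shows "Poly_Mapping.keys (split_lin p1 p2 x) \<subseteq> ltrees A n"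
  unfolding split_lin_def
proof (rule keys_lext_fsmul)
  fix z assume "z \<in> Poly_Mapping.keys x"
  then have z: "z \<in> ltrees E n" using assms(3) by blast
  then have k: "Poly_Mapping.keys (split_tree p1 p2 z :: _ \<Rightarrow>\<^sub>0 'k)
    \<subseteq> {y. mset (lleaves y) = mset (lleaves z) \<and> set_tree (lshape y) \<subseteq> A}"
    using assms(1,2) by (intro keys_split_tree[where E=E]) (auto simp: ltrees_def)
  show "Poly_Mapping.keys (split_tree p1 p2 z :: _ \<Rightarrow>\<^sub>0 'k) \<subseteq> ltrees A n"
  proof
    fix y assume "y \<in> Poly_Mapping.keys (split_tree p1 p2 z :: _ \<Rightarrow>\<^sub>0 'k)"
    then have y: "mset (lleaves y) = mset (lleaves z)" "set_tree (lshape y) \<subseteq> A" using k by auto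
    then show "y \<in> ltrees A n"
      using z mset_eq_setD[OF y(1)] mset_eq_imp_distinct_iff[OF y(1)] by (simp add: ltrees_def)
  qed
qed

text \<open>On labels from the image of \<gamma> the second coordinate is 0 at each vertex, so
  nothing is exchanged and a single tree results.\<close>

lemma split_tree_lab:
  assumes "\<And>a. a \<in> set_tree t \<Longrightarrow> p1 (\<gamma> a) = a \<and> p2 (\<gamma> a) = 0"
  shows "split_tree p1 p2 (lab (map_tree \<gamma> t) p) = basis_vec (lab t p)"
  using assms
proof (induction t arbitrary: p)
  case (Node l a r)
  have "size1 (map_tree \<gamma> l) = size1 l" by (simp add: size1_size)
  then show ?case using Node by simp
qed simp

text \<open>\<open>split_lin\<close> transported along \<open>theta\<close>: exchanging subtrees
  mixes the components of a family, which is simple to express on labelled trees only.\<close>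

definition sym_split :: "('e \<Rightarrow> 'a::zero) \<Rightarrow> ('e \<Rightarrow> 'a) \<Rightarrow> nat
    \<Rightarrow> ((nat \<Rightarrow> nat) \<Rightarrow> ('e tree \<Rightarrow>\<^sub>0 'k::field)) \<Rightarrow> (nat \<Rightarrow> nat) \<Rightarrow> ('a tree \<Rightarrow>\<^sub>0 'k)" where
  "sym_split p1 p2 n X = (\<lambda>\<sigma>. if \<sigma> permutes {1..n} then unlab n \<sigma> (split_lin p1 p2 (theta n X)) else 0)"

definition relab :: "('a \<Rightarrow> 'e) \<Rightarrow> ('a tree \<Rightarrow>\<^sub>0 'k::field) \<Rightarrow> ('e tree \<Rightarrow>\<^sub>0 'k)" where
  "relab \<gamma> = lin_ext (map_tree \<gamma>)"

lemma flin_relab: "flin fsmul (relab \<gamma>)"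
  unfolding relab_def by (rule flin_lin_ext)

lemmas relab_simps = flin_add[OF flin_relab] flin_diff[OF flin_relab] flin_scale[OF flin_relab]
  flin_zero[OF flin_relab]

lemma relab_basis [simp]: "relab \<gamma> (basis_vec t) = basis_vec (map_tree \<gamma> t)"
  by (simp add: relab_def)

lemma map_tree_graft: "map_tree f (graft t i u) = graft (map_tree f t) i (map_tree f u)"
  by (induction t arbitrary: i) auto

lemma relab_space:
  assumes "x \<in> tree_space A n" "\<And>a. a \<in> A \<Longrightarrow> \<gamma> a \<in> E" shows "relab \<gamma> x \<in> tree_space E n"
  unfolding relab_def tree_space_def mem_Collect_eq
proof (rule keys_lin_ext)
  fix t assume "t \<in> Poly_Mapping.keys x"
  then have "size1 t = n" "set_tree t \<subseteq> A" using tree_space_keys[OF assms(1)] by blast+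
  then show "map_tree \<gamma> t \<in> {t. size1 t = n \<and> set_tree t \<subseteq> E}"
    using assms(2) by (auto simp: tree.set_map)
qed

lemma relab_comp:
  "relab \<gamma> (bilin_ext (\<lambda>t u. graft t i u) x y) = bilin_ext (\<lambda>t u. graft t i u) (relab \<gamma> x) (relab \<gamma> y)"
  unfolding relab_def by (rule bilin_ext_lin_ext[symmetric]) (simp add: map_tree_graft)

definition sym_relab :: "('a \<Rightarrow> 'e) \<Rightarrow> ((nat \<Rightarrow> nat) \<Rightarrow> ('a tree \<Rightarrow>\<^sub>0 'k::field)) \<Rightarrow> (nat \<Rightarrow> nat) \<Rightarrow> ('e tree \<Rightarrow>\<^sub>0 'k)" where
  "sym_relab \<gamma> X = (\<lambda>\<sigma>. relab \<gamma> (X \<sigma>))"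

lemma sym_relab_linear:
  "sym_relab \<gamma> (X + Y) = sym_relab \<gamma> X + sym_relab \<gamma> Y" "sym_relab \<gamma> (X - Y) = sym_relab \<gamma> X - sym_relab \<gamma> Y"
  "sym_relab \<gamma> (sym_scale c X) = sym_scale c (sym_relab \<gamma> X)" "sym_relab \<gamma> 0 = 0"
  by (auto simp: sym_relab_def sym_scale_def fun_eq_iff relab_simps)

lemma sym_relab_elem: "sym_relab \<gamma> (sym_elem x \<sigma>) = sym_elem (relab \<gamma> x) \<sigma>"
  by (auto simp: sym_relab_def sym_elem_def fun_eq_iff relab_simps)

lemma sym_relab_act: "sym_relab \<gamma> (sym_act \<rho> X) = sym_act \<rho> (sym_relab \<gamma> X)"
  by (simp add: sym_relab_def sym_act_def)

lemma sym_relab_comp: "sym_relab \<gamma> (sym_comp m i n X Y) = sym_comp m i n (sym_relab \<gamma> X) (sym_relab \<gamma> Y)"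
  by (auto simp: sym_relab_def sym_comp_def fun_eq_iff relab_simps flin_sum[OF flin_relab] relab_comp case_prod_beta)

lemma sym_relab_space:
  "X \<in> sym_space A n \<Longrightarrow> (\<And>a. a \<in> A \<Longrightarrow> \<gamma> a \<in> E) \<Longrightarrow> sym_relab \<gamma> X \<in> sym_space E n"
  by (auto simp: sym_space_iff sym_relab_def relab_simps intro: relab_space)

section \<open>Ideals of symmetric presented operads\<close>

text \<open>Besides \<open>R\<close>, the generators make corollas linear and identify \<tau> with
  the exchange of the two inputs.\<close>

definition sym_pres_ideal ::
  "('k::field \<Rightarrow> 'e::ab_group_add \<Rightarrow> 'e) \<Rightarrow> 'e set \<Rightarrow> ('e \<Rightarrow> 'e)
     \<Rightarrow> ((nat \<Rightarrow> nat) \<Rightarrow> ('e tree \<Rightarrow>\<^sub>0 'k)) set \<Rightarrow> nat \<Rightarrow> ((nat \<Rightarrow> nat) \<Rightarrow> ('e tree \<Rightarrow>\<^sub>0 'k)) set" where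
  "sym_pres_ideal s E \<tau> R n = {X. (n, X) \<in> sym_ideal (sym_operad (tree_operad E))
          (\<lambda>n. if n = 2
               then {sym_elem x id | x. x \<in> corolla_lin_rels s E} \<union>
                    {sym_elem (basis_vec (corolla (\<tau> e))) id
                       - sym_elem (basis_vec (corolla e)) (Transposition.transpose 1 2) | e. e \<in> E}
               else if n = 3 then R else {})}"

locale sym_data =
  fixes s :: "'k::field \<Rightarrow> 'e::ab_group_add \<Rightarrow> 'e" and E :: "'e set" and \<tau> :: "'e \<Rightarrow> 'e"
  assumes vs: "vector_space s" and sub: "module.subspace s E" and tau: "linear_map_on s E s E \<tau>"
begin

sublocale E: vector_space s by (rule vs)

lemma mod: "module s" by (rule E.module_axioms)

lemma tau_in: "e \<in> E \<Longrightarrow> \<tau> e \<in> E"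
  and tau_add: "a \<in> E \<Longrightarrow> b \<in> E \<Longrightarrow> \<tau> (a + b) = \<tau> a + \<tau> b"
  and tau_scale: "a \<in> E \<Longrightarrow> \<tau> (s c a) = s c (\<tau> a)"
  using tau by (auto simp: linear_map_on_def)

abbreviation "SI \<equiv> sym_pres_ideal s E \<tau>"
abbreviation "swap \<equiv> Transposition.transpose (1::nat) 2"

lemma swap_permutes: "swap permutes {1..2}" by (rule permutes_swap_id) auto

lemma SI_lin: "x \<in> corolla_lin_rels s E \<Longrightarrow> sym_elem x id \<in> SI R 2"
  unfolding sym_pres_ideal_def by (auto intro!: sym_ideal.intros(1))

lemma SI_equiv: "e \<in> E \<Longrightarrow> sym_elem (basis_vec (corolla (\<tau> e))) id - sym_elem (basis_vec (corolla e)) swap \<in> SI R 2"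
  unfolding sym_pres_ideal_def by (auto intro!: sym_ideal.intros(1))

lemma SI_rel: "X \<in> R \<Longrightarrow> X \<in> SI R 3"
  unfolding sym_pres_ideal_def by (auto intro!: sym_ideal.intros(1))

lemma SI_zero: "0 \<in> SI R n"
  using sym_ideal.intros(2)[of n "sym_operad (tree_operad E)"] by (simp add: sym_pres_ideal_def sym_operad_simps)

lemma SI_add: "X \<in> SI R n \<Longrightarrow> Y \<in> SI R n \<Longrightarrow> X + Y \<in> SI R n"
  by (simp add: sym_pres_ideal_def sym_ideal.intros(3))

lemma SI_comp_left:
  assumes "X \<in> SI R m" "Y \<in> sym_space E n" "1 \<le> i" "i \<le> m" shows "sym_comp m i n X Y \<in> SI R (m + n - 1)"
  using sym_ideal.intros(5)[of m X "sym_operad (tree_operad E)" _ Y n i] assms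
  by (simp add: sym_pres_ideal_def sym_operad_simps)

lemma SI_comp_right:
  assumes "X \<in> sym_space E m" "Y \<in> SI R n" "1 \<le> i" "i \<le> m" shows "sym_comp m i n X Y \<in> SI R (m + n - 1)"
  using sym_ideal.intros(6)[of X "sym_operad (tree_operad E)" m n Y _ i] assms
  by (simp add: sym_pres_ideal_def sym_operad_simps)

lemma SI_act: "X \<in> SI R n \<Longrightarrow> \<sigma> permutes {1..n} \<Longrightarrow> sym_act \<sigma> X \<in> SI R n"
  using sym_ideal.intros(7)[of n X "sym_operad (tree_operad E)" _ \<sigma>]
  by (simp add: sym_pres_ideal_def sym_operad_simps)

text \<open>Membership in \<open>sym_space\<close> is carried along, since the operad's scaling is
  \<open>sym_scale\<close> only there and the splitting is a morphism only there.\<close>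

lemma SI_induct [consumes 2, case_names lin equiv rel zero add scale left right act]:
  assumes "X \<in> SI R n" and R: "R \<subseteq> sym_space E 3"
    and "\<And>x. x \<in> corolla_lin_rels s E \<Longrightarrow> P 2 (sym_elem x id)"
    and "\<And>e. e \<in> E \<Longrightarrow> P 2 (sym_elem (basis_vec (corolla (\<tau> e))) id - sym_elem (basis_vec (corolla e)) swap)"
    and "\<And>X. X \<in> R \<Longrightarrow> P 3 X"
    and "\<And>n. P n 0"
    and "\<And>n X Y. P n X \<Longrightarrow> P n Y \<Longrightarrow> P n (X + Y)"
    and "\<And>n c X. P n X \<Longrightarrow> X \<in> sym_space E n \<Longrightarrow> P n (sym_scale c X)"
    and "\<And>m n i X Y. P m X \<Longrightarrow> X \<in> sym_space E m \<Longrightarrow> Y \<in> sym_space E n \<Longrightarrow> 1 \<le> i \<Longrightarrow> i \<le> m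
      \<Longrightarrow> P (m + n - 1) (sym_comp m i n X Y)"
    and "\<And>m n i X Y. X \<in> sym_space E m \<Longrightarrow> P n Y \<Longrightarrow> Y \<in> sym_space E n \<Longrightarrow> 1 \<le> i \<Longrightarrow> i \<le> m
      \<Longrightarrow> P (m + n - 1) (sym_comp m i n X Y)"
    and "\<And>n \<sigma> X. P n X \<Longrightarrow> X \<in> sym_space E n \<Longrightarrow> \<sigma> permutes {1..n} \<Longrightarrow> P n (sym_act \<sigma> X)"
  shows "X \<in> sym_space E n \<and> P n X"
proof -
  have l: "x \<in> tree_space E 2" if "x \<in> corolla_lin_rels s E" for x
    using corolla_lin_rels_space[OF mod sub] that by auto
  have "(n, X) \<in> sym_ideal (sym_operad (tree_operad E))
          (\<lambda>n. if n = 2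
               then {sym_elem x id | x. x \<in> corolla_lin_rels s E} \<union>
                    {sym_elem (basis_vec (corolla (\<tau> e))) id
                       - sym_elem (basis_vec (corolla e)) swap | e. e \<in> E}
               else if n = 3 then R else {})"
    using assms(1) by (simp add: sym_pres_ideal_def)
  then show ?thesis
  proof (induction rule: sym_ideal.induct)
    case (1 X n)
    then consider (a) x where "n = 2" "X = sym_elem x id" "x \<in> corolla_lin_rels s E"
      | (b) e where "n = 2" "X = sym_elem (basis_vec (corolla (\<tau> e))) id - sym_elem (basis_vec (corolla e)) swap" "e \<in> E"
      | (c) "n = 3" "X \<in> R"
      by (auto split: if_splits)
    then show ?case
    proof cases
      case a
      then show ?thesis using assms(3) l by (auto intro!: sym_elem_space permutes_id)
    next
      case b
      have "basis_vec (corolla (\<tau> e)) \<in> tree_space E 2" "basis_vec (corolla e) \<in> tree_space E 2"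
        using b tau_in by auto
      then have "sym_elem (basis_vec (corolla (\<tau> e))) id - sym_elem (basis_vec (corolla e)) swap \<in> sym_space E 2"
        by (intro sym_space_closed(3) sym_elem_space permutes_id swap_permutes)
      then show ?thesis using assms(4)[OF b(3)] unfolding b(1,2) by (rule conjI)
    next
      case c
      then show ?thesis using assms(5) R by auto
    qed
  next
    case (4 n x c)
    then show ?case using assms(8) by (simp add: sym_operad_simps sym_space_closed)
  next
    case (5 m x y n i)
    then show ?case using assms(9) by (simp add: sym_operad_simps sym_comp_space del: One_nat_def)
  next
    case (6 x m n y i)
    then show ?case using assms(10) by (simp add: sym_operad_simps sym_comp_space del: One_nat_def)
  next
    case (7 n x \<sigma>)
    then show ?case using assms(11) by (simp add: sym_operad_simps sym_act_space)
  next
    case (2 n)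
    show ?case unfolding sym_operad_simps using assms(6) sym_space_closed(1) by (intro conjI)
  next
    case (3 n x y)
    then show ?case by (intro conjI sym_space_closed(2) assms(7)) (elim conjE, assumption)+
  qed
qed

lemma SI_space:
  assumes "R \<subseteq> sym_space E 3" "X \<in> SI R n" shows "X \<in> sym_space E n"
  using SI_induct[OF assms(2,1), where P="\<lambda>_ _. True"] by simp

lemma SI_scale:
  assumes "R \<subseteq> sym_space E 3" "X \<in> SI R n" shows "sym_scale c X \<in> SI R n"
  using sym_ideal.intros(4)[of n X "sym_operad (tree_operad E)" _ c] assms(2) SI_space[OF assms]
  by (simp add: sym_pres_ideal_def sym_operad_simps)

lemma add_sub_SI:
  assumes "R \<subseteq> sym_space E 3" shows "add_sub (SI R n)"
  unfolding add_sub_def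
proof (intro conjI ballI SI_zero)
  fix X Y assume "X \<in> SI R n" "Y \<in> SI R n"
  then have "X + sym_scale (- 1) Y \<in> SI R n" by (intro SI_add SI_scale assms)
  moreover have "X + sym_scale (- 1) Y = X - Y" by (simp add: sym_scale_def fun_eq_iff)
  ultimately show "X - Y \<in> SI R n" by simp
qed

lemma SI_sum: "(\<And>i. i \<in> I \<Longrightarrow> f i \<in> SI R n) \<Longrightarrow> sum f I \<in> SI R n"
  by (induction I rule: infinite_finite_induct) (simp_all add: SI_zero SI_add)

end

lemma sym_isomorphicI:
  assumes "ns_operad_iso P Q \<phi>"
    "\<And>n \<sigma> x. \<sigma> permutes {1..n} \<Longrightarrow> x \<in> op_space P n \<Longrightarrow> \<phi> n (op_act P n \<sigma> x) = op_act Q n \<sigma> (\<phi> n x)"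
  shows "sym_isomorphic P Q"
  using assms unfolding sym_isomorphic_def by blast

lemma sym_presented_simps:
  fixes s :: "'k::field \<Rightarrow> 'e::ab_group_add \<Rightarrow> 'e" and E \<tau> R
  defines "P \<equiv> sym_presented s E \<tau> R" and "J \<equiv> sym_pres_ideal s E \<tau> R"
  shows "op_space P n = (\<lambda>X. X +o J n) ` sym_space E n"
    "op_scale P n c C = op_scale (sym_operad (tree_operad E)) n c ` C + J n"
    "op_comp P m i n C C' = {sym_comp m i n X Y | X Y. X \<in> C \<and> Y \<in> C'} + J (m + n - 1)"
    "op_unit P = sym_elem (basis_vec \<langle>\<rangle>) id +o J 1"
    "op_act P n \<sigma> C = sym_act \<sigma> ` C"
  by (simp_all add: P_def J_def sym_presented_def sym_quotient_def ns_quotient_def ns_operad.defs operad.defs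
      sym_operad_simps sym_pres_ideal_def image_def)

lemma ns_presented_simps:
  fixes s :: "'k::field \<Rightarrow> 'e::ab_group_add \<Rightarrow> 'e" and E R
  defines "P \<equiv> ns_presented s E R" and "J \<equiv> pres_ideal s E R"
  shows "op_space P n = (\<lambda>x. x +o J n) ` tree_space E n"
    "op_zero P n = J n"
    "op_scale P n c C = fsmul c ` C + J n"
    "op_comp P m i n C C' = {bilin_ext (\<lambda>t u. graft t i u) x y | x y. x \<in> C \<and> y \<in> C'} + J (m + n - 1)"
    "op_unit P = basis_vec \<langle>\<rangle> +o J 1"
  by (simp_all add: P_def J_def ns_presented_def ns_quotient_def pres_ideal_def)

lemma corolla_lin_relsI:
  "a \<in> E \<Longrightarrow> b \<in> E \<Longrightarrow> basis_vec (corolla (a + b)) - basis_vec (corolla a) - basis_vec (corolla b) \<in> corolla_lin_rels s E"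
  "a \<in> E \<Longrightarrow> basis_vec (corolla (s c a)) - fsmul c (basis_vec (corolla a)) \<in> corolla_lin_rels s E"
  unfolding corolla_lin_rels_def by blast+

lemma permutes_2_cases:
  assumes "\<sigma> permutes {1..2::nat}" obtains "\<sigma> = id" | "\<sigma> = Transposition.transpose 1 2"
proof -
  have 1: "{1..2::nat} = {1, 2}" by auto
  have s: "\<sigma> 1 = 1 \<or> \<sigma> 1 = 2" "\<sigma> 2 = 1 \<or> \<sigma> 2 = 2" "\<sigma> 1 \<noteq> \<sigma> 2"
    using permutes_in_image[OF assms, of 1] permutes_in_image[OF assms, of 2]
      inj_eq[OF permutes_inj[OF assms], of 1 2] by auto
  have o: "\<sigma> k = k" if "k \<noteq> 1" "k \<noteq> 2" for k
    using permutes_not_in[OF assms, of k] that unfolding 1 by simp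
  show ?thesis
  proof (cases "\<sigma> 1 = 1")
    case True
    then have "\<sigma> 2 = 2" using s by auto
    then have "\<sigma> = id" using True o by (metis (no_types) eq_id_iff)
    then show ?thesis using that by blast
  next
    case False
    then have "\<sigma> 1 = 2" "\<sigma> 2 = 1" using s by auto
    then have "\<sigma> k = Transposition.transpose 1 2 k" for k
      using o[of k] by (cases "k = 1"; cases "k = 2") auto
    then show ?thesis using that by blast
  qed
qed

section \<open>Presented operads whose generators split\<close>

lemma add_diff_add_eq: "(a + b) - (c + d) = (a - c) + (b - d :: 'v::ab_group_add)"
  by (simp add: algebra_simps)

text \<open>\<open>E\<close> is the representation of the symmetric group on two letters induced
  from \<open>A\<close>, namely the direct sum of \<open>\<gamma> A\<close> and
  \<open>\<tau> (\<gamma> A)\<close>; \<open>p1\<close> and \<open>p2\<close> are the coordinates,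
  which \<tau> exchanges.\<close>

locale split_data = sym_data t E \<tau>
  for t :: "'k::field \<Rightarrow> 'e::ab_group_add \<Rightarrow> 'e" and E :: "'e set" and \<tau> :: "'e \<Rightarrow> 'e" +
  fixes s :: "'k \<Rightarrow> 'a::ab_group_add \<Rightarrow> 'a" and A :: "'a set"
    and \<gamma> :: "'a \<Rightarrow> 'e" and p1 p2 :: "'e \<Rightarrow> 'a"
  assumes vsA: "vector_space s" and subA: "module.subspace s A"
    and gam: "linear_map_on s A t E \<gamma>" and p1: "linear_map_on t E s A p1" and p2: "linear_map_on t E s A p2"
    and p1_gam: "a \<in> A \<Longrightarrow> p1 (\<gamma> a) = a" and p2_gam: "a \<in> A \<Longrightarrow> p2 (\<gamma> a) = 0"
    and p1_tau: "e \<in> E \<Longrightarrow> p1 (\<tau> e) = p2 e" and p2_tau: "e \<in> E \<Longrightarrow> p2 (\<tau> e) = p1 e"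
    and decomp: "e \<in> E \<Longrightarrow> \<gamma> (p1 e) + \<tau> (\<gamma> (p2 e)) = e"
begin

sublocale A: vector_space s by (rule vsA)

lemma modA: "module s" by (rule A.module_axioms)

lemma maps: "a \<in> A \<Longrightarrow> \<gamma> a \<in> E" "e \<in> E \<Longrightarrow> p1 e \<in> A" "e \<in> E \<Longrightarrow> p2 e \<in> A"
  using gam p1 p2 by (auto simp: linear_map_on_def)

lemma maps_add: "a \<in> A \<Longrightarrow> b \<in> A \<Longrightarrow> \<gamma> (a + b) = \<gamma> a + \<gamma> b"
  "e \<in> E \<Longrightarrow> e' \<in> E \<Longrightarrow> p1 (e + e') = p1 e + p1 e'" "e \<in> E \<Longrightarrow> e' \<in> E \<Longrightarrow> p2 (e + e') = p2 e + p2 e'"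
  using gam p1 p2 by (auto simp: linear_map_on_def)

lemma maps_scale: "a \<in> A \<Longrightarrow> \<gamma> (s c a) = t c (\<gamma> a)"
  "e \<in> E \<Longrightarrow> p1 (t c e) = s c (p1 e)" "e \<in> E \<Longrightarrow> p2 (t c e) = s c (p2 e)"
  using gam p1 p2 by (auto simp: linear_map_on_def)

abbreviation D :: "nat \<Rightarrow> ((nat \<Rightarrow> nat) \<Rightarrow> ('e tree \<Rightarrow>\<^sub>0 'k)) \<Rightarrow> (nat \<Rightarrow> nat) \<Rightarrow> ('a tree \<Rightarrow>\<^sub>0 'k)"
  where "D \<equiv> sym_split p1 p2"

abbreviation C :: "((nat \<Rightarrow> nat) \<Rightarrow> ('a tree \<Rightarrow>\<^sub>0 'k)) \<Rightarrow> (nat \<Rightarrow> nat) \<Rightarrow> ('e tree \<Rightarrow>\<^sub>0 'k)"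
  where "C \<equiv> sym_relab \<gamma>"

lemma D_theta:
  assumes "X \<in> sym_space E n" shows "theta n (D n X) = split_lin p1 p2 (theta n X)"
  unfolding sym_split_def
  by (rule theta_unlab, rule keys_split_lin[OF maps(2,3) keys_theta[OF assms]])

lemma D_space: assumes "X \<in> sym_space E n" shows "D n X \<in> sym_space A n"
  using unlab_space[OF keys_split_lin[OF maps(2,3) keys_theta[OF assms]]]
  by (simp add: sym_space_iff sym_split_def)

lemma D_linear:
  "D n (X + Y) = D n X + D n Y" "D n (X - Y) = D n X - D n Y" "D n (sym_scale c X) = sym_scale c (D n X)" "D n 0 = 0"
proof -
  show "D n (X + Y) = D n X + D n Y" "D n (X - Y) = D n X - D n Y" "D n (sym_scale c X) = sym_scale c (D n X)" for X Y
    by (auto simp: sym_split_def fun_eq_iff theta_linear split_lin_simps flin_add[OF flin_unlab]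
        flin_diff[OF flin_unlab] flin_scale[OF flin_unlab] sym_scale_def[of _ "\<lambda>\<sigma>. if _ \<sigma> then _ \<sigma> else _"])
  from this(2)[of 0 0] show "D n 0 = 0" by (simp only: diff_self)
qed

lemma C_space: "X \<in> sym_space A n \<Longrightarrow> C X \<in> sym_space E n"
  by (rule sym_relab_space) (auto intro: maps)

text \<open>Both sides are compared after \<open>theta\<close>, where composition is substitution
  and the splitting commutes with it.\<close>

lemma D_comp:
  assumes "X \<in> sym_space E m" "Y \<in> sym_space E n" "1 \<le> i" "i \<le> m"
  shows "D (m + n - 1) (sym_comp m i n X Y) = sym_comp m i n (D m X) (D n Y)"
proof (rule theta_inj)
  show "D (m + n - 1) (sym_comp m i n X Y) \<in> sym_space A (m + n - 1)"
    by (intro D_space sym_comp_space assms)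
  show "sym_comp m i n (D m X) (D n Y) \<in> sym_space A (m + n - 1)"
    by (intro D_space sym_comp_space assms)
  have k: "Poly_Mapping.keys (theta m X) \<subseteq> {z. distinct (lleaves z) \<and> i \<in> set (lleaves z)}"
    using keys_theta[OF assms(1)] assms(3,4) by (auto simp: ltrees_def)
  show "theta (m + n - 1) (D (m + n - 1) (sym_comp m i n X Y)) = theta (m + n - 1) (sym_comp m i n (D m X) (D n Y))"
    by (simp only: D_theta[OF sym_comp_space[OF assms]] theta_comp[OF assms] split_lin_lsubst[OF k]
        theta_comp[OF D_space[OF assms(1)] D_space[OF assms(2)] assms(3,4)] D_theta[OF assms(1)] D_theta[OF assms(2)])
qed

lemma D_act:
  assumes "X \<in> sym_space E n" "\<rho> permutes {1..n}"
  shows "D n (sym_act \<rho> X) = sym_act \<rho> (D n X)"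
proof (rule theta_inj)
  show "D n (sym_act \<rho> X) \<in> sym_space A n" "sym_act \<rho> (D n X) \<in> sym_space A n"
    by (intro D_space sym_act_space assms)+
  show "theta n (D n (sym_act \<rho> X)) = theta n (sym_act \<rho> (D n X))"
    by (simp only: D_theta[OF sym_act_space[OF assms]] theta_act[OF assms(2)] split_lin_lren D_theta[OF assms(1)])
qed

text \<open>An exact identity, owing to the case distinction on \<open>p2 e = 0\<close> in
  \<open>split_tree\<close>. The opposite composite is the identity only modulo the ideal.\<close>

lemma D_C:
  assumes "X \<in> sym_space A n" shows "D n (C X) = X"
proof (rule theta_inj[OF D_space[OF C_space[OF assms]] assms])
  have "split_lin p1 p2 (lin_ext (\<lambda>t. lab t (inv \<sigma>)) (relab \<gamma> (X \<sigma>))) = lin_ext (\<lambda>t. lab t (inv \<sigma>)) (X \<sigma>)"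
    if "\<sigma> permutes {1..n}" for \<sigma>
  proof (rule flin_eqI[OF flin_comp[OF flin_comp[OF flin_relab flin_lin_ext] flin_split_lin] flin_lin_ext])
    fix u assume "u \<in> Poly_Mapping.keys (X \<sigma>)"
    then have "set_tree u \<subseteq> A" using assms that by (auto simp: sym_space_iff dest: tree_space_keys)
    then have "split_tree p1 p2 (lab (map_tree \<gamma> u) (inv \<sigma>)) = basis_vec (lab u (inv \<sigma>))"
      using p1_gam p2_gam by (intro split_tree_lab) auto
    then show "split_lin p1 p2 (lin_ext (\<lambda>t. lab t (inv \<sigma>)) (relab \<gamma> (basis_vec u))) = lin_ext (\<lambda>t. lab t (inv \<sigma>)) (basis_vec u)"
      by (simp add: split_lin_basis)
  qed
  then have "split_lin p1 p2 (theta n (C X)) = theta n X"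
    by (simp add: theta_def flin_sum[OF flin_split_lin] sym_relab_def)
  then show "theta n (D n (C X)) = theta n X"
    using D_theta[OF C_space[OF assms]] by simp
qed

lemma D_corolla:
  assumes "e \<in> E"
  shows "D 2 (sym_elem (basis_vec (corolla e)) id) =
    sym_elem (basis_vec (corolla (p1 e))) id + sym_elem (if p2 e = 0 then 0 else basis_vec (corolla (p2 e))) swap"
proof (rule theta_inj)
  have e: "sym_elem (basis_vec (corolla e)) id \<in> sym_space E 2"
    using assms by (intro sym_elem_space permutes_id) simp
  then show "D 2 (sym_elem (basis_vec (corolla e)) id) \<in> sym_space A 2" by (rule D_space)
  have "(if p2 e = 0 then 0 else basis_vec (corolla (p2 e)) :: _ \<Rightarrow>\<^sub>0 'k) \<in> tree_space A 2"
    "(basis_vec (corolla (p1 e)) :: _ \<Rightarrow>\<^sub>0 'k) \<in> tree_space A 2"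
    using maps assms by (auto intro: tree_space_closed)
  then show "(sym_elem (basis_vec (corolla (p1 e))) id + sym_elem (if p2 e = 0 then 0 else basis_vec (corolla (p2 e))) swap :: _ \<Rightarrow> _ \<Rightarrow>\<^sub>0 'k)
    \<in> sym_space A 2"
    by (intro sym_space_closed(2) sym_elem_space permutes_id swap_permutes)
  have "inv swap = swap" by simp
  then show "theta 2 (D 2 (sym_elem (basis_vec (corolla e)) id)) =
    theta 2 (sym_elem (basis_vec (corolla (p1 e))) id + sym_elem (if p2 e = 0 then 0 else basis_vec (corolla (p2 e))) swap)"
    by (simp add: theta_elem[OF permutes_id[of "{1..2}"]] theta_elem[OF swap_permutes]
        D_theta[OF e] theta_linear split_lin_simps lin_simps del: One_nat_def)
qed

text \<open>Bridges the gap between dropping a summand with label 0, as the splitting does, and the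
  linear formula, in which a corolla labelled 0 appears.\<close>

lemma corolla_zero: "basis_vec (corolla 0) \<in> pres_ideal s A Rs 2"
proof -
  have "0 \<in> A" by (rule A.subspace_0[OF subA])
  from pres_ideal_lin[OF corolla_lin_relsI(2)[where s=s and c=0, OF this], of Rs] show ?thesis by simp
qed

lemma sym_comp_in_ideal:
  assumes "\<And>\<sigma> \<rho>. \<sigma> permutes {1..m} \<Longrightarrow> \<rho> permutes {1..n} \<Longrightarrow>
      bilin_ext (\<lambda>t u. graft t (\<sigma> i) u) (f \<sigma>) (g \<rho>) \<in> pres_ideal s A Rs (m + n - 1)"
  shows "sym_comp m i n f g \<pi> \<in> pres_ideal s A Rs (m + n - 1)"
proof -
  have sum: "sum h I \<in> pres_ideal s A Rs (m + n - 1)" if "\<And>i. i \<in> I \<Longrightarrow> h i \<in> pres_ideal s A Rs (m + n - 1)"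
    for h :: "_ \<Rightarrow> ('a tree \<Rightarrow>\<^sub>0 'k)" and I
    using that by (induction I rule: infinite_finite_induct) (auto intro: pres_ideal_zero pres_ideal_add)
  show ?thesis
  proof (cases "\<pi> permutes {1..m + n - 1}")
    case True
    have "(\<Sum>(\<sigma>, \<rho>) \<in> {(\<sigma>, \<rho>). \<sigma> permutes {1..m} \<and> \<rho> permutes {1..n} \<and> perm_comp m i n \<sigma> \<rho> = \<pi>}.
             bilin_ext (\<lambda>t u. graft t (\<sigma> i) u) (f \<sigma>) (g \<rho>)) \<in> pres_ideal s A Rs (m + n - 1)"
      by (rule sum) (use assms in \<open>clarify, blast\<close>)
    with True show ?thesis by (simp only: sym_comp_def if_True)
  next
    case False
    then show ?thesis by (simp only: sym_comp_def if_False pres_ideal_zero)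
  qed
qed

text \<open>Relations over \<open>E\<close> and over \<open>A\<close> which \<open>D\<close> and
  \<open>C\<close> carry into each other's ideals. The goal is that \<open>J\<close> is the preimage
  of the families with components in \<open>I\<close>.\<close>

context
  fixes R :: "((nat \<Rightarrow> nat) \<Rightarrow> ('e tree \<Rightarrow>\<^sub>0 'k)) set" and Rs :: "('a tree \<Rightarrow>\<^sub>0 'k) set"
  assumes RE: "R \<subseteq> sym_space E 3" and RA: "Rs \<subseteq> tree_space A 3"
    and D_R: "\<And>X \<sigma>. X \<in> R \<Longrightarrow> \<sigma> permutes {1..3} \<Longrightarrow> D 3 X \<sigma> \<in> pres_ideal s A Rs 3"
    and C_R: "\<And>r. r \<in> Rs \<Longrightarrow> sym_elem (relab \<gamma> r) id \<in> SI R 3"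
begin

abbreviation "I \<equiv> pres_ideal s A Rs"
abbreviation "J \<equiv> SI R"

lemmas I_sub = add_subD[OF add_sub_pres_ideal[of s A Rs]]
lemmas J_sub = add_subD[OF add_sub_SI[OF RE]]

lemma D_corolla_apply:
  assumes "e \<in> E"
  shows "D 2 (sym_elem (basis_vec (corolla e)) id) id - basis_vec (corolla (p1 e)) \<in> I 2"
    "D 2 (sym_elem (basis_vec (corolla e)) id) swap - basis_vec (corolla (p2 e)) \<in> I 2"
proof -
  have ne: "id \<noteq> swap"
  proof
    assume "id = swap"
    then have "id 1 = swap 1" by metis
    then show False by simp
  qed
  show "D 2 (sym_elem (basis_vec (corolla e)) id) id - basis_vec (corolla (p1 e)) \<in> I 2"
    unfolding D_corolla[OF assms] using ne by (simp add: sym_elem_def I_sub(1))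
  show "D 2 (sym_elem (basis_vec (corolla e)) id) swap - basis_vec (corolla (p2 e)) \<in> I 2"
    unfolding D_corolla[OF assms] using ne I_sub(3)[OF corolla_zero] by (simp add: sym_elem_def I_sub(1))
qed

text \<open>\<open>D\<close> respects all operations, so generators decide. Linearity of corollas is
  preserved because \<open>p1\<close> and \<open>p2\<close> are linear, equivariance because \<tau>
  exchanges them.\<close>

lemma D_ideal:
  assumes "X \<in> J n" "\<sigma> permutes {1..n}" shows "D n X \<sigma> \<in> I n"
proof -
  have "X \<in> sym_space E n \<and> (\<forall>\<sigma>. \<sigma> permutes {1..n} \<longrightarrow> D n X \<sigma> \<in> I n)"
    using assms(1) RE
  proof (induction rule: SI_induct)
    case (lin x)
    let ?d = "\<lambda>e. D 2 (sym_elem (basis_vec (corolla e)) id)"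
    have E: "a + b \<in> E" "t c a \<in> E" if "a \<in> E" "b \<in> E" for a b c
      using that E.subspace_add[OF sub] E.subspace_scale[OF sub] by auto
    \<comment> \<open>Both components are treated at once: modulo the ideal each is a corolla
      labelled by one of the linear maps \<open>p1\<close>, \<open>p2\<close>.\<close>
    have *: "?d (a + b) \<sigma> - ?d a \<sigma> - ?d b \<sigma> \<in> I 2 \<and> ?d (t c a) \<sigma> - fsmul c (?d a \<sigma>) \<in> I 2"
      if ab: "a \<in> E" "b \<in> E" and p: "p \<in> {p1, p2}" and d: "\<And>e. e \<in> E \<Longrightarrow> ?d e \<sigma> - basis_vec (corolla (p e)) \<in> I 2" for a b c \<sigma> p
    proof
      have 1: "basis_vec (corolla (p (a + b))) - basis_vec (corolla (p a)) - basis_vec (corolla (p b)) \<in> I 2"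
        using ab p maps maps_add corolla_lin_relsI(1)[of "p a" A "p b" s] by (intro pres_ideal_lin) auto
      have "?d (a + b) \<sigma> - ?d a \<sigma> - ?d b \<sigma>
        = (?d (a + b) \<sigma> - basis_vec (corolla (p (a + b)))) - (?d a \<sigma> - basis_vec (corolla (p a))) - (?d b \<sigma> - basis_vec (corolla (p b)))
          + (basis_vec (corolla (p (a + b))) - basis_vec (corolla (p a)) - basis_vec (corolla (p b)))"
        by simp
      also have "\<dots> \<in> I 2"
        by (rule I_sub(4)[OF I_sub(2)[OF I_sub(2)[OF d[OF E(1)[OF ab]] d[OF ab(1)]] d[OF ab(2)]] 1])
      finally show "?d (a + b) \<sigma> - ?d a \<sigma> - ?d b \<sigma> \<in> I 2" .
      have 2: "basis_vec (corolla (p (t c a))) - fsmul c (basis_vec (corolla (p a))) \<in> I 2"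
        using ab p maps maps_scale corolla_lin_relsI(2)[of "p a" A s c] by (intro pres_ideal_lin) auto
      have "?d (t c a) \<sigma> - fsmul c (?d a \<sigma>)
        = (?d (t c a) \<sigma> - basis_vec (corolla (p (t c a)))) - fsmul c (?d a \<sigma> - basis_vec (corolla (p a)))
          + (basis_vec (corolla (p (t c a))) - fsmul c (basis_vec (corolla (p a))))"
        by (simp add: fsmul_algebra)
      also have "\<dots> \<in> I 2"
        by (rule I_sub(4)[OF I_sub(2)[OF d[OF E(2)[OF ab]] pres_ideal_scale[OF d[OF ab(1)]]] 2])
      finally show "?d (t c a) \<sigma> - fsmul c (?d a \<sigma>) \<in> I 2" .
    qed
    have d12: "\<exists>p\<in>{p1, p2}. \<forall>e\<in>E. ?d e \<sigma> - basis_vec (corolla (p e)) \<in> I 2" if "\<sigma> permutes {1..2}" for \<sigma>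
      using that
    proof (cases rule: permutes_2_cases)
      case 1
      then show ?thesis using D_corolla_apply(1) by blast
    next
      case 2
      then show ?thesis using D_corolla_apply(2) by blast
    qed
    show ?case
    proof (intro allI impI)
      fix \<sigma> assume "\<sigma> permutes {1..2::nat}"
      then obtain p where p: "p \<in> {p1, p2}" "\<And>e. e \<in> E \<Longrightarrow> ?d e \<sigma> - basis_vec (corolla (p e)) \<in> I 2"
        using d12 by blast
      from lin consider (a) a b where "x = basis_vec (corolla (a + b)) - basis_vec (corolla a) - basis_vec (corolla b)" "a \<in> E" "b \<in> E"
        | (b) a c where "x = basis_vec (corolla (t c a)) - fsmul c (basis_vec (corolla a))" "a \<in> E"
        by (auto simp: corolla_lin_rels_def)
      then show "D 2 (sym_elem x id) \<sigma> \<in> I 2"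
      proof cases
        case a
        then show ?thesis using *[OF a(2,3) p] by (simp add: sym_elem_linear D_linear)
      next
        case b
        then show ?thesis using *[OF b(2,2) p] by (simp add: sym_elem_linear D_linear sym_scale_def[of _ "D _ _"])
      qed
    qed
  next
    case (equiv e)
    let ?d = "\<lambda>e. D 2 (sym_elem (basis_vec (corolla e)) id)"
    have te: "\<tau> e \<in> E" by (rule tau_in[OF equiv])
    have e: "sym_elem (basis_vec (corolla e)) id \<in> sym_space E 2"
      using equiv by (intro sym_elem_space permutes_id) simp
    have a: "sym_elem (basis_vec (corolla e)) swap = sym_act swap (sym_elem (basis_vec (corolla e) :: _ \<Rightarrow>\<^sub>0 'k) id)"
      by (simp add: sym_act_elem[OF swap_permutes] del: One_nat_def)
    have e1: "D 2 (sym_elem (basis_vec (corolla (\<tau> e))) id - sym_elem (basis_vec (corolla e)) swap)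
      = ?d (\<tau> e) - sym_act swap (?d e)"
      unfolding a by (simp only: D_linear D_act[OF e swap_permutes])
    have "?d (\<tau> e) \<sigma> - sym_act swap (?d e) \<sigma> \<in> I 2" if "\<sigma> permutes {1..2}" for \<sigma>
      using that
    proof (cases rule: permutes_2_cases)
      case 1
      have "?d (\<tau> e) id - ?d e swap = (?d (\<tau> e) id - basis_vec (corolla (p1 (\<tau> e)))) - (?d e swap - basis_vec (corolla (p2 e)))"
        by (simp add: p1_tau equiv)
      also have "\<dots> \<in> I 2" by (intro I_sub(2) D_corolla_apply te equiv)
      finally show ?thesis using 1 by (simp add: sym_act_def)
    next
      case 2
      have "?d (\<tau> e) swap - ?d e id = (?d (\<tau> e) swap - basis_vec (corolla (p2 (\<tau> e)))) - (?d e id - basis_vec (corolla (p1 e)))"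
        by (simp add: p2_tau equiv)
      also have "\<dots> \<in> I 2" by (intro I_sub(2) D_corolla_apply te equiv)
      finally show ?thesis using 2 by (simp add: sym_act_def)
    qed
    then have "(?d (\<tau> e) - sym_act swap (?d e)) \<sigma> \<in> I 2" if "\<sigma> permutes {1..2}" for \<sigma>
      using that by simp
    then show ?case unfolding e1 by (intro allI impI)
  next
    case (rel X)
    then show ?case using D_R by blast
  next
    case (zero n)
    show ?case unfolding D_linear by (simp add: pres_ideal_zero)
  next
    case (add n X Y)
    then show ?case unfolding D_linear by (simp add: pres_ideal_add)
  next
    case (scale n c X)
    then show ?case unfolding D_linear by (simp add: sym_scale_def pres_ideal_scale)
  next
    case (left m n i X Y)
    have "sym_comp m i n (D m X) (D n Y) \<pi> \<in> I (m + n - 1)" for \<pi>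
    proof (rule sym_comp_in_ideal)
      fix \<sigma> \<rho> assume p: "\<sigma> permutes {1..m}" "\<rho> permutes {1..n}"
      show "bilin_ext (\<lambda>t u. graft t (\<sigma> i) u) (D m X \<sigma>) (D n Y \<rho>) \<in> I (m + n - 1)"
        using left p permutes_in_image[OF p(1), of i] D_space[OF left(3)]
        by (intro pres_ideal_comp_left) (auto simp: sym_space_iff)
    qed
    then show ?case using D_comp[OF left(2,3,4,5)] by simp
  next
    case (right m n i X Y)
    have "sym_comp m i n (D m X) (D n Y) \<pi> \<in> I (m + n - 1)" for \<pi>
    proof (rule sym_comp_in_ideal)
      fix \<sigma> \<rho> assume p: "\<sigma> permutes {1..m}" "\<rho> permutes {1..n}"
      show "bilin_ext (\<lambda>t u. graft t (\<sigma> i) u) (D m X \<sigma>) (D n Y \<rho>) \<in> I (m + n - 1)"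
        using right p permutes_in_image[OF p(1), of i] D_space[OF right(1)]
        by (intro pres_ideal_comp_right) (auto simp: sym_space_iff)
    qed
    then show ?case using D_comp[OF right(1,3,4,5)] by simp
  next
    case (act n \<rho> X)
    show ?case
    proof (intro allI impI)
      fix \<sigma> assume "\<sigma> permutes {1..n}"
      then have "\<sigma> \<circ> inv \<rho> permutes {1..n}" by (simp only: permutes_comp_inv_iff[OF act(3)])
      then have "D n X (\<sigma> \<circ> inv \<rho>) \<in> I n" using act(1) by blast
      then show "D n (sym_act \<rho> X) \<sigma> \<in> I n" unfolding D_act[OF act(2,3)] by (simp only: sym_act_def)
    qed
  qed
  then show ?thesis using assms(2) by blast
qed

text \<open>Relabelling along the linear map \<gamma> takes generators of \<open>I\<close> into
  \<open>J\<close>, and at the identity permutation composition is the nonsymmetric one.\<close>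

lemma C_ideal_id: "x \<in> I n \<Longrightarrow> sym_elem (relab \<gamma> x) id \<in> J n"
proof (induction rule: pres_ideal_induct)
  case (lin x)
  then have "relab \<gamma> x \<in> corolla_lin_rels t E"
  proof -
    from lin consider (a) a b where "x = basis_vec (corolla (a + b)) - basis_vec (corolla a) - basis_vec (corolla b)" "a \<in> A" "b \<in> A"
      | (b) a c where "x = basis_vec (corolla (s c a)) - fsmul c (basis_vec (corolla a))" "a \<in> A"
      by (auto simp: corolla_lin_rels_def)
    then show ?thesis
    proof cases
      case a
      then show ?thesis using maps maps_add corolla_lin_relsI(1)[of "\<gamma> a" E "\<gamma> b" t] by (simp add: relab_simps)
    next
      case b
      then show ?thesis using maps maps_scale corolla_lin_relsI(2)[of "\<gamma> a" E t c] by (simp add: relab_simps)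
    qed
  qed
  then show ?case by (rule SI_lin)
next
  case (rel x)
  then show ?case by (rule C_R)
next
  case (zero n)
  then show ?case by (simp only: relab_simps sym_elem_linear SI_zero)
next
  case (add n x y)
  then show ?case by (simp only: relab_simps sym_elem_linear SI_add)
next
  case (scale n c x)
  then show ?case by (simp only: relab_simps sym_elem_linear SI_scale[OF RE])
next
  case (left m n i x y)
  have "sym_elem (relab \<gamma> y) id \<in> sym_space E n"
    using left(2) maps(1) by (intro sym_elem_space permutes_id relab_space) auto
  from SI_comp_left[OF left(1) this left(3,4)] show ?case
    by (simp only: relab_comp sym_comp_elem_id[OF left(3,4)])
next
  case (right m n i x y)
  have "sym_elem (relab \<gamma> x) id \<in> sym_space E m"
    using right(1) maps(1) by (intro sym_elem_space permutes_id relab_space) auto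
  from SI_comp_right[OF this right(4,2,3)] show ?case
    by (simp only: relab_comp sym_comp_elem_id[OF right(2,3)])
qed

lemma C_ideal:
  assumes "Y \<in> sym_space A n" "\<And>\<sigma>. \<sigma> permutes {1..n} \<Longrightarrow> Y \<sigma> \<in> I n" shows "C Y \<in> J n"
proof -
  have "C Y = (\<Sum>\<sigma> | \<sigma> permutes {1..n}. sym_elem (C Y \<sigma>) \<sigma>)"
    by (rule sym_decompose[OF C_space[OF assms(1)]])
  also have "\<dots> \<in> J n"
  proof (rule SI_sum)
    fix \<sigma> assume "\<sigma> \<in> {\<sigma>. \<sigma> permutes {1..n}}"
    then have \<sigma>: "\<sigma> permutes {1..n}" by simp
    have "sym_act \<sigma> (sym_elem (relab \<gamma> (Y \<sigma>)) id) \<in> J n"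
      by (intro SI_act C_ideal_id assms(2) \<sigma>)
    then show "sym_elem (C Y \<sigma>) \<sigma> \<in> J n" by (simp add: sym_act_elem[OF \<sigma>] sym_relab_def)
  qed
  finally show ?thesis .
qed

text \<open>Up to the convention for label 0, \<open>C\<close> after \<open>D\<close> yields
  \<open>\<gamma> (p1 e)\<close> plus \<open>\<gamma> (p2 e)\<close> with exchanged inputs.
  Equivariance turns the latter into the label \<open>\<tau> (\<gamma> (p2 e))\<close>, and
  linearity adds the two labels up to \<open>e\<close>.\<close>

lemma C_D_corolla:
  assumes "e \<in> E"
  shows "C (D 2 (sym_elem (basis_vec (corolla e)) id)) - sym_elem (basis_vec (corolla e)) id \<in> J 2"
proof -
  let ?c = "\<lambda>e. sym_elem (basis_vec (corolla e)) id :: (nat \<Rightarrow> nat) \<Rightarrow> 'e tree \<Rightarrow>\<^sub>0 'k"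
  let ?g1 = "\<gamma> (p1 e)" and ?g2 = "\<gamma> (p2 e)"
  have g: "?g1 \<in> E" "?g2 \<in> E" using assms maps by auto
  have C: "C (D 2 (?c e)) = ?c ?g1 + sym_elem (relab \<gamma> (if p2 e = 0 then 0 else basis_vec (corolla (p2 e)))) swap"
    by (simp add: D_corolla[OF assms] sym_relab_linear sym_relab_elem)
  have "(if p2 e = 0 then 0 else basis_vec (corolla (p2 e))) - basis_vec (corolla (p2 e)) \<in> I 2"
    using I_sub(3)[OF corolla_zero] I_sub(1) by simp
  from C_ideal_id[OF this] have "sym_act swap (sym_elem (relab \<gamma> ((if p2 e = 0 then 0 else basis_vec (corolla (p2 e))) - basis_vec (corolla (p2 e)))) id) \<in> J 2"
    by (rule SI_act[OF _ swap_permutes])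
  then have 1: "sym_elem (relab \<gamma> (if p2 e = 0 then 0 else basis_vec (corolla (p2 e)))) swap - sym_elem (basis_vec (corolla ?g2)) swap \<in> J 2"
    unfolding relab_simps sym_elem_linear sym_act_linear sym_act_elem[OF swap_permutes] relab_basis by simp
  have 2: "?c (\<tau> ?g2) - sym_elem (basis_vec (corolla ?g2)) swap \<in> J 2" by (rule SI_equiv[OF g(2)])
  have "basis_vec (corolla (?g1 + \<tau> ?g2)) - basis_vec (corolla ?g1) - basis_vec (corolla (\<tau> ?g2)) \<in> corolla_lin_rels t E"
    using g tau_in by (auto simp: corolla_lin_rels_def)
  from SI_lin[OF this] have 3: "?c e - ?c ?g1 - ?c (\<tau> ?g2) \<in> J 2"
    by (simp only: decomp[OF assms] sym_elem_linear)
  have "C (D 2 (?c e)) - ?c e =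
     (sym_elem (relab \<gamma> (if p2 e = 0 then 0 else basis_vec (corolla (p2 e)))) swap - sym_elem (basis_vec (corolla ?g2)) swap)
     - (?c (\<tau> ?g2) - sym_elem (basis_vec (corolla ?g2)) swap) - (?c e - ?c ?g1 - ?c (\<tau> ?g2))"
    unfolding C by (simp only: algebra_simps)
  also have "\<dots> \<in> J 2" by (intro J_sub(2) 1 2 3)
  finally show ?thesis .
qed

text \<open>The error of a composite is the error of the first factor composed with the changed
  second one, plus the unchanged first factor composed with the error of the second.\<close>

lemma C_D_comp:
  assumes "X \<in> sym_space E m" "Y \<in> sym_space E n" "1 \<le> i" "i \<le> m"
    "C (D m X) - X \<in> J m" "C (D n Y) - Y \<in> J n"
  shows "C (D (m + n - 1) (sym_comp m i n X Y)) - sym_comp m i n X Y \<in> J (m + n - 1)"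
proof -
  have s: "C (D n Y) \<in> sym_space E n" by (intro C_space D_space assms)
  have "C (D (m + n - 1) (sym_comp m i n X Y)) - sym_comp m i n X Y
    = sym_comp m i n (C (D m X) - X) (C (D n Y)) + sym_comp m i n X (C (D n Y) - Y)"
    by (simp only: D_comp[OF assms(1-4)] sym_relab_comp sym_comp_linear diff_add_cancel diff_diff_eq2 add_diff_eq)
  also have "\<dots> \<in> J (m + n - 1)"
    by (intro SI_add SI_comp_left SI_comp_right assms s)
  finally show ?thesis .
qed

lemma C_D_tree:
  assumes "set_tree u \<subseteq> E"
  shows "C (D (size1 u) (sym_elem (basis_vec u) id)) - sym_elem (basis_vec u) id \<in> J (size1 u)"
  using assms
proof (induction u)
  case Leaf
  have l: "(sym_elem (basis_vec \<langle>\<rangle>) id :: _ \<Rightarrow> _ \<Rightarrow>\<^sub>0 'k) \<in> sym_space A 1"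
    by (intro sym_elem_space permutes_id) simp
  have C: "C (sym_elem (basis_vec \<langle>\<rangle>) id :: _ \<Rightarrow> _ \<Rightarrow>\<^sub>0 'k) = sym_elem (basis_vec \<langle>\<rangle>) id" by (simp add: sym_relab_elem)
  have "D 1 (sym_elem (basis_vec \<langle>\<rangle>) id :: _ \<Rightarrow> _ \<Rightarrow>\<^sub>0 'k) = sym_elem (basis_vec \<langle>\<rangle>) id"
    using D_C[OF l] unfolding C .
  then show ?case using J_sub(1) C by (simp only: tree.size size1.simps diff_self)
next
  case (Node l e r)
  let ?s = "\<lambda>u. sym_elem (basis_vec u) id :: (nat \<Rightarrow> nat) \<Rightarrow> 'e tree \<Rightarrow>\<^sub>0 'k"
  have sp: "?s u \<in> sym_space E (size1 u)" if "set_tree u \<subseteq> E" for u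
    using that by (intro sym_elem_space permutes_id) simp
  have e: "e \<in> E" "set_tree l \<subseteq> E" "set_tree r \<subseteq> E" using Node.prems by auto
  have c: "?s (corolla e) \<in> sym_space E 2" using sp[of "corolla e"] e by (simp add: numeral_2_eq_2)
  \<comment> \<open>A tree is a corolla with its right subtree inserted first, at input 2; input 1
    then keeps its number for the left subtree.\<close>
  let ?y = "sym_comp 2 2 (size1 r) (?s (corolla e)) (?s r)"
  have y: "?y = ?s \<langle>\<langle>\<rangle>, e, r\<rangle>" by (simp add: sym_comp_elem_id)
  have y1: "C (D (2 + size1 r - 1) ?y) - ?y \<in> J (2 + size1 r - 1)"
    by (rule C_D_comp[OF c sp[OF e(3)] _ _ C_D_corolla[OF e(1)] Node.IH(2)[OF e(3)]]) auto
  have ys: "?y \<in> sym_space E (2 + size1 r - 1)" by (rule sym_comp_space[OF c sp[OF e(3)]]) auto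
  let ?z = "sym_comp (2 + size1 r - 1) 1 (size1 l) ?y (?s l)"
  have z: "?z = ?s \<langle>l, e, r\<rangle>" unfolding y by (subst sym_comp_elem_id) auto
  have "C (D (2 + size1 r - 1 + size1 l - 1) ?z) - ?z \<in> J (2 + size1 r - 1 + size1 l - 1)"
    by (rule C_D_comp[OF ys sp[OF e(2)] _ _ y1 Node.IH(1)[OF e(2)]]) auto
  moreover have "2 + size1 r - 1 + size1 l - 1 = size1 \<langle>l, e, r\<rangle>" by simp
  ultimately show ?case unfolding z by metis
qed

lemma C_D:
  assumes "X \<in> sym_space E n" shows "C (D n X) - X \<in> J n"
proof -
  have 1: "C (D n (sym_elem x id)) - sym_elem x id \<in> J n" if "x \<in> tree_space E n" for x
    using that
  proof (induction x rule: tree_space_induct)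
    case zero
    show ?case by (simp only: sym_elem_linear D_linear sym_relab_linear SI_zero diff_self)
  next
    case (basis c u)
    have "C (D n (sym_elem (basis_vec u) id)) - sym_elem (basis_vec u) id \<in> J n"
      using C_D_tree[OF basis(2)] unfolding basis(1) .
    from SI_scale[OF RE this, of c]
    have "sym_scale c (C (D n (sym_elem (basis_vec u) id))) - sym_scale c (sym_elem (basis_vec u) id) \<in> J n"
      by (simp add: sym_scale_def fsmul_algebra fun_diff_def)
    then show ?case by (simp only: sym_elem_linear D_linear sym_relab_linear)
  next
    case (add x y)
    have "C (D n (sym_elem (x + y) id)) - sym_elem (x + y) id
      = (C (D n (sym_elem x id)) - sym_elem x id) + (C (D n (sym_elem y id)) - sym_elem y id)"
      unfolding sym_elem_linear D_linear sym_relab_linear by (rule add_diff_add_eq)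
    then show ?case using SI_add[OF add(1,2)] by (simp only:)
  qed
  have "C (D n X) - X = (\<Sum>\<sigma> | \<sigma> permutes {1..n}. C (D n (sym_elem (X \<sigma>) \<sigma>)) - sym_elem (X \<sigma>) \<sigma>)"
  proof -
    have sum: "C (D n (sum f S)) = (\<Sum>x\<in>S. C (D n (f x)))" for f :: "(nat \<Rightarrow> nat) \<Rightarrow> (nat \<Rightarrow> nat) \<Rightarrow> 'e tree \<Rightarrow>\<^sub>0 'k" and S
    proof (induction S rule: infinite_finite_induct)
      case (infinite S)
      show ?case by (simp only: sum.infinite[OF infinite] D_linear sym_relab_linear)
    next
      case empty
      show ?case by (simp only: sum.empty D_linear sym_relab_linear)
    next
      case (insert x S)
      show ?case by (simp only: sum.insert[OF insert(1,2)] insert(3) D_linear sym_relab_linear)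
    qed
    show ?thesis
      unfolding sum_subtractf sum[symmetric] sym_decompose[OF assms, symmetric] ..
  qed
  also have "\<dots> \<in> J n"
  proof (rule SI_sum)
    fix \<sigma> assume "\<sigma> \<in> {\<sigma>. \<sigma> permutes {1..n}}"
    then have \<sigma>: "\<sigma> permutes {1..n}" by simp
    then have x: "X \<sigma> \<in> tree_space E n" using assms by (simp add: sym_space_iff)
    have xs: "sym_elem (X \<sigma>) id \<in> sym_space E n" by (intro sym_elem_space x permutes_id)
    have a: "sym_elem (X \<sigma>) \<sigma> = sym_act \<sigma> (sym_elem (X \<sigma>) id)" by (simp add: sym_act_elem[OF \<sigma>])
    have "C (D n (sym_elem (X \<sigma>) \<sigma>)) - sym_elem (X \<sigma>) \<sigma> = sym_act \<sigma> (C (D n (sym_elem (X \<sigma>) id)) - sym_elem (X \<sigma>) id)"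
      unfolding a by (simp only: D_act[OF xs \<sigma>] sym_relab_act sym_act_linear)
    then show "C (D n (sym_elem (X \<sigma>) \<sigma>)) - sym_elem (X \<sigma>) \<sigma> \<in> J n" using SI_act[OF 1[OF x] \<sigma>] by simp
  qed
  finally show ?thesis .
qed

text \<open>\<open>D\<close> and \<open>C\<close> preserve the ideals, and \<open>C (D n X)\<close>
  is congruent to \<open>X\<close>; so if \<open>D n X\<close> lies in the ideal, then so does
  \<open>X\<close>.\<close>

lemma SI_iff:
  "X \<in> J n \<longleftrightarrow> X \<in> sym_space E n \<and> (\<forall>\<sigma>. \<sigma> permutes {1..n} \<longrightarrow> D n X \<sigma> \<in> I n)"
proof
  assume "X \<in> J n"
  then show "X \<in> sym_space E n \<and> (\<forall>\<sigma>. \<sigma> permutes {1..n} \<longrightarrow> D n X \<sigma> \<in> I n)"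
    using D_ideal SI_space[OF RE] by blast
next
  assume X: "X \<in> sym_space E n \<and> (\<forall>\<sigma>. \<sigma> permutes {1..n} \<longrightarrow> D n X \<sigma> \<in> I n)"
  then have "C (D n X) \<in> J n" using D_space by (intro C_ideal) auto
  moreover have "C (D n X) - X \<in> J n" using C_D X by blast
  ultimately have "C (D n X) - (C (D n X) - X) \<in> J n" by (rule J_sub(2))
  then show "X \<in> J n" by (simp only: diff_diff_eq2 add_diff_cancel_left')
qed

end

end

section \<open>Classes in quotient operads\<close>

text \<open>An element of the symmetrised quotient. Outside the symmetric group its value is the 0
  of the set type, which is \<open>{0}\<close> and not the zero class.\<close>

definition coset_family :: "('v::ab_group_add set) \<Rightarrow> nat \<Rightarrow> ((nat \<Rightarrow> nat) \<Rightarrow> 'v) \<Rightarrow> (nat \<Rightarrow> nat) \<Rightarrow> 'v set" where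
  "coset_family I n Y = (\<lambda>\<sigma>. if \<sigma> permutes {1..n} then Y \<sigma> +o I else 0)"

lemma coset_family_eq_iff:
  assumes "add_sub I"
  shows "coset_family I n Y = coset_family I n Z \<longleftrightarrow> (\<forall>\<sigma>. \<sigma> permutes {1..n} \<longrightarrow> Y \<sigma> - Z \<sigma> \<in> I)"
  using coset_eq_iff[OF assms] by (auto simp: coset_family_def fun_eq_iff)

lemma coset_family_add:
  assumes "add_sub I" shows "coset_family I n Y + coset_family I n Z = coset_family I n (Y + Z)"
  by (rule ext) (simp add: coset_family_def coset_add[OF assms])

lemma scale_coset_pres_ideal:
  "fsmul c ` (x +o pres_ideal s E R n) + pres_ideal s E R n = fsmul c x +o pres_ideal s E R n"
proof (rule plus_coset_eq[OF add_sub_pres_ideal])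
  show "fsmul c x \<in> fsmul c ` (x +o pres_ideal s E R n)" using coset_self[OF add_sub_pres_ideal] by blast
  fix y assume "y \<in> fsmul c ` (x +o pres_ideal s E R n)"
  then obtain z where z: "y = fsmul c z" "z \<in> x +o pres_ideal s E R n" by blast
  then have "z - x \<in> pres_ideal s E R n" by (simp only: coset_mem)
  from pres_ideal_scale[OF this, of c] show "y - fsmul c x \<in> pres_ideal s E R n"
    by (simp add: z(1) fsmul_algebra)
qed

lemma comp_coset_pres_ideal:
  assumes "module s" "module.subspace s E" "R \<subseteq> tree_space E 3"
    and "x \<in> tree_space E m" "y \<in> tree_space E n" "1 \<le> i" "i \<le> m"
  shows "{bilin_ext (\<lambda>t u. graft t i u) x' y' | x' y'. x' \<in> x +o pres_ideal s E R m \<and> y' \<in> y +o pres_ideal s E R n}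
      + pres_ideal s E R (m + n - 1) = bilin_ext (\<lambda>t u. graft t i u) x y +o pres_ideal s E R (m + n - 1)"
proof (rule plus_coset_eq[OF add_sub_pres_ideal])
  let ?I = "pres_ideal s E R" and ?c = "bilin_ext (\<lambda>t u. graft t i u)"
  show "?c x y \<in> {?c x' y' | x' y'. x' \<in> x +o ?I m \<and> y' \<in> y +o ?I n}"
    using coset_self[OF add_sub_pres_ideal] by blast
  fix z assume "z \<in> {?c x' y' | x' y'. x' \<in> x +o ?I m \<and> y' \<in> y +o ?I n}"
  then obtain x' y' where z: "z = ?c x' y'" "x' \<in> x +o ?I m" "y' \<in> y +o ?I n" by blast
  then have d: "x' - x \<in> ?I m" "y' - y \<in> ?I n" by (simp_all only: coset_mem)
  have "y' - y \<in> tree_space E n" using pres_ideal_space[of s E R n] assms(1-3) d by auto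
  from tree_space_closed(2)[OF assms(5) this] have y': "y' \<in> tree_space E n" by simp
  have "z - ?c x y = ?c (x' - x) y' + ?c x (y' - y)" by (simp add: z(1) bilin_simps)
  also have "\<dots> \<in> ?I (m + n - 1)"
    using pres_ideal_comp_left[of "x' - x" s E R m y' n i] pres_ideal_comp_right[of x E m "y' - y" s R n i] d y' assms
    by (intro pres_ideal_add) auto
  finally show "z - ?c x y \<in> ?I (m + n - 1)" .
qed

locale ns_data =
  fixes s :: "'k::field \<Rightarrow> 'a::ab_group_add \<Rightarrow> 'a" and A :: "'a set" and Rs :: "('a tree \<Rightarrow>\<^sub>0 'k) set"
  assumes vsA: "vector_space s" and subA: "module.subspace s A" and RA: "Rs \<subseteq> tree_space A 3"
begin

sublocale A: vector_space s by (rule vsA)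

abbreviation "I \<equiv> pres_ideal s A Rs"
abbreviation "Q \<equiv> sym_operad (ns_presented s A Rs)"
abbreviation "cos n \<equiv> coset_family (I n) n"

lemmas I_sub = add_subD[OF add_sub_pres_ideal[of s A Rs]]

lemma Q_space: "op_space Q n = cos n ` sym_space A n"
proof (rule set_eqI, rule iffI)
  fix f assume "f \<in> op_space Q n"
  then have f: "\<sigma> permutes {1..n} \<Longrightarrow> \<exists>y\<in>tree_space A n. f \<sigma> = y +o I n" "\<not> \<sigma> permutes {1..n} \<Longrightarrow> f \<sigma> = 0" for \<sigma>
    unfolding sym_operad_def by (simp_all add: ns_presented_simps image_iff split: if_splits)
  define Y where "Y \<sigma> = (if \<sigma> permutes {1..n} then SOME y. y \<in> tree_space A n \<and> f \<sigma> = y +o I n else 0)" for \<sigma>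
  have Y: "Y \<sigma> \<in> tree_space A n \<and> f \<sigma> = Y \<sigma> +o I n" if "\<sigma> permutes {1..n}" for \<sigma>
    using someI_ex[of "\<lambda>y. y \<in> tree_space A n \<and> f \<sigma> = y +o I n"] f(1)[OF that] that by (auto simp: Y_def)
  have "Y \<in> sym_space A n" using Y by (auto simp: sym_space_iff Y_def)
  moreover have "f = cos n Y" using Y f(2) by (auto simp: coset_family_def fun_eq_iff)
  ultimately show "f \<in> cos n ` sym_space A n" by blast
next
  fix f assume "f \<in> cos n ` sym_space A n"
  then show "f \<in> op_space Q n"
    by (auto simp: sym_operad_def ns_presented_simps coset_family_def sym_space_iff)
qed

lemma Q_scale: "op_scale Q n c (cos n Y) = cos n (sym_scale c Y)"
  by (rule ext) (simp add: sym_operad_def coset_family_def ns_presented_simps scale_coset_pres_ideal sym_scale_def)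

lemma Q_act: "\<rho> permutes {1..n} \<Longrightarrow> op_act Q n \<rho> (cos n Y) = cos n (sym_act \<rho> Y)"
  by (rule ext) (simp add: sym_operad_def coset_family_def sym_act_def permutes_comp_inv_iff)

lemma Q_unit: "op_unit Q = cos 1 (sym_elem (basis_vec \<langle>\<rangle>) id)"
proof
  fix \<sigma> :: "nat \<Rightarrow> nat"
  have "\<sigma> permutes {1..1} \<longleftrightarrow> \<sigma> = id" by simp
  then show "op_unit Q \<sigma> = cos 1 (sym_elem (basis_vec \<langle>\<rangle>) id) \<sigma>"
    by (simp add: sym_operad_def coset_family_def ns_presented_simps sym_elem_def del: One_nat_def)
qed

lemma Q_comp:
  assumes "Y \<in> sym_space A m" "Z \<in> sym_space A n" "1 \<le> i" "i \<le> m"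
  shows "op_comp Q m i n (cos m Y) (cos n Z) = cos (m + n - 1) (sym_comp m i n Y Z)"
proof
  fix \<pi>
  let ?P = "{(\<sigma>, \<rho>). \<sigma> permutes {1..m} \<and> \<rho> permutes {1..n} \<and> perm_comp m i n \<sigma> \<rho> = \<pi>}"
  let ?N = "m + n - 1"
  show "op_comp Q m i n (cos m Y) (cos n Z) \<pi> = cos ?N (sym_comp m i n Y Z) \<pi>"
  proof (cases "\<pi> permutes {1..?N}")
    case True
    have "op_comp Q m i n (cos m Y) (cos n Z) \<pi> = I ?N + (\<Sum>p\<in>?P. (case p of (\<sigma>, \<rho>) \<Rightarrow> 
        op_comp (ns_presented s A Rs) m (\<sigma> i) n (cos m Y \<sigma>) (cos n Z \<rho>)))"
      using True by (simp add: sym_operad_def ns_presented_simps(2) case_prod_beta del: One_nat_def)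
    also have "(\<Sum>p\<in>?P. (case p of (\<sigma>, \<rho>) \<Rightarrow> op_comp (ns_presented s A Rs) m (\<sigma> i) n (cos m Y \<sigma>) (cos n Z \<rho>)))
      = (\<Sum>p\<in>?P. (case p of (\<sigma>, \<rho>) \<Rightarrow> bilin_ext (\<lambda>t u. graft t (\<sigma> i) u) (Y \<sigma>) (Z \<rho>)) +o I ?N)"
    proof (rule sum.cong[OF refl])
      fix p assume "p \<in> ?P"
      then obtain \<sigma> \<rho> where p: "p = (\<sigma>, \<rho>)" "\<sigma> permutes {1..m}" "\<rho> permutes {1..n}" by blast
      have i: "1 \<le> \<sigma> i" "\<sigma> i \<le> m" using permutes_in_image[OF p(2), of i] assms(3,4) by auto
      have "Y \<sigma> \<in> tree_space A m" "Z \<rho> \<in> tree_space A n" using assms p by (auto simp: sym_space_iff)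
      from comp_coset_pres_ideal[OF A.module_axioms subA RA this i]
      show "(case p of (\<sigma>, \<rho>) \<Rightarrow> op_comp (ns_presented s A Rs) m (\<sigma> i) n (cos m Y \<sigma>) (cos n Z \<rho>))
        = (case p of (\<sigma>, \<rho>) \<Rightarrow> bilin_ext (\<lambda>t u. graft t (\<sigma> i) u) (Y \<sigma>) (Z \<rho>)) +o I ?N"
        using p by (simp only: prod.case ns_presented_simps coset_family_def if_True)
    qed
    \<comment> \<open>A permutation that is no composite gives an empty sum; the summand
      \<open>I ?N\<close> makes the result a coset there as well.\<close>
    also have "I ?N + \<dots> = (\<Sum>p\<in>?P. (case p of (\<sigma>, \<rho>) \<Rightarrow> bilin_ext (\<lambda>t u. graft t (\<sigma> i) u) (Y \<sigma>) (Z \<rho>))) +o I ?N"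
      by (rule sum_cosets[OF add_sub_pres_ideal finite_pairs])
    finally show ?thesis using True by (simp only: coset_family_def sym_comp_def if_True)
  next
    case False
    then show ?thesis by (simp add: coset_family_def sym_operad_def del: One_nat_def)
  qed
qed

lemma cos_eq_iff: "cos n Y = cos n Z \<longleftrightarrow> (\<forall>\<sigma>. \<sigma> permutes {1..n} \<longrightarrow> Y \<sigma> - Z \<sigma> \<in> I n)"
  by (rule coset_family_eq_iff[OF add_sub_pres_ideal])

lemma cos_add: "cos n Y + cos n Z = cos n (Y + Z)"
  by (rule coset_family_add[OF add_sub_pres_ideal])

end

section \<open>Operations on classes in a symmetric presented operad\<close>

context sym_data
begin

context
  fixes R :: "((nat \<Rightarrow> nat) \<Rightarrow> ('e tree \<Rightarrow>\<^sub>0 'k)) set"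
  assumes RE: "R \<subseteq> sym_space E 3"
begin

abbreviation "SP \<equiv> sym_presented s E \<tau> R"
abbreviation "SJ \<equiv> SI R"

lemma P_eq_iff: "X +o SJ n = Y +o SJ n \<longleftrightarrow> X - Y \<in> SJ n"
  by (rule coset_eq_iff[OF add_sub_SI[OF RE]])

lemma P_add: "(X +o SJ n) + (Y +o SJ n) = (X + Y) +o SJ n"
  by (rule coset_add[OF add_sub_SI[OF RE]])

lemma P_mem_space: "X \<in> sym_space E n \<Longrightarrow> X' \<in> X +o SJ n \<Longrightarrow> X' \<in> sym_space E n"
proof -
  assume X: "X \<in> sym_space E n" and "X' \<in> X +o SJ n"
  then have "X' - X \<in> sym_space E n" using SI_space[OF RE] by (simp only: coset_mem)
  from sym_space_closed(2)[OF X this] show "X' \<in> sym_space E n" by (simp only: add_diff_eq add_diff_cancel_left')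
qed

lemma P_scale: assumes "X \<in> sym_space E n" shows "op_scale SP n c (X +o SJ n) = sym_scale c X +o SJ n"
  unfolding sym_presented_simps
proof (rule plus_coset_eq[OF add_sub_SI[OF RE]])
  show "sym_scale c X \<in> op_scale (sym_operad (tree_operad E)) n c ` (X +o SJ n)"
    using coset_self[OF add_sub_SI[OF RE]] sym_operad_simps(3)[OF assms] by (metis imageI)
  fix Y assume "Y \<in> op_scale (sym_operad (tree_operad E)) n c ` (X +o SJ n)"
  then obtain X' where X': "Y = op_scale (sym_operad (tree_operad E)) n c X'" "X' \<in> X +o SJ n" by blast
  have Y: "Y = sym_scale c X'" unfolding X'(1) by (rule sym_operad_simps(3)[OF P_mem_space[OF assms X'(2)]])
  from X'(2) have "X' - X \<in> SJ n" by (simp only: coset_mem)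
  from SI_scale[OF RE this, of c] show "Y - sym_scale c X \<in> SJ n"
    by (simp add: Y sym_scale_def fun_diff_def fsmul_algebra)
qed

lemma P_comp:
  assumes "X \<in> sym_space E m" "Y \<in> sym_space E n" "1 \<le> i" "i \<le> m"
  shows "op_comp SP m i n (X +o SJ m) (Y +o SJ n) = sym_comp m i n X Y +o SJ (m + n - 1)"
  unfolding sym_presented_simps
proof (rule plus_coset_eq[OF add_sub_SI[OF RE]])
  show "sym_comp m i n X Y \<in> {sym_comp m i n X' Y' | X' Y'. X' \<in> X +o SJ m \<and> Y' \<in> Y +o SJ n}"
    using coset_self[OF add_sub_SI[OF RE]] by blast
  fix Z assume "Z \<in> {sym_comp m i n X' Y' | X' Y'. X' \<in> X +o SJ m \<and> Y' \<in> Y +o SJ n}"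
  then obtain X' Y' where Z: "Z = sym_comp m i n X' Y'" "X' \<in> X +o SJ m" "Y' \<in> Y +o SJ n" by blast
  then have d: "X' - X \<in> SJ m" "Y' - Y \<in> SJ n" by (simp_all only: coset_mem)
  have "Z - sym_comp m i n X Y = sym_comp m i n (X' - X) Y' + sym_comp m i n X (Y' - Y)"
    unfolding Z(1) sym_comp_linear by (simp only: diff_add_cancel diff_diff_eq2 add_diff_eq)
  also have "\<dots> \<in> SJ (m + n - 1)"
    by (intro SI_add SI_comp_left SI_comp_right assms d P_mem_space[OF assms(2) Z(3)])
  finally show "Z - sym_comp m i n X Y \<in> SJ (m + n - 1)" .
qed

lemma P_act:
  assumes "\<rho> permutes {1..n}" shows "op_act SP n \<rho> (X +o SJ n) = sym_act \<rho> X +o SJ n"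
  unfolding sym_presented_simps
proof (rule set_eqI, rule iffI)
  fix Y assume "Y \<in> sym_act \<rho> ` (X +o SJ n)"
  then obtain X' where X': "Y = sym_act \<rho> X'" "X' - X \<in> SJ n" by (auto simp only: coset_mem)
  from SI_act[OF X'(2) assms] show "Y \<in> sym_act \<rho> X +o SJ n"
    unfolding X'(1) coset_mem sym_act_linear .
next
  fix Y assume "Y \<in> sym_act \<rho> X +o SJ n"
  then have "Y - sym_act \<rho> X \<in> SJ n" by (simp only: coset_mem)
  from SI_act[OF this permutes_inv[OF assms]] have d: "sym_act (inv \<rho>) Y - sym_act (inv \<rho>) (sym_act \<rho> X) \<in> SJ n"
    by (simp only: sym_act_linear)
  have 1: "sym_act (inv \<rho>) (sym_act \<rho> X) = X" "sym_act \<rho> (sym_act (inv \<rho>) Y) = Y"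
    using permutes_inverses[OF assms] permutes_inv_inv[OF assms] by (auto simp: sym_act_def comp_def)
  then have "sym_act (inv \<rho>) Y \<in> X +o SJ n" using d by (simp only: coset_mem)
  then show "Y \<in> sym_act \<rho> ` (X +o SJ n)" using 1(2) by (metis imageI)
qed

end

end

text \<open>The isomorphism is induced by \<open>D\<close>. It is well defined and injective by
  \<open>SI_iff\<close>, and onto because \<open>D\<close> inverts \<open>C\<close> exactly.\<close>

lemma (in split_data) sym_presented_iso:
  fixes R :: "((nat \<Rightarrow> nat) \<Rightarrow> ('e tree \<Rightarrow>\<^sub>0 'k)) set" and Rs :: "('a tree \<Rightarrow>\<^sub>0 'k) set"
  assumes RE: "R \<subseteq> sym_space E 3" and RA: "Rs \<subseteq> tree_space A 3"
    and D_R: "\<And>X \<sigma>. X \<in> R \<Longrightarrow> \<sigma> permutes {1..3} \<Longrightarrow> D 3 X \<sigma> \<in> pres_ideal s A Rs 3"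
    and C_R: "\<And>r. r \<in> Rs \<Longrightarrow> sym_elem (relab \<gamma> r) id \<in> SI R 3"
  shows "sym_isomorphic (sym_presented t E \<tau> R) (sym_operad (ns_presented s A Rs))"
proof -
  interpret N: ns_data s A Rs by unfold_locales (rule subA RA)+
  let ?J = "SI R" and ?I = "pres_ideal s A Rs" and ?P = "sym_presented t E \<tau> R"
  have iff: "X \<in> ?J n \<longleftrightarrow> X \<in> sym_space E n \<and> (\<forall>\<sigma>. \<sigma> permutes {1..n} \<longrightarrow> D n X \<sigma> \<in> ?I n)" for X n
    by (rule SI_iff[OF RE RA]) (use D_R C_R in blast)+
  \<comment> \<open>The map is defined on sets, so a representative is chosen; the next claim shows
    independence of the choice.\<close>
  define rep where "rep n K = (SOME X. X \<in> sym_space E n \<and> K = X +o ?J n)" for n K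
  define \<phi> where "\<phi> n K = N.cos n (D n (rep n K))" for n K
  have \<phi>: "\<phi> n (X +o ?J n) = N.cos n (D n X)" if X: "X \<in> sym_space E n" for n X
  proof -
    have "rep n (X +o ?J n) \<in> sym_space E n \<and> X +o ?J n = rep n (X +o ?J n) +o ?J n"
      unfolding rep_def using X by (intro someI_ex[of "\<lambda>X'. X' \<in> sym_space E n \<and> X +o ?J n = X' +o ?J n"]) blast
    then have "rep n (X +o ?J n) - X \<in> ?J n" using P_eq_iff[OF RE] by metis
    then have "D n (rep n (X +o ?J n) - X) \<sigma> \<in> ?I n" if "\<sigma> permutes {1..n}" for \<sigma> using iff that by blast
    then show ?thesis unfolding \<phi>_def N.cos_eq_iff D_linear by simp
  qed
  have sp: "K \<in> op_space ?P n \<longleftrightarrow> (\<exists>X\<in>sym_space E n. K = X +o ?J n)" for K n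
    by (auto simp: sym_presented_simps)
  have iso: "ns_operad_iso ?P N.Q \<phi>"
    unfolding ns_operad_iso_def
  proof (intro conjI allI impI)
    fix n
    show "linear_map_on (op_scale ?P n) (op_space ?P n) (op_scale N.Q n) (op_space N.Q n) (\<phi> n)"
      unfolding linear_map_on_def
    proof (intro conjI ballI allI)
      fix K assume "K \<in> op_space ?P n"
      then obtain X where X: "X \<in> sym_space E n" "K = X +o ?J n" using sp[of K n] by blast
      then show "\<phi> n K \<in> op_space N.Q n" using D_space by (auto simp: \<phi> N.Q_space)
      fix c show "\<phi> n (op_scale ?P n c K) = op_scale N.Q n c (\<phi> n K)"
        using X sym_space_closed(4)[OF X(1), of c] by (simp only: P_scale[OF RE] \<phi> N.Q_scale D_linear)
    next
      fix K L assume "K \<in> op_space ?P n" "L \<in> op_space ?P n"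
      then obtain X Y where XY: "X \<in> sym_space E n" "K = X +o ?J n" "Y \<in> sym_space E n" "L = Y +o ?J n" using sp[of K] sp[of L] by blast
      then show "\<phi> n (K + L) = \<phi> n K + \<phi> n L"
        using sym_space_closed(2)[OF XY(1,3)] by (simp only: P_add[OF RE] \<phi> N.cos_add D_linear)
    qed
    show "bij_betw (\<phi> n) (op_space ?P n) (op_space N.Q n)"
      unfolding bij_betw_def
    proof
      show "inj_on (\<phi> n) (op_space ?P n)"
      proof (rule inj_onI)
        fix K L assume "K \<in> op_space ?P n" "L \<in> op_space ?P n" and eq: "\<phi> n K = \<phi> n L"
        then obtain X Y where XY: "X \<in> sym_space E n" "K = X +o ?J n" "Y \<in> sym_space E n" "L = Y +o ?J n" using sp[of K] sp[of L] by blast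
        have "N.cos n (D n X) = N.cos n (D n Y)" using eq XY by (simp only: \<phi>)
        then have "D n X \<sigma> - D n Y \<sigma> \<in> ?I n" if "\<sigma> permutes {1..n}" for \<sigma>
          using that unfolding N.cos_eq_iff by blast
        then have "D n (X - Y) \<sigma> \<in> ?I n" if "\<sigma> permutes {1..n}" for \<sigma> using that unfolding D_linear by simp
        then have "X - Y \<in> ?J n" using iff sym_space_closed(3)[OF XY(1,3)] by blast
        then show "K = L" using P_eq_iff[OF RE] XY by blast
      qed
      show "\<phi> n ` op_space ?P n = op_space N.Q n"
      proof (rule set_eqI, rule iffI)
        fix f assume "f \<in> \<phi> n ` op_space ?P n"
        then obtain K where K: "f = \<phi> n K" "K \<in> op_space ?P n" by (rule imageE)
        then obtain X where "X \<in> sym_space E n" "K = X +o ?J n" using sp[of K n] by blast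
        then show "f \<in> op_space N.Q n" using D_space[of X n] K(1) by (simp add: \<phi> N.Q_space)
      next
        fix f assume "f \<in> op_space N.Q n"
        then obtain Y where Y: "Y \<in> sym_space A n" "f = N.cos n Y" by (auto simp: N.Q_space)
        have "f = \<phi> n (C Y +o ?J n)" using C_space[OF Y(1)] Y D_C[OF Y(1)] by (simp only: \<phi>)
        moreover have "C Y +o ?J n \<in> op_space ?P n" using sp[of "C Y +o ?J n" n] C_space[OF Y(1)] by blast
        ultimately show "f \<in> \<phi> n ` op_space ?P n" by (rule image_eqI)
      qed
    qed
  next
    fix m n i K L
    assume i: "(1::nat) \<le> i" "i \<le> m" and "K \<in> op_space ?P m" "L \<in> op_space ?P n"
    then obtain X Y where XY: "X \<in> sym_space E m" "K = X +o ?J m" "Y \<in> sym_space E n" "L = Y +o ?J n" using sp[of K] sp[of L] by blast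
    show "\<phi> (m + n - 1) (op_comp ?P m i n K L) = op_comp N.Q m i n (\<phi> m K) (\<phi> n L)"
      unfolding XY P_comp[OF RE XY(1,3) i] \<phi>[OF XY(1)] \<phi>[OF XY(3)] \<phi>[OF sym_comp_space[OF XY(1,3) i]]
        N.Q_comp[OF D_space[OF XY(1)] D_space[OF XY(3)] i] D_comp[OF XY(1,3) i] ..
  next
    have u: "sym_elem (basis_vec \<langle>\<rangle>) id \<in> sym_space A 1" by (intro sym_elem_space permutes_id) simp
    \<comment> \<open>The unit carries no label, so it is fixed by \<open>C\<close> and hence by
      \<open>D\<close>.\<close>
    have C: "C (sym_elem (basis_vec \<langle>\<rangle>) id) = sym_elem (basis_vec \<langle>\<rangle>) id" by (simp add: sym_relab_elem)
    show "\<phi> 1 (op_unit ?P) = op_unit N.Q"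
      using \<phi>[OF C_space[OF u]] D_C[OF u] unfolding C sym_presented_simps N.Q_unit by (simp only:)
  qed
  show ?thesis
  proof (rule sym_isomorphicI[OF iso])
    fix n \<sigma> K assume \<sigma>: "\<sigma> permutes {1..n}" and "K \<in> op_space ?P n"
    then obtain X where X: "X \<in> sym_space E n" "K = X +o ?J n" using sp[of K n] by blast
    show "\<phi> n (op_act ?P n \<sigma> K) = op_act N.Q n \<sigma> (\<phi> n K)"
      unfolding X(2) P_act[OF RE \<sigma>] \<phi>[OF X(1)] \<phi>[OF sym_act_space[OF X(1) \<sigma>]] N.Q_act[OF \<sigma>] D_act[OF X(1) \<sigma>] ..
  qed
qed

section \<open>Ideals in low arities\<close>

text \<open>The value at a leaf is a dummy. Extended linearly, the label evaluates a combination of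
  corollas to an element of the space of generators.\<close>

definition root_label :: "'e tree \<Rightarrow> 'e::zero" where
  "root_label t = (case t of \<langle>\<rangle> \<Rightarrow> 0 | \<langle>l, a, r\<rangle> \<Rightarrow> a)"

lemma root_label_corolla [simp]: "root_label (corolla a) = a"
  by (simp add: root_label_def)

lemma size1_eq_2: assumes "size1 t = 2" obtains a where "t = corolla a"
proof -
  have s1: "size1 t = 1 \<longleftrightarrow> t = \<langle>\<rangle>" for t :: "'a tree" by (cases t) (auto simp: size1_size)
  obtain l a r where t: "t = \<langle>l, a, r\<rangle>" using assms by (cases t) auto
  have "size1 l + size1 r = 2" "size1 l \<ge> 1" "size1 r \<ge> 1" using assms t by (auto simp: size1_size)
  then have "size1 l = 1" "size1 r = 1" by linarith+
  then show ?thesis using that t s1 by blast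
qed

lemma tree_space_0: assumes "x \<in> tree_space E 0" shows "x = 0"
  using assms by (induction x rule: tree_space_induct) (auto simp: size1_size)

lemma tree_space_1:
  assumes "x \<in> tree_space E 1" shows "\<exists>c. x = fsmul c (basis_vec \<langle>\<rangle>)"
  using assms
proof (induction x rule: tree_space_induct)
  case zero
  show ?case by (rule exI[of _ 0]) simp
next
  case (basis c t)
  then have "t = \<langle>\<rangle>" by (cases t) (auto simp: size1_size)
  then show ?case by blast
next
  case (add x y)
  then show ?case by (metis fsmul_algebra(3))
qed

lemma tree_space_2:
  assumes "x \<in> tree_space E 2" "P 0" "\<And>c a. a \<in> E \<Longrightarrow> P (fsmul c (basis_vec (corolla a)))"
    "\<And>x y. P x \<Longrightarrow> P y \<Longrightarrow> x \<in> tree_space E 2 \<Longrightarrow> y \<in> tree_space E 2 \<Longrightarrow> P (x + y)"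
  shows "P x"
  using assms(1)
proof (induction x rule: tree_space_induct)
  case (basis c t)
  from basis(1) obtain a where "t = corolla a" by (rule size1_eq_2)
  then show ?case using basis assms(3) by simp
qed (use assms in auto)

lemma graft_leaf: "graft t i \<langle>\<rangle> = t"
  by (induction t arbitrary: i) auto

lemma lin_ext_id: "lin_ext (\<lambda>t. t) x = x"
  by (simp add: lin_ext_lext lext_def decompose_basis[symmetric])

context ns_data
begin

lemma root_value_corolla: "lext s root_label (basis_vec (corolla a)) = a"
  by (simp add: lext_basis[OF vsA])

lemmas root_value_simps = flin_add[OF flin_lext[OF vsA]] flin_diff[OF flin_lext[OF vsA]]
  flin_scale[OF flin_lext[OF vsA]] flin_zero[OF flin_lext[OF vsA]] root_value_corolla

text \<open>A composite of arity at most 2 has a factor of arity 1, which is a multiple of the unit,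
  or of arity 0, which is zero. So no relations arise there except linearity, and these have value
  0.\<close>

lemma ideal_low_arity:
  assumes "x \<in> I n" shows "(n \<le> 1 \<longrightarrow> x = 0) \<and> (n = 2 \<longrightarrow> lext s root_label x = 0)"
  using assms
proof (induction rule: pres_ideal_induct)
  case (lin x)
  then show ?case by (auto simp: corolla_lin_rels_def root_value_simps)
next
  case (left m n i x y)
  consider "n = 0" | "n = 1" | "n \<ge> 2" by linarith
  then show ?case
  proof cases
    case 1
    then have "y = 0" using left by (simp add: tree_space_0)
    then show ?thesis by (simp add: bilin_simps root_value_simps)
  next
    case 2
    then obtain c where "y = fsmul c (basis_vec \<langle>\<rangle>)" using left tree_space_1 by auto
    then have "bilin_ext (\<lambda>t u. graft t i u) x y = fsmul c x"
      by (simp add: bilin_simps bilin_ext_basis_right graft_leaf lin_ext_id)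
    then show ?thesis using left 2 by (auto simp: root_value_simps bilin_simps)
  next
    case 3
    then show ?thesis using left by (cases "m = 1") (auto simp: bilin_simps root_value_simps)
  qed
next
  case (right m n i x y)
  consider "m = 1" | "n \<le> 1" | "m \<ge> 2" "n \<ge> 2" using right by linarith
  then show ?case
  proof cases
    case 1
    then obtain c where c: "x = fsmul c (basis_vec \<langle>\<rangle>)" using right tree_space_1 by auto
    have e: "graft \<langle>\<rangle> i = (\<lambda>u :: 'a tree. u)" by (rule ext) simp
    from c have "bilin_ext (\<lambda>t u. graft t i u) x y = fsmul c y"
      using e by (simp only: bilin_simps bilin_ext_basis_left lin_ext_id)
    then show ?thesis using right 1 by (auto simp: root_value_simps bilin_simps)
  next
    case 2
    then have "y = 0" using right by simp
    then show ?thesis by (simp add: bilin_simps root_value_simps)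
  next
    case 3
    then have "\<not> m + n - 1 \<le> 1" "m + n - 1 \<noteq> 2" by linarith+
    then show ?thesis by (simp only: simp_thms)
  qed
qed (auto simp: root_value_simps)

lemma root_value_in: assumes "x \<in> tree_space A 2" shows "lext s root_label x \<in> A"
  using assms
  by (rule tree_space_2) (auto simp: root_value_simps A.subspace_0[OF subA] A.subspace_add[OF subA] A.subspace_scale[OF subA])

text \<open>Modulo linearity, a combination of corollas is one corolla, labelled by the combination
  of the labels.\<close>

lemma arity_2_representative:
  assumes "x \<in> tree_space A 2" shows "x - basis_vec (corolla (lext s root_label x)) \<in> I 2"
  using assms
proof (rule tree_space_2)
  have "basis_vec (corolla (s 0 0)) - fsmul 0 (basis_vec (corolla 0)) \<in> I 2"
    using A.subspace_0[OF subA] by (intro pres_ideal_lin corolla_lin_relsI)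
  from I_sub(3)[OF this] show "0 - basis_vec (corolla (lext s root_label 0)) \<in> I 2"
    by (simp add: root_value_simps)
next
  fix c a assume "a \<in> A"
  then have "basis_vec (corolla (s c a)) - fsmul c (basis_vec (corolla a)) \<in> I 2"
    by (intro pres_ideal_lin corolla_lin_relsI)
  from I_sub(3)[OF this] show "fsmul c (basis_vec (corolla a)) - basis_vec (corolla (lext s root_label (fsmul c (basis_vec (corolla a))))) \<in> I 2"
    by (simp add: root_value_simps)
next
  fix x y assume xy: "x - basis_vec (corolla (lext s root_label x)) \<in> I 2" "y - basis_vec (corolla (lext s root_label y)) \<in> I 2"
    "x \<in> tree_space A 2" "y \<in> tree_space A 2"
  let ?a = "lext s root_label x" and ?b = "lext s root_label y"
  have "basis_vec (corolla (?a + ?b)) - basis_vec (corolla ?a) - basis_vec (corolla ?b) \<in> I 2"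
    by (intro pres_ideal_lin corolla_lin_relsI root_value_in xy)
  from I_sub(2)[OF I_sub(4)[OF xy(1,2)] this]
  show "x + y - basis_vec (corolla (lext s root_label (x + y))) \<in> I 2"
    by (simp add: root_value_simps algebra_simps)
qed

end

section \<open>Symmetric ideals in arities up to three\<close>

lemma sym_space_0: assumes "X \<in> sym_space E 0" shows "X = 0"
proof
  fix \<sigma>
  show "X \<sigma> = 0 \<sigma>"
    using assms tree_space_0[of "X \<sigma>" E] by (cases "\<sigma> permutes {1..0}") (auto simp: sym_space_iff)
qed

lemma sym_space_1:
  assumes "X \<in> sym_space E 1" shows "\<exists>c. X = sym_scale c (sym_elem (basis_vec \<langle>\<rangle>) id)"
proof -
  have p: "\<sigma> permutes {1..1} \<longleftrightarrow> \<sigma> = id" for \<sigma> :: "nat \<Rightarrow> nat" by simp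
  have "X id \<in> tree_space E 1" using assms by (simp add: sym_space_iff)
  then obtain c where c: "X id = fsmul c (basis_vec \<langle>\<rangle>)" using tree_space_1 by blast
  have "X \<sigma> = sym_scale c (sym_elem (basis_vec \<langle>\<rangle>) id) \<sigma>" for \<sigma>
    using assms c unfolding sym_space_iff p by (auto simp: sym_scale_def sym_elem_def)
  then show ?thesis by blast
qed

lemma sym_comp_scale:
  "sym_comp m i n (sym_scale c X) Y = sym_scale c (sym_comp m i n X Y)"
  "sym_comp m i n X (sym_scale c Y) = sym_scale c (sym_comp m i n X Y)"
  by (auto simp: sym_comp_def sym_scale_def fun_eq_iff bilin_simps fsmul_sum case_prod_beta)

text \<open>On labelled trees the unit is the single leaf labelled 1, for which both substitutions
  are trivial.\<close>

lemma sym_comp_unit: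
  assumes "X \<in> sym_space E m"
  shows "1 \<le> i \<Longrightarrow> i \<le> m \<Longrightarrow> sym_comp m i 1 X (sym_elem (basis_vec \<langle>\<rangle>) id) = X"
    "sym_comp 1 1 m (sym_elem (basis_vec \<langle>\<rangle>) id) X = X"
proof -
  let ?U = "sym_elem (basis_vec \<langle>\<rangle>) id :: _ \<Rightarrow> _ \<Rightarrow>\<^sub>0 'b"
  have U: "?U \<in> sym_space E 1" by (intro sym_elem_space permutes_id) simp
  have id1: "id permutes {1..1::nat}" by (rule permutes_id)
  have \<theta>: "theta 1 ?U = basis_vec (Lf 1)" unfolding theta_elem[OF id1] by simp
  show "sym_comp m i 1 X ?U = X" if i: "1 \<le> i" "i \<le> m"
  proof (rule theta_inj)
    have m: "m + 1 - 1 = m" by simp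
    show "sym_comp m i 1 X ?U \<in> sym_space E m" using sym_comp_space[OF assms U i] unfolding m .
    have "lsubst i 1 z (Lf 1) = z" for z :: "'a ltree" using i(1) by (induction z) (auto simp: lshift_def)
    then show "theta m (sym_comp m i 1 X ?U) = theta m X"
      using theta_comp[OF assms U i] unfolding m \<theta> bilin_ext_basis_right by (simp only: lin_ext_id)
  qed (rule assms)
  show "sym_comp 1 1 m ?U X = X"
  proof (rule theta_inj)
    have m: "1 + m - 1 = m" by simp
    show "sym_comp 1 1 m ?U X \<in> sym_space E m" using sym_comp_space[OF U assms order_refl order_refl] unfolding m .
    have e: "lsubst 1 m (Lf 1) = (\<lambda>z :: 'a ltree. z)" by (rule ext) (simp add: lren_id)
    then show "theta m (sym_comp 1 1 m ?U X) = theta m X"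
      using theta_comp[OF U assms order_refl order_refl] unfolding m \<theta> bilin_ext_basis_left e by (simp only: lin_ext_id)
  qed (rule assms)
qed

lemma sym_act_act:
  assumes "\<rho> permutes S" "\<sigma> permutes S" shows "sym_act \<sigma> (sym_act \<rho> X) = sym_act (\<rho> \<circ> \<sigma>) X"
  using o_inv_distrib[OF permutes_bij[OF assms(1)] permutes_bij[OF assms(2)]]
  by (simp add: sym_act_def comp_assoc)

lemma id_neq_swap: "id \<noteq> Transposition.transpose (1::nat) 2"
proof
  assume "id = Transposition.transpose (1::nat) 2"
  then have "id 1 = Transposition.transpose (1::nat) 2 1" by metis
  then show False by simp
qed

context sym_data
begin

text \<open>Arity 2 of the free operad on a representation is the representation itself; a corolla
  with exchanged inputs is counted with \<tau> applied to its label.\<close>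

definition value2 :: "((nat \<Rightarrow> nat) \<Rightarrow> ('e tree \<Rightarrow>\<^sub>0 'k)) \<Rightarrow> 'e" where
  "value2 X = lext s root_label (X id) + lext s (\<lambda>u. \<tau> (root_label u)) (X swap)"

lemmas value_simps = flin_add[OF flin_lext[OF vs]] flin_diff[OF flin_lext[OF vs]]
  flin_scale[OF flin_lext[OF vs]] flin_zero[OF flin_lext[OF vs]] lext_basis[OF vs]

lemma value2_linear: "value2 (X + Y) = value2 X + value2 Y" "value2 (X - Y) = value2 X - value2 Y"
  "value2 (sym_scale c X) = s c (value2 X)" "value2 0 = 0"
  by (simp_all add: value2_def value_simps sym_scale_def E.scale_right_distrib)

lemma value2_elem: "value2 (sym_elem x id) = lext s root_label x"
  "value2 (sym_elem x swap) = lext s (\<lambda>u. \<tau> (root_label u)) x"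
  using id_neq_swap by (auto simp: value2_def sym_elem_def value_simps simp del: One_nat_def)

lemma tau_zero: "\<tau> 0 = 0"
  using tau_scale[of 0 0] E.subspace_0[OF sub] by simp

lemma value_tau:
  assumes "x \<in> tree_space E 2"
  shows "lext s root_label x \<in> E \<and> \<tau> (lext s root_label x) = lext s (\<lambda>u. \<tau> (root_label u)) x"
  using assms
proof (rule tree_space_2)
  show "lext s root_label 0 \<in> E \<and> \<tau> (lext s root_label 0) = lext s (\<lambda>u. \<tau> (root_label u)) 0"
    by (simp add: value_simps tau_zero E.subspace_0[OF sub])
qed (auto simp: value_simps tau_add tau_scale E.subspace_add[OF sub] E.subspace_scale[OF sub])

lemma value2_in: assumes "X \<in> sym_space E 2" shows "value2 X \<in> E"
  using value_tau[of "X id"] value_tau[of "X swap"] assms swap_permutes tau_in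
  unfolding value2_def sym_space_iff by (metis E.subspace_add[OF sub] permutes_id)

text \<open>Exchanging the two components amounts to applying the involution \<tau> to the
  value.\<close>

lemma value2_act:
  assumes "X \<in> sym_space E 2" "\<And>e. e \<in> E \<Longrightarrow> \<tau> (\<tau> e) = e" "value2 X = 0" "\<sigma> permutes {1..2}"
  shows "value2 (sym_act \<sigma> X) = 0"
  using assms(4)
proof (cases rule: permutes_2_cases)
  case 1
  then show ?thesis using assms(3) by (simp add: sym_act_def)
next
  case 2
  have X: "X id \<in> tree_space E 2" "X swap \<in> tree_space E 2"
    using assms(1) swap_permutes by (auto simp: sym_space_iff permutes_id simp del: One_nat_def)
  have "value2 (sym_act swap X) = lext s root_label (X swap) + lext s (\<lambda>u. \<tau> (root_label u)) (X id)"
    by (simp add: value2_def sym_act_def del: One_nat_def)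
  also have "\<dots> = \<tau> (lext s root_label (X id) + lext s (\<lambda>u. \<tau> (root_label u)) (X swap))"
    using value_tau[OF X(1)] value_tau[OF X(2)] tau_in assms(2) by (metis tau_add add.commute)
  also have "\<dots> = 0" using assms(3) tau_zero by (simp add: value2_def)
  finally show ?thesis using 2 by simp
qed

text \<open>By counting arities, arity 3 of the ideal comes from \<open>R\<close>, from composites
  of two elements of arity 2 one of which lies in the ideal, and from the action. A functional
  tested on these vanishes on the whole ideal.\<close>

lemma SI_low_arity:
  fixes L :: "((nat \<Rightarrow> nat) \<Rightarrow> ('e tree \<Rightarrow>\<^sub>0 'k)) \<Rightarrow> 'k"
  assumes RE: "R \<subseteq> sym_space E 3" and tt: "\<And>e. e \<in> E \<Longrightarrow> \<tau> (\<tau> e) = e"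
    and L_add: "\<And>X Y. L (X + Y) = L X + L Y" and L_scale: "\<And>c X. L (sym_scale c X) = c * L X"
    and L_R: "\<And>X \<sigma>. X \<in> R \<Longrightarrow> \<sigma> permutes {1..3} \<Longrightarrow> L (sym_act \<sigma> X) = 0"
    and L_2: "\<And>X Y i \<sigma>. X \<in> sym_space E 2 \<Longrightarrow> Y \<in> sym_space E 2 \<Longrightarrow> value2 X = 0 \<or> value2 Y = 0 \<Longrightarrow>
      1 \<le> i \<Longrightarrow> i \<le> 2 \<Longrightarrow> \<sigma> permutes {1..3} \<Longrightarrow> L (sym_act \<sigma> (sym_comp 2 i 2 X Y)) = 0"
    and "X \<in> SI R n"
  shows "(n \<le> 1 \<longrightarrow> X = 0) \<and> (n = 2 \<longrightarrow> value2 X = 0) \<and> (n = 3 \<longrightarrow> (\<forall>\<sigma>. \<sigma> permutes {1..3} \<longrightarrow> L (sym_act \<sigma> X) = 0))"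
proof -
  \<comment> \<open>All translates under the action are included, since otherwise the case of the
    action would not go through.\<close>
  define Pr where "Pr n X \<longleftrightarrow> (n \<le> 1 \<longrightarrow> X = 0) \<and> (n = 2 \<longrightarrow> value2 X = 0) \<and>
    (n = 3 \<longrightarrow> (\<forall>\<sigma>. \<sigma> permutes {1..3} \<longrightarrow> L (sym_act \<sigma> X) = 0))" for n :: nat and X
  have "L 0 + L 0 = L 0 + 0" using L_add[of 0 0] by (simp only: add_0_left add_0_right)
  then have L0: "L 0 = 0" by (rule add_left_imp_eq)
  have PrI: "Pr n X" if "n \<le> 1 \<Longrightarrow> X = 0" "n = 2 \<Longrightarrow> value2 X = 0"
    "\<And>\<sigma>. n = 3 \<Longrightarrow> \<sigma> permutes {1..3} \<Longrightarrow> L (sym_act \<sigma> X) = 0" for n X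
    using that by (simp only: Pr_def simp_thms) blast
  have Pr0: "Pr n 0" for n by (rule PrI) (simp_all only: value2_linear sym_act_linear L0)
  have scale0: "sym_scale c 0 = (0 :: (nat \<Rightarrow> nat) \<Rightarrow> 'e tree \<Rightarrow>\<^sub>0 'k)" for c by (simp add: sym_scale_def fun_eq_iff)
  have PrS: "Pr n (sym_scale c X)" if "Pr n X" for n c X
    using that by (intro PrI) (simp_all only: Pr_def value2_linear sym_act_linear L_scale mult_zero_right E.scale_zero_right scale0 simp_thms)
  have "X \<in> sym_space E n \<and> Pr n X"
    using assms(7) RE
  proof (induction rule: SI_induct)
    case (lin x)
    have "value2 (sym_elem x id) = 0"
      using lin by (auto simp: value2_elem corolla_lin_rels_def value_simps)
    then show ?case by (intro PrI) simp_all
  next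
    case (equiv e)
    have "value2 (sym_elem (basis_vec (corolla (\<tau> e))) id - sym_elem (basis_vec (corolla e)) swap) = 0"
      unfolding value2_linear value2_elem by (simp add: value_simps)
    then show ?case by (intro PrI; (assumption | simp))
  next
    case (rel X)
    then show ?case using L_R by (intro PrI) simp_all
  next
    case (zero n)
    show ?case by (rule Pr0)
  next
    case (add n X Y)
    then show ?case by (intro PrI) (simp_all only: Pr_def value2_linear sym_act_linear L_add add_0_left simp_thms)
  next
    case (scale n c X)
    then show ?case by (intro PrS)
  next
    case (left m n i X Y)
    consider "n = 0" | "n = 1" | "n \<ge> 2" "m = 1" | "n = 2" "m = 2" | "m + n - 1 \<ge> 4" using left(4,5) by linarith
    then show ?case
    proof cases
      case 1
      then have "Y = 0" using left(3) sym_space_0 by blast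
      then show ?thesis using Pr0 by (simp only: sym_comp_linear)
    next
      case 2
      then obtain c where c: "Y = sym_scale c (sym_elem (basis_vec \<langle>\<rangle>) id)" using left(3) sym_space_1 by blast
      have "sym_comp m i n X Y = sym_scale c X"
        unfolding c 2 sym_comp_scale sym_comp_unit(1)[OF left(2,4,5)] ..
      then show ?thesis using PrS[OF left(1)] 2 by simp
    next
      case 3
      then have "X = 0" using left(1) by (simp add: Pr_def)
      then show ?thesis using Pr0 by (simp only: sym_comp_linear)
    next
      case 4
      then have "value2 X = 0" using left(1) by (simp add: Pr_def)
      then show ?thesis using L_2 4 left by (intro PrI) auto
    next
      case 5
      then show ?thesis by (intro PrI) linarith+
    qed
  next
    case (right m n i X Y)
    consider "n \<le> 1" | "n \<ge> 2" "m = 1" | "n = 2" "m = 2" | "m + n - 1 \<ge> 4" using right(4,5) by linarith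
    then show ?case
    proof cases
      case 1
      then have "Y = 0" using right(2) by (simp add: Pr_def)
      then show ?thesis using Pr0 by (simp only: sym_comp_linear)
    next
      case 2
      then obtain c where c: "X = sym_scale c (sym_elem (basis_vec \<langle>\<rangle>) id)" using right(1) sym_space_1 by blast
      have i: "i = 1" using right(4,5) 2 by simp
      have "sym_comp m i n X Y = sym_scale c Y"
        unfolding c 2 i sym_comp_scale sym_comp_unit(2)[OF right(3)] ..
      then show ?thesis using PrS[OF right(2)] 2 by simp
    next
      case 3
      then have "value2 Y = 0" using right(2) by (simp add: Pr_def)
      then show ?thesis using L_2 3 right by (intro PrI) auto
    next
      case 4
      then show ?thesis by (intro PrI) linarith+
    qed
  next
    case (act n \<rho> X)
    show ?case
    proof (rule PrI)
      assume "n \<le> 1"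
      then have "X = 0" using act(1) by (simp add: Pr_def)
      then show "sym_act \<rho> X = 0" by (simp only: sym_act_linear)
    next
      assume n: "n = 2"
      then have "value2 X = 0" using act(1) by (simp add: Pr_def)
      then show "value2 (sym_act \<rho> X) = 0" using value2_act tt act(2,3) n by blast
    next
      fix \<sigma> :: "nat \<Rightarrow> nat" assume n: "n = 3" and \<sigma>: "\<sigma> permutes {1..3}"
      have \<rho>: "\<rho> permutes {1..3}" using act(3) n by simp
      have "\<rho> \<circ> \<sigma> permutes {1..3}" by (rule permutes_compose[OF \<sigma> \<rho>])
      then show "L (sym_act \<sigma> (sym_act \<rho> X)) = 0"
        unfolding sym_act_act[OF \<rho> \<sigma>] using act(1) n by (simp add: Pr_def)
    qed
  qed
  then show ?thesis by (simp add: Pr_def)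
qed

lemma SI_arity_2:
  assumes "R \<subseteq> sym_space E 3" "\<And>e. e \<in> E \<Longrightarrow> \<tau> (\<tau> e) = e" "X \<in> SI R 2"
  shows "value2 X = 0"
  using SI_low_arity[of R "\<lambda>_. 0" X 2] assms by simp

text \<open>Linearity reduces each component to one corolla; equivariance moves the one with
  exchanged inputs to the identity, and linearity merges the two.\<close>

lemma SI_arity_2_representative:
  assumes RE: "R \<subseteq> sym_space E 3" and X: "X \<in> sym_space E 2"
  shows "X - sym_elem (basis_vec (corolla (value2 X))) id \<in> SI R 2"
proof -
  let ?c = "\<lambda>e. sym_elem (basis_vec (corolla e)) id :: (nat \<Rightarrow> nat) \<Rightarrow> 'e tree \<Rightarrow>\<^sub>0 'k"
  note J = add_subD[OF add_sub_SI[OF RE, of 2]]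
  \<comment> \<open>With no relations of arity 3, the nonsymmetric ideal contains just consequences
    of linearity; these lie in every symmetric ideal.\<close>
  interpret N: ns_data s E "{}" by unfold_locales (auto simp: sub)
  have I: "sym_elem x id \<in> SI R 2" if "x \<in> pres_ideal s E {} 2" for x
  proof -
    have "sym_elem x id \<in> SI R n" if "x \<in> pres_ideal s E {} n" for x n
      using that
    proof (induction rule: pres_ideal_induct)
      case (lin x)
      then show ?case by (rule SI_lin)
    next
      case (left m n i x y)
      have "sym_elem y id \<in> sym_space E n" using left by (intro sym_elem_space permutes_id) auto
      from SI_comp_left[OF left(1) this left(3,4)] show ?case by (simp only: sym_comp_elem_id[OF left(3,4)])
    next
      case (right m n i x y)
      have "sym_elem x id \<in> sym_space E m" using right by (intro sym_elem_space permutes_id) auto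
      from SI_comp_right[OF this right(4,2,3)] show ?case by (simp only: sym_comp_elem_id[OF right(2,3)])
    qed (simp_all only: sym_elem_linear SI_zero SI_add SI_scale[OF RE] empty_iff)
    then show ?thesis using that .
  qed
  have x: "X id \<in> tree_space E 2" "X swap \<in> tree_space E 2"
    using X swap_permutes by (auto simp: sym_space_iff permutes_id simp del: One_nat_def)
  let ?a = "lext s root_label (X id)" and ?b = "lext s root_label (X swap)"
  have ab: "?a \<in> E" "?b \<in> E" "lext s (\<lambda>u. \<tau> (root_label u)) (X swap) = \<tau> ?b"
    using value_tau x by auto
  have Xd: "X = sym_elem (X id) id + sym_elem (X swap) swap"
  proof
    fix \<sigma>
    show "X \<sigma> = (sym_elem (X id) id + sym_elem (X swap) swap) \<sigma>"
    proof (cases "\<sigma> permutes {1..2}")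
      case True
      then show ?thesis
        by (cases rule: permutes_2_cases) (use id_neq_swap in \<open>auto simp: sym_elem_def simp del: One_nat_def\<close>)
    next
      case False
      then have "\<sigma> \<noteq> id" "\<sigma> \<noteq> swap" using swap_permutes permutes_id by metis+
      then show ?thesis using X False by (simp add: sym_elem_def sym_space_iff)
    qed
  qed
  have 1: "sym_elem (X id) id - ?c ?a \<in> SI R 2"
    using I[OF N.arity_2_representative[OF x(1)]] by (simp only: sym_elem_linear)
  have "sym_act swap (sym_elem (X swap - basis_vec (corolla ?b)) id) \<in> SI R 2"
    by (rule SI_act[OF I[OF N.arity_2_representative[OF x(2)]] swap_permutes])
  then have 2: "sym_elem (X swap) swap - sym_elem (basis_vec (corolla ?b)) swap \<in> SI R 2"
    by (simp only: sym_act_elem[OF swap_permutes] sym_elem_linear sym_act_linear id_comp)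
  have 3: "?c (\<tau> ?b) - sym_elem (basis_vec (corolla ?b)) swap \<in> SI R 2" by (rule SI_equiv[OF ab(2)])
  have 4: "?c (?a + \<tau> ?b) - ?c ?a - ?c (\<tau> ?b) \<in> SI R 2"
    using SI_lin[OF corolla_lin_relsI(1)[OF ab(1) tau_in[OF ab(2)]]] by (simp only: sym_elem_linear)
  have v: "value2 X = ?a + \<tau> ?b" by (simp add: value2_def ab(3) del: One_nat_def)
  have gen: "(x1 + x2) - c = (x1 - ca) + ((x2 - s2) - (cb - s2)) - (c - ca - cb)"
    for x1 x2 c ca cb s2 :: "(nat \<Rightarrow> nat) \<Rightarrow> 'e tree \<Rightarrow>\<^sub>0 'k" by (simp add: fun_eq_iff)
  have "X - ?c (value2 X) = (sym_elem (X id) id - ?c ?a) +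
      ((sym_elem (X swap) swap - sym_elem (basis_vec (corolla ?b)) swap) - (?c (\<tau> ?b) - sym_elem (basis_vec (corolla ?b)) swap))
      - (?c (?a + \<tau> ?b) - ?c ?a - ?c (\<tau> ?b))"
    unfolding v by (subst Xd) (rule gen)
  also have "\<dots> \<in> SI R 2" by (rule J(2)[OF J(4)[OF 1 J(2)[OF 2 3]] 4])
  finally show ?thesis .
qed

lemma SI_mono: "R \<subseteq> R' \<Longrightarrow> R' \<subseteq> sym_space E 3 \<Longrightarrow> X \<in> SI R n \<Longrightarrow> X \<in> SI R' n"
proof -
  assume R: "R \<subseteq> R'" "R' \<subseteq> sym_space E 3" and X: "X \<in> SI R n"
  have "X \<in> sym_space E n \<and> X \<in> SI R' n"
    using X order_trans[OF R]
    by (induction rule: SI_induct)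
      (use R in \<open>blast intro: SI_lin SI_equiv SI_rel SI_zero SI_add SI_scale SI_comp_left SI_comp_right SI_act\<close>)+
  then show ?thesis ..
qed

end

section \<open>Recovering the generators from an isomorphism\<close>

lemma sym_scale_zero: "sym_scale 0 X = 0"
  by (simp add: sym_scale_def fun_eq_iff)

text \<open>An arbitrary equivariant isomorphism \<phi> is given, and a splitting of
  \<open>E\<close> together with the ideal of \<open>R\<close> is to be extracted from it.\<close>

locale presented_iso = ns_data s A Rs + sym_data t E \<tau>
  for s :: "'k::field \<Rightarrow> 'a::ab_group_add \<Rightarrow> 'a" and A :: "'a set" and Rs :: "('a tree \<Rightarrow>\<^sub>0 'k) set"
    and t :: "'k \<Rightarrow> 'e::ab_group_add \<Rightarrow> 'e" and E :: "'e set" and \<tau> :: "'e \<Rightarrow> 'e" +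
  fixes R :: "((nat \<Rightarrow> nat) \<Rightarrow> ('e tree \<Rightarrow>\<^sub>0 'k)) set"
    and \<phi> :: "nat \<Rightarrow> ((nat \<Rightarrow> nat) \<Rightarrow> ('e tree \<Rightarrow>\<^sub>0 'k)) set \<Rightarrow> (nat \<Rightarrow> nat) \<Rightarrow> ('a tree \<Rightarrow>\<^sub>0 'k) set"
  assumes RE: "R \<subseteq> sym_space E 3" and tt: "\<And>e. e \<in> E \<Longrightarrow> \<tau> (\<tau> e) = e"
    and iso: "ns_operad_iso (sym_presented t E \<tau> R) (sym_operad (ns_presented s A Rs)) \<phi>"
    and equivariant: "\<And>n \<sigma> x. \<sigma> permutes {1..n} \<Longrightarrow> x \<in> op_space (sym_presented t E \<tau> R) n \<Longrightarrow>
      \<phi> n (op_act (sym_presented t E \<tau> R) n \<sigma> x) = op_act (sym_operad (ns_presented s A Rs)) n \<sigma> (\<phi> n x)"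
begin

abbreviation "cls n X \<equiv> X +o SI R n"

lemma P_space: "X \<in> sym_space E n \<Longrightarrow> cls n X \<in> op_space (SP R) n"
  by (auto simp: sym_presented_simps)

lemma \<phi>_add:
  assumes "X \<in> sym_space E n" "Y \<in> sym_space E n"
  shows "\<phi> n (cls n (X + Y)) = \<phi> n (cls n X) + \<phi> n (cls n Y)"
  using iso P_space[OF assms(1)] P_space[OF assms(2)]
  unfolding ns_operad_iso_def linear_map_on_def P_add[OF RE, symmetric] by blast

lemma \<phi>_scale:
  assumes "X \<in> sym_space E n"
  shows "\<phi> n (cls n (sym_scale c X)) = op_scale Q n c (\<phi> n (cls n X))"
  using iso P_space[OF assms]
  unfolding ns_operad_iso_def linear_map_on_def P_scale[OF RE assms, symmetric] by blast

lemma \<phi>_comp: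
  assumes "X \<in> sym_space E m" "Y \<in> sym_space E n" "1 \<le> i" "i \<le> m"
  shows "\<phi> (m + n - 1) (cls (m + n - 1) (sym_comp m i n X Y)) = op_comp Q m i n (\<phi> m (cls m X)) (\<phi> n (cls n Y))"
  using iso P_space[OF assms(1)] P_space[OF assms(2)] assms(3,4)
  unfolding ns_operad_iso_def P_comp[OF RE assms, symmetric] by blast

lemma \<phi>_unit: "\<phi> 1 (cls 1 (sym_elem (basis_vec \<langle>\<rangle>) id)) = cos 1 (sym_elem (basis_vec \<langle>\<rangle>) id)"
  using iso unfolding ns_operad_iso_def sym_presented_simps Q_unit by blast

lemma \<phi>_act:
  assumes "X \<in> sym_space E n" "\<rho> permutes {1..n}"
  shows "\<phi> n (cls n (sym_act \<rho> X)) = op_act Q n \<rho> (\<phi> n (cls n X))"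
  using equivariant[OF assms(2) P_space[OF assms(1)]] unfolding P_act[OF RE assms(2)] .

lemma \<phi>_inj:
  assumes "X \<in> sym_space E n" "Y \<in> sym_space E n" "\<phi> n (cls n X) = \<phi> n (cls n Y)" shows "X - Y \<in> SI R n"
proof -
  have "inj_on (\<phi> n) (op_space (SP R) n)" using iso unfolding ns_operad_iso_def bij_betw_def by blast
  from inj_onD[OF this assms(3) P_space[OF assms(1)] P_space[OF assms(2)]] show ?thesis
    by (simp only: P_eq_iff[OF RE])
qed

lemma \<phi>_cong: "X - Y \<in> SI R n \<Longrightarrow> \<phi> n (cls n X) = \<phi> n (cls n Y)"
  using P_eq_iff[OF RE, of X n Y] by simp

lemma \<phi>_onto:
  assumes "Y \<in> sym_space A n" obtains X where "X \<in> sym_space E n" "\<phi> n (cls n X) = cos n Y"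
proof -
  have "\<phi> n ` op_space (SP R) n = op_space Q n" using iso unfolding ns_operad_iso_def bij_betw_def by blast
  then have "cos n Y \<in> \<phi> n ` op_space (SP R) n" using assms by (simp add: Q_space)
  then show ?thesis using that by (auto simp: sym_presented_simps)
qed

lemma \<phi>_into:
  assumes "X \<in> sym_space E n" obtains Y where "Y \<in> sym_space A n" "\<phi> n (cls n X) = cos n Y"
proof -
  have "\<phi> n ` op_space (SP R) n = op_space Q n" using iso unfolding ns_operad_iso_def bij_betw_def by blast
  then have "\<phi> n (cls n X) \<in> op_space Q n" using P_space[OF assms] by blast
  then show ?thesis using that by (auto simp: Q_space)
qed

section \<open>The isomorphism in arity two\<close>

definition gen :: "'e \<Rightarrow> (nat \<Rightarrow> nat) \<Rightarrow> ('e tree \<Rightarrow>\<^sub>0 'k)" where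
  "gen e = sym_elem (basis_vec (corolla e)) id"

text \<open>Stands for \<open>a + b \<cdot> (1 2)\<close>. The classes \<open>K a b\<close> give
  coordinates in \<open>A \<times> A\<close> for arity 2 of the symmetrisation.\<close>

definition gens :: "'a \<Rightarrow> 'a \<Rightarrow> (nat \<Rightarrow> nat) \<Rightarrow> ('a tree \<Rightarrow>\<^sub>0 'k)" where
  "gens a b = sym_elem (basis_vec (corolla a)) id + sym_elem (basis_vec (corolla b)) swap"

abbreviation "K a b \<equiv> cos 2 (gens a b)"

lemma gen_space: "e \<in> E \<Longrightarrow> gen e \<in> sym_space E 2"
  unfolding gen_def by (intro sym_elem_space permutes_id) simp

lemma gens_space: "a \<in> A \<Longrightarrow> b \<in> A \<Longrightarrow> gens a b \<in> sym_space A 2"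
  unfolding gens_def by (intro sym_space_closed(2) sym_elem_space permutes_id swap_permutes) simp_all

lemma gens_apply: "gens a b id = basis_vec (corolla a)" "gens a b swap = basis_vec (corolla b)"
  using id_neq_swap by (simp_all add: gens_def sym_elem_def del: One_nat_def)

lemma all_perms_2: "(\<forall>\<sigma>. \<sigma> permutes {1..2::nat} \<longrightarrow> Pr \<sigma>) \<longleftrightarrow> Pr id \<and> Pr swap"
  using permutes_2_cases swap_permutes permutes_id by metis

lemma cos2_eq_iff: "cos 2 Y = cos 2 Z \<longleftrightarrow> Y id - Z id \<in> I 2 \<and> Y swap - Z swap \<in> I 2"
  unfolding cos_eq_iff by (rule all_perms_2)

lemma K_rep: assumes "Y \<in> sym_space A 2" shows "\<exists>a\<in>A. \<exists>b\<in>A. cos 2 Y = K a b"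
proof -
  have Y: "Y id \<in> tree_space A 2" "Y swap \<in> tree_space A 2"
    using assms swap_permutes permutes_id unfolding sym_space_iff by blast+
  show ?thesis
    by (rule bexI[OF _ root_value_in[OF Y(1)]], rule bexI[OF _ root_value_in[OF Y(2)]])
      (simp only: cos2_eq_iff gens_apply arity_2_representative Y simp_thms)
qed

text \<open>The ideal has value 0 in arity 2, so the labels can be recovered from the
  classes.\<close>

lemma K_inj: assumes "K a b = K a' b'" shows "a = a'" "b = b'"
proof -
  have "basis_vec (corolla a) - basis_vec (corolla a') \<in> I 2" "basis_vec (corolla b) - basis_vec (corolla b') \<in> I 2"
    using assms unfolding cos2_eq_iff gens_apply by blast+
  from this[THEN ideal_low_arity] show "a = a'" "b = b'" by (simp_all add: root_value_simps)
qed

lemma K_add: assumes "a \<in> A" "b \<in> A" "a' \<in> A" "b' \<in> A" shows "K a b + K a' b' = K (a + a') (b + b')"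
proof -
  have "basis_vec (corolla (a + a')) - basis_vec (corolla a) - basis_vec (corolla a') \<in> I 2"
    "basis_vec (corolla (b + b')) - basis_vec (corolla b) - basis_vec (corolla b') \<in> I 2"
    by (rule pres_ideal_lin, rule corolla_lin_relsI(1), rule assms, rule assms)+
  from this[THEN I_sub(3)] show ?thesis
    unfolding cos_add cos2_eq_iff plus_fun_apply gens_apply by (simp add: algebra_simps)
qed

lemma K_scale: assumes "a \<in> A" "b \<in> A" shows "op_scale Q 2 c (K a b) = K (s c a) (s c b)"
proof -
  have "basis_vec (corolla (s c a)) - fsmul c (basis_vec (corolla a)) \<in> I 2"
    "basis_vec (corolla (s c b)) - fsmul c (basis_vec (corolla b)) \<in> I 2"
    by (rule pres_ideal_lin, rule corolla_lin_relsI(2), rule assms)+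
  from this[THEN I_sub(3)] show ?thesis
    unfolding Q_scale cos2_eq_iff sym_scale_def gens_apply by simp
qed

lemma K_act: "op_act Q 2 swap (K a b) = K b a"
proof -
  have "sym_act swap (gens a b) id = gens b a id" "sym_act swap (gens a b) swap = gens b a swap"
    by (simp_all add: sym_act_def gens_apply del: One_nat_def)
  then show ?thesis unfolding Q_act[OF swap_permutes] cos2_eq_iff using I_sub(1) by simp
qed

lemma \<phi>_gen_inj: assumes "e \<in> E" "e' \<in> E" "\<phi> 2 (cls 2 (gen e)) = \<phi> 2 (cls 2 (gen e'))" shows "e = e'"
proof -
  have "gen e - gen e' \<in> SI R 2" using \<phi>_inj gen_space assms by blast
  from SI_arity_2[OF RE tt this] show ?thesis
    unfolding value2_linear gen_def value2_elem by (simp add: value_simps)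
qed

lemma gen_rel:
  assumes "e \<in> E"
  shows "e' \<in> E \<Longrightarrow> gen (e + e') - (gen e + gen e') \<in> SI R 2" "gen (t c e) - sym_scale c (gen e) \<in> SI R 2"
    "gen (\<tau> e) - sym_act swap (gen e) \<in> SI R 2"
proof -
  show "gen (e + e') - (gen e + gen e') \<in> SI R 2" if "e' \<in> E"
    using SI_lin[OF corolla_lin_relsI(1)[OF assms that, of t], of R]
    by (simp only: gen_def sym_elem_linear diff_diff_eq)
  show "gen (t c e) - sym_scale c (gen e) \<in> SI R 2"
    using SI_lin[OF corolla_lin_relsI(2)[OF assms, of t c], of R] by (simp only: gen_def sym_elem_linear)
  show "gen (\<tau> e) - sym_act swap (gen e) \<in> SI R 2"
    using SI_equiv[OF assms, of R] by (simp only: gen_def sym_act_elem[OF swap_permutes] id_comp)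
qed

text \<open>\<open>p1 e\<close> and \<open>p2 e\<close> are the coordinates of the image of the
  generator \<open>e\<close>, and \<open>\<gamma> a\<close> is the preimage of the class with
  coordinates \<open>a\<close> and 0. The axioms of the splitting transfer because \<phi> is linear,
  injective and equivariant.\<close>

lemma split_exists:
  obtains \<gamma> p1 p2 where "split_data t E \<tau> s A \<gamma> p1 p2"
    "\<And>a. a \<in> A \<Longrightarrow> \<phi> 2 (cls 2 (gen (\<gamma> a))) = K a 0"
proof -
  have "\<forall>e\<in>E. \<exists>a b. a \<in> A \<and> b \<in> A \<and> \<phi> 2 (cls 2 (gen e)) = K a b"
  proof
    fix e assume "e \<in> E"
    from \<phi>_into[OF gen_space[OF this]] obtain Y where Y: "Y \<in> sym_space A 2" "\<phi> 2 (cls 2 (gen e)) = cos 2 Y" by blast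
    then show "\<exists>a b. a \<in> A \<and> b \<in> A \<and> \<phi> 2 (cls 2 (gen e)) = K a b" using K_rep[OF Y(1)] by metis
  qed
  then obtain p1 p2 where "\<forall>e\<in>E. p1 e \<in> A \<and> p2 e \<in> A \<and> \<phi> 2 (cls 2 (gen e)) = K (p1 e) (p2 e)" by metis
  then have p: "p1 e \<in> A" "p2 e \<in> A" "\<phi> 2 (cls 2 (gen e)) = K (p1 e) (p2 e)" if "e \<in> E" for e using that by blast+
  have p_eq: "p1 e = a" "p2 e = b" if "e \<in> E" "\<phi> 2 (cls 2 (gen e)) = K a b" for e a b
    using K_inj[of "p1 e" "p2 e" a b] that(2) p(3)[OF that(1)] by simp_all
  \<comment> \<open>A generator is determined by its two coordinates; equations for \<gamma> are
    therefore checked after \<open>p1\<close> and \<open>p2\<close>.\<close>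
  have e_eq: "e = e'" if "e \<in> E" "e' \<in> E" "p1 e = p1 e'" "p2 e = p2 e'" for e e'
    using \<phi>_gen_inj[OF that(1,2)] p(3) that by simp
  have zero: "0 \<in> A" by (rule A.subspace_0[OF subA])
  have "\<forall>a\<in>A. \<exists>e. e \<in> E \<and> \<phi> 2 (cls 2 (gen e)) = K a 0"
  proof
    fix a assume "a \<in> A"
    from \<phi>_onto[OF gens_space[OF this zero]] obtain X where X: "X \<in> sym_space E 2" "\<phi> 2 (cls 2 X) = K a 0" by blast
    \<comment> \<open>Surjectivity yields some element of arity 2; its value is a generator with the
      same class.\<close>
    have "\<phi> 2 (cls 2 (gen (value2 X))) = K a 0"
      using \<phi>_cong[OF SI_arity_2_representative[OF RE X(1)]] X(2) by (simp add: gen_def)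
    then show "\<exists>e. e \<in> E \<and> \<phi> 2 (cls 2 (gen e)) = K a 0" using value2_in[OF X(1)] by blast
  qed
  then obtain \<gamma> where "\<forall>a\<in>A. \<gamma> a \<in> E \<and> \<phi> 2 (cls 2 (gen (\<gamma> a))) = K a 0" by metis
  then have \<gamma>: "\<gamma> a \<in> E" "\<phi> 2 (cls 2 (gen (\<gamma> a))) = K a 0" if "a \<in> A" for a using that by blast+
  have \<gamma>p: "p1 (\<gamma> a) = a" "p2 (\<gamma> a) = 0" if "a \<in> A" for a using p_eq[OF \<gamma>[OF that]] .
  have add: "p1 (e + e') = p1 e + p1 e' \<and> p2 (e + e') = p2 e + p2 e'" if "e \<in> E" "e' \<in> E" for e e'
  proof -
    have "\<phi> 2 (cls 2 (gen (e + e'))) = K (p1 e) (p2 e) + K (p1 e') (p2 e')"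
      using \<phi>_cong[OF gen_rel(1)[OF that]] \<phi>_add[OF gen_space[OF that(1)] gen_space[OF that(2)]] p(3) that by simp
    also have "\<dots> = K (p1 e + p1 e') (p2 e + p2 e')" using K_add p that by simp
    finally show ?thesis using p_eq[OF E.subspace_add[OF sub that]] by blast
  qed
  have scale: "p1 (t c e) = s c (p1 e) \<and> p2 (t c e) = s c (p2 e)" if "e \<in> E" for c e
  proof -
    have "\<phi> 2 (cls 2 (gen (t c e))) = op_scale Q 2 c (K (p1 e) (p2 e))"
      using \<phi>_cong[OF gen_rel(2)[OF that]] \<phi>_scale[OF gen_space[OF that]] p(3) that by simp
    also have "\<dots> = K (s c (p1 e)) (s c (p2 e))" using K_scale p that by simp
    finally show ?thesis using p_eq[OF E.subspace_scale[OF sub that]] by blast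
  qed
  have ptau: "p1 (\<tau> e) = p2 e \<and> p2 (\<tau> e) = p1 e" if "e \<in> E" for e
  proof -
    have "\<phi> 2 (cls 2 (gen (\<tau> e))) = op_act Q 2 swap (K (p1 e) (p2 e))"
      using \<phi>_cong[OF gen_rel(3)[OF that]] \<phi>_act[OF gen_space[OF that] swap_permutes] p(3)[OF that] by simp
    then show ?thesis using p_eq[OF tau_in[OF that]] unfolding K_act by blast
  qed
  have \<gamma>_add: "\<gamma> (a + b) = \<gamma> a + \<gamma> b" if ab: "a \<in> A" "b \<in> A" for a b
  proof (rule e_eq)
    have ab': "a + b \<in> A" by (rule A.subspace_add[OF subA ab])
    show "\<gamma> (a + b) \<in> E" "\<gamma> a + \<gamma> b \<in> E" using \<gamma>(1) ab ab' E.subspace_add[OF sub] by auto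
    show "p1 (\<gamma> (a + b)) = p1 (\<gamma> a + \<gamma> b)" "p2 (\<gamma> (a + b)) = p2 (\<gamma> a + \<gamma> b)"
      using add[OF \<gamma>(1)[OF ab(1)] \<gamma>(1)[OF ab(2)]] \<gamma>p ab ab' by simp_all
  qed
  have \<gamma>_scale: "\<gamma> (s c a) = t c (\<gamma> a)" if a: "a \<in> A" for c a
  proof (rule e_eq)
    have a': "s c a \<in> A" by (rule A.subspace_scale[OF subA a])
    show "\<gamma> (s c a) \<in> E" "t c (\<gamma> a) \<in> E" using \<gamma>(1) a a' E.subspace_scale[OF sub] by auto
    show "p1 (\<gamma> (s c a)) = p1 (t c (\<gamma> a))" "p2 (\<gamma> (s c a)) = p2 (t c (\<gamma> a))"
      using scale[OF \<gamma>(1)[OF a]] \<gamma>p a a' by simp_all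
  qed
  have dec: "\<gamma> (p1 e) + \<tau> (\<gamma> (p2 e)) = e" if e: "e \<in> E" for e
  proof (rule e_eq)
    have g: "\<gamma> (p1 e) \<in> E" "\<gamma> (p2 e) \<in> E" using \<gamma>(1) p e by auto
    show "\<gamma> (p1 e) + \<tau> (\<gamma> (p2 e)) \<in> E" using g tau_in E.subspace_add[OF sub] by auto
    show "p1 (\<gamma> (p1 e) + \<tau> (\<gamma> (p2 e))) = p1 e" "p2 (\<gamma> (p1 e) + \<tau> (\<gamma> (p2 e))) = p2 e"
      using add[OF g(1) tau_in[OF g(2)]] ptau[OF g(2)] \<gamma>p p e by simp_all
  qed (rule e)
  have "split_data t E \<tau> s A \<gamma> p1 p2"
    by unfold_locales
      (use p \<gamma> \<gamma>p add scale ptau \<gamma>_add \<gamma>_scale dec subA in \<open>auto simp: linear_map_on_def\<close>)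
  then show ?thesis using \<gamma>(2) by (rule that)
qed

text \<open>In arity 2, \<phi> inverts \<gamma>; since everything is generated in arity 2, it
  inverts \<open>C\<close> in all arities. As \<phi> is injective, it then detects the ideal of
  \<open>R\<close> through \<open>D\<close>.\<close>

lemma recover_split:
  obtains \<gamma> p1 p2 where "split_data t E \<tau> s A \<gamma> p1 p2"
    "\<And>X n. X \<in> SI R n \<longleftrightarrow> X \<in> sym_space E n \<and> (\<forall>\<sigma>. \<sigma> permutes {1..n} \<longrightarrow> sym_split p1 p2 n X \<sigma> \<in> I n)"
proof -
  obtain \<gamma> p1 p2 where sd: "split_data t E \<tau> s A \<gamma> p1 p2"
    and \<gamma>: "\<And>a. a \<in> A \<Longrightarrow> \<phi> 2 (cls 2 (gen (\<gamma> a))) = K a 0" by (rule split_exists) blast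
  interpret D: split_data t E \<tau> s A \<gamma> p1 p2 by (rule sd)
  have zero: "0 \<in> A" by (rule A.subspace_0[OF subA])
  \<comment> \<open>These are the elements on which \<phi> inverts \<open>C\<close>; they contain
    the corollas and are closed under all operations.\<close>
  define good where "good n Y \<longleftrightarrow> Y \<in> sym_space A n \<and> \<phi> n (cls n (D.C Y)) = cos n Y" for n Y
  have good_zero: "good n 0" for n
  proof -
    have z: "0 \<in> sym_space E n" by (rule sym_space_closed)
    obtain Y where Y: "\<phi> n (cls n 0) = cos n Y" using \<phi>_into[OF z] by blast
    \<comment> \<open>Zero is written as a multiple by 0, because the zero class differs from the 0
      of the set type and additivity alone does not determine its image.\<close>
    have "\<phi> n (cls n (sym_scale 0 0)) = cos n (sym_scale 0 Y)"
      unfolding \<phi>_scale[OF z] Y Q_scale ..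
    then show ?thesis using sym_space_closed(1)[of A n] by (simp only: good_def sym_relab_linear sym_scale_zero simp_thms)
  qed
  have good_add: "good n (Y + Z)" if "good n Y" "good n Z" for n Y Z
    using that sym_space_closed(2)[of Y A n Z] \<phi>_add[OF D.C_space D.C_space, of Y n Z]
    by (simp only: good_def sym_relab_linear cos_add simp_thms)
  have good_scale: "good n (sym_scale c Y)" if "good n Y" for n Y c
    using that sym_space_closed(4)[of Y A n c] \<phi>_scale[OF D.C_space, of Y n c]
    by (simp only: good_def sym_relab_linear Q_scale simp_thms)
  have good_act: "good n (sym_act \<rho> Y)" if "good n Y" "\<rho> permutes {1..n}" for n Y \<rho>
    using that sym_act_space[of Y A n \<rho>] \<phi>_act[OF D.C_space, of Y n \<rho>]
    by (simp only: good_def sym_relab_act Q_act simp_thms)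
  have good_comp: "good (m + n - 1) (sym_comp m i n Y Z)" if "good m Y" "good n Z" "1 \<le> i" "i \<le> m" for m n i Y Z
    using that sym_comp_space[of Y A m Z n i] \<phi>_comp[OF D.C_space D.C_space, of Y m Z n i] Q_comp[of Y m Z n i]
    by (simp only: good_def sym_relab_comp simp_thms)
  have good_corolla: "good 2 (sym_elem (basis_vec (corolla a)) id)" if a: "a \<in> A" for a
  proof -
    have "sym_elem (basis_vec (corolla a)) id \<in> sym_space A 2"
      using a by (intro sym_elem_space permutes_id) simp
    moreover have "D.C (sym_elem (basis_vec (corolla a)) id) = gen (\<gamma> a)" by (simp add: sym_relab_elem gen_def)
    moreover have "K a 0 = cos 2 (sym_elem (basis_vec (corolla a)) id)"
      unfolding cos2_eq_iff gens_apply using id_neq_swap I_sub(1) D.corolla_zero[of Rs]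
      by (simp add: sym_elem_def del: One_nat_def)
    ultimately show ?thesis using \<gamma>[OF a] by (simp only: good_def simp_thms)
  qed
  have good_tree: "good (size1 u) (sym_elem (basis_vec u) id)" if "set_tree u \<subseteq> A" for u
    using that
  proof (induction u)
    case Leaf
    have "D.C (sym_elem (basis_vec \<langle>\<rangle>) id) = sym_elem (basis_vec \<langle>\<rangle>) id" by (simp add: sym_relab_elem)
    moreover have "(sym_elem (basis_vec \<langle>\<rangle>) id :: _ \<Rightarrow> _ \<Rightarrow>\<^sub>0 'k) \<in> sym_space A 1" by (intro sym_elem_space permutes_id) simp
    ultimately have "good 1 (sym_elem (basis_vec \<langle>\<rangle>) id)" using \<phi>_unit by (simp only: good_def simp_thms)
    then show ?case by (simp only: size1.simps)
  next
    case (Node l a r)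
    let ?s = "\<lambda>u. sym_elem (basis_vec u) id :: (nat \<Rightarrow> nat) \<Rightarrow> 'a tree \<Rightarrow>\<^sub>0 'k"
    have a: "a \<in> A" "set_tree l \<subseteq> A" "set_tree r \<subseteq> A" using Node.prems by auto
    let ?y = "sym_comp 2 2 (size1 r) (?s (corolla a)) (?s r)"
    have y: "?y = ?s \<langle>\<langle>\<rangle>, a, r\<rangle>" by (simp add: sym_comp_elem_id)
    have gy: "good (2 + size1 r - 1) ?y"
      by (rule good_comp[OF good_corolla[OF a(1)] Node.IH(2)[OF a(3)]]) auto
    let ?z = "sym_comp (2 + size1 r - 1) 1 (size1 l) ?y (?s l)"
    have z: "?z = ?s \<langle>l, a, r\<rangle>" unfolding y by (subst sym_comp_elem_id) auto
    have "good (2 + size1 r - 1 + size1 l - 1) ?z"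
      by (rule good_comp[OF gy Node.IH(1)[OF a(2)]]) auto
    moreover have "2 + size1 r - 1 + size1 l - 1 = size1 \<langle>l, a, r\<rangle>" by simp
    ultimately show ?case unfolding z by metis
  qed
  have good_elem: "good n (sym_elem x id)" if "x \<in> tree_space A n" for n x
    using that
  proof (induction x rule: tree_space_induct)
    case zero
    show ?case unfolding sym_elem_linear by (rule good_zero)
  next
    case (basis c u)
    show ?case unfolding sym_elem_linear using good_scale[OF good_tree[OF basis(2)]] basis(1) by simp
  next
    case (add x y)
    show ?case unfolding sym_elem_linear by (rule good_add[OF add(1,2)])
  qed
  have good: "good n Y" if Y: "Y \<in> sym_space A n" for n Y
  proof -
    have "good n (\<Sum>\<sigma>\<in>S. sym_elem (Y \<sigma>) \<sigma>)" if "finite S" "S \<subseteq> {\<sigma>. \<sigma> permutes {1..n}}" for S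
      using that
    proof (induction S rule: finite_induct)
      case empty
      show ?case unfolding sum.empty by (rule good_zero)
    next
      case (insert \<sigma> S)
      have \<sigma>: "\<sigma> permutes {1..n}" using insert by simp
      have "Y \<sigma> \<in> tree_space A n" using Y \<sigma> by (simp add: sym_space_iff)
      from good_act[OF good_elem[OF this] \<sigma>] have "good n (sym_elem (Y \<sigma>) \<sigma>)"
        by (simp only: sym_act_elem[OF \<sigma>] id_comp)
      then show ?case unfolding sum.insert[OF insert(1,2)] using insert by (intro good_add) auto
    qed
    from this[OF finite_permutations order_refl] show ?thesis using sym_decompose[OF Y] by simp
  qed
  have "X \<in> SI R n \<longleftrightarrow> X \<in> sym_space E n \<and> (\<forall>\<sigma>. \<sigma> permutes {1..n} \<longrightarrow> D.D n X \<sigma> \<in> I n)" for X n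
  proof (cases "X \<in> sym_space E n")
    case True
    note J = add_subD[OF add_sub_SI[OF RE, of n]]
    have DX: "D.D n X \<in> sym_space A n" by (rule D.D_space[OF True])
    \<comment> \<open>Linearity and equivariance suffice for this congruence, so it holds with empty
      sets of relations and hence modulo the ideal of \<open>R\<close>.\<close>
    have "D.C (D.D n X) - X \<in> SI {} n"
      by (rule D.C_D[of "{}" "{}", OF _ _ _ _ True]) simp_all
    then have d: "D.C (D.D n X) - X \<in> SI R n" by (rule SI_mono[rotated 2]) (use RE in auto)
    have "X \<in> SI R n \<longleftrightarrow> X - 0 \<in> SI R n" by (simp only: diff_zero)
    also have "\<dots> \<longleftrightarrow> \<phi> n (cls n X) = \<phi> n (cls n 0)"
      using \<phi>_inj[OF True sym_space_closed(1)] \<phi>_cong by blast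
    also have "\<phi> n (cls n X) = cos n (D.D n X)" using \<phi>_cong[OF d] good[OF DX] by (simp add: good_def)
    also have "\<phi> n (cls n 0) = cos n 0" using good_zero[of n] by (simp only: good_def sym_relab_linear)
    finally show ?thesis using True by (simp add: cos_eq_iff)
  next
    case False
    then show ?thesis using SI_space[OF RE] by blast
  qed
  with sd show ?thesis by (rule that)
qed

end

section \<open>The pairing in arity three\<close>

definition cyclic3 :: "nat \<Rightarrow> nat \<Rightarrow> bool" where
  "cyclic3 p q \<longleftrightarrow> (p, q) \<in> {(1, 2), (2, 3), (3, 1)}"

lemma normal_form_cyclic3: "normal_form \<tau> a b p q k = (k, a, if cyclic3 p q then b else \<tau> b)"
  by (simp only: normal_form_def cyclic3_def)

lemma cyclic3_antisym:
  "p \<in> {1, 2, 3} \<Longrightarrow> q \<in> {1, 2, 3} \<Longrightarrow> p \<noteq> q \<Longrightarrow> cyclic3 q p \<longleftrightarrow> \<not> cyclic3 p q"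
  by (auto simp: cyclic3_def)

text \<open>The normal form depends on the leaf labels and not on the permutation as such, so it can
  be read off the labelled tree.\<close>

fun ltree_normal_form :: "('e \<Rightarrow> 'e) \<Rightarrow> 'e ltree \<Rightarrow> (nat \<times> 'e \<times> 'e) option" where
  "ltree_normal_form \<tau> (Nd (Nd (Lf p) b (Lf q)) a (Lf k)) = Some (normal_form \<tau> a b p q k)"
| "ltree_normal_form \<tau> (Nd (Lf k) a (Nd (Lf p) b (Lf q))) = Some (normal_form \<tau> (\<tau> a) b p q k)"
| "ltree_normal_form \<tau> _ = None"

lemma tree_normal_form_lab:
  assumes "size1 u = 3" shows "tree_normal_form \<tau> u \<rho> = ltree_normal_form \<tau> (lab u (inv \<rho>))"
  using assms
proof (cases rule: size1_eq_3)
  case (1 a b)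
  then show ?thesis by (simp add: numeral_3_eq_3 numeral_2_eq_2)
next
  case (2 a b)
  show ?thesis unfolding 2 circ_2 by (simp add: numeral_3_eq_3 numeral_2_eq_2)
qed

lemma perm3_values:
  assumes "\<sigma> permutes {1..3::nat}"
  shows "\<sigma> 1 \<in> {1, 2, 3} \<and> \<sigma> 2 \<in> {1, 2, 3} \<and> \<sigma> 3 \<in> {1, 2, 3} \<and> \<sigma> 1 \<noteq> \<sigma> 2 \<and> \<sigma> 1 \<noteq> \<sigma> 3 \<and> \<sigma> 2 \<noteq> \<sigma> 3"
proof -
  have e: "{1..3::nat} = {1, 2, 3}" by auto
  have "\<sigma> 1 \<in> {1, 2, 3}" "\<sigma> 2 \<in> {1, 2, 3}" "\<sigma> 3 \<in> {1, 2, 3}"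
    using permutes_in_image[OF assms, of 1] permutes_in_image[OF assms, of 2] permutes_in_image[OF assms, of 3]
    unfolding e by simp_all
  moreover have "\<sigma> 1 \<noteq> \<sigma> 2" "\<sigma> 1 \<noteq> \<sigma> 3" "\<sigma> 2 \<noteq> \<sigma> 3"
    using inj_eq[OF permutes_inj[OF assms], of 1 2] inj_eq[OF permutes_inj[OF assms], of 1 3]
      inj_eq[OF permutes_inj[OF assms], of 2 3] by simp_all
  ultimately show ?thesis by blast
qed

definition nf_value :: "('e \<Rightarrow> 'e) \<Rightarrow> (nat \<Rightarrow> 'e \<Rightarrow> 'e \<Rightarrow> 'k::zero) \<Rightarrow> 'e ltree \<Rightarrow> 'k" where
  "nf_value \<tau> lam z = (case ltree_normal_form \<tau> z of Some (k, a, b) \<Rightarrow> lam k a b | None \<Rightarrow> 0)"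

text \<open>A functional on arity 3, given by \<open>lam k\<close> on the \<open>k\<close>-th of the
  three copies of \<open>E \<otimes> E\<close>. The Koszul pairing has this form in either argument,
  so its compatibility with ideals is proved once.\<close>

definition nf_functional ::
  "('e \<Rightarrow> 'e) \<Rightarrow> (nat \<Rightarrow> 'e \<Rightarrow> 'e \<Rightarrow> 'k::field) \<Rightarrow> ((nat \<Rightarrow> nat) \<Rightarrow> ('e tree \<Rightarrow>\<^sub>0 'k)) \<Rightarrow> 'k" where
  "nf_functional \<tau> lam Y = (\<Sum>\<rho> | \<rho> permutes {1..3}.
     lext (*) (\<lambda>u. case tree_normal_form \<tau> u \<rho> of Some (k, a, b) \<Rightarrow> lam k a b | None \<Rightarrow> 0) (Y \<rho>))"

lemmas lext_mult_simps = flin_add[OF flin_lext[OF vector_space_mult]] flin_diff[OF flin_lext[OF vector_space_mult]]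
  flin_scale[OF flin_lext[OF vector_space_mult]] flin_zero[OF flin_lext[OF vector_space_mult]]
  lext_basis[OF vector_space_mult]

lemma nf_functional_linear:
  "nf_functional \<tau> lam (X + Y) = nf_functional \<tau> lam X + nf_functional \<tau> lam Y"
  "nf_functional \<tau> lam (X - Y) = nf_functional \<tau> lam X - nf_functional \<tau> lam Y"
  "nf_functional \<tau> lam (sym_scale c X) = c * nf_functional \<tau> lam X"
  by (simp_all add: nf_functional_def lext_mult_simps sum.distrib sum_subtractf sym_scale_def sum_distrib_left)

lemma nf_functional_theta:
  assumes "Y \<in> sym_space E 3"
  shows "nf_functional \<tau> lam Y = lext (*) (nf_value \<tau> lam) (theta 3 Y)"
  unfolding nf_functional_def theta_def flin_sum[OF flin_lext[OF vector_space_mult]]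
proof (rule sum.cong[OF refl])
  fix \<rho> :: "nat \<Rightarrow> nat" assume "\<rho> \<in> {\<rho>. \<rho> permutes {1..3}}"
  then have Y: "Y \<rho> \<in> tree_space E 3" using assms by (simp add: sym_space_iff)
  show "lext (*) (\<lambda>u. case tree_normal_form \<tau> u \<rho> of Some (k, a, b) \<Rightarrow> lam k a b | None \<Rightarrow> 0) (Y \<rho>)
    = lext (*) (nf_value \<tau> lam) (lin_ext (\<lambda>t. lab t (inv \<rho>)) (Y \<rho>))"
    by (rule flin_eqI[OF flin_lext[OF vector_space_mult] flin_comp[OF flin_lin_ext flin_lext[OF vector_space_mult]]])
      (simp add: lext_mult_simps nf_value_def tree_normal_form_lab[OF tree_space_keys(1)[OF Y]])
qed

context sym_data
begin

lemma sym_space_2_induct: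
  assumes "X \<in> sym_space E 2" "Pr 0" "\<And>X Y. Pr X \<Longrightarrow> Pr Y \<Longrightarrow> Pr (X + Y)" "\<And>c X. Pr X \<Longrightarrow> Pr (sym_scale c X)"
    "\<And>a \<rho>. a \<in> E \<Longrightarrow> \<rho> = id \<or> \<rho> = swap \<Longrightarrow> Pr (sym_elem (basis_vec (corolla a)) \<rho>)"
  shows "Pr X"
proof -
  have *: "Pr (sym_elem x \<rho>)" if "x \<in> tree_space E 2" "\<rho> = id \<or> \<rho> = swap" for x \<rho>
    using that(1)
    by (rule tree_space_2) (use assms(2-5) that(2) in \<open>simp_all only: sym_elem_linear\<close>)
  have x: "X id \<in> tree_space E 2" "X swap \<in> tree_space E 2"
    using assms(1) swap_permutes permutes_id unfolding sym_space_iff by blast+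
  have "Pr (\<Sum>\<sigma>\<in>S. sym_elem (X \<sigma>) \<sigma>)" if "finite S" "S \<subseteq> {\<sigma>. \<sigma> permutes {1..2}}" for S
    using that
  proof (induction S rule: finite_induct)
    case empty
    show ?case unfolding sum.empty by (rule assms(2))
  next
    case (insert \<sigma> S)
    have "\<sigma> permutes {1..2}" using insert by simp
    then have "Pr (sym_elem (X \<sigma>) \<sigma>)"
      by (cases rule: permutes_2_cases) (simp_all only: * x simp_thms)
    then show ?case unfolding sum.insert[OF insert(1,2)] using insert by (intro assms(3)) auto
  qed
  from this[OF finite_permutations order_refl] show ?thesis using sym_decompose[OF assms(1)] by simp
qed

text \<open>Bilinearity of every \<open>lam k\<close> on \<open>E\<close> expresses that the
  functional respects linearity of labels; equivariance is built into the normal form.\<close>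

context
  fixes lam :: "nat \<Rightarrow> 'e \<Rightarrow> 'e \<Rightarrow> 'k"
  assumes tt: "\<And>e. e \<in> E \<Longrightarrow> \<tau> (\<tau> e) = e"
    and lam_add: "\<And>k a a' b. a \<in> E \<Longrightarrow> a' \<in> E \<Longrightarrow> b \<in> E \<Longrightarrow> lam k (a + a') b = lam k a b + lam k a' b"
      "\<And>k a b b'. a \<in> E \<Longrightarrow> b \<in> E \<Longrightarrow> b' \<in> E \<Longrightarrow> lam k a (b + b') = lam k a b + lam k a b'"
    and lam_scale: "\<And>k a b c. a \<in> E \<Longrightarrow> b \<in> E \<Longrightarrow> lam k (s c a) b = c * lam k a b"
      "\<And>k a b c. a \<in> E \<Longrightarrow> b \<in> E \<Longrightarrow> lam k a (s c b) = c * lam k a b"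
begin

text \<open>\<open>g\<close> will be \<open>inv \<sigma>\<close>, since acting by \<sigma> relabels
  the leaves by its inverse.\<close>

definition comp_value :: "(nat \<Rightarrow> nat) \<Rightarrow> nat \<Rightarrow> 'e \<Rightarrow> 'e \<Rightarrow> 'k" where
  "comp_value g i a b = nf_value \<tau> lam (lren g (lsubst i 2 (Nd (Lf 1) a (Lf 2)) (Nd (Lf 1) b (Lf 2))))"

lemma comp_value_cases:
  "comp_value g 1 a b = lam (g 3) a (if cyclic3 (g 1) (g 2) then b else \<tau> b)"
  "comp_value g 2 a b = lam (g 1) (\<tau> a) (if cyclic3 (g 2) (g 3) then b else \<tau> b)"
  by (simp_all add: comp_value_def nf_value_def normal_form_cyclic3 lshift_def numeral_2_eq_2 numeral_3_eq_3)

lemma comp_value_bilinear: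
  assumes "i = 1 \<or> i = 2"
  shows "a \<in> E \<Longrightarrow> a' \<in> E \<Longrightarrow> b \<in> E \<Longrightarrow> comp_value g i (a + a') b = comp_value g i a b + comp_value g i a' b"
    "a \<in> E \<Longrightarrow> b \<in> E \<Longrightarrow> b' \<in> E \<Longrightarrow> comp_value g i a (b + b') = comp_value g i a b + comp_value g i a b'"
    "a \<in> E \<Longrightarrow> b \<in> E \<Longrightarrow> comp_value g i (s c a) b = c * comp_value g i a b"
    "a \<in> E \<Longrightarrow> b \<in> E \<Longrightarrow> comp_value g i a (s c b) = c * comp_value g i a b"
  using assms
  by (auto simp: comp_value_cases lam_add lam_scale tau_in tau_add tau_scale simp del: One_nat_def)

lemma comp_value_zero:
  assumes "i = 1 \<or> i = 2"
  shows "b \<in> E \<Longrightarrow> comp_value g i 0 b = 0" "a \<in> E \<Longrightarrow> comp_value g i a 0 = 0"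
  using comp_value_bilinear(3)[OF assms, of 0 b g 0] comp_value_bilinear(4)[OF assms, of a 0 g 0]
    E.subspace_0[OF sub] by simp_all

lemma theta_comp_corollas:
  assumes "a \<in> E" "b \<in> E" "\<rho> permutes {1..2}" "\<rho>' permutes {1..2}" "1 \<le> i" "i \<le> 2" "\<sigma> permutes {1..3}"
  shows "nf_functional \<tau> lam (sym_act \<sigma> (sym_comp 2 i 2 (sym_elem (basis_vec (corolla a)) \<rho>) (sym_elem (basis_vec (corolla b)) \<rho>')))
    = nf_value \<tau> lam (lren (inv \<sigma>) (lsubst i 2 (Nd (Lf (inv \<rho> 1)) a (Lf (inv \<rho> 2))) (Nd (Lf (inv \<rho>' 1)) b (Lf (inv \<rho>' 2)))))"
proof -
  let ?X = "sym_elem (basis_vec (corolla a)) \<rho> :: _ \<Rightarrow> _ \<Rightarrow>\<^sub>0 'k" and ?Y = "sym_elem (basis_vec (corolla b)) \<rho>' :: _ \<Rightarrow> _ \<Rightarrow>\<^sub>0 'k"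
  have sp: "?X \<in> sym_space E 2" "?Y \<in> sym_space E 2" using assms by (auto intro!: sym_elem_space)
  have n3: "2 + 2 - 1 = (3::nat)" by simp
  have c: "sym_comp 2 i 2 ?X ?Y \<in> sym_space E 3" using sym_comp_space[OF sp assms(5,6)] unfolding n3 .
  have l: "lab (corolla a) p = Nd (Lf (p 1)) a (Lf (p 2))" for a :: 'e and p by (simp add: numeral_2_eq_2)
  have "theta 3 (sym_act \<sigma> (sym_comp 2 i 2 ?X ?Y))
    = basis_vec (lren (inv \<sigma>) (lsubst i 2 (lab (corolla a) (inv \<rho>)) (lab (corolla b) (inv \<rho>'))))"
    using theta_comp[OF sp assms(5,6)] unfolding n3
    by (simp add: theta_act[OF assms(7)] theta_elem[OF assms(3)] theta_elem[OF assms(4)])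
  then show ?thesis
    unfolding nf_functional_theta[OF sym_act_space[OF c assms(7)]] l by (simp add: lext_mult_simps)
qed

text \<open>The functional sees arity 2 factors only through their values: exchanging the inputs of
  a corolla changes the normal form in the same way as applying \<tau> to its label. By bilinearity
  it is enough to check corollas.\<close>

lemma nf_functional_comp:
  assumes X: "X \<in> sym_space E 2" and Y: "Y \<in> sym_space E 2" and i: "1 \<le> i" "i \<le> 2" and \<sigma>: "\<sigma> permutes {1..3}"
  shows "nf_functional \<tau> lam (sym_act \<sigma> (sym_comp 2 i 2 X Y)) = comp_value (inv \<sigma>) i (value2 X) (value2 Y)"
proof -
  have i': "i = 1 \<or> i = 2" using i by auto
  note B = comp_value_bilinear[OF i'] comp_value_zero[OF i']
  let ?F = "\<lambda>X Y. nf_functional \<tau> lam (sym_act \<sigma> (sym_comp 2 i 2 X Y))"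
  let ?v = "\<lambda>\<rho>. if \<rho> = id then (\<lambda>a. a) else \<tau>"
  have F0: "nf_functional \<tau> lam 0 = 0"
    using nf_functional_linear(2)[of \<tau> lam 0 0] by (simp only: diff_self)
  have val: "value2 (sym_elem (basis_vec (corolla a)) \<rho>) = ?v \<rho> a" if "\<rho> = id \<or> \<rho> = swap" for a \<rho>
    using that id_neq_swap by (auto simp: value2_elem value_simps simp del: One_nat_def)
  have vE: "?v \<rho> a \<in> E" if "a \<in> E" for \<rho> :: "nat \<Rightarrow> nat" and a using that tau_in by simp
  have perm: "\<rho> permutes {1..2}" if "\<rho> = id \<or> \<rho> = swap" for \<rho> using that swap_permutes permutes_id by auto
  note g = perm3_values[OF permutes_inv[OF \<sigma>]]
  have basis: "?F (sym_elem (basis_vec (corolla a)) \<rho>) (sym_elem (basis_vec (corolla b)) \<rho>')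
      = comp_value (inv \<sigma>) i (?v \<rho> a) (?v \<rho>' b)"
    if ab: "a \<in> E" "b \<in> E" and \<rho>: "\<rho> = id \<or> \<rho> = swap" "\<rho>' = id \<or> \<rho>' = swap" for a b \<rho> \<rho>'
  proof -
    have r: "inv \<pi> 1 = (if \<pi> = id then 1 else 2) \<and> inv \<pi> 2 = (if \<pi> = id then 2 else 1)"
      if "\<pi> = id \<or> \<pi> = swap" for \<pi>
      using that id_neq_swap by (auto simp del: One_nat_def)
    \<comment> \<open>An exchange at the inner vertex toggles cyclic order, and hence the \<tau> of
      the normal form. An exchange at the outer vertex toggles the side of the inner one, and hence
      the \<tau> on the outer label.\<close>
    have "nf_value \<tau> lam (lren (inv \<sigma>) (lsubst i 2 (Nd (Lf x1) a (Lf x2)) (Nd (Lf y1) b (Lf y2))))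
      = comp_value (inv \<sigma>) i (if x1 = 1 then a else \<tau> a) (if y1 = 1 then b else \<tau> b)"
      if "(x1, x2) = (1, 2) \<or> (x1, x2) = (2, 1)" "(y1, y2) = (1, 2) \<or> (y1, y2) = (2, 1)" for x1 x2 y1 y2
      using i' that cyclic3_antisym[of "inv \<sigma> 1" "inv \<sigma> 2"] cyclic3_antisym[of "inv \<sigma> 2" "inv \<sigma> 3"] g
      unfolding prod.inject
      by (elim disjE conjE; simp only: comp_value_cases; simp add: nf_value_def normal_form_cyclic3 lshift_def tt ab numeral_2_eq_2 numeral_3_eq_3)
    from this[of "inv \<rho> 1" "inv \<rho> 2" "inv \<rho>' 1" "inv \<rho>' 2"] show ?thesis
      unfolding theta_comp_corollas[OF ab perm[OF \<rho>(1)] perm[OF \<rho>(2)] i \<sigma>]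
      using r[OF \<rho>(1)] r[OF \<rho>(2)] by (cases "\<rho> = id"; cases "\<rho>' = id"; simp)
  qed
  have 1: "?F (sym_elem (basis_vec (corolla a)) \<rho>) Y = comp_value (inv \<sigma>) i (?v \<rho> a) (value2 Y) \<and> value2 Y \<in> E"
    if a: "a \<in> E" and \<rho>: "\<rho> = id \<or> \<rho> = swap" for a \<rho>
    using Y
  proof (rule sym_space_2_induct)
    show "?F (sym_elem (basis_vec (corolla a)) \<rho>) 0 = comp_value (inv \<sigma>) i (?v \<rho> a) (value2 0) \<and> value2 0 \<in> E"
      using B(6)[OF vE[OF a]] E.subspace_0[OF sub] by (simp only: sym_comp_linear sym_act_linear F0 value2_linear simp_thms)
  next
    fix Y Y'
    assume "?F (sym_elem (basis_vec (corolla a)) \<rho>) Y = comp_value (inv \<sigma>) i (?v \<rho> a) (value2 Y) \<and> value2 Y \<in> E"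
      "?F (sym_elem (basis_vec (corolla a)) \<rho>) Y' = comp_value (inv \<sigma>) i (?v \<rho> a) (value2 Y') \<and> value2 Y' \<in> E"
    then show "?F (sym_elem (basis_vec (corolla a)) \<rho>) (Y + Y') = comp_value (inv \<sigma>) i (?v \<rho> a) (value2 (Y + Y')) \<and> value2 (Y + Y') \<in> E"
      using B(2)[OF vE[OF a]] E.subspace_add[OF sub]
      by (simp only: sym_comp_linear sym_act_linear nf_functional_linear value2_linear simp_thms)
  next
    fix c Y
    assume "?F (sym_elem (basis_vec (corolla a)) \<rho>) Y = comp_value (inv \<sigma>) i (?v \<rho> a) (value2 Y) \<and> value2 Y \<in> E"
    then show "?F (sym_elem (basis_vec (corolla a)) \<rho>) (sym_scale c Y) = comp_value (inv \<sigma>) i (?v \<rho> a) (value2 (sym_scale c Y)) \<and> value2 (sym_scale c Y) \<in> E"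
      using B(4)[OF vE[OF a]] E.subspace_scale[OF sub]
      by (simp only: sym_comp_scale sym_act_linear nf_functional_linear value2_linear simp_thms)
  next
    fix b \<rho>' assume b: "b \<in> E" "\<rho>' = id \<or> \<rho>' = swap"
    show "?F (sym_elem (basis_vec (corolla a)) \<rho>) (sym_elem (basis_vec (corolla b)) \<rho>')
      = comp_value (inv \<sigma>) i (?v \<rho> a) (value2 (sym_elem (basis_vec (corolla b)) \<rho>')) \<and> value2 (sym_elem (basis_vec (corolla b)) \<rho>') \<in> E"
      unfolding val[OF b(2)] using basis[OF a b(1) \<rho> b(2)] vE[OF b(1)] by blast
  qed
  have vY: "value2 Y \<in> E" by (rule value2_in[OF Y])
  have "?F X Y = comp_value (inv \<sigma>) i (value2 X) (value2 Y) \<and> value2 X \<in> E"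
    using X
  proof (rule sym_space_2_induct)
    show "?F 0 Y = comp_value (inv \<sigma>) i (value2 0) (value2 Y) \<and> value2 0 \<in> E"
      using B(5)[OF vY] E.subspace_0[OF sub] by (simp only: sym_comp_linear sym_act_linear F0 value2_linear simp_thms)
  next
    fix X X'
    assume "?F X Y = comp_value (inv \<sigma>) i (value2 X) (value2 Y) \<and> value2 X \<in> E"
      "?F X' Y = comp_value (inv \<sigma>) i (value2 X') (value2 Y) \<and> value2 X' \<in> E"
    then show "?F (X + X') Y = comp_value (inv \<sigma>) i (value2 (X + X')) (value2 Y) \<and> value2 (X + X') \<in> E"
      using B(1)[OF _ _ vY] E.subspace_add[OF sub]
      by (simp only: sym_comp_linear sym_act_linear nf_functional_linear value2_linear simp_thms)
  next
    fix c X
    assume "?F X Y = comp_value (inv \<sigma>) i (value2 X) (value2 Y) \<and> value2 X \<in> E"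
    then show "?F (sym_scale c X) Y = comp_value (inv \<sigma>) i (value2 (sym_scale c X)) (value2 Y) \<and> value2 (sym_scale c X) \<in> E"
      using B(3)[OF _ vY] E.subspace_scale[OF sub]
      by (simp only: sym_comp_scale sym_act_linear nf_functional_linear value2_linear simp_thms)
  next
    fix a \<rho> assume a: "a \<in> E" "\<rho> = id \<or> \<rho> = swap"
    show "?F (sym_elem (basis_vec (corolla a)) \<rho>) Y = comp_value (inv \<sigma>) i (value2 (sym_elem (basis_vec (corolla a)) \<rho>)) (value2 Y)
      \<and> value2 (sym_elem (basis_vec (corolla a)) \<rho>) \<in> E"
      unfolding val[OF a(2)] using 1[OF a] vE[OF a(1)] by blast
  qed
  then show ?thesis ..
qed

text \<open>A composite with a factor of value 0 has functional value 0, so the criterion of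
  \<open>SI_low_arity\<close> applies.\<close>

lemma nf_functional_SI:
  assumes RE: "R \<subseteq> sym_space E 3"
    and R: "\<And>X \<sigma>. X \<in> R \<Longrightarrow> \<sigma> permutes {1..3} \<Longrightarrow> nf_functional \<tau> lam (sym_act \<sigma> X) = 0"
    and X: "X \<in> SI R 3"
  shows "nf_functional \<tau> lam X = 0"
proof -
  have "nf_functional \<tau> lam (sym_act \<sigma> (sym_comp 2 i 2 X Y)) = 0"
    if "X \<in> sym_space E 2" "Y \<in> sym_space E 2" "value2 X = 0 \<or> value2 Y = 0" "1 \<le> i" "i \<le> 2" "\<sigma> permutes {1..3}"
    for X Y i \<sigma>
  proof -
    have i: "i = 1 \<or> i = 2" using that by auto
    show ?thesis unfolding nf_functional_comp[OF that(1,2,4,5,6)]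
      using that(3) comp_value_zero[OF i] value2_in[OF that(1)] value2_in[OF that(2)] by auto
  qed
  from SI_low_arity[OF RE tt nf_functional_linear(1,3) R this X]
  have "nf_functional \<tau> lam (sym_act id X) = 0" using permutes_id by blast
  then show ?thesis by (simp add: sym_act_def)
qed

end

end

lemma lext_plus: "lext (*) (\<lambda>t. h t + h' t) x = lext (*) h x + lext (*) h' x"
  by (simp add: lext_def sum.distrib distrib_left)

lemma lext_mult: "lext (*) (\<lambda>t. c * h t) x = c * lext (*) h x"
  by (simp add: lext_def sum_distrib_left mult.left_commute)

lemma lext_zero: "lext (*) (\<lambda>t. 0) x = 0"
  by (simp add: lext_def)

lemma bilin_form_basis_right: "bilin_form p x (basis_vec u) = lext (*) (\<lambda>s. p s u) x"
  by (simp add: bilin_form_lext lext_mult_simps)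

lemma bilin_form_basis_left: "bilin_form p (basis_vec t) y = lext (*) (p t) y"
  by (simp add: bilin_form_lext lext_mult_simps)

lemma bilin_form_mult: "bilin_form (\<lambda>s t. c * p s t) x y = c * bilin_form p x y"
  by (simp add: bilin_form_lext lext_mult)

lemma bilin_form_lin_ext:
  "bilin_form p (lin_ext f x) (lin_ext g y) = bilin_form (\<lambda>s t. p (f s) (g t)) x y"
  by (rule bilin_eqI[where sc="(*)" and F="\<lambda>x y. bilin_form p (lin_ext f x) (lin_ext g y)"
        and G="\<lambda>x y. bilin_form (\<lambda>s t. p (f s) (g t)) x y"])
    (simp_all add: flin_def lin_simps form_simps)

section \<open>The pairing as a functional of either argument\<close>

lemma tree_normal_form_in:
  assumes "size1 u = 3" "set_tree u \<subseteq> D" "\<And>e. e \<in> D \<Longrightarrow> \<tau> e \<in> D" "tree_normal_form \<tau> u \<sigma> = Some (k, a, b)"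
  shows "a \<in> D \<and> b \<in> D"
  using assms(1)
proof (cases rule: size1_eq_3)
  case (1 c d)
  then show ?thesis
    using assms(2-4) by (auto simp: normal_form_cyclic3)
next
  case (2 c d)
  then show ?thesis
    using assms(2-4) by (auto simp: normal_form_cyclic3)
qed

text \<open>The contribution of \<open>X\<close> when the other argument has normal form
  \<open>(k, a, b)\<close>.\<close>

definition pair_left ::
  "'e set \<Rightarrow> ('e \<Rightarrow> 'e) \<Rightarrow> ((nat \<Rightarrow> nat) \<Rightarrow> (('e \<Rightarrow> 'k::field) tree \<Rightarrow>\<^sub>0 'k)) \<Rightarrow> nat \<Rightarrow> 'e \<Rightarrow> 'e \<Rightarrow> 'k" where
  "pair_left E \<tau> X k a b = (\<Sum>\<sigma> | \<sigma> permutes {1..3}. lext (*) (\<lambda>t.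
     case tree_normal_form (dual_action E \<tau>) t \<sigma> of Some (l, f, g) \<Rightarrow> if l = k then f a * g b else 0 | None \<Rightarrow> 0) (X \<sigma>))"

definition pair_right ::
  "('e \<Rightarrow> 'e) \<Rightarrow> ((nat \<Rightarrow> nat) \<Rightarrow> ('e tree \<Rightarrow>\<^sub>0 'k::field)) \<Rightarrow> nat \<Rightarrow> ('e \<Rightarrow> 'k) \<Rightarrow> ('e \<Rightarrow> 'k) \<Rightarrow> 'k" where
  "pair_right \<tau> Y k f g = (\<Sum>\<rho> | \<rho> permutes {1..3}. lext (*) (\<lambda>u.
     case tree_normal_form \<tau> u \<rho> of Some (l, a, b) \<Rightarrow> if k = l then f a * g b else 0 | None \<Rightarrow> 0) (Y \<rho>))"

lemma flin_sum_fun: "(\<And>i. i \<in> I \<Longrightarrow> flin (*) (F i)) \<Longrightarrow> flin (*) (\<lambda>x. \<Sum>i\<in>I. F i x)"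
  by (auto simp: flin_def sum.distrib sum_distrib_left)

lemma sym_pairing_left:
  fixes X :: "(nat \<Rightarrow> nat) \<Rightarrow> (('e \<Rightarrow> 'k::field) tree \<Rightarrow>\<^sub>0 'k)"
  shows "sym_pairing E \<tau> X Y = nf_functional \<tau> (pair_left E \<tau> X) Y"
proof -
  let ?S = "{\<sigma>. \<sigma> permutes {1..3::nat}}"
  have "(\<Sum>\<sigma>\<in>?S. bilin_form (sym_tree_pairing E \<tau> \<sigma> \<rho>) (X \<sigma>) y)
    = lext (*) (\<lambda>u. case tree_normal_form \<tau> u \<rho> of Some (k, a, b) \<Rightarrow> pair_left E \<tau> X k a b | None \<Rightarrow> 0) y" for \<rho> y
  proof (rule flin_eqI[OF flin_sum_fun[OF flin_bilin_form_right] flin_lext[OF vector_space_mult]])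
    fix u
    show "(\<Sum>\<sigma>\<in>?S. bilin_form (sym_tree_pairing E \<tau> \<sigma> \<rho>) (X \<sigma>) (basis_vec u))
      = lext (*) (\<lambda>u. case tree_normal_form \<tau> u \<rho> of Some (k, a, b) \<Rightarrow> pair_left E \<tau> X k a b | None \<Rightarrow> 0) (basis_vec u)"
    proof (cases "tree_normal_form \<tau> u \<rho>")
      case None
      have "sym_tree_pairing E \<tau> \<sigma> \<rho> t u = 0" for \<sigma> and t :: "('e \<Rightarrow> 'k) tree"
        by (simp add: sym_tree_pairing_def None split: option.split)
      then show ?thesis using None by (simp add: bilin_form_basis_right lext_mult_simps lext_zero)
    next
      case (Some kab)
      obtain k a b where kab: "kab = (k, a, b)" by (cases kab)
      have "sym_tree_pairing E \<tau> \<sigma> \<rho> t u = (case tree_normal_form (dual_action E \<tau>) t \<sigma> of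
          Some (l, f, g) \<Rightarrow> if l = k then f a * g b else 0 | None \<Rightarrow> 0)" for \<sigma> and t :: "('e \<Rightarrow> 'k) tree"
        by (simp add: sym_tree_pairing_def Some kab split: option.split)
      then show ?thesis using Some kab by (simp add: bilin_form_basis_right lext_mult_simps pair_left_def)
    qed
  qed
  then show ?thesis unfolding sym_pairing_def nf_functional_def by (subst sum.swap) simp
qed

lemma sym_pairing_right: "sym_pairing E \<tau> X Y = nf_functional (dual_action E \<tau>) (pair_right \<tau> Y) X"
proof -
  let ?S = "{\<sigma>. \<sigma> permutes {1..3::nat}}"
  have "(\<Sum>\<rho>\<in>?S. bilin_form (sym_tree_pairing E \<tau> \<sigma> \<rho>) x (Y \<rho>))
    = lext (*) (\<lambda>t. case tree_normal_form (dual_action E \<tau>) t \<sigma> of Some (k, f, g) \<Rightarrow> pair_right \<tau> Y k f g | None \<Rightarrow> 0) x" for \<sigma> x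
  proof (rule flin_eqI[OF flin_sum_fun[OF flin_bilin_form_left] flin_lext[OF vector_space_mult]])
    fix t
    show "(\<Sum>\<rho>\<in>?S. bilin_form (sym_tree_pairing E \<tau> \<sigma> \<rho>) (basis_vec t) (Y \<rho>))
      = lext (*) (\<lambda>t. case tree_normal_form (dual_action E \<tau>) t \<sigma> of Some (k, f, g) \<Rightarrow> pair_right \<tau> Y k f g | None \<Rightarrow> 0) (basis_vec t)"
    proof (cases "tree_normal_form (dual_action E \<tau>) t \<sigma>")
      case None
      have "sym_tree_pairing E \<tau> \<sigma> \<rho> t = (\<lambda>u. 0)" for \<rho>
        by (rule ext) (simp add: sym_tree_pairing_def None)
      then show ?thesis using None by (simp add: bilin_form_basis_left lext_mult_simps lext_zero)
    next
      case (Some kfg)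
      obtain k f g where kfg: "kfg = (k, f, g)" by (cases kfg)
      have "sym_tree_pairing E \<tau> \<sigma> \<rho> t = (\<lambda>u. case tree_normal_form \<tau> u \<rho> of
          Some (l, a, b) \<Rightarrow> if k = l then f a * g b else 0 | None \<Rightarrow> 0)" for \<rho>
        by (rule ext) (simp add: sym_tree_pairing_def Some kfg split: option.split)
      then show ?thesis using Some kfg by (simp add: bilin_form_basis_left lext_mult_simps pair_right_def)
    qed
  qed
  then show ?thesis unfolding sym_pairing_def nf_functional_def by simp
qed

lemma sum_lext_cong:
  assumes "\<And>\<sigma> t. \<sigma> permutes {1..3::nat} \<Longrightarrow> t \<in> Poly_Mapping.keys (X \<sigma>) \<Longrightarrow> h \<sigma> t = h' \<sigma> t"
  shows "(\<Sum>\<sigma> | \<sigma> permutes {1..3::nat}. lext (*) (h \<sigma>) (X \<sigma>)) = (\<Sum>\<sigma> | \<sigma> permutes {1..3::nat}. lext (*) (h' \<sigma>) (X \<sigma>))"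
  using assms by (auto intro!: sum.cong lext_cong)

context sym_data
begin

abbreviation "E' \<equiv> dual_space s E"
abbreviation "\<tau>' \<equiv> dual_action E \<tau> :: ('e \<Rightarrow> 'k) \<Rightarrow> ('e \<Rightarrow> 'k)"

lemma dual_action_in: assumes "f \<in> E'" shows "\<tau>' f \<in> E'"
  by (rule dual_spaceI)
    (auto simp: dual_action_def tau_add tau_scale tau_in E.subspace_add[OF sub] E.subspace_scale[OF sub] dual_spaceD[OF assms])

lemma dual_sym_data: "sym_data fun_scale E' \<tau>'"
proof
  have "\<tau>' (f + g) = \<tau>' f + \<tau>' g" "\<tau>' (fun_scale c f) = fun_scale c (\<tau>' f)" for f g c
    by (auto simp: dual_action_def fun_scale_def)
  then show "linear_map_on fun_scale E' fun_scale E' \<tau>'"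
    unfolding linear_map_on_def using dual_action_in by blast
qed (simp_all add: subspace_dual_space fun_scale_def fun_eq_iff algebra_simps)

lemma dual_action_involution:
  assumes "\<And>e. e \<in> E \<Longrightarrow> \<tau> (\<tau> e) = e" "f \<in> E'" shows "\<tau>' (\<tau>' f) = f"
  by (rule ext) (simp add: dual_action_def assms(1) tau_in dual_spaceD(3)[OF assms(2)])

text \<open>Elements of the dual are linear on \<open>E\<close> only, so one has to know that the
  labels occurring in normal forms stay in the dual space.\<close>

lemma pair_left_bilinear:
  assumes X: "X \<in> sym_space E' 3"
  shows "a \<in> E \<Longrightarrow> a' \<in> E \<Longrightarrow> pair_left E \<tau> X k (a + a') b = pair_left E \<tau> X k a b + pair_left E \<tau> X k a' b"
    "b \<in> E \<Longrightarrow> b' \<in> E \<Longrightarrow> pair_left E \<tau> X k a (b + b') = pair_left E \<tau> X k a b + pair_left E \<tau> X k a b'"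
    "a \<in> E \<Longrightarrow> pair_left E \<tau> X k (s c a) b = c * pair_left E \<tau> X k a b"
    "b \<in> E \<Longrightarrow> pair_left E \<tau> X k a (s c b) = c * pair_left E \<tau> X k a b"
proof -
  have fg: "f \<in> E' \<and> g \<in> E'"
    if "\<sigma> permutes {1..3}" "t \<in> Poly_Mapping.keys (X \<sigma>)" "tree_normal_form \<tau>' t \<sigma> = Some (l, f, g)" for \<sigma> t l f g
  proof -
    have "X \<sigma> \<in> tree_space E' 3" using X that(1) by (simp add: sym_space_iff)
    from tree_normal_form_in[OF tree_space_keys[OF this that(2)] dual_action_in that(3)] show ?thesis by blast
  qed
  have nfE: thesis
    if "\<sigma> permutes {1..3}" "t \<in> Poly_Mapping.keys (X \<sigma>)" "tree_normal_form \<tau>' t \<sigma> = None \<Longrightarrow> thesis"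
      "\<And>l f g. tree_normal_form \<tau>' t \<sigma> = Some (l, f, g) \<Longrightarrow> f \<in> E' \<Longrightarrow> g \<in> E' \<Longrightarrow> thesis" for \<sigma> t thesis
    using that fg[OF that(1,2)] by (cases "tree_normal_form \<tau>' t \<sigma>") auto
  show "pair_left E \<tau> X k (a + a') b = pair_left E \<tau> X k a b + pair_left E \<tau> X k a' b" if "a \<in> E" "a' \<in> E"
    unfolding pair_left_def sum.distrib[symmetric] lext_plus[symmetric]
    by (rule sum_lext_cong, erule (1) nfE) (auto simp: dual_spaceD[where s=s and E=E] that algebra_simps)
  show "pair_left E \<tau> X k a (b + b') = pair_left E \<tau> X k a b + pair_left E \<tau> X k a b'" if "b \<in> E" "b' \<in> E"
    unfolding pair_left_def sum.distrib[symmetric] lext_plus[symmetric]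
    by (rule sum_lext_cong, erule (1) nfE) (auto simp: dual_spaceD[where s=s and E=E] that algebra_simps)
  show "pair_left E \<tau> X k (s c a) b = c * pair_left E \<tau> X k a b" if "a \<in> E"
    unfolding pair_left_def sum_distrib_left lext_mult[symmetric]
    by (rule sum_lext_cong, erule (1) nfE) (auto simp: dual_spaceD[where s=s and E=E] that algebra_simps)
  show "pair_left E \<tau> X k a (s c b) = c * pair_left E \<tau> X k a b" if "b \<in> E"
    unfolding pair_left_def sum_distrib_left lext_mult[symmetric]
    by (rule sum_lext_cong, erule (1) nfE) (auto simp: dual_spaceD[where s=s and E=E] that algebra_simps)
qed

lemma pair_right_bilinear:
  "pair_right \<tau> Y k (f + f') g = pair_right \<tau> Y k f g + pair_right \<tau> Y k f' g"
  "pair_right \<tau> Y k f (g + g') = pair_right \<tau> Y k f g + pair_right \<tau> Y k f g'"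
  "pair_right \<tau> Y k (fun_scale c f) g = c * pair_right \<tau> Y k f g"
  "pair_right \<tau> Y k f (fun_scale c g) = c * pair_right \<tau> Y k f g"
  unfolding pair_right_def sum.distrib[symmetric] lext_plus[symmetric] sum_distrib_left lext_mult[symmetric]
  by (rule sum_lext_cong; auto split: option.split simp: fun_scale_def algebra_simps)+

text \<open>Pairing with \<open>X\<close> is of the form treated by \<open>nf_functional_SI\<close>,
  so orthogonality to \<open>R\<close> and its translates extends to arity 3 of the ideal. The
  orthogonal thus depends on the ideal alone.\<close>

lemma sym_orthogonal_iff:
  assumes RE: "R \<subseteq> sym_space E 3" and tt: "\<And>e. e \<in> E \<Longrightarrow> \<tau> (\<tau> e) = e"
  shows "X \<in> sym_orthogonal s E \<tau> R \<longleftrightarrow> X \<in> sym_space E' 3 \<and> (\<forall>Y\<in>SI R 3. sym_pairing E \<tau> X Y = 0)"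
proof
  assume "X \<in> sym_orthogonal s E \<tau> R"
  then have X: "X \<in> sym_space E' 3" "\<And>r \<sigma>. r \<in> R \<Longrightarrow> \<sigma> permutes {1..3} \<Longrightarrow> sym_pairing E \<tau> X (sym_act \<sigma> r) = 0"
    by (auto simp: sym_orthogonal_def sym_operad_simps)
  have "sym_pairing E \<tau> X Y = 0" if "Y \<in> SI R 3" for Y
    unfolding sym_pairing_left
    by (rule nf_functional_SI[where lam="pair_left E \<tau> X", OF tt pair_left_bilinear[OF X(1)] RE _ that])
      (use X(2) in \<open>simp_all add: sym_pairing_left\<close>)
  with X show "X \<in> sym_space E' 3 \<and> (\<forall>Y\<in>SI R 3. sym_pairing E \<tau> X Y = 0)" by blast
next
  assume "X \<in> sym_space E' 3 \<and> (\<forall>Y\<in>SI R 3. sym_pairing E \<tau> X Y = 0)"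
  then show "X \<in> sym_orthogonal s E \<tau> R"
    using SI_act[OF SI_rel] by (auto simp: sym_orthogonal_def sym_operad_simps)
qed

text \<open>The pairing respects linearity and equivariance in its first argument too; dual elements
  may be replaced by congruent ones.\<close>

lemma sym_pairing_dual_ideal:
  assumes tt: "\<And>e. e \<in> E \<Longrightarrow> \<tau> (\<tau> e) = e" and X: "X \<in> sym_pres_ideal fun_scale E' \<tau>' {} 3"
  shows "sym_pairing E \<tau> X Y = 0"
  unfolding sym_pairing_right
  by (rule sym_data.nf_functional_SI[OF dual_sym_data, where lam="pair_right \<tau> Y", OF dual_action_involution[OF tt] pair_right_bilinear _ _ X])
    simp_all

lemma sym_pairing_diff_left: "sym_pairing E \<tau> (X - X') Y = sym_pairing E \<tau> X Y - sym_pairing E \<tau> X' Y"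
  unfolding sym_pairing_right by (rule nf_functional_linear)

end

section \<open>The pairing of split generators\<close>

lemma cyclic3_rotate:
  "p \<in> {1, 2, 3} \<Longrightarrow> q \<in> {1, 2, 3} \<Longrightarrow> k \<in> {1, 2, 3} \<Longrightarrow> p \<noteq> q \<Longrightarrow> p \<noteq> k \<Longrightarrow> q \<noteq> k \<Longrightarrow> cyclic3 q k \<longleftrightarrow> cyclic3 p q"
  by (auto simp: cyclic3_def)

text \<open>
  In the pairing of generators from the image of \<open>\<gamma>\<close> with dual generators, \<open>f \<circ>\<^sub>1 g\<close> is paired with
  \<open>a \<circ>\<^sub>2 b\<close> and vice versa, the inputs being reversed.
\<close>

fun cross_pairing :: "('e \<Rightarrow> 'k::field) tree \<Rightarrow> 'e tree \<Rightarrow> 'k" where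
  "cross_pairing \<langle>\<langle>\<langle>\<rangle>, g, \<langle>\<rangle>\<rangle>, f, \<langle>\<rangle>\<rangle> \<langle>\<langle>\<rangle>, a, \<langle>\<langle>\<rangle>, b, \<langle>\<rangle>\<rangle>\<rangle> = f a * g b"
| "cross_pairing \<langle>\<langle>\<rangle>, f, \<langle>\<langle>\<rangle>, g, \<langle>\<rangle>\<rangle>\<rangle> \<langle>\<langle>\<langle>\<rangle>, b, \<langle>\<rangle>\<rangle>, a, \<langle>\<rangle>\<rangle> = - (f a * g b)"
| "cross_pairing _ _ = 0"

text \<open>Reads three leaves from right to left, which matches the inputs of a left comb with
  those of a right comb.\<close>

abbreviation reversal :: "nat \<Rightarrow> nat" where "reversal \<equiv> Transposition.transpose 1 3"

lemma reversal_permutes: "reversal permutes {1..3}"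
  by (rule permutes_swap_id) auto

lemma eq_reversal_iff:
  assumes "\<sigma> permutes {1..3}" "\<rho> permutes {1..3}"
  shows "\<sigma> = reversal \<circ> \<rho> \<longleftrightarrow> inv \<sigma> 1 = inv \<rho> 3 \<and> inv \<sigma> 2 = inv \<rho> 2 \<and> inv \<sigma> 3 = inv \<rho> 1"
proof -
  have r: "inv (reversal \<circ> \<rho>) = inv \<rho> \<circ> reversal"
    using o_inv_distrib[OF permutes_bij[OF reversal_permutes] permutes_bij[OF assms(2)]] by simp
  have p: "reversal \<circ> \<rho> permutes {1..3}" by (rule permutes_compose[OF assms(2) reversal_permutes])
  have "\<sigma> = reversal \<circ> \<rho> \<longleftrightarrow> inv \<sigma> = inv (reversal \<circ> \<rho>)"
    using permutes_inv_inv[OF assms(1)] permutes_inv_inv[OF p] by metis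
  also have "\<dots> \<longleftrightarrow> (\<forall>k. inv \<sigma> k = inv \<rho> (reversal k))" unfolding r by (simp add: fun_eq_iff)
  also have "\<dots> \<longleftrightarrow> inv \<sigma> 1 = inv \<rho> 3 \<and> inv \<sigma> 2 = inv \<rho> 2 \<and> inv \<sigma> 3 = inv \<rho> 1"
  proof
    assume *: "\<forall>k. inv \<sigma> k = inv \<rho> (reversal k)"
    from *[rule_format, of 1] *[rule_format, of 2] *[rule_format, of 3]
    show "inv \<sigma> 1 = inv \<rho> 3 \<and> inv \<sigma> 2 = inv \<rho> 2 \<and> inv \<sigma> 3 = inv \<rho> 1" by (simp add: Transposition.transpose_def)
  next
    assume *: "inv \<sigma> 1 = inv \<rho> 3 \<and> inv \<sigma> 2 = inv \<rho> 2 \<and> inv \<sigma> 3 = inv \<rho> 1"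
    show "\<forall>k. inv \<sigma> k = inv \<rho> (reversal k)"
    proof
      fix k :: nat
      have "k = 1 \<or> k = 2 \<or> k = 3 \<or> k \<notin> {1..3}" by auto
      then consider "k = 1" | "k = 2" | "k = 3" | "k \<notin> {1..3}" by blast
      then show "inv \<sigma> k = inv \<rho> (reversal k)"
      proof cases
        case 4
        then have "reversal k = k" by (rule permutes_not_in[OF reversal_permutes])
        then show ?thesis using permutes_not_in[OF permutes_inv[OF assms(1)] 4] permutes_not_in[OF permutes_inv[OF assms(2)] 4] by simp
      qed (use * in \<open>auto simp: Transposition.transpose_def\<close>)
    qed
  qed
  finally show ?thesis .
qed

context tensor_endo
begin

lemma primal_rels_space: "primal_rels 1 2 \<subseteq> tree_space A 3"
proof
  fix r assume "r \<in> primal_rels 1 2"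
  then obtain a b v where r: "r = circ_map 2 (basis_vec [a, b]) - circ_map 1 v" "a \<in> A" "b \<in> A" "img (basis_vec [a, b]) v"
    by (auto simp: primal_rels_def)
  have "basis_vec [a, b] \<in> tensor2 A" using r by simp
  then show "r \<in> tree_space A 3"
    unfolding r(1) using img_coset(1)[OF r(4)] by (intro tree_space_closed(3) circ_map_space) auto
qed

lemma dual_As_rels_space: "dual_As_rels 1 2 \<subseteq> tree_space dual 3"
proof
  fix x assume "x \<in> dual_As_rels 1 2"
  then obtain f g u where x: "x = circ_map 2 (basis_vec [f, g]) - circ_map 1 u"
    "f \<in> dual" "g \<in> dual" "u \<in> \<Phi>t (pure_tensor fun_scale dual [f, g])"
    by (auto simp: dual_As_rels_def)
  have "basis_vec [f, g] \<in> tensor2 dual" using x by simp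
  then show "x \<in> tree_space dual 3"
    unfolding x(1) using transpose_pure(2)[OF x(2-4)] by (intro tree_space_closed(3) circ_map_space) auto
qed

end

locale koszul_data = split_data t E \<tau> s A \<gamma> p1 p2 + tensor_endo s A \<Phi>
  for t :: "'k::field \<Rightarrow> 'e::ab_group_add \<Rightarrow> 'e" and E :: "'e set" and \<tau> :: "'e \<Rightarrow> 'e"
    and s :: "'k \<Rightarrow> 'a::ab_group_add \<Rightarrow> 'a" and A :: "'a set" and \<gamma> :: "'a \<Rightarrow> 'e" and p1 p2 :: "'e \<Rightarrow> 'a"
    and \<Phi> :: "('a list \<Rightarrow>\<^sub>0 'k) set \<Rightarrow> ('a list \<Rightarrow>\<^sub>0 'k) set"
begin

lemma tau_tau: assumes "e \<in> E" shows "\<tau> (\<tau> e) = e"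
proof -
  have "p1 (\<tau> (\<tau> e)) = p1 e" "p2 (\<tau> (\<tau> e)) = p2 e"
    using p1_tau p2_tau tau_in assms by simp_all
  then show ?thesis using decomp[OF assms] decomp[OF tau_in[OF tau_in[OF assms]]] by simp
qed

definition dual_gen :: "('a \<Rightarrow> 'k) \<Rightarrow> ('e \<Rightarrow> 'k)" where
  "dual_gen f = (\<lambda>e. if e \<in> E then f (p2 e) else 0)"

text \<open>A functional \<open>dual_gen f\<close> is \<open>f\<close> on
  \<open>\<tau> (\<gamma> A)\<close> and 0 on \<open>\<gamma> A\<close>, so the first coordinate is
  the restriction to the second summand of \<open>E\<close>.\<close>

definition dual_p1 :: "('e \<Rightarrow> 'k) \<Rightarrow> ('a \<Rightarrow> 'k)" where
  "dual_p1 h = (\<lambda>a. if a \<in> A then h (\<tau> (\<gamma> a)) else 0)"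

text \<open>The sign compensates the signature twist: the transposed generator takes the value
  \<open>- f a\<close> at \<open>\<gamma> a\<close>.\<close>

definition dual_p2 :: "('e \<Rightarrow> 'k) \<Rightarrow> ('a \<Rightarrow> 'k)" where
  "dual_p2 h = (\<lambda>a. if a \<in> A then - h (\<gamma> a) else 0)"

lemma dual_zero: "f \<in> dual \<Longrightarrow> f 0 = 0"
  by (rule dual_space_zero[OF _ modA subA])

text \<open>The table behind every pairing of split generators: half of the entries vanish, and one
  carries the sign of the twist.\<close>

lemma dual_gen_values:
  assumes "f \<in> dual" "a \<in> A"
  shows "dual_gen f (\<gamma> a) = 0" "dual_gen f (\<tau> (\<gamma> a)) = f a" "\<tau>' (dual_gen f) (\<gamma> a) = - f a" "\<tau>' (dual_gen f) (\<tau> (\<gamma> a)) = 0"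
  using assms maps(1)[OF assms(2)] tau_in[OF maps(1)[OF assms(2)]] p1_gam p2_gam p2_tau tau_tau dual_zero[OF assms(1)]
  by (simp_all add: dual_gen_def dual_action_def)

lemma dual_gen_in: assumes "f \<in> dual" shows "dual_gen f \<in> E'"
  by (rule dual_spaceI)
    (auto simp: dual_gen_def E.subspace_add[OF sub] E.subspace_scale[OF sub] maps maps_add maps_scale dual_spaceD[OF assms])

lemma dual_p_in: assumes "h \<in> E'" shows "dual_p1 h \<in> dual" "dual_p2 h \<in> dual"
proof -
  note simps = A.subspace_add[OF subA] A.subspace_scale[OF subA] maps maps_add maps_scale tau_in tau_add tau_scale
    dual_spaceD[OF assms]
  show "dual_p1 h \<in> dual" by (rule dual_spaceI) (auto simp: dual_p1_def simps)
  show "dual_p2 h \<in> dual" by (rule dual_spaceI) (auto simp: dual_p2_def simps)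
qed

lemma dual_split: "split_data fun_scale E' \<tau>' fun_scale dual dual_gen dual_p1 dual_p2"
proof -
  interpret S: sym_data fun_scale E' \<tau>' by (rule dual_sym_data)
  show ?thesis
  proof (intro split_data.intro[OF dual_sym_data] split_data_axioms.intro)
    show "module.subspace fun_scale dual" by (rule subspace_dual_space)
    show "vector_space (fun_scale :: 'k \<Rightarrow> ('a \<Rightarrow> 'k) \<Rightarrow> _)" by (rule vector_space_fun_scale)
    show "linear_map_on fun_scale dual fun_scale E' dual_gen"
      by (auto simp: linear_map_on_def dual_gen_in fun_eq_iff) (auto simp: dual_gen_def fun_scale_def)
    show "linear_map_on fun_scale E' fun_scale dual dual_p1"
      by (auto simp: linear_map_on_def dual_p_in fun_eq_iff) (auto simp: dual_p1_def fun_scale_def)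
    show "linear_map_on fun_scale E' fun_scale dual dual_p2"
      by (auto simp: linear_map_on_def dual_p_in fun_eq_iff) (auto simp: dual_p2_def fun_scale_def)
    show "dual_p1 (dual_gen f) = f" if "f \<in> dual" for f
      by (rule ext) (simp add: dual_p1_def dual_gen_values[OF that] dual_spaceD(3)[OF that])
    show "dual_p2 (dual_gen f) = 0" if "f \<in> dual" for f
      by (rule ext) (simp add: dual_p2_def dual_gen_values[OF that])
    show "dual_p1 (\<tau>' h) = dual_p2 h" if "h \<in> E'" for h
      by (rule ext) (simp add: dual_p1_def dual_p2_def dual_action_def maps tau_in tau_tau)
    show "dual_p2 (\<tau>' h) = dual_p1 h" if "h \<in> E'" for h
      by (rule ext) (simp add: dual_p1_def dual_p2_def dual_action_def maps tau_in)
    show "dual_gen (dual_p1 h) + \<tau>' (dual_gen (dual_p2 h)) = h" if h: "h \<in> E'" for h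
    proof
      fix e
      show "(dual_gen (dual_p1 h) + \<tau>' (dual_gen (dual_p2 h))) e = h e"
      proof (cases "e \<in> E")
        case True
        have "h (\<tau> (\<gamma> (p2 e))) + h (\<gamma> (p1 e)) = h (\<gamma> (p1 e) + \<tau> (\<gamma> (p2 e)))"
          using True maps tau_in dual_spaceD(1)[OF h] by (simp add: add.commute)
        then show ?thesis
          using True by (simp add: dual_gen_def dual_p1_def dual_p2_def dual_action_def maps tau_in p2_tau decomp)
      next
        case False
        then show ?thesis using dual_spaceD(3)[OF h] by (simp add: dual_gen_def dual_action_def)
      qed
    qed
  qed
qed

text \<open>The signature of \<sigma>: a permutation of three letters is even exactly if its inverse
  takes 1 and 2 to a pair in cyclic order.\<close>

definition parity :: "(nat \<Rightarrow> nat) \<Rightarrow> 'k" where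
  "parity \<sigma> = (if cyclic3 (inv \<sigma> 1) (inv \<sigma> 2) then 1 else - 1)"

text \<open>The outer labels pair to 0 unless one comb is left and the other right. The inner ones
  pair to 0 unless exactly one normal form applies the action to its inner label, that is, unless
  the inner inputs appear in opposite orders.\<close>

lemma sym_tree_pairing_gens:
  assumes "\<sigma> permutes {1..3}" "\<rho> permutes {1..3}" "size1 v = 3" "set_tree v \<subseteq> dual" "size1 u = 3" "set_tree u \<subseteq> A"
  shows "sym_tree_pairing E \<tau> \<sigma> \<rho> (map_tree dual_gen v) (map_tree \<gamma> u)
    = (if \<sigma> = reversal \<circ> \<rho> then parity \<sigma> * cross_pairing v u else 0)"
proof -
  obtain p q k where \<sigma>: "inv \<sigma> 1 = p" "inv \<sigma> 2 = q" "inv \<sigma> 3 = k" by blast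
  obtain p' q' k' where \<rho>: "inv \<rho> 1 = p'" "inv \<rho> 2 = q'" "inv \<rho> 3 = k'" by blast
  have d: "p \<in> {1, 2, 3}" "q \<in> {1, 2, 3}" "k \<in> {1, 2, 3}" "p \<noteq> q" "p \<noteq> k" "q \<noteq> k"
    "p' \<in> {1, 2, 3}" "q' \<in> {1, 2, 3}" "k' \<in> {1, 2, 3}" "p' \<noteq> q'" "p' \<noteq> k'" "q' \<noteq> k'"
    using perm3_values[OF permutes_inv[OF assms(1)]] perm3_values[OF permutes_inv[OF assms(2)]] \<sigma> \<rho> by auto
  have c: "cyclic3 q p \<longleftrightarrow> \<not> cyclic3 p q" "cyclic3 k q \<longleftrightarrow> \<not> cyclic3 p q" "cyclic3 q k \<longleftrightarrow> cyclic3 p q"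
    using d cyclic3_antisym[of p q] cyclic3_antisym[of q k] cyclic3_rotate[of p q k] by blast+
  \<comment> \<open>Equal outer inputs leave two orders for the inner ones; only the reversed order
    gives a nonzero value.\<close>
  have e1: "k = p' \<Longrightarrow> p = q' \<and> q = k' \<or> p = k' \<and> q = q'" and e2: "p = k' \<Longrightarrow> q = p' \<and> k = q' \<or> q = q' \<and> k = p'"
    using d by auto
  have eq: "\<sigma> = reversal \<circ> \<rho> \<longleftrightarrow> p = k' \<and> q = q' \<and> k = p'"
    unfolding eq_reversal_iff[OF assms(1,2)] \<sigma> \<rho> ..
  have par: "parity \<sigma> = (if cyclic3 p q then 1 else - 1)" by (simp only: parity_def \<sigma>)
  have circs: "\<exists>f g. v = circ 1 f g \<or> v = circ 2 f g" "\<exists>a b. u = circ 1 a b \<or> u = circ 2 a b"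
    using assms(3,5) by (auto elim: size1_eq_3)
  then obtain f g a b where v: "v = circ 1 f g \<or> v = circ 2 f g" and u: "u = circ 1 a b \<or> u = circ 2 a b" by blast
  have fg: "f \<in> dual" "g \<in> dual" using v assms(4) by auto
  have ab: "a \<in> A" "b \<in> A" using u assms(6) by auto
  note vals = dual_gen_values[OF fg(1) ab(1)] dual_gen_values[OF fg(2) ab(2)]
  note nf = sym_tree_pairing_def normal_form_cyclic3 \<sigma>[unfolded One_nat_def] \<rho>[unfolded One_nat_def]
  consider "v = circ 1 f g" "u = circ 1 a b" | "v = circ 1 f g" "u = circ 2 a b"
    | "v = circ 2 f g" "u = circ 1 a b" | "v = circ 2 f g" "u = circ 2 a b" using v u by blast
  then have "sym_tree_pairing E \<tau> \<sigma> \<rho> (map_tree dual_gen v) (map_tree \<gamma> u)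
    = (if p = k' \<and> q = q' \<and> k = p' then (if cyclic3 p q then 1 else - 1) * cross_pairing v u else 0)"
  proof cases
    case 1
    then show ?thesis by (simp add: nf vals)
  next
    case 2
    show ?thesis
    proof (cases "k = p'")
      case True
      from e1[OF this] show ?thesis using 2 True d c by (auto simp: nf vals)
    next
      case False
      then show ?thesis using 2 by (simp add: nf)
    qed
  next
    case 3
    show ?thesis
    proof (cases "p = k'")
      case True
      from e2[OF this] show ?thesis using 3 True d c by (auto simp: nf vals)
    next
      case False
      then show ?thesis using 3 by (simp add: nf)
    qed
  next
    case 4
    then show ?thesis by (simp add: nf vals)
  qed
  then show ?thesis unfolding eq par .
qed

text \<open>Of all components of \<open>W\<close> just one is matched with \<rho>, so testing with
  varying \<rho> separates the components.\<close>

lemma sym_pairing_gens: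
  assumes W: "W \<in> sym_space dual 3" and r: "r \<in> tree_space A 3" and \<rho>: "\<rho> permutes {1..3}"
  shows "sym_pairing E \<tau> (sym_relab dual_gen W) (sym_elem (relab \<gamma> r) \<rho>)
    = parity (reversal \<circ> \<rho>) * bilin_form cross_pairing (W (reversal \<circ> \<rho>)) r"
proof -
  let ?S = "{\<sigma>. \<sigma> permutes {1..3::nat}}"
  have fin: "finite ?S" by (simp add: finite_permutations)
  have "(\<Sum>\<rho>'\<in>?S. bilin_form (sym_tree_pairing E \<tau> \<sigma> \<rho>') (sym_relab dual_gen W \<sigma>) (sym_elem (relab \<gamma> r) \<rho> \<rho>'))
    = (if \<sigma> = reversal \<circ> \<rho> then parity \<sigma> * bilin_form cross_pairing (W \<sigma>) r else 0)" if \<sigma>: "\<sigma> \<in> ?S" for \<sigma>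
  proof -
    have "(\<Sum>\<rho>'\<in>?S. bilin_form (sym_tree_pairing E \<tau> \<sigma> \<rho>') (sym_relab dual_gen W \<sigma>) (sym_elem (relab \<gamma> r) \<rho> \<rho>'))
      = (\<Sum>\<rho>'\<in>?S. if \<rho>' = \<rho> then bilin_form (sym_tree_pairing E \<tau> \<sigma> \<rho>) (sym_relab dual_gen W \<sigma>) (relab \<gamma> r) else 0)"
      by (rule sum.cong) (auto simp: sym_elem_def form_simps)
    also have "\<dots> = bilin_form (sym_tree_pairing E \<tau> \<sigma> \<rho>) (sym_relab dual_gen W \<sigma>) (relab \<gamma> r)"
      using fin \<rho> by simp
    also have "\<dots> = bilin_form (\<lambda>v u. sym_tree_pairing E \<tau> \<sigma> \<rho> (map_tree dual_gen v) (map_tree \<gamma> u)) (W \<sigma>) r"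
      by (simp add: sym_relab_def relab_def bilin_form_lin_ext)
    also have "\<dots> = bilin_form (\<lambda>v u. (if \<sigma> = reversal \<circ> \<rho> then parity \<sigma> else 0) * cross_pairing v u) (W \<sigma>) r"
    proof (rule bilin_form_cong)
      fix v u assume "v \<in> Poly_Mapping.keys (W \<sigma>)" "u \<in> Poly_Mapping.keys r"
      then have "size1 v = 3" "set_tree v \<subseteq> dual" "size1 u = 3" "set_tree u \<subseteq> A"
        using tree_space_keys[of "W \<sigma>" dual 3 v] tree_space_keys[OF r, of u] W \<sigma> by (auto simp: sym_space_iff)
      from sym_tree_pairing_gens[OF _ \<rho> this, of \<sigma>] \<sigma>
      show "sym_tree_pairing E \<tau> \<sigma> \<rho> (map_tree dual_gen v) (map_tree \<gamma> u)
        = (if \<sigma> = reversal \<circ> \<rho> then parity \<sigma> else 0) * cross_pairing v u" by simp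
    qed
    finally show ?thesis by (simp add: bilin_form_mult)
  qed
  then have "sym_pairing E \<tau> (sym_relab dual_gen W) (sym_elem (relab \<gamma> r) \<rho>)
    = (\<Sum>\<sigma>\<in>?S. if \<sigma> = reversal \<circ> \<rho> then parity \<sigma> * bilin_form cross_pairing (W \<sigma>) r else 0)"
    unfolding sym_pairing_def by (rule sum.cong[OF refl])
  moreover have "reversal \<circ> \<rho> \<in> ?S" using permutes_compose[OF \<rho> reversal_permutes] by simp
  ultimately show ?thesis using fin by simp
qed

lemma cross_pairing_circ:
  "cross_pairing (circ 1 f g) (circ 1 a b) = 0 * (f a * g b)"
  "cross_pairing (circ 2 f g) (circ 2 a b) = 0 * (f a * g b)"
  "cross_pairing (circ 1 f g) (circ 2 a b) = 1 * (f a * g b)"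
  "cross_pairing (circ 2 f g) (circ 1 a b) = (- 1) * (f a * g b)"
  by simp_all

lemma cross_circ_maps:
  assumes "u \<in> tensor2 U" "v \<in> tensor2 V"
  shows "bilin_form cross_pairing (circ_map 1 u) (circ_map 1 v) = 0"
    "bilin_form cross_pairing (circ_map 2 u) (circ_map 2 v) = 0"
    "bilin_form cross_pairing (circ_map 1 u) (circ_map 2 v) = tensor_ev u v"
    "bilin_form cross_pairing (circ_map 2 u) (circ_map 1 v) = - tensor_ev u v"
  using bilin_form_circ_maps[OF cross_pairing_circ(1) assms] bilin_form_circ_maps[OF cross_pairing_circ(2) assms]
    bilin_form_circ_maps[OF cross_pairing_circ(3) assms] bilin_form_circ_maps[OF cross_pairing_circ(4) assms]
  by simp_all

text \<open>Against \<open>a \<circ>\<^sub>2 b\<close> minus its image, the crossed pairing gives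
  the evaluation of the \<open>\<circ>\<^sub>1\<close> part at \<open>a \<otimes> b\<close> plus
  that of the \<open>\<circ>\<^sub>2\<close> part at the image. This is the hypothesis of
  \<open>orthogonal_in_ideal\<close> with the original roles 1 and 2.\<close>

lemma cross_orthogonal_in_ideal:
  assumes x: "x \<in> tree_space dual 3" and 0: "\<And>r. r \<in> primal_rels 1 2 \<Longrightarrow> bilin_form cross_pairing x r = 0"
  shows "x \<in> pres_ideal fun_scale dual (dual_As_rels 1 2) 3"
proof -
  obtain x1 x2 where d: "x1 \<in> tensor2 dual" "x2 \<in> tensor2 dual" "x = circ_map 1 x1 + circ_map 2 x2"
    using x by (auto elim: arity3_decompose)
  have "tensor_ev x1 (basis_vec [a, b]) + tensor_ev x2 v = 0"
    if ab: "a \<in> A" "b \<in> A" and v: "img (basis_vec [a, b]) v" for a b v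
  proof -
    have t: "basis_vec [a, b] \<in> tensor2 A" using ab by simp
    have "circ_map 2 (basis_vec [a, b]) - circ_map 1 v \<in> primal_rels 1 2"
      using ab v by (auto simp: primal_rels_def)
    from 0[OF this] show ?thesis
      unfolding d(3) form_simps cross_circ_maps[OF d(1) t] cross_circ_maps[OF d(2) t]
        cross_circ_maps[OF d(1) img_coset(1)[OF v]] cross_circ_maps[OF d(2) img_coset(1)[OF v]] by simp
  qed
  then show ?thesis unfolding d(3) using d by (intro orthogonal_in_ideal) auto
qed

text \<open>The two mixed terms are the two sides of the defining equation of the transpose, with
  opposite signs.\<close>

lemma cross_pairing_rels:
  assumes "x \<in> dual_As_rels 1 2" "r \<in> primal_rels 1 2" shows "bilin_form cross_pairing x r = 0"
proof -
  obtain f g u where x: "x = circ_map 2 (basis_vec [f, g]) - circ_map 1 u"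
    "f \<in> dual" "g \<in> dual" "u \<in> \<Phi>t (pure_tensor fun_scale dual [f, g])"
    using assms(1) by (auto simp: dual_As_rels_def)
  note u = transpose_pure(2,3)[OF x(2-4)]
  have fg: "basis_vec [f, g] \<in> tensor2 dual" using x by simp
  obtain a b v where r: "r = circ_map 2 (basis_vec [a, b]) - circ_map 1 v" "a \<in> A" "b \<in> A" "img (basis_vec [a, b]) v"
    using assms(2) by (auto simp: primal_rels_def)
  have ab: "basis_vec [a, b] \<in> tensor2 A" using r by simp
  note v = img_coset(1)[OF r(4)]
  have "tensor_ev u (basis_vec [a, b]) = tensor_ev (basis_vec [f, g]) v"
    using u(2) r by (simp add: adj_def)
  then show ?thesis
    unfolding x(1) r(1) form_simps cross_circ_maps[OF fg ab] cross_circ_maps[OF u(1) ab]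
      cross_circ_maps[OF fg v] cross_circ_maps[OF u(1) v] by simp
qed

end

section \<open>The Koszul dual of a symmetrisation\<close>

context split_data
begin

text \<open>The nonsymmetric relations written in the generators \<open>\<gamma> a\<close>, at the
  identity permutation.\<close>

definition gens :: "('a tree \<Rightarrow>\<^sub>0 'k) set \<Rightarrow> ((nat \<Rightarrow> nat) \<Rightarrow> ('e tree \<Rightarrow>\<^sub>0 'k)) set" where
  "gens Rs = {sym_elem (relab \<gamma> r) id | r. r \<in> Rs}"

lemma relab_elem:
  assumes "r \<in> tree_space A 3" "\<rho> permutes {1..3}"
  shows "sym_elem (relab \<gamma> r) \<rho> \<in> sym_space E 3" "D 3 (sym_elem (relab \<gamma> r) \<rho>) = sym_elem r \<rho>"
proof -
  have "sym_elem r \<rho> \<in> sym_space A 3" by (rule sym_elem_space[OF assms])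
  from C_space[OF this] D_C[OF this] show "sym_elem (relab \<gamma> r) \<rho> \<in> sym_space E 3"
    "D 3 (sym_elem (relab \<gamma> r) \<rho>) = sym_elem r \<rho>" unfolding sym_relab_elem .
qed

lemma gens_space: assumes "Rs \<subseteq> tree_space A 3" shows "gens Rs \<subseteq> sym_space E 3"
  using relab_elem(1)[OF _ permutes_id] assms by (auto simp: gens_def)

lemma D_gens:
  assumes "Rs \<subseteq> tree_space A 3" "X \<in> gens Rs" shows "D 3 X \<sigma> \<in> pres_ideal s A Rs 3"
proof -
  obtain r where r: "r \<in> Rs" "X = sym_elem (relab \<gamma> r) id" using assms(2) by (auto simp: gens_def)
  then have "D 3 X = sym_elem r id" using relab_elem(2)[OF _ permutes_id] assms(1) by blast
  then show ?thesis using r(1) by (simp add: sym_elem_def pres_ideal_rel pres_ideal_zero)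
qed

lemma gens_rel: "r \<in> Rs \<Longrightarrow> sym_elem (relab \<gamma> r) id \<in> SI (gens Rs) 3"
  by (rule SI_rel) (auto simp: gens_def)

lemma SI_gens:
  assumes "Rs \<subseteq> tree_space A 3"
  shows "X \<in> SI (gens Rs) n \<longleftrightarrow> X \<in> sym_space E n \<and> (\<forall>\<sigma>. \<sigma> permutes {1..n} \<longrightarrow> D n X \<sigma> \<in> pres_ideal s A Rs n)"
  by (rule SI_iff[OF gens_space[OF assms] assms D_gens[OF assms] gens_rel])

lemma sym_presented_gens_iso:
  assumes "Rs \<subseteq> tree_space A 3"
  shows "sym_isomorphic (sym_presented t E \<tau> (gens Rs)) (sym_operad (ns_presented s A Rs))"
  by (rule sym_presented_iso[OF gens_space[OF assms] assms D_gens[OF assms] gens_rel])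

end

context koszul_data
begin

text \<open>\<open>R\<close> generates the same ideal as \<open>gens (primal_rels 1 2)\<close>, so the orthogonal can be computed from the latter.\<close>

lemma sym_koszul_dual_iso:
  assumes RE: "R \<subseteq> sym_space E 3"
    and iff: "\<And>X n. X \<in> SI R n \<longleftrightarrow> X \<in> sym_space E n \<and>
      (\<forall>\<sigma>. \<sigma> permutes {1..n} \<longrightarrow> D n X \<sigma> \<in> pres_ideal s A (primal_rels 1 2) n)"
  shows "sym_isomorphic (sym_koszul_dual t E \<tau> R) (sym_operad (ns_presented fun_scale dual (dual_As_rels 1 2)))"
proof -
  interpret S: split_data fun_scale E' \<tau>' fun_scale dual dual_gen dual_p1 dual_p2 by (rule dual_split)
  let ?P = "primal_rels 1 2" and ?O = "sym_orthogonal t E \<tau> R"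
  have SI: "SI (gens ?P) 3 = SI R 3"
    using SI_gens[OF primal_rels_space] iff by blast
  have O: "X \<in> ?O \<longleftrightarrow> X \<in> sym_space E' 3 \<and> (\<forall>Y\<in>SI R 3. sym_pairing E \<tau> X Y = 0)" for X
    by (rule sym_orthogonal_iff[OF RE tau_tau])
  have O': "X \<in> sym_orthogonal t E \<tau> (gens ?P) \<longleftrightarrow> X \<in> ?O" for X
  proof -
    have "X \<in> sym_orthogonal t E \<tau> (gens ?P) \<longleftrightarrow> X \<in> sym_space E' 3 \<and> (\<forall>Y\<in>SI (gens ?P) 3. sym_pairing E \<tau> X Y = 0)"
      by (rule sym_orthogonal_iff[OF gens_space[OF primal_rels_space] tau_tau])
    then show ?thesis unfolding O SI .
  qed
  show ?thesis
    unfolding sym_koszul_dual_def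
  proof (rule S.sym_presented_iso)
    show "?O \<subseteq> sym_space E' 3" using O by blast
    show "dual_As_rels 1 2 \<subseteq> tree_space dual 3" by (rule dual_As_rels_space)
  next
    fix X \<sigma> assume X: "X \<in> ?O" and \<sigma>: "\<sigma> permutes {1..3::nat}"
    have XE: "X \<in> sym_space E' 3" using X O by blast
    define W where "W = sym_split dual_p1 dual_p2 3 X"
    have W: "W \<in> sym_space dual 3" unfolding W_def by (rule S.D_space[OF XE])
    \<comment> \<open>\<open>X\<close> is replaced by an element in the dual generators; the
      difference pairs to 0 with everything.\<close>
    have dW: "sym_relab dual_gen W - X \<in> sym_pres_ideal fun_scale E' \<tau>' {} 3"
      unfolding W_def by (rule S.C_D[of "{}" "{}", OF _ _ _ _ XE]) simp_all
    have "W \<sigma> \<in> pres_ideal fun_scale dual (dual_As_rels 1 2) 3"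
    proof (rule cross_orthogonal_in_ideal)
      show "W \<sigma> \<in> tree_space dual 3" using W \<sigma> by (simp add: sym_space_iff)
      fix r assume r: "r \<in> ?P"
      then have rA: "r \<in> tree_space A 3" using primal_rels_space by blast
      \<comment> \<open>This choice of the test permutation singles out the component of
        \<open>W\<close> at \<sigma>.\<close>
      define \<rho> where "\<rho> = reversal \<circ> \<sigma>"
      have \<rho>: "\<rho> permutes {1..3}" unfolding \<rho>_def by (rule permutes_compose[OF \<sigma> reversal_permutes])
      have rr: "reversal \<circ> \<rho> = \<sigma>" by (simp add: \<rho>_def fun_eq_iff)
      have "sym_elem (relab \<gamma> r) \<rho> \<in> SI R 3"
        unfolding iff relab_elem(2)[OF rA \<rho>]
        using relab_elem(1)[OF rA \<rho>] r by (simp add: sym_elem_def pres_ideal_rel pres_ideal_zero)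
      then have "sym_pairing E \<tau> X (sym_elem (relab \<gamma> r) \<rho>) = 0" using X O by blast
      moreover have "sym_pairing E \<tau> (sym_relab dual_gen W - X) (sym_elem (relab \<gamma> r) \<rho>) = 0"
        by (rule sym_pairing_dual_ideal[OF tau_tau dW])
      ultimately have "parity \<sigma> * bilin_form cross_pairing (W \<sigma>) r = 0"
        unfolding sym_pairing_diff_left sym_pairing_gens[OF W rA \<rho>] rr by simp
      \<comment> \<open>A sign may be cancelled in every field, also in characteristic 2.\<close>
      then show "bilin_form cross_pairing (W \<sigma>) r = 0" by (simp add: parity_def split: if_splits)
    qed
    then show "sym_split dual_p1 dual_p2 3 X \<sigma> \<in> pres_ideal fun_scale dual (dual_As_rels 1 2) 3"
      unfolding W_def .
  next
    fix x assume x: "x \<in> dual_As_rels 1 2"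
    then have xA: "x \<in> tree_space dual 3" using dual_As_rels_space by blast
    let ?X = "sym_elem (relab dual_gen x) id"
    have W: "sym_elem x id \<in> sym_space dual 3" by (rule sym_elem_space[OF xA permutes_id])
    have "sym_pairing E \<tau> ?X (sym_act \<sigma> Y) = 0" if Y: "Y \<in> gens ?P" and \<sigma>: "\<sigma> permutes {1..3}" for Y \<sigma>
    proof -
      obtain r where r: "r \<in> ?P" "Y = sym_elem (relab \<gamma> r) id" using Y by (auto simp: gens_def)
      have rA: "r \<in> tree_space A 3" using r primal_rels_space by blast
      \<comment> \<open>Either the component is the one at the identity, where two relations are
        paired, or it is 0.\<close>
      have "bilin_form cross_pairing (sym_elem x id (reversal \<circ> \<sigma>)) r = 0"
        using cross_pairing_rels[OF x r(1)] by (simp add: sym_elem_def form_simps)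
      then show ?thesis
        unfolding r(2) sym_act_elem[OF \<sigma>] id_comp sym_pairing_gens[OF W rA \<sigma>, unfolded sym_relab_elem] by simp
    qed
    then have "?X \<in> sym_orthogonal t E \<tau> (gens ?P)"
      using S.relab_elem(1)[OF xA permutes_id] by (simp add: sym_orthogonal_def sym_operad_simps)
    then show "?X \<in> sym_pres_ideal fun_scale E' \<tau>' ?O 3" unfolding O' by (rule S.SI_rel)
  qed
qed

end

section \<open>The generators of the symmetrisation\<close>

context
  fixes s :: "'k::field \<Rightarrow> 'a::ab_group_add \<Rightarrow> 'a" and A :: "'a set"
  assumes fd: "fin_dim_space s A"
begin

text \<open>Pairs \<open>(a, b)\<close> stand for \<open>a + b \<cdot> (1 2)\<close>; with the swap
  of coordinates they form the space of binary operations of the symmetrisation.\<close>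

definition prod_scale :: "'k \<Rightarrow> 'a \<times> 'a \<Rightarrow> 'a \<times> 'a" where
  "prod_scale c x = (s c (fst x), s c (snd x))"

lemma vector_space_prod_scale: "vector_space prod_scale"
proof -
  interpret vector_space s using fd by (simp add: fin_dim_space_def)
  show ?thesis
    by unfold_locales (auto simp: prod_scale_def prod_eq_iff algebra_simps)
qed

lemma subspace_prod: "module.subspace prod_scale (A \<times> A)"
proof -
  interpret A: vector_space s using fd by (simp add: fin_dim_space_def)
  interpret P: vector_space prod_scale by (rule vector_space_prod_scale)
  have "A.subspace A" using fd by (simp add: fin_dim_space_def)
  then show ?thesis by (auto simp: A.subspace_def P.subspace_def prod_scale_def zero_prod_def)
qed

lemma fin_dim_prod: "fin_dim_space prod_scale (A \<times> A)"
proof -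
  interpret A: vector_space s using fd by (simp add: fin_dim_space_def)
  interpret P: vector_space prod_scale by (rule vector_space_prod_scale)
  obtain B where B: "finite B" "A = A.span B" using fd by (auto simp: fin_dim_space_def)
  let ?C = "(\<lambda>b. (b, 0)) ` B \<union> (\<lambda>b. (0, b)) ` B"
  have "?C \<subseteq> A \<times> A" unfolding B(2) by (auto intro: A.span_base A.span_zero)
  then have "P.span ?C \<subseteq> A \<times> A" by (rule P.span_minimal[OF _ subspace_prod])
  moreover have "A \<times> A \<subseteq> P.span ?C"
  proof clarify
    fix a b assume ab: "a \<in> A" "b \<in> A"
    have 1: "(a, 0) \<in> P.span ?C \<and> (0, a) \<in> P.span ?C" if "a \<in> A.span B" for a
      using that
    proof (induction a rule: A.span_induct_alt)
      case base
      show ?case using P.span_zero[of ?C] by (simp add: zero_prod_def)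
    next
      case (step c x y)
      have "(s c x + y, 0) = prod_scale c (x, 0) + (y, 0)" "(0, s c x + y) = prod_scale c (0, x) + (0, y)"
        by (simp_all add: prod_scale_def)
      moreover have "(x, 0) \<in> ?C" "(0, x) \<in> ?C" using step by auto
      ultimately show ?case using step by (metis P.span_add P.span_scale P.span_base)
    qed
    have "(a, b) = (a, 0) + (0, b)" by simp
    then show "(a, b) \<in> P.span ?C" using 1 ab P.span_add unfolding B(2) by metis
  qed
  ultimately show ?thesis
    unfolding fin_dim_space_def using vector_space_prod_scale subspace_prod B(1)
    by (intro conjI exI[of _ ?C]) auto
qed

text \<open>The model splitting: first coordinates are the generators, second coordinates their
  opposites.\<close>

lemma prod_split_data:
  "split_data prod_scale (A \<times> A) prod.swap s A (\<lambda>a. (a, 0)) fst snd"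
proof -
  interpret A: vector_space s using fd by (simp add: fin_dim_space_def)
  have A: "A.subspace A" using fd by (simp add: fin_dim_space_def)
  then have "0 \<in> A" by (rule A.subspace_0)
  then show ?thesis
    by (intro split_data.intro split_data_axioms.intro sym_data.intro vector_space_prod_scale subspace_prod A
        A.vector_space_axioms) (auto simp: linear_map_on_def prod_scale_def)
qed

end

text \<open>A symmetric Koszul dual is attached to a presentation and not to an operad. Part 3
  therefore speaks about every quadratic presentation of the symmetrisation, and the existence of
  one keeps it from being vacuous.\<close>

theorem proposition3p9:
  fixes s :: "'k::field \<Rightarrow> 'a::ab_group_add \<Rightarrow> 'a"
    and A :: "'a set"
    and \<Phi> :: "('a list \<Rightarrow>\<^sub>0 'k) set \<Rightarrow> ('a list \<Rightarrow>\<^sub>0 'k) set"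
  assumes "fin_dim_space s A"
    and "lEAS s A \<Phi>"
  shows
    "ns_isomorphic (ns_koszul_dual s A (As_rels s A \<Phi>))
       (As_op_operad fun_scale (dual_space s A) (transpose_map s A \<Phi>)) \<and>
     ns_isomorphic (ns_koszul_dual s A (As_op_rels s A \<Phi>))
       (As_operad fun_scale (dual_space s A) (transpose_map s A \<Phi>)) \<and>
     (\<exists>(t :: 'k \<Rightarrow> 'a \<times> 'a \<Rightarrow> 'a \<times> 'a) E \<tau> R.
        quadratic_data t E \<tau> R \<and>
        sym_isomorphic (sym_presented t E \<tau> R) (sym_operad (As_operad s A \<Phi>))) \<and>
     (\<forall>(t :: 'k \<Rightarrow> 'e::ab_group_add \<Rightarrow> 'e) E \<tau> R.
        quadratic_data t E \<tau> R \<and>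
        sym_isomorphic (sym_presented t E \<tau> R) (sym_operad (As_operad s A \<Phi>)) \<longrightarrow>
        sym_isomorphic (sym_koszul_dual t E \<tau> R)
          (sym_operad (As_operad fun_scale (dual_space s A) (transpose_map s A \<Phi>))))"
proof (intro conjI allI impI)
  interpret T: tensor_endo s A \<Phi>
    using assms by unfold_locales (auto simp: lEAS_def)
  show "ns_isomorphic (ns_koszul_dual s A (As_rels s A \<Phi>)) (As_op_operad fun_scale T.dual T.\<Phi>t)"
    "ns_isomorphic (ns_koszul_dual s A (As_op_rels s A \<Phi>)) (As_operad fun_scale T.dual T.\<Phi>t)"
    unfolding T.ns_koszul_duals by (rule ns_isomorphic_refl)+
  let ?P = "T.primal_rels 1 2"
  have As: "As_operad s A \<Phi> = ns_presented s A ?P" by (simp only: As_operad_def T.primal_rels_eq)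
  have P: "?P \<subseteq> tree_space A 3" by (rule T.primal_rels_space)
  show "\<exists>(t :: 'k \<Rightarrow> 'a \<times> 'a \<Rightarrow> 'a \<times> 'a) E \<tau> R. quadratic_data t E \<tau> R \<and>
    sym_isomorphic (sym_presented t E \<tau> R) (sym_operad (As_operad s A \<Phi>))"
  proof -
    \<comment> \<open>The presentation exhibited has the generators \<open>A \<times> A\<close> and
      the relations of the nonsymmetric operad between the pairs \<open>(a, 0)\<close>.\<close>
    interpret S: split_data "prod_scale s" "A \<times> A" prod.swap s A "\<lambda>a. (a, 0)" fst snd
      by (rule prod_split_data[OF assms(1)])
    have "quadratic_data (prod_scale s) (A \<times> A) prod.swap (S.gens ?P)"
      unfolding quadratic_data_def sym_operad_simps
      using fin_dim_prod[OF assms(1)] S.tau S.gens_space[OF P] by simp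
    with S.sym_presented_gens_iso[OF P] show ?thesis unfolding As by blast
  qed
  \<comment> \<open>From here on the presentation is arbitrary; the splitting and the description of
    its ideal come out of the given isomorphism.\<close>
  fix t :: "'k \<Rightarrow> 'e::ab_group_add \<Rightarrow> 'e" and E \<tau> R
  assume *: "quadratic_data t E \<tau> R \<and> sym_isomorphic (sym_presented t E \<tau> R) (sym_operad (As_operad s A \<Phi>))"
  then obtain \<phi> where \<phi>: "ns_operad_iso (sym_presented t E \<tau> R) (sym_operad (ns_presented s A ?P)) \<phi>"
    "\<And>n \<sigma> x. \<sigma> permutes {1..n} \<Longrightarrow> x \<in> op_space (sym_presented t E \<tau> R) n \<Longrightarrow>
      \<phi> n (op_act (sym_presented t E \<tau> R) n \<sigma> x) = op_act (sym_operad (ns_presented s A ?P)) n \<sigma> (\<phi> n x)"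
    unfolding sym_isomorphic_def As by blast
  have q: "fin_dim_space t E" "linear_map_on t E t E \<tau>" "\<And>e. e \<in> E \<Longrightarrow> \<tau> (\<tau> e) = e" "R \<subseteq> sym_space E 3"
    using * unfolding quadratic_data_def sym_operad_simps by auto
  interpret I: presented_iso s A ?P t E \<tau> R \<phi>
    using assms(1) q P \<phi>
    by (intro presented_iso.intro ns_data.intro sym_data.intro presented_iso_axioms.intro) (simp_all only: fin_dim_space_def)
  obtain \<gamma> p1 p2 where sd: "split_data t E \<tau> s A \<gamma> p1 p2"
    and iff: "\<And>X n. X \<in> I.SI R n \<longleftrightarrow> X \<in> sym_space E n \<and>
      (\<forall>\<sigma>. \<sigma> permutes {1..n} \<longrightarrow> sym_split p1 p2 n X \<sigma> \<in> pres_ideal s A ?P n)"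
    by (rule I.recover_split) blast
  interpret K: koszul_data t E \<tau> s A \<gamma> p1 p2 \<Phi>
    by (intro koszul_data.intro sd T.tensor_endo_axioms)
  from K.sym_koszul_dual_iso[OF q(4) iff]
  show "sym_isomorphic (sym_koszul_dual t E \<tau> R) (sym_operad (As_operad fun_scale T.dual T.\<Phi>t))"
    by (simp only: As_operad_def T.dual_As_rels_eq)
qed

end
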